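(* Let $w\in A_p$, $1\le p<\infty$. The maximal heat operator $W^*$, the maximal Poisson operator $P^*$ and the square function $g$ are norms of vector-valued Calderón--Zygmund operators in the sense of the space of homogeneous type $(\mathbb{Z},\mu,|\cdot|)$; that is, $W^*f(n)=\|\{W_tf(n)\}_{t}\|_{L^\infty}$, $P^*f(n)=\|\{P_tf(n)\}_{t}\|_{L^\infty}$ and $gf(n)=\|\{t\,\partial_tW_tf(n)\}_{t}\|_{\mathbb{B}}$ with $\mathbb{B}=L^2((0,\infty),\frac{dt}{t})$, where the linear operators $f\mapsto\{W_tf\}_t$, $f\mapsto\{P_tf\}_t$ and $f\mapsto\{t\,\partial_tW_tf\}_t$ are vector-valued Calderón--Zygmund operators on $(\mathbb{Z},\mu,|\cdot|)$. Therefore, $W^*$, $P^*$ and $g$ are bounded from $\ell^p(w)$ into itself for $1<p<\infty$ and $w\in A_p$, and also from $\ell^1(w)$ into weak-$\ell^1(w)$ for $w\in A_1$.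
   Context: For $k\in\mathbb{Z}$, $I_k(t)=\sum_{m=0}^\infty\frac{1}{m!\,\Gamma(m+k+1)}\left(\frac t2\right)^{2m+k}$ is the modified Bessel function of the first kind (with $1/\Gamma(j)=0$ for $j=0,-1,-2,\dots$). The discrete heat semigroup is $W_tf(n)=\sum_{m\in\mathbb{Z}}e^{-2t}I_{n-m}(2t)f(m)$, $t\ge0$, $n\in\mathbb{Z}$, and the discrete Poisson semigroup is $P_tf(n)=\frac{1}{\sqrt\pi}\int_0^\infty\frac{e^{-u}}{\sqrt u}W_{t^2/(4u)}f(n)\,du$, $t\ge0$. Put $W^*f=\sup_{t\ge0}|W_tf|$, $P^*f=\sup_{t\ge0}|P_tf|$, and $gf(n)=\left(\int_0^\infty|t\,\partial_tW_tf(n)|^2\frac{dt}{t}\right)^{1/2}$. A weight is a sequence $w=\{w(n)\}_{n\in\mathbb{Z}}$ of positive numbers. For $1<p<\infty$, $w\in A_p$ means that there is $C<\infty$ such that for all integers $M\le N$, $$\Big(\sum_{k=M}^Nw(k)\Big)\Big(\sum_{k=M}^Nw(k)^{-1/(p-1)}\Big)^{p-1}\le C(N-M+1)^p,$$ and $w\in A_1$ means that there is $C<\infty$ such that for all integers $M\le N$, $\big(\sum_{k=M}^Nw(k)\big)\sup_{k\in[M,N]}w(k)^{-1}\le C(N-M+1)$. The space $\ell^p(w)$ has norm $\|f\|_{\ell^p(w)}=\big(\sum_n|f(n)|^pw(n)\big)^{1/p}$; an operator $T$ is bounded from $\ell^1(w)$ into weak-$\ell^1(w)$ if there is $C$ with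 $\lambda\sum_{n:|Tf(n)|>\lambda}w(n)\le C\|f\|_{\ell^1(w)}$ for all $\lambda>0$ and $f\in\ell^1(w)$. $(\mathbb{Z},\mu,|\cdot|)$ is $\mathbb{Z}$ with counting measure $\mu$ and the usual distance. For a Banach space $\mathbb{E}$, a ($\mathbb{E}$-valued) Calderón--Zygmund operator on this space is, in the standard sense, a linear operator $T$ that is bounded from $\ell^r(\mathbb{Z})$ into $\ell^r_{\mathbb{E}}(\mathbb{Z})$ for some $1<r<\infty$ and is of the form $Tf(n)=\sum_mK(n,m)f(m)$ with an $\mathbb{E}$-valued kernel satisfying $\|K(n,m)\|_{\mathbb{E}}\le\frac{C}{|n-m|}$ for $n\ne m$ and $\|K(n,m)-K(n,m')\|_{\mathbb{E}}+\|K(m,n)-K(m',n)\|_{\mathbb{E}}\le C\frac{|m-m'|}{|n-m|^2}$ for $|n-m|>2|m-m'|$. Here $\ell^r_{\mathbb{E}}$ has norm $\big(\sum_n\|f(n)\|_{\mathbb{E}}^r\big)^{1/r}$, and $L^\infty$ denotes bounded functions of $t\ge0$ with the sup norm. *)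

theory Defs
  imports "HOL-Analysis.Analysis" "HOL-Library.Function_Algebras"
begin

text \<open>Sequences are complex-valued functions on \<open>int\<close>; real-valued sequences are a special case.\<close>

subsection \<open>Weighted sequence spaces and Muckenhoupt weights\<close>

definition wlp :: "real \<Rightarrow> (int \<Rightarrow> real) \<Rightarrow> (int \<Rightarrow> 'a::real_normed_vector) set" where
  "wlp p w = {f. (\<lambda>n. norm (f n) powr p * w n) summable_on UNIV}"

definition wlp_norm :: "real \<Rightarrow> (int \<Rightarrow> real) \<Rightarrow> (int \<Rightarrow> 'a::real_normed_vector) \<Rightarrow> real" where
  "wlp_norm p w f = (\<Sum>\<^sub>\<infinity>n. norm (f n) powr p * w n) powr (1 / p)"

abbreviation lp :: "real \<Rightarrow> (int \<Rightarrow> 'a::real_normed_vector) set" where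
  "lp p \<equiv> wlp p (\<lambda>_. 1)"

abbreviation lp_norm :: "real \<Rightarrow> (int \<Rightarrow> 'a::real_normed_vector) \<Rightarrow> real" where
  "lp_norm p \<equiv> wlp_norm p (\<lambda>_. 1)"

definition muckenhoupt :: "real \<Rightarrow> (int \<Rightarrow> real) \<Rightarrow> bool" where
  "muckenhoupt p w \<longleftrightarrow> (\<forall>n. 0 < w n) \<and>
     (if p = 1
      then \<exists>C. \<forall>M N. M \<le> N \<longrightarrow>
             (\<Sum>k=M..N. w k) * (SUP k\<in>{M..N}. inverse (w k)) \<le> C * of_int (N - M + 1)
      else \<exists>C. \<forall>M N. M \<le> N \<longrightarrow>
             (\<Sum>k=M..N. w k) * (\<Sum>k=M..N. w k powr (- 1 / (p - 1))) powr (p - 1)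
               \<le> C * of_int (N - M + 1) powr p)"

text \<open>
  The operators below are sublinear, with real values given by a supremum or an integral.
  Finiteness of these suprema and integrals is not part of the two following notions;
  it has to be asserted separately.
\<close>

definition strong_type ::
  "real \<Rightarrow> (int \<Rightarrow> real) \<Rightarrow> ((int \<Rightarrow> complex) \<Rightarrow> int \<Rightarrow> real) \<Rightarrow> bool" where
  "strong_type p w S \<longleftrightarrow>
     (\<exists>C. \<forall>f\<in>wlp p w. S f \<in> wlp p w \<and> wlp_norm p w (S f) \<le> C * wlp_norm p w f)"

definition weak_type_1 ::
  "(int \<Rightarrow> real) \<Rightarrow> ((int \<Rightarrow> complex) \<Rightarrow> int \<Rightarrow> real) \<Rightarrow> bool" where
  "weak_type_1 w S \<longleftrightarrow>
     (\<exists>C. \<forall>f\<in>wlp 1 w. \<forall>l>0.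
        w summable_on {n. \<bar>S f n\<bar> > l} \<and>
        l * (\<Sum>\<^sub>\<infinity>n\<in>{n. \<bar>S f n\<bar> > l}. w n) \<le> C * wlp_norm 1 w f)"


subsection \<open>Heat and Poisson semigroups\<close>

text \<open>
  The library function \<open>rGamma\<close> is the reciprocal Gamma function, which vanishes at
  \<open>0, -1, -2, \<dots>\<close>. In particular the terms with a negative exponent \<open>2 * m + k\<close> are all zero.
\<close>

definition bessel_I :: "int \<Rightarrow> real \<Rightarrow> real" where
  "bessel_I k t = (\<Sum>m. 1 / fact m * rGamma (of_int (int m + k + 1)) * (t / 2) powi (2 * int m + k))"

definition heat_kernel :: "real \<Rightarrow> int \<Rightarrow> real" where
  "heat_kernel t k = exp (- 2 * t) * bessel_I k (2 * t)"

definition heat :: "real \<Rightarrow> (int \<Rightarrow> complex) \<Rightarrow> int \<Rightarrow> complex" where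
  "heat t f n = (\<Sum>\<^sub>\<infinity>m. heat_kernel t (n - m) *\<^sub>R f m)"

definition poisson :: "real \<Rightarrow> (int \<Rightarrow> complex) \<Rightarrow> int \<Rightarrow> complex" where
  "poisson t f n =
     (1 / sqrt pi) *\<^sub>R (LINT u:{0<..}|lborel. (exp (- u) / sqrt u) *\<^sub>R heat (t\<^sup>2 / (4 * u)) f n)"

definition t_dt_heat :: "real \<Rightarrow> (int \<Rightarrow> complex) \<Rightarrow> int \<Rightarrow> complex" where
  "t_dt_heat t f n = t *\<^sub>R vector_derivative (\<lambda>s. heat s f n) (at t)"

definition heat_max :: "(int \<Rightarrow> complex) \<Rightarrow> int \<Rightarrow> real" where
  "heat_max f n = (SUP t\<in>{0..}. norm (heat t f n))"

definition poisson_max :: "(int \<Rightarrow> complex) \<Rightarrow> int \<Rightarrow> real" where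
  "poisson_max f n = (SUP t\<in>{0..}. norm (poisson t f n))"

definition square_fun :: "(int \<Rightarrow> complex) \<Rightarrow> int \<Rightarrow> real" where
  "square_fun f n = sqrt (LINT t:{0<..}|lborel. (norm (t_dt_heat t f n))\<^sup>2 / t)"

text \<open>
  Convergence of the series, derivatives and integrals by which the semigroups act on \<open>f\<close>;
  \<open>infsum\<close>, \<open>vector_derivative\<close> and the Bochner integral are total functions.
\<close>

definition semigroups_defined :: "(int \<Rightarrow> complex) \<Rightarrow> bool" where
  "semigroups_defined f \<longleftrightarrow> (\<forall>n.
     (\<forall>t\<ge>0. (\<lambda>m. heat_kernel t (n - m) *\<^sub>R f m) summable_on UNIV) \<and>
     (\<forall>t>0. (\<lambda>s. heat s f n) differentiable (at t)) \<and>
     (\<forall>t\<ge>0. set_integrable lborel {0<..}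
               (\<lambda>u. (exp (- u) / sqrt u) *\<^sub>R heat (t\<^sup>2 / (4 * u)) f n)))"


subsection \<open>Vector-valued Calderon-Zygmund operators on the integers\<close>

text \<open>
  A complex Banach space, presented by representatives: \<open>E\<close> is a subspace of an ambient complex
  vector space and \<open>nrm\<close> a complete seminorm on it. The Banach space is the quotient
  of \<open>E\<close> by the null space of \<open>nrm\<close>, so two elements \<open>x, y\<close> are identified iff
  \<open>nrm (x - y) = 0\<close>. This covers \<open>L\<^sup>2\<close> without passing to classes modulo a.e. equality.
\<close>

locale complex_banach = vector_space sc
  for sc :: "complex \<Rightarrow> 'e::ab_group_add \<Rightarrow> 'e" +
  fixes E :: "'e set" and nrm :: "'e \<Rightarrow> real"
  assumes subspace_E: "subspace E"
    and nrm_nonneg: "x \<in> E \<Longrightarrow> 0 \<le> nrm x"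
    and nrm_triangle: "x \<in> E \<Longrightarrow> y \<in> E \<Longrightarrow> nrm (x + y) \<le> nrm x + nrm y"
    and nrm_scale: "x \<in> E \<Longrightarrow> nrm (sc c x) = cmod c * nrm x"
    and complete_E: "(\<And>k. X k \<in> E) \<Longrightarrow>
           (\<And>e. e > 0 \<Longrightarrow> \<exists>k0::nat. \<forall>i\<ge>k0. \<forall>j\<ge>k0. nrm (X i - X j) < e) \<Longrightarrow>
           \<exists>x\<in>E. (\<lambda>k. nrm (X k - x)) \<longlonglongrightarrow> 0"

text \<open>
  The series \<open>\<Sum>m. K n m * f m\<close> is understood as unconditional convergence in \<open>E\<close>.
\<close>

definition calderon_zygmund ::
  "(complex \<Rightarrow> 'e::ab_group_add \<Rightarrow> 'e) \<Rightarrow> 'e set \<Rightarrow> ('e \<Rightarrow> real) \<Rightarrow>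
     ((int \<Rightarrow> complex) \<Rightarrow> int \<Rightarrow> 'e) \<Rightarrow> bool" where
  "calderon_zygmund sc E nrm T \<longleftrightarrow> complex_banach sc E nrm \<and>
     (\<exists>r>1.
        (\<forall>f\<in>lp r. \<forall>n. T f n \<in> E) \<and>
        (\<forall>f\<in>lp r. \<forall>g\<in>lp r. \<forall>a b n.
           nrm (T (\<lambda>m. a * f m + b * g m) n - (sc a (T f n) + sc b (T g n))) = 0) \<and>
        (\<exists>A. \<forall>f\<in>lp r. (\<lambda>n. nrm (T f n)) \<in> lp r \<and>
                        lp_norm r (\<lambda>n. nrm (T f n)) \<le> A * lp_norm r f) \<and>
        (\<exists>K C.
           (\<forall>n m. K n m \<in> E) \<and>
           (\<forall>f\<in>lp r. \<forall>n.
              ((\<lambda>F. nrm (T f n - (\<Sum>m\<in>F. sc (f m) (K n m)))) \<longlongrightarrow> 0)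
                (finite_subsets_at_top UNIV)) \<and>
           (\<forall>n m. n \<noteq> m \<longrightarrow> nrm (K n m) \<le> C / of_int \<bar>n - m\<bar>) \<and>
           (\<forall>n m m'. \<bar>n - m\<bar> > 2 * \<bar>m - m'\<bar> \<longrightarrow>
              nrm (K n m - K n m') + nrm (K m n - K m' n)
                \<le> C * of_int \<bar>m - m'\<bar> / (of_int \<bar>n - m\<bar>)\<^sup>2)))"


subsection \<open>The two spaces of functions of \<open>t\<close>\<close>

definition fscale :: "complex \<Rightarrow> (real \<Rightarrow> complex) \<Rightarrow> real \<Rightarrow> complex" where
  "fscale c \<phi> = (\<lambda>t. c * \<phi> t)"

text \<open>Only the values at \<open>t \<ge> 0\<close> (respectively \<open>t > 0\<close>) matter in the two spaces.\<close>

definition Linf :: "(real \<Rightarrow> complex) set" where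
  "Linf = {\<phi>. bounded (\<phi> ` {0..})}"

definition Linf_norm :: "(real \<Rightarrow> complex) \<Rightarrow> real" where
  "Linf_norm \<phi> = (SUP t\<in>{0..}. norm (\<phi> t))"

definition dt_over_t :: "real measure" where
  "dt_over_t = density (restrict_space lborel {0<..}) (\<lambda>t. ennreal (1 / t))"

definition L2 :: "(real \<Rightarrow> complex) set" where
  "L2 = {\<phi> \<in> borel_measurable dt_over_t. integrable dt_over_t (\<lambda>t. (norm (\<phi> t))\<^sup>2)}"

definition L2_norm :: "(real \<Rightarrow> complex) \<Rightarrow> real" where
  "L2_norm \<phi> = sqrt (LINT t|dt_over_t. (norm (\<phi> t))\<^sup>2)"

end

theory Submission
  imports Defs "HOL-Analysis.Analysis" "HOL-Real_Asymp.Real_Asymp"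
begin

text \<open>
The three operators are of the form \<open>T f n = (\<Sum>m. \<kappa> (n - m) * f m)\<close> with an even kernel \<open>\<kappa>\<close>
whose values are functions of \<open>t\<close>. Three facts are needed about each of them: the size
\<open>1/|k|\<close> and the difference \<open>1/k\<^sup>2\<close> of the kernel in the respective norm, and an
unweighted \<open>\<ell>\<^sup>2\<close> bound. The rest is real-variable theory on the integers.

\<^bold>\<open>Kernel.\<close> The identity \<open>e\<^sup>2\<^sup>t I\<^sub>k(2t) = (\<Sum>j. C(2j, j+k) t\<^sup>j / j!)\<close> (\<open>heat_kernel_series\<close>) exhibits
\<open>heat_kernel t\<close> as a Poisson mixture, with mean \<open>4t\<close>, of centred binomial distributions. Positivity,
symmetry, unimodality, total mass, the semigroup law (Vandermonde) and the heat equation (Pascal) are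
inherited from binomial coefficients, and so are the estimates
\<open>|\<Delta> K\<^sub>t(k)| \<le> (2k\<^sup>2/t\<^sup>2 + 1/t) K\<^sub>t(k)\<close> and its analogue for the difference of \<open>\<Delta> K\<^sub>t\<close>, since second differences of
\<open>C(2j, j+k)\<close> are explicit rational multiples of binomial coefficients. The three term recurrence
\<open>k K\<^sub>t(k) = t (K\<^sub>t(k-1) - K\<^sub>t(k+1))\<close> yields the decay \<open>K\<^sub>t(k) \<le> C (1+t)\<^sup>3 / k\<^sup>7\<close>. Together these bounds
give \<open>|K\<^sub>t(k) - K\<^sub>t(k+1)| \<le> C / k\<^sup>2\<close> uniformly in \<open>t\<close> (\<open>heat_kernel_grad\<close>), and, for the square
function, pointwise bounds which are integrable in \<open>t\<close> (\<open>heat_kernel_lap_weighted\<close>).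

\<^bold>\<open>Maximal operators.\<close> Since \<open>K\<^sub>t\<close> is even, decreasing on \<open>k \<ge> 0\<close> and has mass \<open>1\<close>, summation by parts gives
\<open>|W\<^sub>t f| \<le> M f\<close> for the Hardy--Littlewood maximal function (\<open>heat_kernel_average_le\<close>), and \<open>P\<^sub>t\<close> is an average of
the \<open>W\<^sub>s\<close>. The weighted bounds of \<open>M\<close> follow from the weak type inequality for maximal averages with
respect to an arbitrary measure (\<open>max_avg_weak\<close>), by an argument of Lerner for \<open>A\<^sub>p\<close> (\<open>max_avg_Ap\<close>) and
by comparing averages with weighted averages for \<open>A\<^sub>1\<close>.

\<^bold>\<open>Square function.\<close> The identity \<open>\<Sum>\<^sub>n \<integral> t |\<Delta> W\<^sub>t f(n)|\<^sup>2 dt = |f|\<^sup>2 / 4\<close> bounds \<open>g\<close> on \<open>\<ell>\<^sup>2\<close>; the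
semigroup law reduces it to the integral of an exact derivative (\<open>quad_form_integral\<close>). The \<open>A\<^sub>p\<close> bound comes from domination by a sparse
form (\<open>sparse_form_bound\<close>, \<open>strong_type_Ap\<close>), which rests on the unweighted weak type inequality and the regularity of the kernel; the weighted weak type inequality
comes from the Calderon--Zygmund decomposition (\<open>weak_type_A1\<close>), where the good part is handled in \<open>\<ell>\<^sup>2(w)\<close>
because \<open>A\<^sub>1\<close> is contained in \<open>A\<^sub>2\<close>.

All bounds are proved for finitely supported sequences and finite sums. They extend by truncation because every
\<open>f\<close> in \<open>\<ell>\<^sup>p(w)\<close> satisfies \<open>\<Sum>\<^sub>m |f(m)| / (1 + |m|) < \<infinity>\<close> (\<open>admissible\<close>), and this sum controls the norm of \<open>T f n\<close>.
\<close>

section \<open>Maximal averages over integer intervals\<close>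

text \<open>
Doob's argument: integrating the hypothesis against \<open>l powr (p - 2)\<close> bounds the sum of \<open>a powr p\<close> by a
multiple of the sum of \<open>h * a powr (p - 1)\<close>, and Young's inequality absorbs the power of \<open>a\<close>. The constant
depends on \<open>p\<close> alone, which is what makes the maximal averages usable for all measures at once.
\<close>

lemma strong_from_restricted_weak:
  fixes a h \<mu> :: "'i \<Rightarrow> real" and p :: real
  assumes fin: "finite X" and p: "1 < p"
    and \<mu>: "\<And>x. x \<in> X \<Longrightarrow> 0 \<le> \<mu> x" and h: "\<And>x. x \<in> X \<Longrightarrow> 0 \<le> h x" and a: "\<And>x. x \<in> X \<Longrightarrow> 0 \<le> a x"
    and weak: "\<And>l. 0 < l \<Longrightarrow> l * (\<Sum>x\<in>{x\<in>X. l \<le> a x}. \<mu> x) \<le> (\<Sum>x\<in>{x\<in>X. l \<le> a x}. h x * \<mu> x)"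
  shows "(\<Sum>x\<in>X. a x powr p * \<mu> x) \<le> (p / (p - 1)) powr p * (\<Sum>x\<in>X. h x powr p * \<mu> x)"
proof -
  define q where "q = p / (p - 1)"
  have q: "q > 0" "1 / p + 1 / q = 1" using p by (auto simp: q_def field_simps)
  define b where "b = (\<Sum>x\<in>X. a x)"
  have ab: "a x \<le> b" if "x \<in> X" for x
    unfolding b_def using that fin a by (intro member_le_sum) auto
  have I: "((\<lambda>l. if l \<in> {0..a x} then l powr s else 0) has_integral (a x powr (s + 1) / (s + 1))) {0..b}"
    if "x \<in> X" "s > -1" for x s
    using has_integral_powr_from_0[OF that(2) a[OF that(1)]] ab[OF that(1)]
    by (subst has_integral_restrict) auto
  have I1: "((\<lambda>l. \<Sum>x\<in>X. \<mu> x * (if l \<in> {0..a x} then l powr (p - 1) else 0))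
      has_integral (\<Sum>x\<in>X. \<mu> x * (a x powr p / p))) {0..b}"
    using I[of _ "p - 1"] p fin by (intro has_integral_sum has_integral_mult_right) auto
  have I2: "((\<lambda>l. \<Sum>x\<in>X. (h x * \<mu> x) * (if l \<in> {0..a x} then l powr (p - 2) else 0))
      has_integral (\<Sum>x\<in>X. (h x * \<mu> x) * (a x powr (p - 1) / (p - 1)))) {0..b}"
    using I[of _ "p - 2"] p fin by (intro has_integral_sum has_integral_mult_right) auto
  have "(\<Sum>x\<in>X. \<mu> x * (a x powr p / p)) \<le> (\<Sum>x\<in>X. (h x * \<mu> x) * (a x powr (p - 1) / (p - 1)))"
  proof (rule has_integral_le[OF I1 I2])
    fix l assume l: "l \<in> {0..b}"
    show "(\<Sum>x\<in>X. \<mu> x * (if l \<in> {0..a x} then l powr (p - 1) else 0))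
       \<le> (\<Sum>x\<in>X. (h x * \<mu> x) * (if l \<in> {0..a x} then l powr (p - 2) else 0))"
    proof (cases "l = 0")
      case False
      with l have l0: "l > 0" by auto
      have "(\<Sum>x\<in>X. \<mu> x * (if l \<in> {0..a x} then l powr (p - 1) else 0))
         = (\<Sum>x\<in>{x\<in>X. l \<le> a x}. \<mu> x * l powr (p - 1))"
        using l0 fin by (intro sum.mono_neutral_cong_right) auto
      also have "\<dots> = l powr (p - 2) * (l * (\<Sum>x\<in>{x\<in>X. l \<le> a x}. \<mu> x))"
        using l0 powr_add[of l "p-2" 1] by (simp add: sum_distrib_left mult_ac)
      also have "\<dots> \<le> l powr (p - 2) * (\<Sum>x\<in>{x\<in>X. l \<le> a x}. h x * \<mu> x)"
        using weak[OF l0] by (intro mult_left_mono) auto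
      also have "\<dots> = (\<Sum>x\<in>X. (h x * \<mu> x) * (if l \<in> {0..a x} then l powr (p - 2) else 0))"
        unfolding sum_distrib_left using l0 fin by (intro sum.mono_neutral_cong_left) auto
      finally show ?thesis .
    qed (simp cong: if_cong)
  qed
  hence "(\<Sum>x\<in>X. a x powr p * \<mu> x) / p \<le> (\<Sum>x\<in>X. \<mu> x * (h x * (a x powr (p - 1)) / (p - 1)))"
    by (simp add: sum_divide_distrib mult_ac)
  also have "\<dots> \<le> (\<Sum>x\<in>X. \<mu> x * (((q * h x) powr p / p + a x powr p / q) / p))"
  proof (intro sum_mono mult_left_mono \<mu>)
    fix x assume x: "x \<in> X"
    have "(q * h x) * (a x powr (p - 1)) \<le> (q * h x) powr p / p + (a x powr (p - 1)) powr q / q"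
      using p q x h[OF x] by (intro Youngs_inequality) (auto simp: q_def)
    also have "(a x powr (p - 1)) powr q = a x powr p" using p by (simp add: powr_powr q_def)
    finally have "(q * h x) * (a x powr (p - 1)) / p \<le> ((q * h x) powr p / p + a x powr p / q) / p"
      using p by (intro divide_right_mono) auto
    thus "h x * (a x powr (p - 1)) / (p - 1) \<le> ((q * h x) powr p / p + a x powr p / q) / p"
      using p by (simp add: q_def)
  qed auto
  also have "\<dots> = (q powr p * (\<Sum>x\<in>X. h x powr p * \<mu> x) / p + (\<Sum>x\<in>X. a x powr p * \<mu> x) / q) / p"
    using h q by (simp add: sum_divide_distrib sum_distrib_left sum.distrib[symmetric] powr_mult field_simps)
  finally have "(\<Sum>x\<in>X. a x powr p * \<mu> x) \<le> q powr p * (\<Sum>x\<in>X. h x powr p * \<mu> x) / p + (\<Sum>x\<in>X. a x powr p * \<mu> x) / q"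
    using p by (simp add: field_simps)
  moreover have "(\<Sum>x\<in>X. a x powr p * \<mu> x) / q = (\<Sum>x\<in>X. a x powr p * \<mu> x) * (1 - 1/p)"
  proof -
    have "1 / q = 1 - 1 / p" using q(2) by linarith
    thus ?thesis by (metis times_divide_eq_right mult.right_neutral)
  qed
  ultimately have "(\<Sum>x\<in>X. a x powr p * \<mu> x) / p \<le> q powr p * (\<Sum>x\<in>X. h x powr p * \<mu> x) / p"
    by (simp add: algebra_simps)
  thus ?thesis using p by (simp add: q_def divide_le_cancel)
qed

text \<open>
The one-sided maximal average with respect to the measure \<open>\<mu>\<close>. Confining the endpoint to \<open>b \<le> B\<close> makes the
supremum a maximum over a finite set.
\<close>

definition fwd_max :: "int \<Rightarrow> (int \<Rightarrow> real) \<Rightarrow> (int \<Rightarrow> real) \<Rightarrow> int \<Rightarrow> real" where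
  "fwd_max B \<mu> h n = Max ((\<lambda>b. (\<Sum>i=n..b. h i * \<mu> i) / (\<Sum>i=n..b. \<mu> i)) ` {n..B})"

lemma sum_weight_pos:
  fixes \<mu> :: "int \<Rightarrow> real"
  assumes "\<And>i. 0 < \<mu> i" "a \<le> b"
  shows "0 < (\<Sum>i=a..b. \<mu> i)"
  using assms by (intro sum_pos) auto

lemma fwd_max_ge:
  assumes "n \<le> b" "b \<le> B" "\<And>i. 0 < \<mu> i"
  shows "(\<Sum>i=n..b. h i * \<mu> i) \<le> fwd_max B \<mu> h n * (\<Sum>i=n..b. \<mu> i)"
proof -
  have "(\<Sum>i=n..b. h i * \<mu> i) / (\<Sum>i=n..b. \<mu> i) \<le> fwd_max B \<mu> h n"
    unfolding fwd_max_def using assms by (intro Max_ge) auto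
  thus ?thesis using sum_weight_pos[of \<mu> n b] assms by (simp add: pos_divide_le_eq)
qed

lemma fwd_max_geE:
  assumes "l \<le> fwd_max B \<mu> h n" "n \<le> B" "\<And>i. 0 < \<mu> i"
  obtains b where "n \<le> b" "b \<le> B" "l * (\<Sum>i=n..b. \<mu> i) \<le> (\<Sum>i=n..b. h i * \<mu> i)"
proof -
  have "fwd_max B \<mu> h n \<in> (\<lambda>b. (\<Sum>i=n..b. h i * \<mu> i) / (\<Sum>i=n..b. \<mu> i)) ` {n..B}"
    unfolding fwd_max_def using assms by (intro Max_in) auto
  then obtain b where b: "n \<le> b" "b \<le> B" "fwd_max B \<mu> h n = (\<Sum>i=n..b. h i * \<mu> i) / (\<Sum>i=n..b. \<mu> i)"
    by auto
  show ?thesis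
    using that[OF b(1,2)] assms(1) b sum_weight_pos[of \<mu> n b] assms(3) by (simp add: pos_le_divide_eq)
qed

lemma finite_int_Collect [simp]: "finite {i::int. a \<le> i \<and> i \<le> b \<and> P i}"
  by (rule finite_subset[of _ "{a..b}"]) auto

lemma sum_Un_le:
  fixes g :: "'i \<Rightarrow> real"
  assumes "finite X" "finite Y" "\<And>x. 0 \<le> g x"
  shows "sum g (X \<union> Y) \<le> sum g X + sum g Y"
  using sum.union_inter[OF assms(1,2), of g] sum_nonneg[of "X \<inter> Y" g] assms(3) by simp

lemma sum_int_split:
  fixes g :: "int \<Rightarrow> real"
  assumes "a \<le> c + 1" "c \<le> b"
  shows "(\<Sum>i=a..b. g i) = (\<Sum>i=a..c. g i) + (\<Sum>i=c+1..b. g i)"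
proof -
  have "{a..b} = {a..c} \<union> {c+1..b}" using assms by auto
  thus ?thesis by (simp add: sum.union_disjoint)
qed

text \<open>
The rising sun lemma, by induction on the left end of the range. If \<open>n\<close> itself belongs to the superlevel set, it starts an
interval whose average is at least \<open>l\<close>; choosing the shortest such interval puts all of it into the
superlevel set, and the induction hypothesis takes care of what lies to its right.
\<close>

lemma fwd_max_rising_sun:
  assumes \<mu>: "\<And>i. 0 < \<mu> i"
  shows "l * (\<Sum>i\<in>{i\<in>{n..B}. l \<le> fwd_max B \<mu> h i}. \<mu> i)
       \<le> (\<Sum>i\<in>{i\<in>{n..B}. l \<le> fwd_max B \<mu> h i}. h i * \<mu> i)"
proof (induction "nat (B + 1 - n)" arbitrary: n rule: less_induct)
  case less
  define U where "U m = {i\<in>{m..B}. l \<le> fwd_max B \<mu> h i}" for m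
  have IH: "l * (\<Sum>i\<in>U m. \<mu> i) \<le> (\<Sum>i\<in>U m. h i * \<mu> i)" if "n < m" "n \<le> B" for m
    unfolding U_def using that by (intro less) auto
  consider "B < n" | "n \<le> B" "n \<notin> U n" | "n \<le> B" "n \<in> U n" by force
  hence "l * (\<Sum>i\<in>U n. \<mu> i) \<le> (\<Sum>i\<in>U n. h i * \<mu> i)"
  proof cases
    case 1 thus ?thesis by (simp add: U_def)
  next
    case 2
    have "U n = U (n + 1)"
    proof (rule set_eqI)
      fix i show "i \<in> U n \<longleftrightarrow> i \<in> U (n + 1)" using 2(2) by (cases "i = n") (auto simp: U_def)
    qed
    thus ?thesis using IH[of "n + 1"] 2 by simp
  next
    case 3
    let ?P = "\<lambda>b. n \<le> b \<and> b \<le> B \<and> l * (\<Sum>i=n..b. \<mu> i) \<le> (\<Sum>i=n..b. h i * \<mu> i)"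
    from 3 have "l \<le> fwd_max B \<mu> h n" by (auto simp: U_def)
    then obtain b0 where "?P b0" by (rule fwd_max_geE[OF _ 3(1) \<mu>]) auto
    hence ex: "\<exists>k. ?P (n + int k)" by (intro exI[of _ "nat (b0 - n)"]) auto
    define k where "k = (LEAST k. ?P (n + int k))"
    have Pk: "?P (n + int k)" unfolding k_def by (rule LeastI_ex[OF ex])
    have min: "\<not> ?P (n + int j)" if "j < k" for j using that unfolding k_def by (rule not_less_Least)
    define b where "b = n + int k"
    have sub: "{n..b} \<subseteq> U n"
    proof
      fix i assume i: "i \<in> {n..b}"
      \<comment> \<open>as \<open>b\<close> is the first good endpoint, the part of \<open>{n..b}\<close> to the right of \<open>i\<close> has average at least \<open>l\<close>\<close>
      have "l * (\<Sum>j=i..b. \<mu> j) \<le> (\<Sum>j=i..b. h j * \<mu> j)"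
      proof (cases "i = n")
        case True thus ?thesis using Pk by (simp add: b_def)
      next
        case False
        with i have "\<not> ?P (n + int (nat (i - 1 - n)))" by (intro min) (auto simp: b_def)
        moreover have "n + int (nat (i - 1 - n)) = i - 1" using False i by auto
        ultimately have "l * (\<Sum>j=n..i-1. \<mu> j) > (\<Sum>j=n..i-1. h j * \<mu> j)"
          using False i Pk by (auto simp: b_def)
        moreover have "l * (\<Sum>j=n..b. \<mu> j) \<le> (\<Sum>j=n..b. h j * \<mu> j)" using Pk by (simp add: b_def)
        moreover have "(\<Sum>j=n..b. \<mu> j) = (\<Sum>j=n..i-1. \<mu> j) + (\<Sum>j=i..b. \<mu> j)"
          "(\<Sum>j=n..b. h j * \<mu> j) = (\<Sum>j=n..i-1. h j * \<mu> j) + (\<Sum>j=i..b. h j * \<mu> j)"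
          using i sum_int_split[of n "i-1" b] by auto
        ultimately show ?thesis by (simp add: algebra_simps)
      qed
      also have "\<dots> \<le> fwd_max B \<mu> h i * (\<Sum>j=i..b. \<mu> j)"
        using i Pk \<mu> by (intro fwd_max_ge) (auto simp: b_def)
      finally have "l \<le> fwd_max B \<mu> h i"
        using sum_weight_pos[of \<mu> i b] \<mu> i by auto
      thus "i \<in> U n" using i Pk by (auto simp: U_def b_def)
    qed
    have U: "U n = {n..b} \<union> U (b + 1)" using sub by (auto simp: U_def b_def)
    have disj: "{n..b} \<inter> U (b + 1) = {}" by (auto simp: U_def)
    have fin: "finite (U m)" for m by (auto simp: U_def)
    have "l * (\<Sum>i\<in>U (b+1). \<mu> i) \<le> (\<Sum>i\<in>U (b+1). h i * \<mu> i)"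
      using 3 by (intro IH) (auto simp: b_def)
    moreover have "l * (\<Sum>i=n..b. \<mu> i) \<le> (\<Sum>i=n..b. h i * \<mu> i)" using Pk by (simp add: b_def)
    ultimately show ?thesis
      unfolding U using disj fin by (simp add: sum.union_disjoint algebra_simps)
  qed
  thus ?case by (simp add: U_def)
qed

text \<open>
The uncentred maximal average over the subintervals of \<open>{A..B}\<close> containing \<open>n\<close>, with respect to the measure \<open>\<mu>\<close>.
\<close>

definition max_avg :: "int \<Rightarrow> int \<Rightarrow> (int \<Rightarrow> real) \<Rightarrow> (int \<Rightarrow> real) \<Rightarrow> int \<Rightarrow> real" where
  "max_avg A B \<mu> h n = Max ((\<lambda>(a, b). (\<Sum>i=a..b. h i * \<mu> i) / (\<Sum>i=a..b. \<mu> i)) ` ({A..n} \<times> {n..B}))"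

lemma max_avg_ge:
  assumes "A \<le> a" "a \<le> n" "n \<le> b" "b \<le> B" "\<And>i. 0 < \<mu> i"
  shows "(\<Sum>i=a..b. h i * \<mu> i) \<le> max_avg A B \<mu> h n * (\<Sum>i=a..b. \<mu> i)"
proof -
  have "(\<Sum>i=a..b. h i * \<mu> i) / (\<Sum>i=a..b. \<mu> i) \<le> max_avg A B \<mu> h n"
    unfolding max_avg_def using assms by (intro Max_ge) force+
  thus ?thesis using sum_weight_pos[of \<mu> a b] assms by (simp add: pos_divide_le_eq)
qed

lemma max_avg_attained:
  assumes "n \<in> {A..B}" "\<And>i. 0 < \<mu> i"
  obtains a b where "A \<le> a" "a \<le> n" "n \<le> b" "b \<le> B"
    "max_avg A B \<mu> h n * (\<Sum>i=a..b. \<mu> i) = (\<Sum>i=a..b. h i * \<mu> i)"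
proof -
  have "max_avg A B \<mu> h n \<in> (\<lambda>(a, b). (\<Sum>i=a..b. h i * \<mu> i) / (\<Sum>i=a..b. \<mu> i)) ` ({A..n} \<times> {n..B})"
    unfolding max_avg_def using assms by (intro Max_in) auto
  then obtain a b where b: "A \<le> a" "a \<le> n" "n \<le> b" "b \<le> B"
    "max_avg A B \<mu> h n = (\<Sum>i=a..b. h i * \<mu> i) / (\<Sum>i=a..b. \<mu> i)" by auto
  show ?thesis
    using that[OF b(1-4)] b sum_weight_pos[of \<mu> a b] assms(2) by simp
qed

lemma max_avg_nonneg:
  assumes "n \<in> {A..B}" "\<And>i. 0 < \<mu> i" "\<And>i. 0 \<le> h i"
  shows "0 \<le> max_avg A B \<mu> h n"
proof -
  have "0 \<le> h n * \<mu> n" using assms(3)[of n] assms(2)[of n] by simp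
  also have "h n * \<mu> n \<le> max_avg A B \<mu> h n * \<mu> n"
    using max_avg_ge[of A n n n B \<mu> h] assms by simp
  finally show ?thesis using assms(2)[of n] by (simp add: zero_le_mult_iff)
qed

definition bwd_max :: "int \<Rightarrow> (int \<Rightarrow> real) \<Rightarrow> (int \<Rightarrow> real) \<Rightarrow> int \<Rightarrow> real" where
  "bwd_max A \<mu> h n = fwd_max (- A) (\<lambda>i. \<mu> (- i)) (\<lambda>i. h (- i)) (- n)"

lemma sum_reflect: "(\<Sum>i=a..b. g (- i)) = (\<Sum>i= -b.. -a. g i)" for g :: "int \<Rightarrow> real"
  by (rule sum.reindex_bij_witness[of _ uminus uminus]) auto

text \<open>
An interval containing \<open>n\<close> is the union of two one-sided intervals which share the point \<open>n\<close>; counting it twice only increases the sum of \<open>h\<close>.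
\<close>

lemma max_avg_le_fwd_bwd:
  assumes n: "n \<in> {A..B}" and \<mu>: "\<And>i. 0 < \<mu> i" and h: "\<And>i. 0 \<le> h i"
  shows "max_avg A B \<mu> h n \<le> fwd_max B \<mu> h n + bwd_max A \<mu> h n"
    and "0 \<le> fwd_max B \<mu> h n" and "0 \<le> bwd_max A \<mu> h n"
proof -
  have F: "(\<Sum>i=n..b. h i * \<mu> i) \<le> fwd_max B \<mu> h n * (\<Sum>i=n..b. \<mu> i)" if "n \<le> b" "b \<le> B" for b
    using fwd_max_ge[OF that \<mu>] .
  have Bw: "(\<Sum>i=a..n. h i * \<mu> i) \<le> bwd_max A \<mu> h n * (\<Sum>i=a..n. \<mu> i)" if "A \<le> a" "a \<le> n" for a
    using fwd_max_ge[of "-n" "-a" "-A" "\<lambda>i. \<mu> (- i)" "\<lambda>i. h (- i)"] that \<mu>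
      sum_reflect[of "\<lambda>i. h i * \<mu> i" "-n" "-a"] sum_reflect[of \<mu> "-n" "-a"]
    by (simp add: bwd_max_def)
  have "0 \<le> h n * \<mu> n" using h[of n] \<mu>[of n] by simp
  with F[of n] Bw[of n] n have "0 \<le> fwd_max B \<mu> h n * \<mu> n" "0 \<le> bwd_max A \<mu> h n * \<mu> n" by auto
  thus F0: "0 \<le> fwd_max B \<mu> h n" and B0: "0 \<le> bwd_max A \<mu> h n"
    using \<mu>[of n] by (auto simp: zero_le_mult_iff)
  obtain a b where ab: "A \<le> a" "a \<le> n" "n \<le> b" "b \<le> B"
    "max_avg A B \<mu> h n * (\<Sum>i=a..b. \<mu> i) = (\<Sum>i=a..b. h i * \<mu> i)"
    by (rule max_avg_attained[of n A B \<mu> h, OF n \<mu>])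
  have nn: "0 \<le> h i * \<mu> i" for i using h[of i] \<mu>[of i] by simp
  have "(\<Sum>i=a..b. h i * \<mu> i) \<le> (\<Sum>i=a..n. h i * \<mu> i) + (\<Sum>i=n..b. h i * \<mu> i)"
    using ab sum_int_split[of a n b "\<lambda>i. h i * \<mu> i"] sum_mono2[of "{n..b}" "{n+1..b}" "\<lambda>i. h i * \<mu> i"] nn by auto
  also have "\<dots> \<le> bwd_max A \<mu> h n * (\<Sum>i=a..n. \<mu> i) + fwd_max B \<mu> h n * (\<Sum>i=n..b. \<mu> i)"
    using F[of b] Bw[of a] ab by auto
  also have "\<dots> \<le> bwd_max A \<mu> h n * (\<Sum>i=a..b. \<mu> i) + fwd_max B \<mu> h n * (\<Sum>i=a..b. \<mu> i)"
    using ab \<mu> F0 B0 by (intro add_mono mult_left_mono sum_mono2) (auto simp: less_imp_le)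
  finally have "max_avg A B \<mu> h n * (\<Sum>i=a..b. \<mu> i) \<le> (fwd_max B \<mu> h n + bwd_max A \<mu> h n) * (\<Sum>i=a..b. \<mu> i)"
    using ab by (simp add: algebra_simps)
  thus "max_avg A B \<mu> h n \<le> fwd_max B \<mu> h n + bwd_max A \<mu> h n"
    using sum_weight_pos[of \<mu> a b] \<mu> ab(1-4) by (simp del: ab add: mult_le_cancel_right)
qed

lemma bwd_max_rising_sun:
  assumes \<mu>: "\<And>i. 0 < \<mu> i"
  shows "l * (\<Sum>i\<in>{i\<in>{A..n}. l \<le> bwd_max A \<mu> h i}. \<mu> i)
       \<le> (\<Sum>i\<in>{i\<in>{A..n}. l \<le> bwd_max A \<mu> h i}. h i * \<mu> i)"
proof -
  define V where "V = {i\<in>{-n..-A}. l \<le> fwd_max (-A) (\<lambda>i. \<mu> (- i)) (\<lambda>i. h (- i)) i}"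
  have "(\<Sum>i\<in>{i\<in>{A..n}. l \<le> bwd_max A \<mu> h i}. g i) = (\<Sum>i\<in>V. g (- i))" for g :: "int \<Rightarrow> real"
    by (rule sum.reindex_bij_witness[of _ uminus uminus]) (auto simp: V_def bwd_max_def)
  thus ?thesis
    using fwd_max_rising_sun[of "\<lambda>i. \<mu> (- i)" l "-n" "-A" "\<lambda>i. h (- i)"] \<mu> unfolding V_def by simp
qed

text \<open>
Either one-sided maximal average exceeds half the level, so that two applications of the rising sun lemma suffice.
\<close>

lemma max_avg_weak:
  assumes \<mu>: "\<And>i. 0 < \<mu> i" and h: "\<And>i. 0 \<le> h i" and l: "0 < l"
  shows "l * (\<Sum>n\<in>{n\<in>{A..B}. l \<le> max_avg A B \<mu> h n}. \<mu> n) \<le> 4 * (\<Sum>n=A..B. h n * \<mu> n)"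
proof -
  let ?F = "{n\<in>{A..B}. l/2 \<le> fwd_max B \<mu> h n}" and ?G = "{n\<in>{A..B}. l/2 \<le> bwd_max A \<mu> h n}"
  have sub: "{n\<in>{A..B}. l \<le> max_avg A B \<mu> h n} \<subseteq> ?F \<union> ?G"
  proof
    fix n assume n: "n \<in> {n\<in>{A..B}. l \<le> max_avg A B \<mu> h n}"
    hence "max_avg A B \<mu> h n \<le> fwd_max B \<mu> h n + bwd_max A \<mu> h n"
      using \<mu> h by (intro max_avg_le_fwd_bwd(1)) auto
    hence "l/2 \<le> fwd_max B \<mu> h n \<or> l/2 \<le> bwd_max A \<mu> h n" using n by auto
    thus "n \<in> ?F \<union> ?G" using n by auto
  qed
  have nn: "0 \<le> h i * \<mu> i" for i using h[of i] \<mu>[of i] by simp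
  have "(\<Sum>n\<in>{n\<in>{A..B}. l \<le> max_avg A B \<mu> h n}. \<mu> n) \<le> (\<Sum>n\<in>?F \<union> ?G. \<mu> n)"
    using sub \<mu> by (intro sum_mono2) (auto simp: less_imp_le)
  also have "\<dots> \<le> (\<Sum>n\<in>?F. \<mu> n) + (\<Sum>n\<in>?G. \<mu> n)"
    using \<mu> by (intro sum_Un_le) (auto simp: less_imp_le)
  finally have "l/2 * (\<Sum>n\<in>{n\<in>{A..B}. l \<le> max_avg A B \<mu> h n}. \<mu> n) \<le> l/2 * (\<Sum>n\<in>?F. \<mu> n) + l/2 * (\<Sum>n\<in>?G. \<mu> n)"
    using l by (subst distrib_left[symmetric]) (intro mult_left_mono, auto)
  also have "\<dots> \<le> (\<Sum>n\<in>?F. h n * \<mu> n) + (\<Sum>n\<in>?G. h n * \<mu> n)"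
    by (intro add_mono fwd_max_rising_sun bwd_max_rising_sun \<mu>)
  also have "\<dots> \<le> (\<Sum>n=A..B. h n * \<mu> n) + (\<Sum>n=A..B. h n * \<mu> n)"
    using nn by (intro add_mono sum_mono2) auto
  finally show ?thesis by simp
qed

lemma max_avg_strong:
  assumes p: "1 < p"
  obtains C where "C > 0" "\<And>(\<mu> :: int \<Rightarrow> real) h A B. (\<And>i. 0 < \<mu> i) \<Longrightarrow> (\<And>i. 0 \<le> h i) \<Longrightarrow>
     (\<Sum>n=A..B. max_avg A B \<mu> h n powr p * \<mu> n) \<le> C * (\<Sum>n=A..B. h n powr p * \<mu> n)"
proof
  let ?q = "(p / (p - 1)) powr p"
  show "2 powr p * (?q + ?q) > 0" using p by (intro mult_pos_pos add_pos_pos) auto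
  fix \<mu> h :: "int \<Rightarrow> real" and A B
  assume \<mu>: "\<And>i. 0 < \<mu> i" and h: "\<And>i. 0 \<le> h i"
  have "(\<Sum>n=A..B. max_avg A B \<mu> h n powr p * \<mu> n)
     \<le> (\<Sum>n=A..B. 2 powr p * (fwd_max B \<mu> h n powr p + bwd_max A \<mu> h n powr p) * \<mu> n)"
  proof (intro sum_mono mult_right_mono)
    fix n assume n: "n \<in> {A..B}"
    note * = max_avg_le_fwd_bwd[of n A B \<mu> h, OF n \<mu> h]
    have "max_avg A B \<mu> h n \<le> 2 * max (fwd_max B \<mu> h n) (bwd_max A \<mu> h n)" using * by linarith
    hence "max_avg A B \<mu> h n powr p \<le> (2 * max (fwd_max B \<mu> h n) (bwd_max A \<mu> h n)) powr p"
      using max_avg_nonneg[OF n \<mu> h] p by (intro powr_mono2) auto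
    also have "\<dots> = 2 powr p * max (fwd_max B \<mu> h n) (bwd_max A \<mu> h n) powr p"
      using * by (simp add: powr_mult)
    also have "\<dots> \<le> 2 powr p * (fwd_max B \<mu> h n powr p + bwd_max A \<mu> h n powr p)"
      by (intro mult_left_mono) (auto simp: max_def)
    finally show "max_avg A B \<mu> h n powr p \<le> \<dots>" .
  qed (use \<mu> in \<open>auto simp: less_imp_le\<close>)
  also have "\<dots> = 2 powr p * ((\<Sum>n=A..B. fwd_max B \<mu> h n powr p * \<mu> n) + (\<Sum>n=A..B. bwd_max A \<mu> h n powr p * \<mu> n))"
    by (simp add: sum_distrib_left sum.distrib[symmetric] algebra_simps)
  also have "\<dots> \<le> 2 powr p * (?q * (\<Sum>n=A..B. h n powr p * \<mu> n) + ?q * (\<Sum>n=A..B. h n powr p * \<mu> n))"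
    using p \<mu> h
    by (intro mult_left_mono add_mono strong_from_restricted_weak fwd_max_rising_sun bwd_max_rising_sun)
       (auto simp: less_imp_le intro: max_avg_le_fwd_bwd)
  finally show "(\<Sum>n=A..B. max_avg A B \<mu> h n powr p * \<mu> n) \<le> 2 powr p * (?q + ?q) * (\<Sum>n=A..B. h n powr p * \<mu> n)"
    by (simp add: algebra_simps)
qed

section \<open>Maximal averages and Muckenhoupt weights\<close>

definition dual_weight :: "real \<Rightarrow> (int \<Rightarrow> real) \<Rightarrow> int \<Rightarrow> real" where
  "dual_weight p w n = w n powr (- 1 / (p - 1))"

text \<open>
The Muckenhoupt condition with its constant made explicit; \<open>dual_weight\<close> is the weight
\<open>\<sigma> = w powr (- 1 / (p - 1))\<close>, for which \<open>\<ell>\<^sup>p(w)\<close> is dual to \<open>\<ell>\<^sup>q(\<sigma>)\<close> with respect to the unweighted pairing.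
\<close>

definition Ap_const :: "real \<Rightarrow> real \<Rightarrow> (int \<Rightarrow> real) \<Rightarrow> bool" where
  "Ap_const p C w \<longleftrightarrow> (\<forall>n. 0 < w n) \<and> (\<forall>M N. M \<le> N \<longrightarrow>
     (\<Sum>k=M..N. w k) * (\<Sum>k=M..N. dual_weight p w k) powr (p - 1) \<le> C * of_int (N - M + 1) powr p)"

lemma dual_weight_pos: "0 < w n \<Longrightarrow> 0 < dual_weight p w n"
  by (simp add: dual_weight_def)

lemma Ap_constD:
  assumes "Ap_const p C w"
  shows "0 < w n" "0 < dual_weight p w n"
    "M \<le> N \<Longrightarrow> (\<Sum>k=M..N. w k) * (\<Sum>k=M..N. dual_weight p w k) powr (p - 1) \<le> C * of_int (N - M + 1) powr p"
  using assms dual_weight_pos[of w n p] by (auto simp: Ap_const_def)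

lemma Ap_const_pos:
  assumes "Ap_const p C w"
  shows "0 < C"
proof -
  have "0 < w 0 * dual_weight p w 0 powr (p - 1)"
    using Ap_constD(1,2)[OF assms, of 0] by (intro mult_pos_pos) auto
  also have "\<dots> \<le> C" using Ap_constD(3)[OF assms, of 0 0] by simp
  finally show ?thesis .
qed

lemma Ap_const_dual:
  assumes p: "1 < p" and w: "Ap_const p C w"
  shows "Ap_const (p / (p - 1)) (C powr (1 / (p - 1))) (dual_weight p w)"
    and "dual_weight (p / (p - 1)) (dual_weight p w) = w"
proof -
  have e: "p / (p - 1) - 1 = 1 / (p - 1)" using p by (simp add: field_simps)
  have e': "(1 - p) / (p - 1) = - 1" using p by (simp add: divide_eq_minus_1_iff)
  show dd: "dual_weight (p / (p - 1)) (dual_weight p w) = w"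
    using p Ap_constD(1)[OF w] by (auto simp: dual_weight_def powr_powr e e' less_imp_le intro!: ext)
  show "Ap_const (p / (p - 1)) (C powr (1 / (p - 1))) (dual_weight p w)"
    unfolding Ap_const_def dd e
  proof (intro conjI allI impI)
    fix M N :: int assume MN: "M \<le> N"
    let ?W = "\<Sum>k=M..N. w k" and ?S = "\<Sum>k=M..N. dual_weight p w k"
    have pos: "?W > 0" "?S > 0" using MN Ap_constD(1,2)[OF w] by (auto intro: sum_weight_pos)
    have "(?W * ?S powr (p - 1)) powr (1 / (p - 1)) \<le> (C * of_int (N - M + 1) powr p) powr (1 / (p - 1))"
      using pos p Ap_constD(3)[OF w MN] by (intro powr_mono2) auto
    thus "?S * ?W powr (1 / (p - 1)) \<le> C powr (1 / (p - 1)) * of_int (N - M + 1) powr (p / (p - 1))"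
      using pos p MN Ap_const_pos[OF w] by (simp add: powr_mult powr_powr mult.commute)
  qed (use Ap_constD(2)[OF w] in auto)
qed

text \<open>
Lerner's proof of Muckenhoupt's theorem. Writing \<open>\<sigma>\<close> for the dual weight, the condition on an interval \<open>I\<close> says that
\<open>(avg\<^sub>I h) powr (p - 1) \<le> C * (avg\<^sub>I 1/w d\<mu>\<^sub>w) * (avg\<^sub>I (h/\<sigma>) d\<mu>\<^sub>\<sigma>) powr (p - 1)\<close>, whence
\<open>(M h) powr (p - 1) \<le> C * M\<^sub>w ((M\<^sub>\<sigma> (h/\<sigma>)) powr (p - 1) / w)\<close>. The weighted maximal averages
\<open>M\<^sub>w\<close> and \<open>M\<^sub>\<sigma>\<close> are bounded on \<open>\<ell>\<^sup>q(w)\<close> and \<open>\<ell>\<^sup>p(\<sigma>)\<close> for every weight.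
\<close>

lemma max_avg_Ap:
  assumes p: "1 < p" and w: "Ap_const p C w"
  obtains K where "K > 0" "\<And>(h :: int \<Rightarrow> real) A B. (\<And>i. 0 \<le> h i) \<Longrightarrow>
     (\<Sum>n=A..B. max_avg A B (\<lambda>_. 1) h n powr p * w n) \<le> K * (\<Sum>n=A..B. h n powr p * w n)"
proof -
  define q where "q = p / (p - 1)"
  define s where "s = dual_weight p w"
  have q: "1 < q" "(p - 1) * q = p" "1 - q = - 1 / (p - 1)" using p by (auto simp: q_def field_simps)
  have w0: "0 < w i" and s0: "0 < s i" for i using Ap_constD(1,2)[OF w] by (auto simp: s_def)
  have C0: "0 < C" using Ap_const_pos[OF w] .
  obtain Kp where Kp: "Kp > 0" "\<And>(\<mu> :: int \<Rightarrow> real) h A B. (\<And>i. 0 < \<mu> i) \<Longrightarrow> (\<And>i. 0 \<le> h i) \<Longrightarrow>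
     (\<Sum>n=A..B. max_avg A B \<mu> h n powr p * \<mu> n) \<le> Kp * (\<Sum>n=A..B. h n powr p * \<mu> n)"
    using max_avg_strong[OF p] by blast
  obtain Kq where Kq: "Kq > 0" "\<And>(\<mu> :: int \<Rightarrow> real) h A B. (\<And>i. 0 < \<mu> i) \<Longrightarrow> (\<And>i. 0 \<le> h i) \<Longrightarrow>
     (\<Sum>n=A..B. max_avg A B \<mu> h n powr q * \<mu> n) \<le> Kq * (\<Sum>n=A..B. h n powr q * \<mu> n)"
    using max_avg_strong[OF q(1)] by blast
  show thesis
  proof (rule that[of "C powr q * Kq * Kp"])
    show "C powr q * Kq * Kp > 0" using C0 Kp Kq by simp
    fix h :: "int \<Rightarrow> real" and A B :: int
    assume h: "\<And>i. 0 \<le> h i"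
    define F where "F n = max_avg A B s (\<lambda>i. h i / s i) n" for n
    define g where "g n = (if n \<in> {A..B} then F n powr (p - 1) / w n else 0)" for n
    have g0: "0 \<le> g n" for n using w0[of n] by (auto simp: g_def intro!: divide_nonneg_pos)
    have hs0: "0 \<le> h i / s i" for i using h s0 by (simp add: less_imp_le)
    have F0: "0 \<le> F n" if "n \<in> {A..B}" for n
      unfolding F_def using that s0 hs0 by (intro max_avg_nonneg) auto
    have key: "max_avg A B (\<lambda>_. 1) h n powr (p - 1) \<le> C * max_avg A B w g n" if n: "n \<in> {A..B}" for n
    proof -
      obtain a b where ab: "A \<le> a" "a \<le> n" "n \<le> b" "b \<le> B"
        and m: "max_avg A B (\<lambda>_. 1) h n * (\<Sum>i=a..b. 1) = (\<Sum>i=a..b. h i * 1)"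
        by (rule max_avg_attained[of n A B "\<lambda>_. 1" h]) (use n in auto)
      define L where "L = (of_int (b - a + 1) :: real)"
      define H where "H = (\<Sum>i=a..b. h i)"
      define W where "W = (\<Sum>i=a..b. w i)"
      define S where "S = (\<Sum>i=a..b. s i)"
      have pos: "L > 0" "W > 0" "S > 0" using ab w0 s0 by (auto simp: L_def W_def S_def intro: sum_weight_pos)
      have H0: "0 \<le> H" using h by (auto simp: H_def intro: sum_nonneg)
      have card: "real (card {a..b}) = L" using ab by (simp add: L_def)
      have m: "max_avg A B (\<lambda>_. 1) h n = H / L" using m pos ab by (simp add: H_def L_def field_simps)
      have HF: "H / S \<le> F y" if y: "y \<in> {a..b}" for y
      proof -
        have "(\<Sum>i=a..b. h i / s i * s i) \<le> F y * S"
          unfolding F_def S_def using y ab s0 by (intro max_avg_ge) auto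
        also have "(\<Sum>i=a..b. h i / s i * s i) = H"
          unfolding H_def using s0 by (intro sum.cong) (auto simp: less_imp_neq[symmetric])
        finally show ?thesis using pos by (simp add: pos_divide_le_eq)
      qed
      have "L * (H / S) powr (p - 1) = (\<Sum>y=a..b. (H / S) powr (p - 1))" by (simp add: card[symmetric])
      also have "\<dots> \<le> (\<Sum>y=a..b. F y powr (p - 1))"
        using HF H0 pos p by (intro sum_mono powr_mono2) auto
      also have "\<dots> = (\<Sum>y=a..b. g y * w y)"
        using ab w0 by (intro sum.cong) (auto simp: g_def less_imp_neq[symmetric])
      also have "\<dots> \<le> max_avg A B w g n * W"
        unfolding W_def using ab w0 by (intro max_avg_ge) auto
      finally have 1: "(H / S) powr (p - 1) \<le> max_avg A B w g n * W / L" using pos by (simp add: field_simps)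
      have "(H / L) powr (p - 1) = (H / S) powr (p - 1) * (S powr (p - 1) / L powr (p - 1))"
        using pos H0 by (simp add: powr_divide)
      also have "\<dots> \<le> (max_avg A B w g n * W / L) * (S powr (p - 1) / L powr (p - 1))"
        using 1 by (intro mult_right_mono) auto
      also have "\<dots> = max_avg A B w g n * ((W * S powr (p - 1)) / L powr p)"
        using pos by (simp add: powr_diff)
      also have "\<dots> \<le> max_avg A B w g n * C"
      proof (rule mult_left_mono)
        show "W * S powr (p - 1) / L powr p \<le> C"
          using Ap_constD(3)[OF w, of a b] ab pos by (simp add: pos_divide_le_eq W_def S_def L_def s_def)
        show "0 \<le> max_avg A B w g n" using n w0 g0 by (intro max_avg_nonneg) auto
      qed
      finally show ?thesis by (simp add: m mult.commute)
    qed
    have "(\<Sum>n=A..B. max_avg A B (\<lambda>_. 1) h n powr p * w n)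
        \<le> (\<Sum>n=A..B. C powr q * (max_avg A B w g n powr q * w n))"
    proof (rule sum_mono)
      fix n assume n: "n \<in> {A..B}"
      have m0: "0 \<le> max_avg A B w g n" using n w0 g0 by (intro max_avg_nonneg) auto
      have "max_avg A B (\<lambda>_. 1) h n powr p = (max_avg A B (\<lambda>_. 1) h n powr (p - 1)) powr q"
        by (simp add: powr_powr q)
      also have "\<dots> \<le> (C * max_avg A B w g n) powr q"
        using key[OF n] q by (intro powr_mono2) auto
      also have "\<dots> = C powr q * max_avg A B w g n powr q" using C0 m0 by (simp add: powr_mult)
      finally show "max_avg A B (\<lambda>_. 1) h n powr p * w n \<le> C powr q * (max_avg A B w g n powr q * w n)"
        using w0[of n] by (simp add: mult.assoc[symmetric])
    qed
    also have "\<dots> = C powr q * (\<Sum>n=A..B. max_avg A B w g n powr q * w n)"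
      by (simp add: sum_distrib_left)
    also have "\<dots> \<le> C powr q * (Kq * (\<Sum>n=A..B. g n powr q * w n))"
      using w0 g0 by (intro mult_left_mono Kq(2)) auto
    also have "(\<Sum>n=A..B. g n powr q * w n) = (\<Sum>n=A..B. F n powr p * s n)"
    proof (rule sum.cong)
      fix n assume n: "n \<in> {A..B}"
      have "g n powr q * w n = F n powr p * (w n powr 1 / w n powr q)"
        using n F0[OF n] w0[of n] by (simp add: g_def powr_divide powr_powr q)
      also have "w n powr 1 / w n powr q = s n"
        unfolding powr_diff[symmetric] q(3) by (simp add: s_def dual_weight_def)
      finally show "g n powr q * w n = F n powr p * s n" .
    qed auto
    also have "C powr q * (Kq * \<dots>) \<le> C powr q * (Kq * (Kp * (\<Sum>n=A..B. (h n / s n) powr p * s n)))"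
      unfolding F_def using s0 hs0 Kq(1) by (intro mult_left_mono Kp(2)) auto
    also have "(\<Sum>n=A..B. (h n / s n) powr p * s n) = (\<Sum>n=A..B. h n powr p * w n)"
    proof (rule sum.cong)
      fix n
      have "(h n / s n) powr p * s n = h n powr p * (s n powr 1 / s n powr p)"
        using h[of n] s0[of n] by (simp add: powr_divide)
      also have "s n powr 1 / s n powr p = w n"
      proof -
        have e: "(1 - p) / (p - 1) = - 1" using p by (simp add: divide_eq_minus_1_iff)
        show ?thesis
          unfolding powr_diff[symmetric] using w0[of n] by (simp add: s_def dual_weight_def powr_powr e)
      qed
      finally show "(h n / s n) powr p * s n = h n powr p * w n" .
    qed auto
    finally show "(\<Sum>n=A..B. max_avg A B (\<lambda>_. 1) h n powr p * w n)
       \<le> C powr q * Kq * Kp * (\<Sum>n=A..B. h n powr p * w n)" by (simp add: mult.assoc)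
  qed
qed

text \<open>
Dyadic summation of an inverse square kernel: the annulus \<open>2\<^sup>i L \<le> |n - c| < 2\<^sup>i\<^sup>+\<^sup>1 L\<close> contributes at most
a constant times \<open>A / (2\<^sup>i L)\<close>.
\<close>

lemma inverse_square_tail:
  fixes h :: "int \<Rightarrow> real" and c L :: int
  assumes h: "\<And>n. 0 \<le> h n" and L: "1 \<le> L" and A: "0 \<le> A"
    and avg: "\<And>R. L \<le> R \<Longrightarrow> (\<Sum>n=c-R..c+R. h n) \<le> A * of_int (2 * R + 1)"
    and F: "finite F" "\<And>n. n \<in> F \<Longrightarrow> L \<le> \<bar>n - c\<bar>"
  shows "(\<Sum>n\<in>F. h n / (of_int (n - c))\<^sup>2) \<le> 9 * A / of_int L"
proof -
  define H where "H R = (\<Sum>n=c-R..c+R. h n)" for R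
  define T where "T N = {n\<in>{c-N..c+N}. L \<le> \<bar>n - c\<bar>}" for N
  have fT: "finite (T N)" for N by (simp add: T_def)
  have step: "(\<Sum>n\<in>T N. h n / (of_int (n - c))\<^sup>2) \<le> H N / (of_int N)\<^sup>2 + 9 * A * (1 / of_int L - 1 / of_int N)"
    if "L \<le> N" for N
    using that
  proof (induction rule: int_ge_induct)
    case base
    have "T L \<subseteq> {c - L..c + L}" by (auto simp: T_def)
    have "(\<Sum>n\<in>T L. h n / (of_int (n - c))\<^sup>2) = (\<Sum>n\<in>T L. h n / (of_int L)\<^sup>2)"
    proof (rule sum.cong)
      fix n assume "n \<in> T L"
      hence "\<bar>n - c\<bar> = \<bar>L\<bar>" using L by (auto simp: T_def)
      hence "(of_int (n - c) :: real)\<^sup>2 = (of_int L)\<^sup>2" by (metis of_int_abs power2_abs)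
      thus "h n / (of_int (n - c))\<^sup>2 = h n / (of_int L)\<^sup>2" by simp
    qed auto
    also have "\<dots> \<le> H L / (of_int L)\<^sup>2"
      unfolding sum_divide_distrib[symmetric] H_def using h
      by (intro divide_right_mono sum_mono2) (auto simp: T_def)
    finally show ?case by simp
  next
    case (step N)
    have N: "1 \<le> N" using step L by simp
    have T: "T (N + 1) = T N \<union> {c - (N + 1), c + (N + 1)}" using step L by (auto simp: T_def)
    have e: "{c - (N + 1)..c + (N + 1)} = {c-N..c+N} \<union> {c - (N + 1), c + (N + 1)}" using N by auto
    hence H: "H (N + 1) = H N + (h (c - (N + 1)) + h (c + (N + 1)))"
      unfolding H_def e using N by (simp add: sum.union_disjoint)
    have "(\<Sum>n\<in>T (N + 1). h n / (of_int (n - c))\<^sup>2)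
        = (\<Sum>n\<in>T N. h n / (of_int (n - c))\<^sup>2) + (\<Sum>n\<in>{c - (N + 1), c + (N + 1)}. h n / (of_int (n - c))\<^sup>2)"
      unfolding T by (intro sum.union_disjoint fT) (use N in \<open>auto simp: T_def\<close>)
    also have "(\<Sum>n\<in>{c - (N + 1), c + (N + 1)}. h n / (of_int (n - c))\<^sup>2)
        = (H (N + 1) - H N) / (of_int N + 1)\<^sup>2"
      unfolding H using N by (simp add: add_divide_distrib power2_commute[of _ "of_int N + 1"] power2_eq_square algebra_simps)
    finally have 1: "(\<Sum>n\<in>T (N + 1). h n / (of_int (n - c))\<^sup>2)
        \<le> H N / (of_int N)\<^sup>2 + 9 * A * (1 / of_int L - 1 / of_int N) + (H (N + 1) - H N) / (of_int N + 1)\<^sup>2"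
      using step.IH by simp
    define x where "x = (of_int N :: real)"
    have x: "x \<ge> 1" using N by (simp add: x_def)
    have HN: "H N \<le> A * (2 * x + 1)" using avg[of N] step by (simp add: H_def x_def)
    have "H N / x\<^sup>2 - H N / (x + 1)\<^sup>2 = H N * ((2 * x + 1) / (x\<^sup>2 * (x + 1)\<^sup>2))"
      using x by (simp add: divide_simps) (simp add: power2_eq_square algebra_simps)
    also have "\<dots> \<le> (A * (2 * x + 1)) * ((2 * x + 1) / (x\<^sup>2 * (x + 1)\<^sup>2))"
      using HN x by (intro mult_right_mono) auto
    also have "\<dots> = A * ((2 * x + 1)\<^sup>2 / (x\<^sup>2 * (x + 1)\<^sup>2))" by (simp add: power2_eq_square)
    also have "\<dots> \<le> A * (9 / (x * (x + 1)))"
    proof (rule mult_left_mono[OF _ A])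
      have "(2 * x + 1)\<^sup>2 \<le> 9 * (x * (x + 1))"
      proof -
        have "1 \<le> 5 * x + 5 * (x * x)" using x zero_le_square[of x] by linarith
        thus ?thesis by (simp add: power2_eq_square algebra_simps)
      qed
      hence "(2 * x + 1)\<^sup>2 / (x\<^sup>2 * (x + 1)\<^sup>2) \<le> 9 * (x * (x + 1)) / (x\<^sup>2 * (x + 1)\<^sup>2)"
        by (intro divide_right_mono) auto
      also have "\<dots> = 9 / (x * (x + 1))"
        using x by (simp add: divide_simps) (simp add: power2_eq_square algebra_simps)
      finally show "(2 * x + 1)\<^sup>2 / (x\<^sup>2 * (x + 1)\<^sup>2) \<le> 9 / (x * (x + 1))" .
    qed
    also have "\<dots> = 9 * A * (1 / x - 1 / (x + 1))" using x by (simp add: field_simps)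
    finally have "H N / x\<^sup>2 - H N / (x + 1)\<^sup>2 \<le> 9 * A * (1 / x - 1 / (x + 1))" .
    with 1 show ?case by (simp add: x_def[symmetric] diff_divide_distrib algebra_simps)
  qed
  obtain N0 where N0: "\<And>n. n \<in> F \<Longrightarrow> \<bar>n - c\<bar> \<le> N0"
    using finite_imageI[OF F(1), of "\<lambda>n. \<bar>n - c\<bar>"] by (meson Max_ge imageI)
  define N where "N = max L N0"
  have N: "L \<le> N" "1 \<le> N" "F \<subseteq> T N"
    using L N0 F(2) by (force simp: N_def T_def abs_le_iff)+
  have "(\<Sum>n\<in>F. h n / (of_int (n - c))\<^sup>2) \<le> (\<Sum>n\<in>T N. h n / (of_int (n - c))\<^sup>2)"
    using N h fT by (intro sum_mono2) auto
  also have "\<dots> \<le> H N / (of_int N)\<^sup>2 + 9 * A * (1 / of_int L - 1 / of_int N)" by (rule step[OF N(1)])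
  also have "\<dots> \<le> 9 * A / of_int N + 9 * A * (1 / of_int L - 1 / of_int N)"
  proof (rule add_right_mono)
    have "H N \<le> A * of_int (2 * N + 1)" using avg[OF N(1)] by (simp add: H_def)
    also have "\<dots> \<le> A * (9 * of_int N)" using N A by (intro mult_left_mono) auto
    finally have "H N / (of_int N)\<^sup>2 \<le> A * (9 * of_int N) / (of_int N)\<^sup>2" by (intro divide_right_mono) auto
    thus "H N / (of_int N)\<^sup>2 \<le> 9 * A / of_int N" using N by (simp add: power2_eq_square mult.commute)
  qed
  finally show ?thesis by (simp add: algebra_simps)
qed

section \<open>Dyadic intervals and sublinear Calderon--Zygmund operators\<close>

definition dyadic :: "nat \<Rightarrow> int \<Rightarrow> int set" where
  "dyadic k i = {i * 2 ^ k .. (i + 1) * 2 ^ k - 1}"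

text \<open>
The dyadic interval \<open>dyadic k i\<close> of length \<open>2\<^sup>k\<close> together with its two neighbours on either side.
\<close>

definition dyadic5 :: "nat \<Rightarrow> int \<Rightarrow> int set" where
  "dyadic5 k i = {(i - 2) * 2 ^ k .. (i + 3) * 2 ^ k - 1}"

lemma dyadic_0 [simp]: "dyadic 0 i = {i}"
  by (auto simp: dyadic_def)

lemma finite_dyadic [simp]: "finite (dyadic k i)" "finite (dyadic5 k i)"
  by (auto simp: dyadic_def dyadic5_def)

lemma card_dyadic [simp]: "card (dyadic k i) = 2 ^ k" "card (dyadic5 k i) = 5 * 2 ^ k"
proof -
  have "(i + 1) * 2 ^ k - i * 2 ^ k = (2 ^ k :: int)" "(i + 3) * 2 ^ k - (i - 2) * 2 ^ k = (5 * 2 ^ k :: int)"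
    by (simp_all add: algebra_simps)
  thus "card (dyadic k i) = 2 ^ k" "card (dyadic5 k i) = 5 * 2 ^ k"
    by (simp_all add: dyadic_def dyadic5_def nat_power_eq nat_mult_distrib)
qed

lemma dyadic_subset_dyadic5: "dyadic k i \<subseteq> dyadic5 k i"
proof -
  have "(i - 2) * 2 ^ k \<le> i * (2 ^ k :: int)" "(i + 1) * 2 ^ k \<le> (i + 3) * (2 ^ k :: int)"
    by (intro mult_right_mono; simp)+
  thus ?thesis unfolding dyadic_def dyadic5_def atLeastatMost_subset_iff
    by (intro disjI2 conjI) linarith+
qed

lemma dyadic_Suc: "dyadic (Suc k) i = dyadic k (2 * i) \<union> dyadic k (2 * i + 1)"
  by (auto simp: dyadic_def algebra_simps)

lemma dyadic_siblings_disjoint: "dyadic k (2 * i) \<inter> dyadic k (2 * i + 1) = {}"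
  by (auto simp: dyadic_def algebra_simps)

lemma dyadic_subset_parent: "dyadic k i \<subseteq> dyadic (Suc k) (i div 2)"
proof -
  have "i = 2 * (i div 2) \<or> i = 2 * (i div 2) + 1" by presburger
  thus ?thesis unfolding dyadic_Suc by (metis Un_upper1 Un_upper2)
qed

lemma dyadic5_mono:
  assumes "j < k" "dyadic j m \<subseteq> dyadic k i"
  shows "dyadic5 j m \<subseteq> dyadic5 k i"
proof -
  have "m * 2 ^ j \<in> dyadic j m" "(m + 1) * 2 ^ j - 1 \<in> dyadic j m" by (auto simp: dyadic_def algebra_simps)
  with assms(2) have "m * 2 ^ j \<in> dyadic k i" "(m + 1) * 2 ^ j - 1 \<in> dyadic k i" by blast+
  hence *: "i * 2 ^ k \<le> m * (2 ^ j :: int)" "(m + 1) * 2 ^ j \<le> (i + 1) * (2 ^ k :: int)"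
    by (auto simp: dyadic_def)
  have "2 ^ Suc j \<le> (2 ^ k :: int)" using assms(1) by (intro power_increasing) auto
  with * show ?thesis by (auto simp: dyadic5_def algebra_simps)
qed

text \<open>
Selection of the maximal dyadic subintervals which satisfy the stopping condition, by halving the interval: a selected
interval is stopped for the first time, so that its parent does not satisfy the condition.
\<close>

lemma dyadic_stopping:
  fixes Stop :: "nat \<Rightarrow> int \<Rightarrow> bool"
  assumes "\<not> Stop k i"
  shows "\<exists>S. finite S \<and>
     (\<forall>Q\<in>S. fst Q < k \<and> dyadic (fst Q) (snd Q) \<subseteq> dyadic k i \<and> Stop (fst Q) (snd Q) \<and> \<not> Stop (Suc (fst Q)) (snd Q div 2)) \<and>
     (\<forall>Q\<in>S. \<forall>Q'\<in>S. Q \<noteq> Q' \<longrightarrow> dyadic (fst Q) (snd Q) \<inter> dyadic (fst Q') (snd Q') = {}) \<and>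
     (\<forall>x\<in>dyadic k i. Stop 0 x \<longrightarrow> x \<in> (\<Union>Q\<in>S. dyadic (fst Q) (snd Q)))"
  using assms
proof (induction k arbitrary: i)
  case 0
  show ?case by (rule exI[of _ "{}"]) (use 0 in auto)
next
  case (Suc k)
  define good where "good c S \<longleftrightarrow> finite S \<and>
     (\<forall>Q\<in>S. fst Q < Suc k \<and> dyadic (fst Q) (snd Q) \<subseteq> dyadic k c \<and> Stop (fst Q) (snd Q) \<and> \<not> Stop (Suc (fst Q)) (snd Q div 2)) \<and>
     (\<forall>Q\<in>S. \<forall>Q'\<in>S. Q \<noteq> Q' \<longrightarrow> dyadic (fst Q) (snd Q) \<inter> dyadic (fst Q') (snd Q') = {}) \<and>
     (\<forall>x\<in>dyadic k c. Stop 0 x \<longrightarrow> x \<in> (\<Union>Q\<in>S. dyadic (fst Q) (snd Q)))" for c and S :: "(nat \<times> int) set"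
  have ex: "\<exists>S. good c S" if c: "c div 2 = i" for c
  proof (cases "Stop k c")
    case True
    have "good c {(k, c)}" using True c Suc.prems by (auto simp: good_def)
    thus ?thesis ..
  next
    case False
    from Suc.IH[OF this] obtain S where "finite S \<and>
     (\<forall>Q\<in>S. fst Q < k \<and> dyadic (fst Q) (snd Q) \<subseteq> dyadic k c \<and> Stop (fst Q) (snd Q) \<and> \<not> Stop (Suc (fst Q)) (snd Q div 2)) \<and>
     (\<forall>Q\<in>S. \<forall>Q'\<in>S. Q \<noteq> Q' \<longrightarrow> dyadic (fst Q) (snd Q) \<inter> dyadic (fst Q') (snd Q') = {}) \<and>
     (\<forall>x\<in>dyadic k c. Stop 0 x \<longrightarrow> x \<in> (\<Union>Q\<in>S. dyadic (fst Q) (snd Q)))" ..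
    hence "good c S" unfolding good_def by (auto simp: less_SucI)
    thus ?thesis ..
  qed
  obtain S1 where S1: "good (2 * i) S1" using ex[of "2 * i"] by auto
  obtain S2 where S2: "good (2 * i + 1) S2" using ex[of "2 * i + 1"] by auto
  have d: "dyadic (fst Q) (snd Q) \<inter> dyadic (fst Q') (snd Q') = {}" if "Q \<in> S1" "Q' \<in> S2" for Q Q'
  proof -
    have "dyadic (fst Q) (snd Q) \<subseteq> dyadic k (2 * i)" "dyadic (fst Q') (snd Q') \<subseteq> dyadic k (2 * i + 1)"
      using that S1 S2 by (auto simp: good_def)
    thus ?thesis using dyadic_siblings_disjoint[of k i] by blast
  qed
  show ?case
  proof (rule exI[of _ "S1 \<union> S2"], intro conjI ballI impI)
    show "finite (S1 \<union> S2)" using S1 S2 by (auto simp: good_def)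
    fix Q assume "Q \<in> S1 \<union> S2"
    hence *: "fst Q < Suc k" "dyadic (fst Q) (snd Q) \<subseteq> dyadic k (2 * i) \<or> dyadic (fst Q) (snd Q) \<subseteq> dyadic k (2 * i + 1)"
        "Stop (fst Q) (snd Q)" "\<not> Stop (Suc (fst Q)) (snd Q div 2)"
      using S1 S2 unfolding good_def by (elim UnE; simp)+
    show "fst Q < Suc k" "Stop (fst Q) (snd Q)" "\<not> Stop (Suc (fst Q)) (snd Q div 2)" by (rule *)+
    show "dyadic (fst Q) (snd Q) \<subseteq> dyadic (Suc k) i" using *(2) unfolding dyadic_Suc by blast
  next
    fix Q Q' assume QQ: "Q \<in> S1 \<union> S2" "Q' \<in> S1 \<union> S2" "Q \<noteq> Q'"
    then consider "Q \<in> S1" "Q' \<in> S1" | "Q \<in> S2" "Q' \<in> S2" | "Q \<in> S1" "Q' \<in> S2" | "Q \<in> S2" "Q' \<in> S1"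
      by blast
    thus "dyadic (fst Q) (snd Q) \<inter> dyadic (fst Q') (snd Q') = {}"
    proof cases
      case 1 with S1 QQ show ?thesis by (auto simp: good_def)
    next
      case 2 with S2 QQ show ?thesis by (auto simp: good_def)
    next
      case 3 with d show ?thesis by blast
    next
      case 4 with d[of Q' Q] show ?thesis by blast
    qed
  next
    fix x assume "x \<in> dyadic (Suc k) i" "Stop 0 x"
    thus "x \<in> (\<Union>Q\<in>S1 \<union> S2. dyadic (fst Q) (snd Q))"
      using S1 S2 unfolding good_def dyadic_Suc by (elim UnE) simp_all
  qed
qed

text \<open>
A dyadic interval is represented by the pair of its scale and its position.
\<close>

abbreviation dq :: "nat \<times> int \<Rightarrow> int set" where "dq Q \<equiv> dyadic (fst Q) (snd Q)"

abbreviation d5 :: "nat \<times> int \<Rightarrow> int set" where "d5 Q \<equiv> dyadic5 (fst Q) (snd Q)"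

lemma dyadic_stoppingE:
  assumes "\<not> Stop k i"
  obtains S where "finite S"
    "\<And>Q. Q \<in> S \<Longrightarrow> fst Q < k" "\<And>Q. Q \<in> S \<Longrightarrow> dq Q \<subseteq> dyadic k i"
    "\<And>Q. Q \<in> S \<Longrightarrow> Stop (fst Q) (snd Q)" "\<And>Q. Q \<in> S \<Longrightarrow> \<not> Stop (Suc (fst Q)) (snd Q div 2)"
    "\<And>Q Q'. Q \<in> S \<Longrightarrow> Q' \<in> S \<Longrightarrow> Q \<noteq> Q' \<Longrightarrow> dq Q \<inter> dq Q' = {}"
    "\<And>x. x \<in> dyadic k i \<Longrightarrow> Stop 0 x \<Longrightarrow> x \<in> (\<Union>Q\<in>S. dq Q)"
proof -
  from dyadic_stopping[of Stop, OF assms] obtain S where S: "finite S \<and>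
     (\<forall>Q\<in>S. fst Q < k \<and> dyadic (fst Q) (snd Q) \<subseteq> dyadic k i \<and> Stop (fst Q) (snd Q) \<and> \<not> Stop (Suc (fst Q)) (snd Q div 2)) \<and>
     (\<forall>Q\<in>S. \<forall>Q'\<in>S. Q \<noteq> Q' \<longrightarrow> dyadic (fst Q) (snd Q) \<inter> dyadic (fst Q') (snd Q') = {}) \<and>
     (\<forall>x\<in>dyadic k i. Stop 0 x \<longrightarrow> x \<in> (\<Union>Q\<in>S. dyadic (fst Q) (snd Q)))" ..
  show thesis by (rule that[of S]) (use S in auto)
qed

text \<open>
The \<open>A\<^sub>1\<close> condition without the supremum: each average of \<open>w\<close> is at most \<open>D\<close> times every value of \<open>w\<close> on the interval.
\<close>

definition muckenhoupt_A1 :: "real \<Rightarrow> (int \<Rightarrow> real) \<Rightarrow> bool" where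
  "muckenhoupt_A1 D w \<longleftrightarrow> (\<forall>n. 0 < w n) \<and>
     (\<forall>M N k. M \<le> k \<and> k \<le> N \<longrightarrow> (\<Sum>n=M..N. w n) \<le> D * of_int (N - M + 1) * w k)"

lemma muckenhoupt_A1D:
  assumes "muckenhoupt_A1 D w"
  shows "0 < w n" "M \<le> k \<Longrightarrow> k \<le> N \<Longrightarrow> (\<Sum>n=M..N. w n) \<le> D * of_int (N - M + 1) * w k" "1 \<le> D"
proof -
  show w: "0 < w n" for n using assms by (auto simp: muckenhoupt_A1_def)
  show a: "(\<Sum>n=M..N. w n) \<le> D * of_int (N - M + 1) * w k" if "M \<le> k" "k \<le> N" for M N k
    using assms that by (auto simp: muckenhoupt_A1_def)
  show "1 \<le> D" using a[of 0 0 0] w[of 0] by simp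
qed

lemma muckenhoupt_A1_one: "muckenhoupt_A1 1 (\<lambda>_. 1)"
  by (auto simp: muckenhoupt_A1_def)

lemma muckenhoupt_A1_dyadic:
  assumes "muckenhoupt_A1 D w" "m \<in> dyadic k i"
  shows "(\<Sum>n\<in>dyadic k i. w n) \<le> D * 2 ^ k * w m" "(\<Sum>n\<in>dyadic5 k i. w n) \<le> D * (5 * 2 ^ k) * w m"
proof -
  have "(i + 1) * 2 ^ k - i * 2 ^ k = (2 ^ k :: int)" "(i + 3) * 2 ^ k - (i - 2) * 2 ^ k = (5 * 2 ^ k :: int)"
    by (simp_all add: algebra_simps)
  hence e: "(i + 1) * 2 ^ k - 1 - i * 2 ^ k + 1 = (2 ^ k :: int)" "(i + 3) * 2 ^ k - 1 - (i - 2) * 2 ^ k + 1 = (5 * 2 ^ k :: int)"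
    by linarith+
  show "(\<Sum>n\<in>dyadic k i. w n) \<le> D * 2 ^ k * w m"
    using muckenhoupt_A1D(2)[OF assms(1), of "i * 2 ^ k" m "(i + 1) * 2 ^ k - 1"] assms(2) e(1)
    by (simp add: dyadic_def)
  have "m \<in> dyadic5 k i" using assms(2) dyadic_subset_dyadic5 by blast
  thus "(\<Sum>n\<in>dyadic5 k i. w n) \<le> D * (5 * 2 ^ k) * w m"
    using muckenhoupt_A1D(2)[OF assms(1), of "(i - 2) * 2 ^ k" m "(i + 3) * 2 ^ k - 1"] e(2)
    by (simp add: dyadic5_def)
qed

text \<open>
What the weighted theory uses of a Calderon--Zygmund operator \<open>T\<close> with values in a normed space, expressed through
\<open>G f n\<close>, the norm of \<open>T f n\<close>: sublinearity, the \<open>\<ell>\<^sup>2\<close> bound, and the two halves of the kernel regularity, in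
the form in which they are applied. \<open>G_mean_zero\<close> concerns sequences with mean zero near \<open>c\<close> seen from the distance,
and \<open>G_smooth\<close> the variation of \<open>G f\<close> away from the support of \<open>f\<close>. Only finitely supported sequences occur.
\<close>

locale cz_sublinear =
  fixes G :: "(int \<Rightarrow> complex) \<Rightarrow> int \<Rightarrow> real" and c0 :: real
  assumes c0: "0 \<le> c0"
    and G_nonneg: "0 \<le> G f n"
    and G_add: "finite {x. f x \<noteq> 0} \<Longrightarrow> finite {x. g x \<noteq> 0} \<Longrightarrow> G (\<lambda>x. f x + g x) n \<le> G f n + G g n"
    and G_minus: "finite {x. f x \<noteq> 0} \<Longrightarrow> G (\<lambda>x. - f x) n = G f n"
    and G_l2: "finite S \<Longrightarrow> (\<And>x. x \<notin> S \<Longrightarrow> f x = 0) \<Longrightarrow> finite F \<Longrightarrow>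
        (\<Sum>n\<in>F. (G f n)\<^sup>2) \<le> c0 * (\<Sum>x\<in>S. (norm (f x))\<^sup>2)"
    and G_mean_zero: "finite S \<Longrightarrow> (\<And>x. x \<notin> S \<Longrightarrow> f x = 0) \<Longrightarrow> (\<Sum>x\<in>S. f x) = 0 \<Longrightarrow>
        (\<And>m. m \<in> S \<Longrightarrow> 2 * \<bar>m - c\<bar> < \<bar>n - c\<bar>) \<Longrightarrow>
        G f n \<le> c0 * (\<Sum>m\<in>S. norm (f m) * of_int \<bar>m - c\<bar> / (of_int (n - c))\<^sup>2)"
    and G_smooth: "finite S \<Longrightarrow> (\<And>x. x \<notin> S \<Longrightarrow> f x = 0) \<Longrightarrow>
        (\<And>m. m \<in> S \<Longrightarrow> 2 * \<bar>x - y\<bar> < \<bar>m - x\<bar>) \<Longrightarrow>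
        G f y \<le> G f x + c0 * (\<Sum>m\<in>S. norm (f m) * of_int \<bar>x - y\<bar> / (of_int (m - x))\<^sup>2)"
begin

lemma G_zero: "G (\<lambda>_. 0) n = 0"
  using G_l2[of "{}" "\<lambda>_. 0" "{n}"] G_nonneg[of "\<lambda>_. 0" n] by simp

lemma G_sum:
  assumes "finite I" "\<And>i. i \<in> I \<Longrightarrow> finite {x. b i x \<noteq> 0}"
  shows "G (\<lambda>x. \<Sum>i\<in>I. b i x) n \<le> (\<Sum>i\<in>I. G (b i) n)"
  using assms
proof (induction I rule: finite_induct)
  case (insert j I)
  have "finite {x. (\<Sum>i\<in>I. b i x) \<noteq> 0}"
    by (rule finite_subset[of _ "\<Union>i\<in>I. {x. b i x \<noteq> 0}"]) (use insert in \<open>auto dest: sum.not_neutral_contains_not_neutral\<close>)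
  hence "G (\<lambda>x. b j x + (\<Sum>i\<in>I. b i x)) n \<le> G (b j) n + G (\<lambda>x. \<Sum>i\<in>I. b i x) n"
    using insert by (intro G_add) auto
  thus ?case using insert by force
qed (simp add: G_zero)

text \<open>
Outside the dilated interval the regularity of the kernel gains a factor \<open>2\<^sup>k / |n - c|\<^sup>2\<close>, and the \<open>A\<^sub>1\<close>
condition turns the tail sum of \<open>w\<close> against it into a value of \<open>w\<close> on the interval.
\<close>

lemma G_mean_zero_weighted:
  assumes w: "muckenhoupt_A1 D w" and b: "\<And>x. x \<notin> dyadic k i \<Longrightarrow> b x = 0" "(\<Sum>x\<in>dyadic k i. b x) = 0"
    and F: "finite F"
  shows "(\<Sum>n\<in>F - dyadic5 k i. G b n * w n) \<le> 9 * D * c0 * (\<Sum>m\<in>dyadic k i. norm (b m) * w m)"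
proof -
  define c where "c = i * 2 ^ k"
  note w0 = muckenhoupt_A1D(1)[OF w]
  have m: "\<bar>m - c\<bar> < 2 ^ k" if "m \<in> dyadic k i" for m
    using that by (auto simp: dyadic_def c_def algebra_simps)
  have n: "2 * 2 ^ k \<le> \<bar>n - c\<bar>" if "n \<notin> dyadic5 k i" for n
    using that by (auto simp: dyadic5_def c_def algebra_simps abs_if)
  have "G b n * w n \<le> (\<Sum>m\<in>dyadic k i. c0 * norm (b m) * 2 ^ k * (w n / (of_int (n - c))\<^sup>2))"
    if "n \<in> F - dyadic5 k i" for n
  proof -
    have "G b n \<le> c0 * (\<Sum>m\<in>dyadic k i. norm (b m) * of_int \<bar>m - c\<bar> / (of_int (n - c))\<^sup>2)"
      using m n[of n] that by (intro G_mean_zero b) force+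
    also have "\<dots> \<le> c0 * (\<Sum>m\<in>dyadic k i. norm (b m) * 2 ^ k / (of_int (n - c))\<^sup>2)"
    proof (intro mult_left_mono sum_mono divide_right_mono c0)
      fix x assume "x \<in> dyadic k i"
      from m[OF this] have "of_int \<bar>x - c\<bar> \<le> (of_int (2 ^ k) :: real)" by (simp only: of_int_le_iff)
      thus "real_of_int \<bar>x - c\<bar> \<le> 2 ^ k" by simp
    qed auto
    finally have "G b n * w n \<le> c0 * (\<Sum>m\<in>dyadic k i. norm (b m) * 2 ^ k / (of_int (n - c))\<^sup>2) * w n"
      using w0[of n] by (intro mult_right_mono) auto
    thus ?thesis by (simp add: sum_distrib_left sum_distrib_right mult_ac)
  qed
  hence "(\<Sum>n\<in>F - dyadic5 k i. G b n * w n)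
      \<le> (\<Sum>n\<in>F - dyadic5 k i. \<Sum>m\<in>dyadic k i. c0 * norm (b m) * 2 ^ k * (w n / (of_int (n - c))\<^sup>2))"
    by (rule sum_mono)
  also have "\<dots> = (\<Sum>m\<in>dyadic k i. c0 * norm (b m) * 2 ^ k * (\<Sum>n\<in>F - dyadic5 k i. w n / (of_int (n - c))\<^sup>2))"
    unfolding sum_distrib_left by (rule sum.swap)
  also have "\<dots> \<le> (\<Sum>m\<in>dyadic k i. c0 * norm (b m) * 2 ^ k * (9 * (D * w m) / of_int (2 ^ k)))"
  proof (intro sum_mono mult_left_mono)
    fix x assume x: "x \<in> dyadic k i"
    show "(\<Sum>n\<in>F - dyadic5 k i. w n / (of_int (n - c))\<^sup>2) \<le> 9 * (D * w x) / of_int (2 ^ k)"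
    proof (rule inverse_square_tail)
      fix R :: int assume "2 ^ k \<le> R"
      with m[OF x] have "c - R \<le> x" "x \<le> c + R" by auto
      from muckenhoupt_A1D(2)[OF w this] show "sum w {c - R..c + R} \<le> D * w x * of_int (2 * R + 1)"
        by (simp add: algebra_simps)
    next
      fix n' assume "n' \<in> F - dyadic5 k i"
      with n[of n'] show "2 ^ k \<le> \<bar>n' - c\<bar>" by (smt (verit) DiffD2 zero_less_power)
    qed (use w0 muckenhoupt_A1D(3)[OF w] F in \<open>auto simp: less_imp_le\<close>)
  qed (use c0 in auto)
  also have "\<dots> = 9 * D * c0 * (\<Sum>m\<in>dyadic k i. norm (b m) * w m)"
    by (simp add: sum_distrib_left mult_ac)
  finally show ?thesis .
qed

end

section \<open>The weak type inequality for \<open>A\<^sub>1\<close> weights\<close>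

lemma sum_UN_le:
  fixes g :: "'b \<Rightarrow> real"
  assumes "finite I" "\<And>i. i \<in> I \<Longrightarrow> finite (A i)" "\<And>x. 0 \<le> g x"
  shows "sum g (\<Union>i\<in>I. A i) \<le> (\<Sum>i\<in>I. sum g (A i))"
  using assms(1,2)
proof (induction I rule: finite_induct)
  case (insert i I)
  have "sum g (A i \<union> (\<Union>i\<in>I. A i)) \<le> sum g (A i) + sum g (\<Union>i\<in>I. A i)"
    using insert assms(3) by (intro sum_Un_le) auto
  thus ?case using insert by force
qed simp

text \<open>
Dyadic intervals never straddle the origin, so two of them are needed to cover a finite set.
\<close>

lemma ex_dyadic_cover:
  fixes S :: "int set" and x :: real
  assumes "finite S"
  obtains K where "S \<subseteq> dyadic K 0 \<union> dyadic K (-1)" "x \<le> 2 ^ K"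
proof -
  obtain b where b: "\<And>n. n \<in> S \<Longrightarrow> \<bar>n\<bar> \<le> b"
    using finite_imageI[OF assms, of "abs"] by (meson Max_ge imageI)
  obtain K where K: "max x (of_int b + 1) < 2 ^ K" using real_arch_pow[of 2 "max x (of_int b + 1)"] by auto
  have "of_int b + 1 < (2 ^ K :: real)" using K by (simp only: max_less_iff_conj)
  hence "of_int b < (2 ^ K :: real)" by linarith
  hence "b < 2 ^ K" by (metis of_int_less_iff of_int_numeral of_int_power)
  hence "S \<subseteq> dyadic K 0 \<union> dyadic K (-1)" using b by (force simp: dyadic_def abs_le_iff)
  thus ?thesis using that[of K] K by simp
qed

context cz_sublinear begin

text \<open>
The Calderon--Zygmund decomposition at height \<open>l\<close>, \<open>f = g + (\<Sum>Q. b Q)\<close>, over the maximal dyadic intervals \<open>Q\<close> on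
which the average of \<open>|f|\<close> exceeds \<open>l\<close>. The level set of \<open>G f\<close> is covered by three sets: that of \<open>G g\<close>, which is
controlled by Chebyshev's inequality in \<open>\<ell>\<^sup>2(w)\<close> as \<open>|g| \<le> 2 * l\<close>; the dilated intervals, whose weight is controlled by
\<open>A\<^sub>1\<close>; and the part outside of them where the \<open>G (b Q)\<close> are large, controlled by \<open>G_mean_zero_weighted\<close>.
\<close>

lemma weak_type_A1:
  assumes w: "muckenhoupt_A1 D w" and B: "0 \<le> B"
    and strong: "\<And>f S F. finite S \<Longrightarrow> (\<And>x. x \<notin> S \<Longrightarrow> f x = 0) \<Longrightarrow> finite F \<Longrightarrow>
        (\<Sum>n\<in>F. (G f n)\<^sup>2 * w n) \<le> B * (\<Sum>x\<in>S. (norm (f x))\<^sup>2 * w x)"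
  obtains C where "0 < C" "\<And>f S F l. finite S \<Longrightarrow> (\<And>x. x \<notin> S \<Longrightarrow> f x = 0) \<Longrightarrow> finite F \<Longrightarrow> 0 < l \<Longrightarrow>
        l * (\<Sum>n\<in>{n\<in>F. l < G f n}. w n) \<le> C * (\<Sum>x\<in>S. norm (f x) * w x)"
proof (rule that[of "8 * B * D + 5 * D + 18 * D * c0 * (1 + D)"])
  note w0 = muckenhoupt_A1D(1)[OF w]
  have D: "1 \<le> D" by (rule muckenhoupt_A1D(3)[OF w])
  show "0 < 8 * B * D + 5 * D + 18 * D * c0 * (1 + D)" using D B c0 by (intro add_nonneg_pos add_pos_nonneg) auto
  fix f :: "int \<Rightarrow> complex" and S0 F :: "int set" and l :: real
  assume S0: "finite S0" "\<And>x. x \<notin> S0 \<Longrightarrow> f x = 0" and F: "finite F" and l: "0 < l"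
  obtain K where K: "S0 \<subseteq> dyadic K 0 \<union> dyadic K (-1)" "(\<Sum>x\<in>S0. norm (f x)) / l \<le> 2 ^ K"
    using ex_dyadic_cover[OF S0(1)] by metis
  define W where "W = dyadic K 0 \<union> dyadic K (-1)"
  have fW: "finite W" by (simp add: W_def)
  have f0: "f x = 0" if "x \<notin> W" for x using that K(1) S0(2)[of x] by (auto simp: W_def)
  have SW: "(\<Sum>x\<in>S0. norm (f x) * g x) = (\<Sum>x\<in>W. norm (f x) * g x)" for g :: "int \<Rightarrow> real"
    using K(1) S0 fW by (intro sum.mono_neutral_left) (auto simp: W_def)
  \<comment> \<open>average of \<open>|f|\<close> above \<open>l\<close>; the scale \<open>K\<close> is so large that the covering intervals are not stopped\<close>
  define Stop where "Stop k i \<longleftrightarrow> l * 2 ^ k < (\<Sum>x\<in>dyadic k i. norm (f x))" for k i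
  have noStop: "\<not> Stop K i" if "i \<in> {0, -1}" for i
  proof -
    have "(\<Sum>x\<in>dyadic K i. norm (f x)) \<le> (\<Sum>x\<in>W. norm (f x))"
      using that fW by (intro sum_mono2) (auto simp: W_def)
    also have "\<dots> = (\<Sum>x\<in>S0. norm (f x))" using SW[of "\<lambda>_. 1"] by simp
    also have "\<dots> \<le> l * 2 ^ K" using K(2) l by (simp add: pos_divide_le_eq mult.commute)
    finally show ?thesis by (simp add: Stop_def)
  qed
  obtain \<S>1 where S1: "finite \<S>1" "\<And>Q. Q \<in> \<S>1 \<Longrightarrow> dq Q \<subseteq> dyadic K 0"
     "\<And>Q. Q \<in> \<S>1 \<Longrightarrow> Stop (fst Q) (snd Q)" "\<And>Q. Q \<in> \<S>1 \<Longrightarrow> \<not> Stop (Suc (fst Q)) (snd Q div 2)"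
     "\<And>Q Q'. Q \<in> \<S>1 \<Longrightarrow> Q' \<in> \<S>1 \<Longrightarrow> Q \<noteq> Q' \<Longrightarrow> dq Q \<inter> dq Q' = {}"
     "\<And>x. x \<in> dyadic K 0 \<Longrightarrow> Stop 0 x \<Longrightarrow> x \<in> (\<Union>Q\<in>\<S>1. dq Q)"
    by (rule dyadic_stoppingE[of Stop K "0", OF noStop]) auto
  obtain \<S>2 where S2: "finite \<S>2" "\<And>Q. Q \<in> \<S>2 \<Longrightarrow> dq Q \<subseteq> dyadic K (-1)"
     "\<And>Q. Q \<in> \<S>2 \<Longrightarrow> Stop (fst Q) (snd Q)" "\<And>Q. Q \<in> \<S>2 \<Longrightarrow> \<not> Stop (Suc (fst Q)) (snd Q div 2)"
     "\<And>Q Q'. Q \<in> \<S>2 \<Longrightarrow> Q' \<in> \<S>2 \<Longrightarrow> Q \<noteq> Q' \<Longrightarrow> dq Q \<inter> dq Q' = {}"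
     "\<And>x. x \<in> dyadic K (-1) \<Longrightarrow> Stop 0 x \<Longrightarrow> x \<in> (\<Union>Q\<in>\<S>2. dq Q)"
    by (rule dyadic_stoppingE[of Stop K "-1", OF noStop]) auto
  define \<S> where "\<S> = \<S>1 \<union> \<S>2"
  have S: "finite \<S>" using S1 S2 by (simp add: \<S>_def)
  have SQ: "dq Q \<subseteq> W" "Stop (fst Q) (snd Q)" "\<not> Stop (Suc (fst Q)) (snd Q div 2)" if "Q \<in> \<S>" for Q
    using that S1(2-4)[of Q] S2(2-4)[of Q] unfolding \<S>_def W_def by auto
  have dj: "dyadic K 0 \<inter> dyadic K (-1) = {}" by (auto simp: dyadic_def)
  have disj: "dq Q \<inter> dq Q' = {}" if "Q \<in> \<S>" "Q' \<in> \<S>" "Q \<noteq> Q'" for Q Q'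
  proof -
    have *: "dq Q \<inter> dq Q' = {}" if "Q \<in> \<S>1" "Q' \<in> \<S>2" for Q Q'
      using S1(2)[OF that(1)] S2(2)[OF that(2)] dj by blast
    from that(1,2) consider "Q \<in> \<S>1" "Q' \<in> \<S>1" | "Q \<in> \<S>2" "Q' \<in> \<S>2" | "Q \<in> \<S>1" "Q' \<in> \<S>2" | "Q \<in> \<S>2" "Q' \<in> \<S>1"
      unfolding \<S>_def by blast
    thus ?thesis
    proof cases
      case 4 thus ?thesis using *[of Q' Q] by (simp add: Int_commute)
    qed (use S1(5) S2(5) * that(3) in auto)
  qed
  define U where "U = (\<Union>Q\<in>\<S>. dq Q)"
  have UW: "U \<subseteq> W" using SQ(1) by (auto simp: U_def)
  have fU: "finite U" using S by (simp add: U_def)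
  have sumU: "(\<Sum>Q\<in>\<S>. \<Sum>x\<in>dq Q. g x) = (\<Sum>x\<in>U. g x)" for g :: "int \<Rightarrow> real"
    unfolding U_def using S disj by (subst sum.UNION_disjoint) auto
  have sumUW: "(\<Sum>Q\<in>\<S>. \<Sum>x\<in>dq Q. norm (f x) * w x) \<le> (\<Sum>x\<in>W. norm (f x) * w x)"
    unfolding sumU using UW fW w0 by (intro sum_mono2) (auto simp: less_imp_le)
  have small: "norm (f x) \<le> l" if "x \<notin> U" for x
  proof (cases "x \<in> W")
    case True
    hence "\<not> Stop 0 x" using S1(6)[of x] S2(6)[of x] that by (auto simp: W_def U_def \<S>_def)
    thus ?thesis by (simp add: Stop_def)
  qed (use f0 l in simp)
  define a where "a Q = (\<Sum>x\<in>dq Q. f x) / of_nat (2 ^ fst Q)" for Q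
  define b where "b Q x = (if x \<in> dq Q then f x - a Q else 0)" for Q x
  define g where "g x = f x - (\<Sum>Q\<in>\<S>. b Q x)" for x
  have norm_a: "norm (a Q) \<le> (\<Sum>x\<in>dq Q. norm (f x)) / 2 ^ fst Q" for Q
    unfolding a_def norm_divide using norm_sum[of f "dq Q"] by (simp add: norm_power divide_right_mono)
  \<comment> \<open>the parent of \<open>Q\<close> is not stopped and has twice the length\<close>
  have a2: "norm (a Q) \<le> 2 * l" if "Q \<in> \<S>" for Q
  proof -
    have "(\<Sum>x\<in>dq Q. norm (f x)) \<le> (\<Sum>x\<in>dyadic (Suc (fst Q)) (snd Q div 2). norm (f x))"
      using dyadic_subset_parent by (intro sum_mono2) auto
    also have "\<dots> \<le> l * 2 ^ Suc (fst Q)" using SQ(3)[OF that] by (simp add: Stop_def)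
    finally have "(\<Sum>x\<in>dq Q. norm (f x)) / 2 ^ fst Q \<le> 2 * l" by (simp add: pos_divide_le_eq)
    with norm_a[of Q] show ?thesis by simp
  qed
  have aw: "norm (a Q) * (\<Sum>x\<in>dq Q. w x) \<le> D * (\<Sum>x\<in>dq Q. norm (f x) * w x)" for Q
  proof -
    have "norm (a Q) * (\<Sum>x\<in>dq Q. w x) \<le> (\<Sum>x\<in>dq Q. norm (f x)) / 2 ^ fst Q * (\<Sum>x\<in>dq Q. w x)"
      using norm_a w0 by (intro mult_right_mono sum_nonneg) (auto simp: less_imp_le)
    also have "\<dots> = (\<Sum>x\<in>dq Q. norm (f x) * ((\<Sum>y\<in>dq Q. w y) / 2 ^ fst Q))"
      by (simp add: sum_divide_distrib[symmetric] sum_distrib_right[symmetric])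
    also have "\<dots> \<le> (\<Sum>x\<in>dq Q. norm (f x) * (D * w x))"
    proof (intro sum_mono mult_left_mono)
      fix x assume "x \<in> dq Q"
      thus "(\<Sum>y\<in>dq Q. w y) / 2 ^ fst Q \<le> D * w x"
        using muckenhoupt_A1_dyadic(1)[OF w, of x "fst Q" "snd Q"] by (simp add: pos_divide_le_eq mult_ac)
    qed auto
    finally show ?thesis by (simp add: sum_distrib_left mult_ac)
  qed
  have gU: "g x = a Q" if "Q \<in> \<S>" "x \<in> dq Q" for x Q
  proof -
    have "(\<Sum>Q\<in>\<S>. b Q x) = b Q x + (\<Sum>Q\<in>\<S> - {Q}. b Q x)" using S that by (simp add: sum.remove)
    also have "(\<Sum>Q\<in>\<S> - {Q}. b Q x) = 0"
      using disj[OF that(1)] that(2) by (intro sum.neutral) (auto simp: b_def)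
    finally show ?thesis using that by (simp add: g_def b_def)
  qed
  have gU': "g x = f x" if "x \<notin> U" for x
    unfolding g_def using that by (subst sum.neutral) (auto simp: b_def U_def)
  have g0: "g x = 0" if "x \<notin> W" for x using that gU'[of x] UW f0 by auto
  have g2: "norm (g x) \<le> 2 * l" for x
  proof (cases "x \<in> U")
    case True thus ?thesis using gU a2 by (auto simp: U_def)
  next
    case False thus ?thesis using small[OF False] gU'[OF False] l by simp
  qed
  have gw: "(\<Sum>x\<in>W. norm (g x) * w x) \<le> D * (\<Sum>x\<in>W. norm (f x) * w x)"
  proof -
    have "(\<Sum>x\<in>U. norm (g x) * w x) = (\<Sum>Q\<in>\<S>. norm (a Q) * (\<Sum>x\<in>dq Q. w x))"
      unfolding sumU[symmetric] sum_distrib_left by (intro sum.cong refl) (simp add: gU)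
    also have "\<dots> \<le> (\<Sum>Q\<in>\<S>. D * (\<Sum>x\<in>dq Q. norm (f x) * w x))" by (intro sum_mono aw)
    also have "\<dots> = D * (\<Sum>x\<in>U. norm (f x) * w x)" unfolding sumU[symmetric] by (simp add: sum_distrib_left)
    finally have 1: "(\<Sum>x\<in>U. norm (g x) * w x) \<le> D * (\<Sum>x\<in>U. norm (f x) * w x)" .
    have "(\<Sum>x\<in>W - U. norm (g x) * w x) = 1 * (\<Sum>x\<in>W - U. norm (f x) * w x)" by (simp add: gU')
    also have "\<dots> \<le> D * (\<Sum>x\<in>W - U. norm (f x) * w x)"
      using D w0 by (intro mult_right_mono sum_nonneg) (auto simp: less_imp_le)
    finally show ?thesis
      using 1 sum.subset_diff[OF UW fW, of "\<lambda>x. norm (g x) * w x"] sum.subset_diff[OF UW fW, of "\<lambda>x. norm (f x) * w x"]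
      by (simp add: algebra_simps)
  qed
  define E1 where "E1 = {n\<in>F. l / 2 \<le> G g n}"
  define E2 where "E2 = (\<Union>Q\<in>\<S>. d5 Q)"
  define E3 where "E3 = {n\<in>F - E2. l / 2 \<le> (\<Sum>Q\<in>\<S>. G (b Q) n)}"
  have fE: "finite E1" "finite E2" "finite E3" using F S by (auto simp: E1_def E2_def E3_def)
  have sub: "{n\<in>F. l < G f n} \<subseteq> E1 \<union> E2 \<union> E3"
  proof
    fix n assume n: "n \<in> {n\<in>F. l < G f n}"
    have fin: "finite {x. b Q x \<noteq> 0}" for Q
      by (rule finite_subset[of _ "dq Q"]) (auto simp: b_def)
    have "f = (\<lambda>x. g x + (\<Sum>Q\<in>\<S>. b Q x))" by (auto simp: g_def)
    hence "G f n = G (\<lambda>x. g x + (\<Sum>Q\<in>\<S>. b Q x)) n" by simp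
    also have "\<dots> \<le> G g n + G (\<lambda>x. \<Sum>Q\<in>\<S>. b Q x) n"
    proof (rule G_add)
      show "finite {x. g x \<noteq> 0}" by (rule finite_subset[OF _ fW]) (use g0 in auto)
      have "(\<Sum>Q\<in>\<S>. b Q x) = 0" if "x \<notin> U" for x
        using that by (intro sum.neutral) (auto simp: b_def U_def)
      thus "finite {x. (\<Sum>Q\<in>\<S>. b Q x) \<noteq> 0}" by (intro finite_subset[OF _ fU]) auto
    qed
    also have "\<dots> \<le> G g n + (\<Sum>Q\<in>\<S>. G (b Q) n)" using G_sum[of \<S> b n] S fin by simp
    finally show "n \<in> E1 \<union> E2 \<union> E3" using n by (auto simp: E1_def E3_def)
  qed
  define X where "X = (\<Sum>x\<in>W. norm (f x) * w x)"
  have X0: "0 \<le> X" unfolding X_def using w0 by (intro sum_nonneg) (auto simp: less_imp_le)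
  have 1: "l * sum w E1 \<le> 8 * B * D * X"
  proof -
    have "(l / 2)\<^sup>2 * sum w E1 \<le> (\<Sum>n\<in>E1. (G g n)\<^sup>2 * w n)"
      unfolding sum_distrib_left using w0 l
      by (intro sum_mono mult_right_mono power_mono) (auto simp: E1_def less_imp_le)
    also have "\<dots> \<le> B * (\<Sum>x\<in>W. (norm (g x))\<^sup>2 * w x)"
      using strong[OF fW g0 fE(1)] by simp
    also have "\<dots> \<le> B * (\<Sum>x\<in>W. 2 * l * (norm (g x) * w x))"
    proof (intro mult_left_mono sum_mono B)
      fix x show "(norm (g x))\<^sup>2 * w x \<le> 2 * l * (norm (g x) * w x)"
        using mult_right_mono[OF g2[of x], of "norm (g x) * w x"] w0[of x] by (simp add: power2_eq_square mult_ac)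
    qed
    also have "\<dots> = B * (2 * l * (\<Sum>x\<in>W. norm (g x) * w x))" by (simp add: sum_distrib_left)
    also have "\<dots> \<le> B * (2 * l * (D * X))"
      unfolding X_def using gw B l by (intro mult_left_mono) auto
    finally have "l * (l * sum w E1) \<le> l * (8 * B * D * X)" by (simp add: power2_eq_square field_simps)
    thus ?thesis using l by simp
  qed
  have 2: "l * sum w E2 \<le> 5 * D * X"
  proof -
    have "l * sum w (d5 Q) \<le> 5 * D * (\<Sum>x\<in>dq Q. norm (f x) * w x)" if "Q \<in> \<S>" for Q
    proof -
      have "l * 2 ^ fst Q * sum w (d5 Q) \<le> (\<Sum>x\<in>dq Q. norm (f x)) * sum w (d5 Q)"
        using SQ(2)[OF that] w0 by (intro mult_right_mono sum_nonneg) (auto simp: Stop_def less_imp_le)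
      also have "\<dots> = (\<Sum>x\<in>dq Q. norm (f x) * sum w (d5 Q))" by (simp add: sum_distrib_right)
      also have "\<dots> \<le> (\<Sum>x\<in>dq Q. norm (f x) * (D * (5 * 2 ^ fst Q) * w x))"
        by (intro sum_mono mult_left_mono muckenhoupt_A1_dyadic(2)[OF w]) auto
      finally have "2 ^ fst Q * (l * sum w (d5 Q)) \<le> 2 ^ fst Q * (5 * D * (\<Sum>x\<in>dq Q. norm (f x) * w x))"
        by (simp add: sum_distrib_left mult_ac)
      thus ?thesis by simp
    qed
    hence "(\<Sum>Q\<in>\<S>. l * sum w (d5 Q)) \<le> (\<Sum>Q\<in>\<S>. 5 * D * (\<Sum>x\<in>dq Q. norm (f x) * w x))"
      by (rule sum_mono)
    also have "\<dots> = 5 * D * (\<Sum>Q\<in>\<S>. \<Sum>x\<in>dq Q. norm (f x) * w x)" by (simp add: sum_distrib_left)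
    also have "\<dots> \<le> 5 * D * X" unfolding X_def using sumUW D by (intro mult_left_mono) auto
    finally have "l * (\<Sum>Q\<in>\<S>. sum w (d5 Q)) \<le> 5 * D * X" by (simp add: sum_distrib_left)
    moreover have "sum w E2 \<le> (\<Sum>Q\<in>\<S>. sum w (d5 Q))"
      unfolding E2_def using S w0 by (intro sum_UN_le) (auto simp: less_imp_le)
    ultimately show ?thesis using l by (meson mult_left_mono order_trans less_imp_le)
  qed
  have 3: "l * sum w E3 \<le> 18 * D * c0 * (1 + D) * X"
  proof -
    have "l / 2 * sum w E3 \<le> (\<Sum>n\<in>E3. (\<Sum>Q\<in>\<S>. G (b Q) n) * w n)"
      unfolding sum_distrib_left using w0
      by (intro sum_mono mult_right_mono) (auto simp: E3_def less_imp_le)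
    also have "\<dots> \<le> (\<Sum>n\<in>F - E2. (\<Sum>Q\<in>\<S>. G (b Q) n) * w n)"
      using F w0 G_nonneg by (intro sum_mono2) (auto simp: E3_def less_imp_le intro!: mult_nonneg_nonneg sum_nonneg)
    also have "\<dots> = (\<Sum>Q\<in>\<S>. \<Sum>n\<in>F - E2. G (b Q) n * w n)"
      unfolding sum_distrib_right by (rule sum.swap)
    also have "\<dots> \<le> (\<Sum>Q\<in>\<S>. 9 * D * c0 * ((1 + D) * (\<Sum>x\<in>dq Q. norm (f x) * w x)))"
    proof (rule sum_mono)
      fix Q assume Q: "Q \<in> \<S>"
      have "(\<Sum>n\<in>F - E2. G (b Q) n * w n) \<le> (\<Sum>n\<in>F - d5 Q. G (b Q) n * w n)"
        using F Q w0 G_nonneg by (intro sum_mono2) (auto simp: E2_def less_imp_le)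
      also have "\<dots> \<le> 9 * D * c0 * (\<Sum>m\<in>dq Q. norm (b Q m) * w m)"
      proof (rule G_mean_zero_weighted[OF w _ _ F])
        have "(\<Sum>x\<in>dq Q. b Q x) = (\<Sum>x\<in>dq Q. f x) - of_nat (card (dq Q)) * a Q"
          by (simp add: b_def sum_subtractf)
        also have "\<dots> = 0" by (simp add: a_def)
        finally show "(\<Sum>x\<in>dyadic (fst Q) (snd Q). b Q x) = 0" .
      qed (auto simp: b_def)
      also have "\<dots> \<le> 9 * D * c0 * (\<Sum>m\<in>dq Q. norm (f m) * w m + norm (a Q) * w m)"
      proof (intro mult_left_mono sum_mono)
        fix m assume "m \<in> dq Q"
        hence "norm (b Q m) \<le> norm (f m) + norm (a Q)" by (simp add: b_def norm_triangle_ineq4)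
        from mult_right_mono[OF this, of "w m"] w0[of m]
        show "norm (b Q m) * w m \<le> norm (f m) * w m + norm (a Q) * w m" by (simp add: algebra_simps)
      qed (use D c0 in auto)
      also have "\<dots> \<le> 9 * D * c0 * ((1 + D) * (\<Sum>x\<in>dq Q. norm (f x) * w x))"
        using aw[of Q] D c0 by (intro mult_left_mono) (auto simp: sum.distrib sum_distrib_left algebra_simps)
      finally show "(\<Sum>n\<in>F - E2. G (b Q) n * w n) \<le> 9 * D * c0 * ((1 + D) * (\<Sum>x\<in>dq Q. norm (f x) * w x))" .
    qed
    also have "\<dots> = 9 * D * c0 * (1 + D) * (\<Sum>Q\<in>\<S>. \<Sum>x\<in>dq Q. norm (f x) * w x)"
      by (simp add: sum_distrib_left mult.assoc)
    also have "\<dots> \<le> 9 * D * c0 * (1 + D) * X"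
      unfolding X_def using sumUW D c0 by (intro mult_left_mono) auto
    finally show ?thesis by simp
  qed
  have "(\<Sum>n\<in>{n\<in>F. l < G f n}. w n) \<le> sum w (E1 \<union> E2 \<union> E3)"
    using sub fE w0 by (intro sum_mono2) (auto simp: less_imp_le)
  also have "\<dots> \<le> sum w (E1 \<union> E2) + sum w E3"
    using fE w0 by (intro sum_Un_le) (auto simp: less_imp_le)
  also have "\<dots> \<le> sum w E1 + sum w E2 + sum w E3"
    using fE w0 by (intro add_right_mono sum_Un_le) (auto simp: less_imp_le)
  finally have "l * (\<Sum>n\<in>{n\<in>F. l < G f n}. w n) \<le> l * sum w E1 + l * sum w E2 + l * sum w E3"
    using l by (metis mult_left_mono less_imp_le distrib_left)
  also have "\<dots> \<le> (8 * B * D + 5 * D + 18 * D * c0 * (1 + D)) * X"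
    using 1 2 3 by (simp add: algebra_simps)
  also have "X = (\<Sum>x\<in>S0. norm (f x) * w x)" using SW[of w] by (simp add: X_def)
  finally show "l * (\<Sum>n\<in>{n\<in>F. l < G f n}. w n)
      \<le> (8 * B * D + 5 * D + 18 * D * c0 * (1 + D)) * (\<Sum>x\<in>S0. norm (f x) * w x)" .
qed

end

section \<open>Sparse domination of the bilinear form\<close>

definition restr :: "int set \<Rightarrow> (int \<Rightarrow> complex) \<Rightarrow> int \<Rightarrow> complex" where
  "restr S f x = (if x \<in> S then f x else 0)"

lemma finite_supp_restr [simp]: "finite S \<Longrightarrow> finite {x. restr S f x \<noteq> 0}"
  by (rule finite_subset[of _ S]) (auto simp: restr_def)

context cz_sublinear begin

lemma weak_type_unweighted:
  obtains C where "0 < C" "\<And>f S F l. finite S \<Longrightarrow> (\<And>x. x \<notin> S \<Longrightarrow> f x = 0) \<Longrightarrow> finite F \<Longrightarrow> 0 < l \<Longrightarrow>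
        l * real (card {n\<in>F. l < G f n}) \<le> C * (\<Sum>x\<in>S. norm (f x))"
proof -
  obtain C where "0 < C" "\<And>f S F l. finite S \<Longrightarrow> (\<And>x. x \<notin> S \<Longrightarrow> f x = 0) \<Longrightarrow> finite F \<Longrightarrow> 0 < l \<Longrightarrow>
        l * (\<Sum>n\<in>{n\<in>F. l < G f n}. 1) \<le> C * (\<Sum>x\<in>S. norm (f x) * 1)"
    by (rule weak_type_A1[OF muckenhoupt_A1_one c0]) (use G_l2 in auto)
  thus thesis using that by auto
qed

text \<open>
Sparse domination by induction on the scale. Let \<open>a\<close> be the average of \<open>|f|\<close> near the interval. By the unweighted weak type
inequalities, the set \<open>E\<close> where \<open>G f\<close> or the maximal function of \<open>f\<close> exceeds a large multiple of \<open>a\<close> fills at most a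
sixteenth of the interval. The maximal dyadic intervals \<open>Q\<close> in which \<open>E\<close> has density above a quarter then fill at
most a quarter of it. Off their union \<open>G f\<close> is at most a multiple of \<open>a\<close>. On such a \<open>Q\<close> the value \<open>G f x\<close> exceeds that of the local part
\<open>restr (d5 Q) f\<close> by at most a multiple of \<open>a\<close>: this holds at some good point \<open>y\<close> of \<open>Q\<close> and the remaining part of \<open>G f\<close> varies little on \<open>Q\<close>. The local parts are
handled by the induction hypothesis.

The hypothesis on \<open>\<theta>\<close> says that every contribution \<open>a * (\<Sum>n\<in>Q. v n)\<close> can be charged to the values of \<open>\<theta>\<close> on
any subset \<open>E\<close> which contains at least half of the interval. As the part of an interval outside its
children is such a subset and these parts are disjoint, the charges add up.
\<close>

lemma sparse_form_bound:
  obtains C where "0 < C"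
    "\<And>f v \<theta> D k i. (\<And>n. 0 \<le> v n) \<Longrightarrow> (\<And>n. 0 \<le> \<theta> n) \<Longrightarrow> 0 \<le> D \<Longrightarrow>
      (\<And>j m E. dyadic j m \<subseteq> dyadic k i \<Longrightarrow> E \<subseteq> dyadic j m \<Longrightarrow> 2 ^ j \<le> 2 * card E \<Longrightarrow>
         (\<Sum>x\<in>dyadic5 j m. norm (f x)) * (\<Sum>n\<in>dyadic j m. v n) \<le> D * 2 ^ j * (\<Sum>n\<in>E. \<theta> n)) \<Longrightarrow>
      (\<Sum>n\<in>dyadic k i. G (restr (dyadic5 k i) f) n * v n) \<le> C * D * (\<Sum>n\<in>dyadic k i. \<theta> n)"
proof -
  obtain A1 where A1: "0 < A1" "\<And>f S F l. finite S \<Longrightarrow> (\<And>x. x \<notin> S \<Longrightarrow> f x = 0) \<Longrightarrow> finite F \<Longrightarrow> 0 < l \<Longrightarrow>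
        l * real (card {n\<in>F. l < G f n}) \<le> A1 * (\<Sum>x\<in>S. norm (f x))"
    using weak_type_unweighted by blast
  \<comment> \<open>the level at which the two exceptional sets together have density at most \<open>1/16\<close>\<close>
  define A where "A = 16 * (A1 + 4)"
  have A: "0 < A" using A1 by (simp add: A_def)
  define C where "C = A + 5 * A\<^sup>2 + 9 * c0 * A"
  have C: "0 < C" using A c0 by (auto simp: C_def intro!: add_pos_nonneg)
  show thesis
  proof (rule that[OF C])
    fix f :: "int \<Rightarrow> complex" and v \<theta> :: "int \<Rightarrow> real" and D :: real and k :: nat and i :: int
    assume v: "\<And>n. 0 \<le> v n" and \<theta>: "\<And>n. 0 \<le> \<theta> n" and D: "0 \<le> D"
    assume "\<And>j m E. dyadic j m \<subseteq> dyadic k i \<Longrightarrow> E \<subseteq> dyadic j m \<Longrightarrow> 2 ^ j \<le> 2 * card E \<Longrightarrow>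
         (\<Sum>x\<in>dyadic5 j m. norm (f x)) * (\<Sum>n\<in>dyadic j m. v n) \<le> D * 2 ^ j * (\<Sum>n\<in>E. \<theta> n)"
    thus "(\<Sum>n\<in>dyadic k i. G (restr (dyadic5 k i) f) n * v n) \<le> C * D * (\<Sum>n\<in>dyadic k i. \<theta> n)"
    proof (induction k arbitrary: i rule: less_induct)
      case (less k)
      define f' where "f' = restr (dyadic5 k i) f"
      have supp: "f' x = 0" if "x \<notin> dyadic5 k i" for x using that by (simp add: f'_def restr_def)
      have f'f: "norm (f' x) = norm (f x)" if "x \<in> dyadic5 k i" for x using that by (simp add: f'_def restr_def)
      define N0 where "N0 = (\<Sum>x\<in>dyadic5 k i. norm (f x))"
      have N0': "N0 = (\<Sum>x\<in>dyadic5 k i. norm (f' x))" unfolding N0_def by (intro sum.cong) (auto simp: f'f)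
      have N0: "0 \<le> N0" by (auto simp: N0_def intro: sum_nonneg)
      show ?case
      proof (cases "N0 = 0")
        case True
        hence "f' x = 0" for x
          using supp[of x] by (cases "x \<in> dyadic5 k i") (auto simp: N0' sum_nonneg_eq_0_iff)
        hence "f' = (\<lambda>_. 0)" by auto
        hence "(\<Sum>n\<in>dyadic k i. G (restr (dyadic5 k i) f) n * v n) = 0"
          unfolding f'_def[symmetric] by (simp add: G_zero)
        thus ?thesis using C D \<theta> by (simp add: sum_nonneg)
      next
        case False
        hence Npos: "0 < N0" using N0 by simp
        define a where "a = N0 / 2 ^ k"
        have a: "0 < a" using Npos by (simp add: a_def)
        define lo where "lo = (i - 2) * 2 ^ k"
        define hi where "hi = (i + 3) * 2 ^ k - 1"
        have lohi: "dyadic5 k i = {lo..hi}" by (simp add: dyadic5_def lo_def hi_def)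
        define M where "M = max_avg lo hi (\<lambda>_. 1) (\<lambda>x. norm (f' x))"
        define E where "E = {x\<in>dyadic k i. A * a < G f' x} \<union> {x\<in>dyadic k i. A * a \<le> M x}"
        have fE: "finite E" by (auto simp: E_def)
        have cardE: "16 * real (card E) \<le> 2 ^ k"
        proof -
          have "A * a * real (card {x\<in>dyadic k i. A * a < G f' x}) \<le> A1 * N0"
            using A1(2)[of "dyadic5 k i" f' "dyadic k i" "A * a"] supp A a by (simp add: N0')
          moreover have "A * a * real (card {x\<in>dyadic k i. A * a \<le> M x}) \<le> 4 * N0"
          proof -
            have "A * a * real (card {x\<in>dyadic k i. A * a \<le> M x}) \<le> A * a * real (card {x\<in>{lo..hi}. A * a \<le> M x})"
              using A a dyadic_subset_dyadic5[of k i] unfolding lohi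
              by (intro mult_left_mono of_nat_mono card_mono) auto
            also have "\<dots> \<le> 4 * N0"
              using max_avg_weak[of "\<lambda>_. 1" "\<lambda>x. norm (f' x)" "A * a" lo hi] A a
              by (simp add: M_def N0' lohi)
            finally show ?thesis .
          qed
          ultimately have "A * a * (real (card {x\<in>dyadic k i. A * a < G f' x}) + real (card {x\<in>dyadic k i. A * a \<le> M x})) \<le> (A1 + 4) * N0"
            by (simp add: algebra_simps)
          moreover have "card E \<le> card {x\<in>dyadic k i. A * a < G f' x} + card {x\<in>dyadic k i. A * a \<le> M x}"
            unfolding E_def by (rule card_Un_le)
          hence "A * a * real (card E) \<le> A * a * (real (card {x\<in>dyadic k i. A * a < G f' x}) + real (card {x\<in>dyadic k i. A * a \<le> M x}))"
            using A a by (intro mult_left_mono) auto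
          ultimately have "A * a * real (card E) \<le> (A1 + 4) * N0" by simp
          hence "(A1 + 4) * N0 * (16 * real (card E)) \<le> (A1 + 4) * N0 * 2 ^ k"
            by (simp add: A_def a_def field_simps)
          thus ?thesis using A1(1) Npos by simp
        qed
        \<comment> \<open>density of \<open>E\<close> above a quarter\<close>
        define Stop where "Stop j m \<longleftrightarrow> 2 ^ j < 4 * card (dyadic j m \<inter> E)" for j m
        have "E \<subseteq> dyadic k i" by (auto simp: E_def)
        hence "dyadic k i \<inter> E = E" by blast
        moreover have "real (16 * card E) \<le> real (2 ^ k)" using cardE by simp
        hence "16 * card E \<le> 2 ^ k" by (simp only: of_nat_le_iff)
        ultimately have "\<not> Stop k i" by (simp add: Stop_def)
        then obtain \<S> where S: "finite \<S>"
          "\<And>Q. Q \<in> \<S> \<Longrightarrow> fst Q < k" "\<And>Q. Q \<in> \<S> \<Longrightarrow> dq Q \<subseteq> dyadic k i"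
          "\<And>Q. Q \<in> \<S> \<Longrightarrow> Stop (fst Q) (snd Q)" "\<And>Q. Q \<in> \<S> \<Longrightarrow> \<not> Stop (Suc (fst Q)) (snd Q div 2)"
          "\<And>Q Q'. Q \<in> \<S> \<Longrightarrow> Q' \<in> \<S> \<Longrightarrow> Q \<noteq> Q' \<Longrightarrow> dq Q \<inter> dq Q' = {}"
          "\<And>x. x \<in> dyadic k i \<Longrightarrow> Stop 0 x \<Longrightarrow> x \<in> (\<Union>Q\<in>\<S>. dq Q)"
          by (rule dyadic_stoppingE[of Stop k i]) auto
        define U where "U = (\<Union>Q\<in>\<S>. dq Q)"
        have UQ: "U \<subseteq> dyadic k i" using S(3) by (auto simp: U_def)
        have sumU: "(\<Sum>Q\<in>\<S>. \<Sum>x\<in>dq Q. g x) = (\<Sum>x\<in>U. g x)" for g :: "int \<Rightarrow> real"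
          unfolding U_def using S(1,6) by (subst sum.UNION_disjoint) auto
        have EU: "x \<notin> E" if "x \<in> dyadic k i" "x \<notin> U" for x
          using S(7)[OF that(1)] that(2) by (auto simp: U_def Stop_def)
        have cardU: "4 * card U \<le> 2 ^ k"
        proof -
          have "card U = (\<Sum>Q\<in>\<S>. card (dq Q))"
            unfolding U_def using S(1,6) by (intro card_UN_disjoint) auto
          also have "\<dots> \<le> (\<Sum>Q\<in>\<S>. 4 * card (dq Q \<inter> E))"
            using S(4) by (intro sum_mono) (auto simp: Stop_def intro: less_imp_le)
          also have "\<dots> = 4 * card (\<Union>Q\<in>\<S>. dq Q \<inter> E)"
          proof -
            have "(dq Q \<inter> E) \<inter> (dq Q' \<inter> E) = {}" if "Q \<in> \<S>" "Q' \<in> \<S>" "Q \<noteq> Q'" for Q Q'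
              using S(6)[OF that] by blast
            hence "card (\<Union>Q\<in>\<S>. dq Q \<inter> E) = (\<Sum>Q\<in>\<S>. card (dq Q \<inter> E))"
              using S(1) fE by (intro card_UN_disjoint) auto
            thus ?thesis by (simp add: sum_distrib_left)
          qed
          also have "\<dots> \<le> 4 * card E" using fE by (intro mult_left_mono card_mono) auto
          finally have "real (4 * card U) \<le> 16 * real (card E)" by simp
          also have "\<dots> \<le> 2 ^ k" by (rule cardE)
          finally show ?thesis by (metis of_nat_le_iff of_nat_numeral of_nat_power)
        qed
        have off: "G f' x \<le> C * a" if "x \<in> dyadic k i" "x \<notin> U" for x
        proof -
          have "G f' x \<le> A * a" using EU[OF that] that by (auto simp: E_def not_less)
          also have "\<dots> \<le> C * a" using a A c0 by (intro mult_right_mono) (auto simp: C_def)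
          finally show ?thesis .
        qed
        have on: "G f' x \<le> G (restr (d5 Q) f) x + C * a" if Q: "Q \<in> \<S>" and x: "x \<in> dq Q" for Q x
        proof -
          define j where "j = fst Q"
          have sub5: "d5 Q \<subseteq> dyadic5 k i" using S(2,3)[OF Q] by (intro dyadic5_mono) auto
          define aQ where "aQ = (\<Sum>y\<in>d5 Q. norm (f y)) / 2 ^ j"
          define B where "B = {y\<in>dq Q. A * aQ < G (restr (d5 Q) f) y}"
          have fB: "finite B" by (simp add: B_def)
          have s5: "(\<Sum>y\<in>d5 Q. norm (restr (d5 Q) f y)) = (\<Sum>y\<in>d5 Q. norm (f y))"
            by (intro sum.cong) (auto simp: restr_def)
          have cardB: "16 * real (card B) \<le> 2 ^ j"
          proof (cases "(\<Sum>y\<in>d5 Q. norm (f y)) = 0")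
            case True
            hence "restr (d5 Q) f = (\<lambda>_. 0)" by (auto simp: restr_def fun_eq_iff sum_nonneg_eq_0_iff)
            hence "B = {}" using True by (simp add: B_def aQ_def G_zero)
            thus ?thesis by simp
          next
            case False
            hence sp: "0 < (\<Sum>y\<in>d5 Q. norm (f y))" by (simp add: sum_nonneg less_le)
            have "A * aQ * real (card B) \<le> A1 * (\<Sum>y\<in>d5 Q. norm (f y))"
              unfolding B_def s5[symmetric] using A sp by (intro A1(2)) (auto simp: restr_def aQ_def)
            also have "\<dots> \<le> (A1 + 4) * (\<Sum>y\<in>d5 Q. norm (f y))" using sp by simp
            finally have "(A1 + 4) * (\<Sum>y\<in>d5 Q. norm (f y)) * (16 * real (card B))
                \<le> (A1 + 4) * (\<Sum>y\<in>d5 Q. norm (f y)) * 2 ^ j"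
              by (simp add: A_def aQ_def field_simps)
            thus ?thesis using A1(1) sp by simp
          qed
          have "card (dq Q \<inter> E) \<le> card (dyadic (Suc j) (snd Q div 2) \<inter> E)"
            using dyadic_subset_parent[of j "snd Q"] by (intro card_mono) (auto simp: j_def)
          hence "4 * card (dq Q \<inter> E) \<le> 2 ^ Suc j" using S(5)[OF Q] by (simp add: Stop_def j_def)
          hence "real (4 * card (dq Q \<inter> E)) \<le> real (2 ^ Suc j)" by (simp only: of_nat_le_iff)
          hence "4 * real (card (dq Q \<inter> E)) \<le> 2 * 2 ^ j" by simp
          moreover have "real (card (dq Q \<inter> E \<union> B)) \<le> real (card (dq Q \<inter> E)) + real (card B)"
            using card_Un_le[of "dq Q \<inter> E" B] by linarith
          moreover have "(0::real) < 2 ^ j" by simp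
          ultimately have "real (card (dq Q \<inter> E \<union> B)) < 2 ^ j" using cardB by linarith
          hence "card (dq Q \<inter> E \<union> B) \<noteq> card (dq Q)" by (auto simp: j_def)
          hence "\<not> dq Q \<subseteq> dq Q \<inter> E \<union> B" by (metis B_def Collect_subset Int_lower1 Un_least subset_antisym)
          \<comment> \<open>a point at which \<open>G f\<close>, the maximal function and \<open>G\<close> of the local part are all under control\<close>
          then obtain y where y: "y \<in> dq Q" "y \<notin> E" "y \<notin> B" by blast
          have yk: "y \<in> dyadic k i" using y S(3)[OF Q] by auto
          hence ylh: "y \<in> {lo..hi}" using dyadic_subset_dyadic5 lohi by blast
          have Gy: "G f' y \<le> A * a" "M y \<le> A * a" "G (restr (d5 Q) f) y \<le> A * aQ"
            using y yk by (auto simp: E_def B_def not_less not_le less_imp_le)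
          have aQ: "aQ \<le> 5 * M y"
          proof -
            have y5: "y \<in> d5 Q" using y dyadic_subset_dyadic5 by blast
            obtain a' b' where ab: "d5 Q = {a'..b'}" by (simp add: dyadic5_def)
            have "(\<Sum>y\<in>d5 Q. norm (f y)) = (\<Sum>y=a'..b'. norm (f' y) * 1)"
              unfolding ab[symmetric] using sub5 by (intro sum.cong) (auto simp: f'f)
            also have "\<dots> \<le> M y * (\<Sum>y=a'..b'. 1)"
              unfolding M_def using y5 sub5 unfolding ab lohi by (intro max_avg_ge) auto
            also have "(\<Sum>y=a'..b'. 1) = (5 * 2 ^ j :: real)"
              unfolding ab[symmetric] by (simp add: j_def)
            finally show ?thesis by (simp add: aQ_def pos_divide_le_eq mult_ac)
          qed
          define R where "R = dyadic5 k i - d5 Q"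
          have fR: "finite R" by (simp add: R_def)
          have dxy: "\<bar>y - x\<bar> < 2 ^ j" using x y by (auto simp: dyadic_def j_def algebra_simps)
          have far: "2 * 2 ^ j < \<bar>m - y\<bar>" if "m \<notin> d5 Q" for m
            using that y(1) by (auto simp: dyadic_def dyadic5_def j_def algebra_simps abs_if)
          have tail: "(\<Sum>m\<in>R. norm (f' m) / (of_int (m - y))\<^sup>2) \<le> 9 * M y / of_int (2 ^ j)"
          proof (rule inverse_square_tail)
            show "0 \<le> M y" unfolding M_def using ylh by (intro max_avg_nonneg) auto
            fix r :: int assume "2 ^ j \<le> r"
            hence r: "0 \<le> r" by (smt (verit) zero_less_power)
            have "(\<Sum>n=y - r..y + r. norm (f' n)) = (\<Sum>n=max lo (y - r)..min hi (y + r). norm (f' n))"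
              using supp unfolding lohi by (intro sum.mono_neutral_right) auto
            also have "\<dots> = (\<Sum>n=max lo (y - r)..min hi (y + r). norm (f' n) * 1)" by simp
            also have "\<dots> \<le> M y * (\<Sum>n=max lo (y - r)..min hi (y + r). 1)"
              unfolding M_def using ylh r by (intro max_avg_ge) (auto simp: less_imp_le)
            also have "\<dots> \<le> M y * of_int (2 * r + 1)"
            proof (rule mult_left_mono)
              show "0 \<le> M y" unfolding M_def using ylh by (intro max_avg_nonneg) auto
            qed (use r in auto)
            finally show "(\<Sum>n=y - r..y + r. norm (f' n)) \<le> M y * of_int (2 * r + 1)" .
          next
            fix n assume "n \<in> R"
            hence "n \<notin> d5 Q" by (auto simp: R_def)
            from far[OF this] show "2 ^ j \<le> \<bar>n - y\<bar>" by (smt (verit) zero_less_power)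
          qed (use fR in auto)
          have Rf: "restr R f m = f' m" if "m \<in> R" for m using that by (auto simp: restr_def R_def f'_def)
          have "G (restr R f) x \<le> G (restr R f) y + c0 * (\<Sum>m\<in>R. norm (restr R f m) * of_int \<bar>y - x\<bar> / (of_int (m - y))\<^sup>2)"
          proof (rule G_smooth[OF fR])
            fix m assume "m \<in> R"
            hence "m \<notin> d5 Q" by (auto simp: R_def)
            have "2 * \<bar>y - x\<bar> < 2 * 2 ^ j" using dxy by (intro mult_strict_left_mono) auto
            also have "\<dots> < \<bar>m - y\<bar>" by (rule far) fact
            finally show "2 * \<bar>y - x\<bar> < \<bar>m - y\<bar>" .
          qed (simp add: restr_def)
          also have "(\<Sum>m\<in>R. norm (restr R f m) * of_int \<bar>y - x\<bar> / (of_int (m - y))\<^sup>2)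
              \<le> (\<Sum>m\<in>R. 2 ^ j * (norm (f' m) / (of_int (m - y))\<^sup>2))"
          proof (rule sum_mono)
            fix m assume m: "m \<in> R"
            have "real_of_int \<bar>y - x\<bar> \<le> real_of_int (2 ^ j)" using dxy by (intro of_int_le_iff[THEN iffD2]) simp
            hence "norm (f' m) * real_of_int \<bar>y - x\<bar> \<le> norm (f' m) * 2 ^ j" by (intro mult_left_mono) auto
            from divide_right_mono[OF this, of "(of_int (m - y))\<^sup>2"]
            show "norm (restr R f m) * of_int \<bar>y - x\<bar> / (of_int (m - y))\<^sup>2 \<le> 2 ^ j * (norm (f' m) / (of_int (m - y))\<^sup>2)"
              using Rf[OF m] by (simp add: mult_ac)
          qed
          also have "\<dots> = 2 ^ j * (\<Sum>m\<in>R. norm (f' m) / (of_int (m - y))\<^sup>2)" by (simp add: sum_distrib_left)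
          also have "\<dots> \<le> 2 ^ j * (9 * M y / of_int (2 ^ j))" using tail by (intro mult_left_mono) auto
          also have "\<dots> = 9 * M y" by simp
          also have "\<dots> \<le> 9 * (A * a)" using Gy by simp
          finally have 1: "G (restr R f) x \<le> G (restr R f) y + c0 * (9 * (A * a))"
            using c0 by (simp add: mult_left_mono)
          have "restr R f = (\<lambda>m. f' m + - restr (d5 Q) f m)"
            using sub5 by (auto simp: fun_eq_iff restr_def R_def f'_def)
          hence "G (restr R f) y \<le> G f' y + G (\<lambda>m. - restr (d5 Q) f m) y"
            using G_add[of f' "\<lambda>m. - restr (d5 Q) f m" y] by (simp add: f'_def)
          also have "\<dots> \<le> A * a + A * aQ" using Gy G_minus[of "restr (d5 Q) f" y] by simp
          also have "\<dots> \<le> A * a + A * (5 * (A * a))" using aQ Gy A by (intro add_left_mono mult_left_mono) auto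
          finally have 2: "G (restr R f) x \<le> C * a" using 1 by (simp add: C_def algebra_simps power2_eq_square)
          have "f' = (\<lambda>m. restr (d5 Q) f m + restr R f m)"
            using sub5 by (auto simp: fun_eq_iff restr_def R_def f'_def)
          hence "G f' x \<le> G (restr (d5 Q) f) x + G (restr R f) x"
            using G_add[of "restr (d5 Q) f" "restr R f" x] fR by simp
          with 2 show ?thesis by simp
        qed
        have "(\<Sum>n\<in>dyadic k i. G f' n * v n) = (\<Sum>n\<in>dyadic k i - U. G f' n * v n) + (\<Sum>Q\<in>\<S>. \<Sum>n\<in>dq Q. G f' n * v n)"
          unfolding sumU by (rule sum.subset_diff[OF UQ]) simp
        also have "\<dots> \<le> (\<Sum>n\<in>dyadic k i - U. C * a * v n) + (\<Sum>Q\<in>\<S>. \<Sum>n\<in>dq Q. (G (restr (d5 Q) f) n + C * a) * v n)"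
          using off on v by (intro add_mono sum_mono mult_right_mono) auto
        also have "\<dots> = ((\<Sum>n\<in>dyadic k i - U. C * a * v n) + (\<Sum>Q\<in>\<S>. \<Sum>n\<in>dq Q. C * a * v n))
             + (\<Sum>Q\<in>\<S>. \<Sum>n\<in>dq Q. G (restr (d5 Q) f) n * v n)"
          by (simp add: distrib_right sum.distrib)
        also have "(\<Sum>n\<in>dyadic k i - U. C * a * v n) + (\<Sum>Q\<in>\<S>. \<Sum>n\<in>dq Q. C * a * v n) = (\<Sum>n\<in>dyadic k i. C * a * v n)"
          unfolding sumU by (rule sum.subset_diff[OF UQ, symmetric]) simp
        also have "\<dots> = C * (N0 * (\<Sum>n\<in>dyadic k i. v n) / 2 ^ k)"
          by (simp add: sum_distrib_left sum_divide_distrib a_def mult_ac)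
        also have "\<dots> \<le> C * (D * (\<Sum>n\<in>dyadic k i - U. \<theta> n))"
        proof (rule mult_left_mono)
          have "card (dyadic k i - U) = 2 ^ k - card U" using UQ by (subst card_Diff_subset) (auto intro: finite_subset)
          hence "2 ^ k \<le> 2 * card (dyadic k i - U)" using cardU by linarith
          from less.prems[OF subset_refl _ this]
          show "N0 * (\<Sum>n\<in>dyadic k i. v n) / 2 ^ k \<le> D * (\<Sum>n\<in>dyadic k i - U. \<theta> n)"
            by (simp add: N0_def pos_divide_le_eq mult_ac)
        qed (use C in simp)
        also have "(\<Sum>Q\<in>\<S>. \<Sum>n\<in>dq Q. G (restr (d5 Q) f) n * v n) \<le> (\<Sum>Q\<in>\<S>. C * D * (\<Sum>n\<in>dq Q. \<theta> n))"
        proof (rule sum_mono)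
          fix Q assume Q: "Q \<in> \<S>"
          show "(\<Sum>n\<in>dq Q. G (restr (d5 Q) f) n * v n) \<le> C * D * (\<Sum>n\<in>dq Q. \<theta> n)"
            using S(2,3)[OF Q] by (intro less.IH less.prems) auto
        qed
        also have "\<dots> = C * D * (\<Sum>n\<in>U. \<theta> n)" by (simp add: sum_distrib_left[symmetric] sumU)
        also have "C * (D * (\<Sum>n\<in>dyadic k i - U. \<theta> n)) + C * D * (\<Sum>n\<in>U. \<theta> n) = C * D * (\<Sum>n\<in>dyadic k i. \<theta> n)"
          using sum.subset_diff[OF UQ, of \<theta>] by (simp add: algebra_simps)
        finally show ?thesis by (simp add: f'_def)
      qed
    qed
  qed
qed

end

section \<open>The strong type inequality for \<open>A\<^sub>p\<close> weights\<close>

text \<open>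
At most half of the points of \<open>E\<close> can have \<open>u n\<close> larger than twenty times the average of \<open>u\<close> over \<open>J\<close>.
\<close>

lemma sum_powr_neg_lower:
  fixes u :: "'i \<Rightarrow> real"
  assumes J: "finite J" "E \<subseteq> J" "J \<noteq> {}" "card J \<le> 10 * card E" and u: "\<And>n. 0 < u n" and r: "0 \<le> r"
  shows "card J / 20 * (20 * (\<Sum>n\<in>J. u n) / card J) powr (- r) \<le> (\<Sum>n\<in>E. u n powr (- r))"
proof -
  define U where "U = (\<Sum>n\<in>J. u n)"
  define b where "b = 20 * U / card J"
  define H where "H = {n\<in>E. u n \<le> b}"
  have fE: "finite E" using J finite_subset by auto
  have cJ: "0 < real (card J)" using J by (auto simp: card_gt_0_iff)
  have U: "0 < U" unfolding U_def using J u by (intro sum_pos) auto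
  have b: "0 < b" using U cJ by (simp add: b_def)
  have "b * real (card (E - H)) = (\<Sum>n\<in>E - H. b)" by simp
  also have "\<dots> \<le> (\<Sum>n\<in>E - H. u n)" by (intro sum_mono) (auto simp: H_def)
  also have "\<dots> \<le> U" unfolding U_def using J u by (intro sum_mono2) (auto simp: less_imp_le)
  finally have "20 * real (card (E - H)) \<le> card J" using U cJ by (simp add: b_def field_simps)
  moreover have "card (E - H) = card E - card H" "card H \<le> card E"
    using fE by (auto simp: H_def intro!: card_Diff_subset card_mono)
  ultimately have cH: "card J / 20 \<le> real (card H)" using J(4) by (simp add: of_nat_diff)
  have "card J / 20 * b powr (- r) \<le> real (card H) * b powr (- r)" using cH by (intro mult_right_mono) auto
  also have "\<dots> = (\<Sum>n\<in>H. b powr (- r))" by simp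
  also have "\<dots> \<le> (\<Sum>n\<in>H. u n powr (- r))"
    using u r by (intro sum_mono powr_mono2') (auto simp: H_def)
  also have "\<dots> \<le> (\<Sum>n\<in>E. u n powr (- r))" using fE by (intro sum_mono2) (auto simp: H_def)
  finally show ?thesis by (simp add: b_def U_def)
qed

text \<open>
The quantitative fact behind sparse bounds: on an interval \<open>I\<close> and for a large part \<open>E\<close> of it,
\<open>w(I) \<sigma>(I) \<le> C |I| (\<Sum>n\<in>E. w n * \<sigma> n)\<close>. By the \<open>A\<^sub>p\<close> condition \<open>w(I) \<sigma>(I) \<le> C |I|\<^sup>p \<sigma>(I)\<^sup>2\<^sup>-\<^sup>p\<close>, and as
\<open>w * \<sigma> = \<sigma> powr (- (p - 2))\<close>, the right-hand side is bounded by the sum of a nonpositive power of \<open>\<sigma>\<close> over \<open>E\<close>.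
\<close>

lemma Ap_product_ge2:
  assumes p: "2 \<le> p" and w: "Ap_const p C w" and MN: "M \<le> N" and E: "E \<subseteq> {M..N}" "N - M + 1 \<le> 10 * int (card E)"
  shows "(\<Sum>n=M..N. w n) * (\<Sum>n=M..N. dual_weight p w n)
      \<le> C * 20 powr (p - 1) * of_int (N - M + 1) * (\<Sum>n\<in>E. w n * dual_weight p w n)"
proof -
  define s where "s = dual_weight p w"
  define V where "V = (\<Sum>n=M..N. w n)"
  define U where "U = (\<Sum>n=M..N. s n)"
  define L where "L = (of_int (N - M + 1) :: real)"
  have w0: "0 < w n" and s0: "0 < s n" for n using Ap_constD(1,2)[OF w] by (auto simp: s_def)
  have pos: "0 < U" "0 < V" "0 < L" using MN w0 s0 by (auto simp: U_def V_def L_def intro: sum_weight_pos)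
  have C: "0 < C" by (rule Ap_const_pos[OF w])
  have card: "real (card {M..N}) = L" using MN by (simp add: L_def)
  have ws: "s n powr (- (p - 2)) = w n * s n" for n
  proof -
    have "w n * s n = w n powr (1 + - 1 / (p - 1))"
      unfolding powr_add using w0[of n] by (simp add: s_def dual_weight_def)
    also have "1 + - 1 / (p - 1) = (- 1 / (p - 1)) * (- (p - 2))" using p by (simp add: field_simps)
    also have "w n powr \<dots> = s n powr (- (p - 2))" by (simp only: s_def dual_weight_def powr_powr)
    finally show ?thesis by simp
  qed
  have "L / 20 * (20 * U / L) powr (- (p - 2)) \<le> (\<Sum>n\<in>E. s n powr (- (p - 2)))"
    unfolding U_def card[symmetric] using MN E s0 p by (intro sum_powr_neg_lower) auto
  hence 1: "L * (20 * U / L) powr (- (p - 2)) \<le> 20 * (\<Sum>n\<in>E. w n * s n)"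
    unfolding ws[symmetric] by simp
  have "V * U = (V * U powr (p - 1)) * U powr (- (p - 2))"
    using pos by (simp add: mult.assoc powr_add[symmetric])
  also have "\<dots> \<le> (C * L powr p) * U powr (- (p - 2))"
    using Ap_constD(3)[OF w MN] by (intro mult_right_mono) (auto simp: V_def U_def s_def L_def)
  also have "U = 20 * U / L * (L / 20)" using pos by simp
  also have "(20 * U / L * (L / 20)) powr (- (p - 2)) = (20 * U / L) powr (- (p - 2)) * (L powr (- (p - 2)) * 20 powr (p - 2))"
    using pos by (simp add: powr_mult powr_divide powr_minus divide_simps powr_add[symmetric])
  also have "(C * L powr p) * \<dots> = C * 20 powr (p - 2) * (L powr p * L powr (- (p - 2))) * (20 * U / L) powr (- (p - 2))"
    by simp
  also have "L powr p * L powr (- (p - 2)) = L * L" using pos by (simp add: powr_add[symmetric] power2_eq_square)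
  also have "C * 20 powr (p - 2) * (L * L) * (20 * U / L) powr (- (p - 2))
      = C * 20 powr (p - 2) * L * (L * (20 * U / L) powr (- (p - 2)))" by simp
  also have "\<dots> \<le> C * 20 powr (p - 2) * L * (20 * (\<Sum>n\<in>E. w n * s n))"
    using 1 C pos by (intro mult_left_mono) auto
  also have "\<dots> = C * (20 powr (p - 2) * 20 powr 1) * L * (\<Sum>n\<in>E. w n * s n)" by simp
  also have "20 powr (p - 2) * 20 powr 1 = (20 powr (p - 1) :: real)" by (simp only: powr_add[symmetric]) simp
  finally show ?thesis using pos by (simp add: V_def U_def s_def L_def)
qed

text \<open>
The statement is symmetric in \<open>w\<close> and \<open>\<sigma>\<close>, so that for \<open>p < 2\<close> it follows from the case of the dual exponent.
\<close>

lemma Ap_product: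
  assumes p: "1 < p" and w: "Ap_const p C w"
  obtains D where "0 < D" "\<And>M N E. M \<le> N \<Longrightarrow> E \<subseteq> {M..N} \<Longrightarrow> N - M + 1 \<le> 10 * int (card E) \<Longrightarrow>
    (\<Sum>n=M..N. w n) * (\<Sum>n=M..N. dual_weight p w n) \<le> D * of_int (N - M + 1) * (\<Sum>n\<in>E. w n * dual_weight p w n)"
proof (cases "2 \<le> p")
  case True
  show ?thesis using that[of "C * 20 powr (p - 1)"] Ap_const_pos[OF w] Ap_product_ge2[OF True w] by simp
next
  case False
  define q where "q = p / (p - 1)"
  have q: "2 \<le> q" using p False by (simp add: q_def field_simps)
  note d = Ap_const_dual[OF p w, folded q_def]
  have "(\<Sum>n=M..N. w n) * (\<Sum>n=M..N. dual_weight p w n)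
      \<le> (C powr (1 / (p - 1)) * 20 powr (q - 1)) * of_int (N - M + 1) * (\<Sum>n\<in>E. w n * dual_weight p w n)"
    if "M \<le> N" "E \<subseteq> {M..N}" "N - M + 1 \<le> 10 * int (card E)" for M N E
    using Ap_product_ge2[OF q d(1) that] unfolding d(2) by (simp add: mult.commute)
  thus ?thesis using that[of "C powr (1 / (p - 1)) * 20 powr (q - 1)"] Ap_const_pos[OF w] by simp
qed

text \<open>
Testing against \<open>h = G f powr (p - 1)\<close>, the sparse bound applies with \<open>v = h * w\<close> and
\<open>\<theta> = M\<^sub>\<sigma> (|f|/\<sigma>) * M\<^sub>w h * w * \<sigma>\<close>; the hypothesis on \<open>\<theta>\<close> is \<open>Ap_product\<close>. Hoelder's inequality (in the form of
Young's) and the universal bounds of \<open>M\<^sub>\<sigma>\<close> on \<open>\<ell>\<^sup>p(\<sigma>)\<close> and \<open>M\<^sub>w\<close> on \<open>\<ell>\<^sup>q(w)\<close> conclude, because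
\<open>h powr q = G f powr p\<close>.
\<close>

theorem (in cz_sublinear) strong_type_Ap:
  assumes p: "1 < p" and w: "Ap_const p C w"
  obtains K where "0 < K" "\<And>f S F. finite S \<Longrightarrow> (\<And>x. x \<notin> S \<Longrightarrow> f x = 0) \<Longrightarrow> finite F \<Longrightarrow>
        (\<Sum>n\<in>F. G f n powr p * w n) \<le> K * (\<Sum>x\<in>S. norm (f x) powr p * w x)"
proof -
  define q where "q = p / (p - 1)"
  define s where "s = dual_weight p w"
  have q: "1 < q" "1 / p + 1 / q = 1" "(p - 1) * q = p" using p by (auto simp: q_def field_simps)
  have w0: "0 < w n" and s0: "0 < s n" for n using Ap_constD(1,2)[OF w] by (auto simp: s_def)
  have ws: "w n * s n = s n powr (1 / p) * w n powr (1 / q)" for n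
  proof -
    have "w n * s n = w n powr (1 + - 1 / (p - 1))"
      unfolding powr_add using w0[of n] by (simp add: s_def dual_weight_def)
    also have "1 + - 1 / (p - 1) = (- 1 / (p - 1)) * (1 / p) + 1 / q"
      using p by (simp add: q_def divide_simps) (simp add: algebra_simps)
    also have "w n powr \<dots> = s n powr (1 / p) * w n powr (1 / q)"
      by (simp only: s_def dual_weight_def powr_powr powr_add)
    finally show ?thesis .
  qed
  have sp: "(x / s n) powr p * s n = x powr p * w n" if "0 \<le> x" for n x
  proof -
    have "(x / s n) powr p * s n = x powr p * (s n powr 1 / s n powr p)"
      using that s0[of n] by (simp add: powr_divide)
    also have "s n powr 1 / s n powr p = s n powr (1 - p)" by (simp only: powr_diff)
    also have "\<dots> = w n powr ((- 1 / (p - 1)) * (1 - p))" by (simp only: s_def dual_weight_def powr_powr)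
    also have "(- 1 / (p - 1)) * (1 - p) = 1" using p by (simp add: field_simps)
    finally show ?thesis using w0[of n] by simp
  qed
  obtain Kp where Kp: "Kp > 0" "\<And>(\<mu> :: int \<Rightarrow> real) h A B. (\<And>i. 0 < \<mu> i) \<Longrightarrow> (\<And>i. 0 \<le> h i) \<Longrightarrow>
     (\<Sum>n=A..B. max_avg A B \<mu> h n powr p * \<mu> n) \<le> Kp * (\<Sum>n=A..B. h n powr p * \<mu> n)"
    using max_avg_strong[OF p] by blast
  obtain Kq where Kq: "Kq > 0" "\<And>(\<mu> :: int \<Rightarrow> real) h A B. (\<And>i. 0 < \<mu> i) \<Longrightarrow> (\<And>i. 0 \<le> h i) \<Longrightarrow>
     (\<Sum>n=A..B. max_avg A B \<mu> h n powr q * \<mu> n) \<le> Kq * (\<Sum>n=A..B. h n powr q * \<mu> n)"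
    using max_avg_strong[OF q(1)] by blast
  obtain D0 where D0: "0 < D0" "\<And>M N E. M \<le> N \<Longrightarrow> E \<subseteq> {M..N} \<Longrightarrow> N - M + 1 \<le> 10 * int (card E) \<Longrightarrow>
    (\<Sum>n=M..N. w n) * (\<Sum>n=M..N. s n) \<le> D0 * of_int (N - M + 1) * (\<Sum>n\<in>E. w n * s n)"
    unfolding s_def by (rule Ap_product[OF p w]) blast
  obtain C1 where C1: "0 < C1"
    "\<And>f v \<theta> D k i. (\<And>n. 0 \<le> v n) \<Longrightarrow> (\<And>n. 0 \<le> \<theta> n) \<Longrightarrow> 0 \<le> D \<Longrightarrow>
      (\<And>j m E. dyadic j m \<subseteq> dyadic k i \<Longrightarrow> E \<subseteq> dyadic j m \<Longrightarrow> 2 ^ j \<le> 2 * card E \<Longrightarrow>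
         (\<Sum>x\<in>dyadic5 j m. norm (f x)) * (\<Sum>n\<in>dyadic j m. v n) \<le> D * 2 ^ j * (\<Sum>n\<in>E. \<theta> n)) \<Longrightarrow>
      (\<Sum>n\<in>dyadic k i. G (restr (dyadic5 k i) f) n * v n) \<le> C1 * D * (\<Sum>n\<in>dyadic k i. \<theta> n)"
    using sparse_form_bound by blast
  define c where "c = C1 * (5 * D0)"
  have c: "0 < c" using C1 D0 by (simp add: c_def)
  \<comment> \<open>the parameter in Young's inequality is chosen so that the second term is absorbed\<close>
  define e where "e = (q / (2 * c * Kq)) powr (1 / q)"
  have e: "0 < e" using q c Kq by (simp add: e_def)
  have eq: "c * Kq * e powr q / q = 1 / 2" using q c Kq by (simp add: e_def powr_powr)
  define K where "K = 2 * (c * Kp / (e powr p * p))"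
  show thesis
  proof (rule that[of K])
    show "0 < K" using c Kp e p by (simp add: K_def)
    fix f :: "int \<Rightarrow> complex" and S F :: "int set"
    assume S: "finite S" "\<And>x. x \<notin> S \<Longrightarrow> f x = 0" and F: "finite F"
    obtain k where k: "S \<union> F \<subseteq> dyadic k 0 \<union> dyadic k (-1)"
      using ex_dyadic_cover[of "S \<union> F"] S F by blast
    define W where "W = dyadic k 0 \<union> dyadic k (-1)"
    define A where "A = - 3 * (2 ^ k :: int)"
    define B where "B = 3 * (2 ^ k :: int) - 1"
    have fW: "finite W" by (simp add: W_def)
    have five: "W \<subseteq> dyadic5 k i" "dyadic5 k i \<subseteq> {A..B}" if "i = 0 \<or> i = -1" for i
    proof -
      define x where "x = (2 ^ k :: int)"
      have "1 \<le> x" by (simp add: x_def)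
      thus "W \<subseteq> dyadic5 k i" "dyadic5 k i \<subseteq> {A..B}"
        using that by (auto simp: W_def A_def B_def dyadic_def dyadic5_def x_def[symmetric])
    qed
    have WAB: "W \<subseteq> {A..B}" using five[of 0] by auto
    have f0: "f x = 0" if "x \<notin> W" for x using that S(2)[of x] k by (auto simp: W_def)
    have rf: "restr (dyadic5 k i) f = f" if "i = 0 \<or> i = -1" for i
      using five(1)[OF that] f0 by (auto simp: fun_eq_iff restr_def)
    define h where "h n = (if n \<in> W then G f n powr (p - 1) else 0)" for n
    define v where "v n = h n * w n" for n
    define P where "P n = max_avg A B s (\<lambda>x. norm (f x) / s x) n" for n
    define H where "H n = max_avg A B w h n" for n
    define \<theta> where "\<theta> n = (if n \<in> {A..B} then P n * H n * (w n * s n) else 0)" for n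
    have h0: "0 \<le> h n" for n by (simp add: h_def)
    have fs0: "0 \<le> norm (f n) / s n" for n using s0[of n] by simp
    have P0: "0 \<le> P n" and H0: "0 \<le> H n" if "n \<in> {A..B}" for n
      unfolding P_def H_def using that s0 w0 h0 fs0 by (auto intro!: max_avg_nonneg)
    have \<theta>0: "0 \<le> \<theta> n" for n using P0 H0 w0[of n] s0[of n] by (auto simp: \<theta>_def less_imp_le)
    have form: "(\<Sum>n\<in>dyadic k i. G f n * v n) \<le> c * (\<Sum>n\<in>dyadic k i. \<theta> n)" if i: "i = 0 \<or> i = -1" for i
    proof -
      have "(\<Sum>n\<in>dyadic k i. G (restr (dyadic5 k i) f) n * v n) \<le> C1 * (5 * D0) * (\<Sum>n\<in>dyadic k i. \<theta> n)"
      proof (rule C1(2))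
        fix j m E assume jm: "dyadic j m \<subseteq> dyadic k i" and E: "E \<subseteq> dyadic j m" "2 ^ j \<le> 2 * card E"
        have jk: "dyadic5 j m \<subseteq> dyadic5 k i"
        proof (cases "j < k")
          case True thus ?thesis using jm by (rule dyadic5_mono)
        next
          case False
          have "card (dyadic j m) \<le> card (dyadic k i)" using jm by (intro card_mono) auto
          hence "j \<le> k" by simp
          with False have "j = k" by simp
          have "m * 2 ^ k \<in> dyadic k m" by (simp add: dyadic_def algebra_simps)
          hence "m * 2 ^ k \<in> dyadic k i" using jm \<open>j = k\<close> by blast
          hence "i * 2 ^ k \<le> m * 2 ^ k" "m * 2 ^ k < (i + 1) * 2 ^ k" by (auto simp: dyadic_def)
          hence "m = i" by (simp add: mult_less_cancel_right mult_le_cancel_right)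
          with \<open>j = k\<close> show ?thesis by simp
        qed
        define a b where "a = (m - 2) * 2 ^ j" and "b = (m + 3) * 2 ^ j - 1"
        have ab: "dyadic5 j m = {a..b}" by (simp add: dyadic5_def a_def b_def)
        have L: "b - a + 1 = 5 * 2 ^ j" by (simp add: a_def b_def algebra_simps)
        have ale: "a \<le> b" using L by (smt (verit) zero_less_power)
        have sub: "{a..b} \<subseteq> {A..B}" using jk five(2)[OF i] unfolding ab by (rule order_trans)
        have Ea: "E \<subseteq> {a..b}" using E(1) dyadic_subset_dyadic5 ab by blast
        define f1 where "f1 = (\<Sum>x=a..b. norm (f x))"
        define w1 where "w1 = (\<Sum>x=a..b. w x)"
        define s1 where "s1 = (\<Sum>x=a..b. s x)"
        define v1 where "v1 = (\<Sum>x\<in>dyadic j m. v x)"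
        have pos: "0 < w1" "0 < s1" using ale w0 s0 by (auto simp: w1_def s1_def intro: sum_weight_pos)
        have v0: "0 \<le> v x" for x using h0[of x] w0[of x] by (simp add: v_def)
        have fv0: "0 \<le> f1" "0 \<le> v1" using v0 by (auto simp: f1_def v1_def intro: sum_nonneg)
        have P: "f1 / s1 \<le> P n" if n: "n \<in> {a..b}" for n
        proof -
          have "f1 = (\<Sum>x=a..b. norm (f x) / s x * s x)"
            unfolding f1_def using s0 by (intro sum.cong) (auto simp: less_imp_neq[symmetric])
          also have "\<dots> \<le> P n * s1"
            unfolding P_def s1_def using n sub s0 by (intro max_avg_ge) auto
          finally show ?thesis using pos by (simp add: pos_divide_le_eq)
        qed
        have H: "v1 / w1 \<le> H n" if n: "n \<in> {a..b}" for n
        proof -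
          have "v1 \<le> (\<Sum>x=a..b. h x * w x)"
            unfolding v1_def v_def[symmetric] using dyadic_subset_dyadic5[of j m] v0 ab by (intro sum_mono2) auto
          also have "\<dots> \<le> H n * w1"
            unfolding H_def w1_def using n sub w0 by (intro max_avg_ge) auto
          finally show ?thesis using pos by (simp add: pos_divide_le_eq)
        qed
        have "f1 * v1 = (f1 / s1) * (v1 / w1) * (w1 * s1)" using pos by simp
        also have "\<dots> \<le> (f1 / s1) * (v1 / w1) * (D0 * of_int (b - a + 1) * (\<Sum>n\<in>E. w n * s n))"
        proof (rule mult_left_mono)
          have "int (2 ^ j) \<le> int (2 * card E)" using E(2) by (simp only: of_nat_le_iff)
          hence "b - a + 1 \<le> 10 * int (card E)" unfolding L by simp
          thus "w1 * s1 \<le> D0 * of_int (b - a + 1) * (\<Sum>n\<in>E. w n * s n)"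
            unfolding w1_def s1_def using ale Ea by (intro D0) auto
        qed (use fv0 pos in auto)
        also have "\<dots> = D0 * of_int (b - a + 1) * (\<Sum>n\<in>E. (f1 / s1) * (v1 / w1) * (w n * s n))"
          by (simp add: sum_distrib_left mult_ac)
        also have "\<dots> \<le> D0 * of_int (b - a + 1) * (\<Sum>n\<in>E. \<theta> n)"
        proof (intro mult_left_mono sum_mono)
          fix n assume "n \<in> E"
          hence n: "n \<in> {a..b}" "n \<in> {A..B}" using Ea sub by auto
          have "(f1 / s1) * (v1 / w1) * (w n * s n) \<le> P n * H n * (w n * s n)"
            using P[OF n(1)] H[OF n(1)] P0[OF n(2)] fv0 pos w0[of n] s0[of n] by (intro mult_right_mono mult_mono) auto
          thus "(f1 / s1) * (v1 / w1) * (w n * s n) \<le> \<theta> n" using n by (simp add: \<theta>_def)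
        qed (use D0(1) ale in auto)
        also have "of_int (b - a + 1) = (5 * 2 ^ j :: real)" unfolding L by simp
        finally show "(\<Sum>x\<in>dyadic5 j m. norm (f x)) * (\<Sum>n\<in>dyadic j m. v n) \<le> 5 * D0 * 2 ^ j * (\<Sum>n\<in>E. \<theta> n)"
          unfolding ab f1_def[symmetric] v1_def[symmetric] by (simp add: mult_ac)
      qed (use h0 w0 \<theta>0 D0(1) in \<open>auto simp: v_def less_imp_le\<close>)
      thus ?thesis by (simp add: rf[OF i] c_def)
    qed
    define X where "X = (\<Sum>n\<in>W. G f n powr p * w n)"
    define Y where "Y = (\<Sum>n\<in>W. norm (f n) powr p * w n)"
    have dj: "dyadic k 0 \<inter> dyadic k (-1) = {}" by (auto simp: dyadic_def)
    have "X = (\<Sum>n\<in>W. G f n * v n)"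
    proof (unfold X_def, rule sum.cong)
      fix n assume "n \<in> W"
      thus "G f n powr p * w n = G f n * v n"
        using G_nonneg[of f n] by (auto simp: v_def h_def powr_diff)
    qed simp
    also have "\<dots> = (\<Sum>n\<in>dyadic k 0. G f n * v n) + (\<Sum>n\<in>dyadic k (-1). G f n * v n)"
      unfolding W_def using dj by (intro sum.union_disjoint) auto
    also have "\<dots> \<le> c * (\<Sum>n\<in>dyadic k 0. \<theta> n) + c * (\<Sum>n\<in>dyadic k (-1). \<theta> n)"
      by (intro add_mono form) auto
    also have "\<dots> = c * (\<Sum>n\<in>W. \<theta> n)"
      unfolding W_def using dj by (subst sum.union_disjoint) (auto simp: distrib_left)
    also have "\<dots> \<le> c * (\<Sum>n=A..B. \<theta> n)"
      using c WAB \<theta>0 by (intro mult_left_mono sum_mono2) auto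
    also have "\<dots> \<le> c * (\<Sum>n=A..B. (P n powr p * s n) / (e powr p * p) + e powr q * (H n powr q * w n) / q)"
    proof (intro mult_left_mono sum_mono)
      fix n assume n: "n \<in> {A..B}"
      have "\<theta> n = P n * H n * (s n powr (1 / p) * w n powr (1 / q))"
        using n by (simp add: \<theta>_def ws[symmetric])
      also have "\<dots> = (P n * s n powr (1 / p) / e) * (e * H n * w n powr (1 / q))"
        using e by simp
      also have "\<dots> \<le> (P n * s n powr (1 / p) / e) powr p / p + (e * H n * w n powr (1 / q)) powr q / q"
        using p q e P0[OF n] H0[OF n] by (intro Youngs_inequality) auto
      also have "(P n * s n powr (1 / p) / e) powr p = P n powr p * s n / e powr p"
        using p e P0[OF n] s0[of n] by (simp add: powr_mult powr_divide powr_powr)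
      also have "(e * H n * w n powr (1 / q)) powr q = e powr q * (H n powr q * w n)"
        using q e H0[OF n] w0[of n] by (simp add: powr_mult powr_powr)
      finally show "\<theta> n \<le> (P n powr p * s n) / (e powr p * p) + e powr q * (H n powr q * w n) / q" by simp
    qed (use c in simp)
    also have "\<dots> = c / (e powr p * p) * (\<Sum>n=A..B. P n powr p * s n) + c * e powr q / q * (\<Sum>n=A..B. H n powr q * w n)"
      by (simp add: sum.distrib sum_distrib_left sum_divide_distrib distrib_left mult_ac)
    also have "\<dots> \<le> c / (e powr p * p) * (Kp * Y) + c * e powr q / q * (Kq * X)"
    proof (intro add_mono mult_left_mono)
      have "(\<Sum>n=A..B. P n powr p * s n) \<le> Kp * (\<Sum>n=A..B. (norm (f n) / s n) powr p * s n)"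
        unfolding P_def using s0 fs0 by (intro Kp(2)) auto
      also have "(\<Sum>n=A..B. (norm (f n) / s n) powr p * s n) = (\<Sum>n=A..B. norm (f n) powr p * w n)"
        by (intro sum.cong sp) auto
      also have "\<dots> = Y"
        unfolding Y_def using WAB f0 by (intro sum.mono_neutral_right) auto
      finally show "(\<Sum>n=A..B. P n powr p * s n) \<le> Kp * Y" .
      have "(\<Sum>n=A..B. H n powr q * w n) \<le> Kq * (\<Sum>n=A..B. h n powr q * w n)"
        unfolding H_def using w0 h0 by (intro Kq(2)) auto
      also have "(\<Sum>n=A..B. h n powr q * w n) = (\<Sum>n\<in>W. h n powr q * w n)"
        using WAB by (intro sum.mono_neutral_right) (auto simp: h_def)
      also have "\<dots> = X" unfolding X_def by (intro sum.cong) (auto simp: h_def powr_powr q(3))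
      finally show "(\<Sum>n=A..B. H n powr q * w n) \<le> Kq * X" .
    qed (use c e p q in auto)
    also have "c * e powr q / q * (Kq * X) = (c * Kq * e powr q / q) * X" by simp
    also have "\<dots> = X / 2" unfolding eq by simp
    finally have XY: "X \<le> K * Y" by (simp add: K_def)
    have "(\<Sum>n\<in>F. G f n powr p * w n) \<le> X"
      unfolding X_def using k fW w0 by (intro sum_mono2) (auto simp: W_def less_imp_le)
    also note XY
    also have "Y = (\<Sum>x\<in>S. norm (f x) powr p * w x)"
      unfolding Y_def using k fW S by (intro sum.mono_neutral_right) (auto simp: W_def)
    finally show "(\<Sum>n\<in>F. G f n powr p * w n) \<le> K * (\<Sum>x\<in>S. norm (f x) powr p * w x)" .
  qed
qed

section \<open>The heat kernel and the binomial distribution\<close>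

text \<open>
The reciprocal factorial, extended by zero to the negative integers. With it, the recurrences for binomial coefficients
hold for all integers, without boundary cases.
\<close>

definition rfact :: "int \<Rightarrow> real" where
  "rfact n = rGamma (of_int (n + 1))"

lemma rfact_pred: "rfact (n - 1) = of_int n * rfact n"
  unfolding rfact_def using rGamma_plus1[of "of_int n :: real"] by simp

lemma rfact_neg: "n < 0 \<Longrightarrow> rfact n = 0"
  unfolding rfact_def using nonpos_Ints_of_int[of "n + 1", where 'a = real]
  by (subst rGamma_eq_zero_iff) simp

lemma rfact_nat: "rfact (int n) = 1 / fact n"
  unfolding rfact_def using rGamma_inverse_Gamma[of "of_nat n + 1 :: real"] Gamma_fact[of n, where 'a = real]
  by (simp add: add.commute inverse_eq_divide)

lemma rfact_nonneg: "0 \<le> rfact n"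
  by (cases n) (auto simp: rfact_nat rfact_neg)

text \<open>
The binomial coefficient \<open>C(2j, j + k)\<close>.
\<close>

definition cbin :: "nat \<Rightarrow> int \<Rightarrow> real" where
  "cbin j k = fact (2 * j) * rfact (int j + k) * rfact (int j - k)"

lemma cbin_nonneg: "0 \<le> cbin j k"
  by (simp add: cbin_def rfact_nonneg)

lemma cbin_minus: "cbin j (- k) = cbin j k"
  by (simp add: cbin_def mult_ac)

lemma rfact_0: "rfact 0 = 1"
  using rfact_nat[of 0] by simp

lemma cbin_0: "cbin 0 k = (if k = 0 then 1 else 0)"
  by (cases "k < 0") (auto simp: cbin_def rfact_0 rfact_neg)

lemma fact_double_Suc: "fact (2 * Suc j) = (2 * real j + 2) * (2 * real j + 1) * fact (2 * j)"
proof -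
  have "2 * Suc j = Suc (Suc (2 * j))" by simp
  thus ?thesis by (simp only: fact_Suc) (simp add: algebra_simps)
qed

lemma cbin_Suc_ratio:
  "cbin j k * ((2 * real j + 2) * (2 * real j + 1)) = cbin (Suc j) k * ((real j + 1)\<^sup>2 - (of_int k)\<^sup>2)"
  "cbin j (k + 1) * ((2 * real j + 2) * (2 * real j + 1)) = cbin (Suc j) k * ((real j + 1 - of_int k) * (real j - of_int k))"
  "cbin j (k - 1) * ((2 * real j + 2) * (2 * real j + 1)) = cbin (Suc j) k * ((real j + 1 + of_int k) * (real j + of_int k))"
proof -
  define x where "x = int j + 1 + k"
  define y where "y = int j + 1 - k"
  have "int j + k = x - 1" "int j - k = y - 1" "int j + (k - 1) = x - 1 - 1" "int j - (k + 1) = y - 1 - 1"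
    by (simp_all add: x_def y_def)
  hence e: "rfact (int j + k) = of_int x * rfact x" "rfact (int j - k) = of_int y * rfact y"
    "rfact (int j + (k - 1)) = of_int (x - 1) * (of_int x * rfact x)"
    "rfact (int j - (k + 1)) = of_int (y - 1) * (of_int y * rfact y)"
    by (simp_all only: rfact_pred)
  have e2: "rfact (int j + (k + 1)) = rfact x" "rfact (int j - (k - 1)) = rfact y"
    "rfact (int (Suc j) + k) = rfact x" "rfact (int (Suc j) - k) = rfact y"
    by (simp_all add: x_def y_def algebra_simps)
  show "cbin j k * ((2 * real j + 2) * (2 * real j + 1)) = cbin (Suc j) k * ((real j + 1)\<^sup>2 - (of_int k)\<^sup>2)"
    unfolding cbin_def e e2 fact_double_Suc by (simp add: x_def y_def power2_eq_square algebra_simps)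
  show "cbin j (k + 1) * ((2 * real j + 2) * (2 * real j + 1)) = cbin (Suc j) k * ((real j + 1 - of_int k) * (real j - of_int k))"
    unfolding cbin_def e e2 fact_double_Suc by (simp add: x_def y_def algebra_simps)
  show "cbin j (k - 1) * ((2 * real j + 2) * (2 * real j + 1)) = cbin (Suc j) k * ((real j + 1 + of_int k) * (real j + of_int k))"
    unfolding cbin_def e e2 fact_double_Suc by (simp add: x_def y_def algebra_simps)
qed

lemma cbin_Suc: "cbin (Suc j) k = cbin j (k - 1) + 2 * cbin j k + cbin j (k + 1)"
proof -
  define c where "c = (2 * real j + 2) * (2 * real j + 1)"
  note r = cbin_Suc_ratio[of j k, folded c_def]
  have "(cbin j (k - 1) + 2 * cbin j k + cbin j (k + 1)) * c = cbin j (k - 1) * c + 2 * (cbin j k * c) + cbin j (k + 1) * c"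
    by (simp add: algebra_simps)
  also have "\<dots> = cbin (Suc j) k * c"
    unfolding r by (simp add: c_def power2_eq_square algebra_simps)
  finally show ?thesis by (simp add: c_def add_nonneg_eq_0_iff)
qed

lemma cbin_central_diff: "(cbin j (k - 1) - cbin j (k + 1)) * (real j + 1) = of_int k * cbin (Suc j) k"
proof -
  define c where "c = (2 * real j + 2) * (2 * real j + 1)"
  note r = cbin_Suc_ratio[of j k, folded c_def]
  have "((cbin j (k - 1) - cbin j (k + 1)) * (real j + 1)) * c
      = (cbin j (k - 1) * c - cbin j (k + 1) * c) * (real j + 1)" by (simp add: algebra_simps)
  also have "\<dots> = of_int k * cbin (Suc j) k * c"
    unfolding r by (simp add: c_def algebra_simps)
  finally show ?thesis by (simp add: c_def add_nonneg_eq_0_iff)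
qed

text \<open>
The second difference of the binomial coefficients is an explicit multiple of the next one. This replaces the asymptotic
expansion of Bessel functions in the estimates below.
\<close>

lemma cbin_laplacian:
  "(cbin j (k - 1) - 2 * cbin j k + cbin j (k + 1)) * ((real j + 1) * (2 * real j + 1))
     = cbin (Suc j) k * (2 * (of_int k)\<^sup>2 - (real j + 1))"
proof -
  define c where "c = (2 * real j + 2) * (2 * real j + 1)"
  note r = cbin_Suc_ratio[of j k, folded c_def]
  have "(cbin j (k - 1) - 2 * cbin j k + cbin j (k + 1)) * ((real j + 1) * (2 * real j + 1)) * 2
     = cbin j (k - 1) * c - 2 * (cbin j k * c) + cbin j (k + 1) * c" by (simp add: c_def algebra_simps)
  also have "\<dots> = cbin (Suc j) k * (2 * (of_int k)\<^sup>2 - (real j + 1)) * 2"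
    unfolding r by (simp add: power2_eq_square algebra_simps)
  finally show ?thesis by simp
qed

lemma cbin_next: "cbin j (k + 1) * (real j + of_int k + 1) = cbin j k * (real j - of_int k)"
proof -
  define x where "x = int j + k + 1"
  define y where "y = int j - k"
  have e: "int j + (k + 1) = x" "int j - (k + 1) = y - 1" "int j + k = x - 1" "int j - k = y"
    by (simp_all add: x_def y_def)
  show ?thesis unfolding cbin_def e rfact_pred by (simp add: x_def y_def algebra_simps)
qed

lemma cbin_decreasing:
  assumes "0 \<le> k"
  shows "cbin j (k + 1) \<le> cbin j k"
proof (cases "k \<le> int j")
  case True
  have "cbin j (k + 1) * (real j + of_int k + 1) \<le> cbin j k * (real j + of_int k + 1)"
    unfolding cbin_next using assms cbin_nonneg by (intro mult_left_mono) auto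
  thus ?thesis using assms by (auto simp: mult_le_cancel_right)
next
  case False
  thus ?thesis using cbin_nonneg[of j k] by (simp add: cbin_def rfact_neg)
qed

lemma cbin_Suc_ge: "2 * cbin j k \<le> cbin (Suc j) k"
  using cbin_nonneg[of j "k - 1"] cbin_nonneg[of j "k + 1"] by (simp add: cbin_Suc)

lemma has_sum_shift_int:
  fixes f :: "int \<Rightarrow> 'a :: {comm_monoid_add, topological_space}"
  shows "((\<lambda>n. f (n + a)) has_sum S) UNIV \<longleftrightarrow> (f has_sum S) UNIV"
  by (rule has_sum_reindex_bij_witness[of _ "\<lambda>n. n - a" "\<lambda>n. n + a"]) auto

lemma cbin_has_sum: "((\<lambda>k. cbin j k) has_sum 4 ^ j) UNIV"
proof (induction j)
  case 0
  show ?case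
    by (rule has_sum_finite_neutralI[of "{0}"]) (auto simp: cbin_0)
next
  case (Suc j)
  have "((\<lambda>k. cbin j (k + (-1)) + 2 * cbin j k + cbin j (k + 1)) has_sum (4 ^ j + 2 * 4 ^ j + 4 ^ j)) UNIV"
    by (intro has_sum_add has_sum_cmult_right Suc has_sum_shift_int[THEN iffD2])
  thus ?case by (simp add: cbin_Suc)
qed

lemma cbin_le: "cbin j k \<le> 4 ^ j"
  using has_sum_mono_neutral[OF has_sum_finite[of "{k}" "cbin j"] cbin_has_sum[of j]] cbin_nonneg by auto

text \<open>
The convolution of two centred binomial distributions is again one.
\<close>

lemma cbin_vandermonde:
  "((\<lambda>n. cbin i (n - a) * cbin j (n - b)) has_sum cbin (i + j) (a - b)) UNIV"
proof (induction i arbitrary: a)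
  case 0
  show ?case
    by (rule has_sum_finite_neutralI[of "{a}"]) (auto simp: cbin_0)
next
  case (Suc i)
  have "((\<lambda>n. cbin i (n - (a + 1)) * cbin j (n - b) + 2 * (cbin i (n - a) * cbin j (n - b)) + cbin i (n - (a - 1)) * cbin j (n - b))
      has_sum (cbin (i + j) (a + 1 - b) + 2 * cbin (i + j) (a - b) + cbin (i + j) (a - 1 - b))) UNIV"
    by (intro has_sum_add has_sum_cmult_right Suc)
  also have "cbin (i + j) (a + 1 - b) + 2 * cbin (i + j) (a - b) + cbin (i + j) (a - 1 - b) = cbin (Suc i + j) (a - b)"
    by (simp add: cbin_Suc algebra_simps)
  also have "(\<lambda>n. cbin i (n - (a + 1)) * cbin j (n - b) + 2 * (cbin i (n - a) * cbin j (n - b)) + cbin i (n - (a - 1)) * cbin j (n - b))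
     = (\<lambda>n. cbin (Suc i) (n - a) * cbin j (n - b))"
    by (simp add: cbin_Suc algebra_simps)
  finally show ?case .
qed

text \<open>
The Taylor coefficients of \<open>t \<mapsto> I\<^sub>k(2t)\<close>.
\<close>

definition bes_coeff :: "int \<Rightarrow> nat \<Rightarrow> real" where
  "bes_coeff k n = (if even (int n - k) then rfact ((int n - k) div 2) * rfact ((int n + k) div 2) else 0)"

lemma bes_coeff_Suc: "real (Suc n) * bes_coeff k (Suc n) = bes_coeff (k - 1) n + bes_coeff (k + 1) n"
proof (cases "even (int (Suc n) - k)")
  case True
  then obtain x where x: "int (Suc n) - k = 2 * x" by (elim evenE)
  define y where "y = x + k"
  have y: "int (Suc n) + k = 2 * y" using x by (simp add: y_def)
  have e: "int n - (k - 1) = 2 * x" "int n + (k - 1) = 2 * (y - 1)" "int n - (k + 1) = 2 * (x - 1)" "int n + (k + 1) = 2 * y"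
    using x y by auto
  have xy: "real (Suc n) = of_int x + of_int y"
  proof -
    have "int (Suc n) = x + y" using x y by linarith
    thus ?thesis by (metis of_int_add of_int_of_nat_eq)
  qed
  show ?thesis
    unfolding bes_coeff_def x y e xy by (simp add: rfact_pred algebra_simps)
next
  case False
  hence "odd (int n - (k - 1))" "odd (int n - (k + 1))" by auto
  with False show ?thesis by (simp add: bes_coeff_def)
qed

lemma bes_coeff_0: "bes_coeff k 0 = (if k = 0 then 1 else 0)"
proof (cases "even k")
  case True
  then obtain b where k: "k = 2 * b" by (elim evenE)
  hence e: "(int 0 - k) div 2 = - b" "(int 0 + k) div 2 = b" by presburger+
  show ?thesis
    unfolding bes_coeff_def e using k by (cases b "0 :: int" rule: linorder_cases) (auto simp: rfact_0 rfact_neg)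
qed (auto simp: bes_coeff_def)

text \<open>
The Cauchy product for \<open>e\<^sup>2\<^sup>t I\<^sub>k(2t)\<close>. Both families of power series solve \<open>A\<^sub>k' = A\<^sub>k\<^sub>-\<^sub>1 + 2 A\<^sub>k + A\<^sub>k\<^sub>+\<^sub>1\<close> with the same
initial values; for binomial coefficients this is Pascal's rule applied twice.
\<close>

lemma bes_coeff_exp: "(\<Sum>i\<le>n. 2 ^ i / fact i * bes_coeff k (n - i)) = cbin n k / fact n"
proof -
  define B where "B k = Abs_fps (bes_coeff k)" for k
  define A where "A k = fps_exp 2 * B k" for k
  have dB: "fps_deriv (B k) = B (k - 1) + B (k + 1)" for k
    by (rule fps_ext) (use bes_coeff_Suc in \<open>simp add: B_def\<close>)
  have dA: "fps_deriv (A k) = A (k - 1) + 2 * A k + A (k + 1)" for k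
    by (simp add: A_def dB algebra_simps numeral_fps_const)
  have "fps_nth (A k) n = cbin n k / fact n" for k
  proof (induction n arbitrary: k)
    case 0
    show ?case by (simp add: A_def B_def bes_coeff_0 cbin_0)
  next
    case (Suc n)
    have "real (Suc n) * fps_nth (A k) (Suc n) = fps_nth (fps_deriv (A k)) n" by simp
    also have "\<dots> = fps_nth (A (k - 1)) n + 2 * fps_nth (A k) n + fps_nth (A (k + 1)) n"
      by (simp add: dA numeral_fps_const)
    also have "\<dots> = cbin (Suc n) k / fact n" by (simp add: Suc cbin_Suc add_divide_distrib)
    finally have "real (Suc n) * fps_nth (A k) (Suc n) = cbin (Suc n) k / fact n" .
    thus ?case unfolding fact_Suc of_nat_mult by (simp add: field_simps del: of_nat_Suc)
  qed
  thus ?thesis by (simp add: A_def B_def fps_mult_nth atLeast0AtMost)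
qed

lemma bes_coeff_nonneg: "0 \<le> bes_coeff k n"
  by (simp add: bes_coeff_def rfact_nonneg)

lemma bes_coeff_le: "bes_coeff k n \<le> 4 ^ n / fact n"
proof -
  have "bes_coeff k n = 2 ^ 0 / fact 0 * bes_coeff k (n - 0)" by simp
  also have "\<dots> \<le> (\<Sum>i\<le>n. 2 ^ i / fact i * bes_coeff k (n - i))"
    by (rule member_le_sum) (auto simp: bes_coeff_nonneg)
  also have "\<dots> \<le> 4 ^ n / fact n" unfolding bes_coeff_exp using cbin_le by (intro divide_right_mono) auto
  finally show ?thesis .
qed

lemma summable_4_exp: "summable (\<lambda>n. (4::real) ^ n / fact n * \<bar>t\<bar> ^ n)"
  using summable_exp[of "4 * \<bar>t\<bar>"] by (simp add: power_mult_distrib inverse_eq_divide field_simps)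

lemma summable_bes_coeff: "summable (\<lambda>n. norm (bes_coeff k n * t ^ n))"
proof (rule summable_comparison_test'[OF summable_4_exp[of t]])
  fix n :: nat
  have "norm (norm (bes_coeff k n * t ^ n)) = bes_coeff k n * \<bar>t\<bar> ^ n"
    using bes_coeff_nonneg[of k n] by (simp add: abs_mult power_abs)
  also have "\<dots> \<le> 4 ^ n / fact n * \<bar>t\<bar> ^ n"
    by (intro mult_right_mono bes_coeff_le) auto
  finally show "norm (norm (bes_coeff k n * t ^ n)) \<le> 4 ^ n / fact n * \<bar>t\<bar> ^ n" .
qed

lemma bessel_sums: "(\<lambda>n. bes_coeff k n * t ^ n) sums bessel_I k (2 * t)"
proof -
  define F where "F m = 1 / fact m * rfact (int m + k) * t powi (2 * int m + k)" for m :: nat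
  define f where "f n = bes_coeff k n * t ^ n" for n
  have bI: "bessel_I k (2 * t) = suminf F"
    unfolding bessel_I_def by (rule arg_cong[of _ _ suminf]) (auto simp: fun_eq_iff F_def rfact_def)
  have sf: "summable f" unfolding f_def using summable_bes_coeff[of k t] by (rule summable_norm_cancel)
  have F: "F m = f (nat (2 * int m + k))" if "0 \<le> int m + k" "0 \<le> 2 * int m + k" for m
    using that by (simp add: F_def f_def bes_coeff_def rfact_nat power_int_def add.commute)
  have "F sums suminf f"
  proof (cases "0 \<le> k")
    case True
    have "(\<lambda>m. f (nat (2 * int m + k))) sums suminf f \<longleftrightarrow> f sums suminf f"
    proof (rule sums_mono_reindex)
      show "strict_mono (\<lambda>m. nat (2 * int m + k))" using True by (auto simp: strict_mono_def)
      fix n assume n: "n \<notin> range (\<lambda>m. nat (2 * int m + k))"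
      show "f n = 0"
      proof (cases "even (int n - k) \<and> k \<le> int n")
        case True
        hence "2 dvd int n - k" by blast
        then obtain m where m: "int n - k = 2 * m" by (elim dvdE)
        hence "0 \<le> m" using True by linarith
        hence "n = nat (2 * int (nat m) + k)" using m by linarith
        with n show ?thesis by blast
      next
        case False
        thus ?thesis by (auto simp: f_def bes_coeff_def rfact_neg elim!: evenE)
      qed
    qed
    moreover have "(\<lambda>m. f (nat (2 * int m + k))) = F" using F True by auto
    ultimately show ?thesis using sf by (simp add: summable_sums)
  next
    case False
    have "(\<lambda>m. f (nat (2 * int m - k))) sums suminf f \<longleftrightarrow> f sums suminf f"
    proof (rule sums_mono_reindex)
      show "strict_mono (\<lambda>m. nat (2 * int m - k))" using False by (auto simp: strict_mono_def)
      fix n assume n: "n \<notin> range (\<lambda>m. nat (2 * int m - k))"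
      show "f n = 0"
      proof (cases "even (int n + k) \<and> - k \<le> int n")
        case True
        hence "2 dvd int n + k" by blast
        then obtain m where m: "int n + k = 2 * m" by (elim dvdE)
        hence "0 \<le> m" using True by linarith
        hence "n = nat (2 * int (nat m) - k)" using m by linarith
        with n show ?thesis by blast
      next
        case False
        thus ?thesis by (auto simp: f_def bes_coeff_def rfact_neg elim!: evenE)
      qed
    qed
    moreover have "(\<lambda>m. F (m + nat (- k))) sums suminf f \<longleftrightarrow> F sums suminf f"
    proof (rule sums_mono_reindex[where g = "\<lambda>m. m + nat (- k)"])
      show "strict_mono (\<lambda>m. m + nat (- k))" by (auto simp: strict_mono_def)
      fix n assume n: "n \<notin> range (\<lambda>m. m + nat (- k))"
      have "int n + k < 0"
      proof (rule ccontr)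
        assume "\<not> int n + k < 0"
        hence "n = (n - nat (- k)) + nat (- k)" by auto
        with n show False by blast
      qed
      thus "F n = 0" by (simp add: F_def rfact_neg)
    qed
    moreover have "F (m + nat (- k)) = f (nat (2 * int m - k))" for m
      using F[of "m + nat (- k)"] False by (simp add: algebra_simps)
    ultimately show ?thesis using sf by (simp add: summable_sums)
  qed
  thus ?thesis using sf by (simp add: bI f_def[symmetric] sums_iff)
qed

lemma summable_cbin: "summable (\<lambda>j. cbin j k / fact j * t ^ j)"
proof (rule summable_comparison_test'[OF summable_4_exp[of t]])
  fix n :: nat
  show "norm (cbin n k / fact n * t ^ n) \<le> 4 ^ n / fact n * \<bar>t\<bar> ^ n"
    using cbin_nonneg[of n k] cbin_le[of n k]
    by (auto simp: abs_mult power_abs intro!: mult_right_mono divide_right_mono)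
qed

lemma heat_kernel_series: "heat_kernel t k = exp (- 4 * t) * (\<Sum>j. cbin j k / fact j * t ^ j)"
proof -
  have e: "(\<lambda>n. norm ((2::real) ^ n / fact n * t ^ n)) = (\<lambda>n. norm ((2 * t) ^ n /\<^sub>R fact n))"
    by (simp add: power_mult_distrib field_simps)
  have "(\<lambda>n. \<Sum>i\<le>n. (2 ^ i / fact i * t ^ i) * (bes_coeff k (n - i) * t ^ (n - i)))
      sums ((\<Sum>i. 2 ^ i / fact i * t ^ i) * (\<Sum>n. bes_coeff k n * t ^ n))"
    by (rule Cauchy_product_sums) (use summable_norm_exp[of "2 * t"] summable_bes_coeff[of k t] e in auto)
  also have "(\<lambda>n. \<Sum>i\<le>n. (2 ^ i / fact i * t ^ i) * (bes_coeff k (n - i) * t ^ (n - i)))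
      = (\<lambda>n. (\<Sum>i\<le>n. 2 ^ i / fact i * bes_coeff k (n - i)) * t ^ n)"
  proof (rule ext)
    fix n
    show "(\<Sum>i\<le>n. (2 ^ i / fact i * t ^ i) * (bes_coeff k (n - i) * t ^ (n - i)))
      = (\<Sum>i\<le>n. 2 ^ i / fact i * bes_coeff k (n - i)) * t ^ n"
      unfolding sum_distrib_right by (intro sum.cong refl) (simp add: power_add[symmetric] mult_ac)
  qed
  also have "(\<Sum>i. 2 ^ i / fact i * t ^ i) = exp (2 * t)"
    by (simp add: exp_def power_mult_distrib field_simps)
  also have "(\<Sum>n. bes_coeff k n * t ^ n) = bessel_I k (2 * t)" using bessel_sums[of k t] by (simp add: sums_iff)
  finally have "(\<lambda>n. cbin n k / fact n * t ^ n) sums (exp (2 * t) * bessel_I k (2 * t))"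
    unfolding bes_coeff_exp .
  hence "(\<Sum>n. cbin n k / fact n * t ^ n) = exp (2 * t) * bessel_I k (2 * t)" by (simp only: sums_iff)
  moreover have "exp (- 2 * t) = exp (- 4 * t) * exp (2 * t)" by (simp add: exp_add[symmetric])
  ultimately show ?thesis by (simp add: heat_kernel_def)
qed

section \<open>Elementary properties of the heat kernel\<close>

definition lap :: "(int \<Rightarrow> real) \<Rightarrow> int \<Rightarrow> real" where
  "lap \<phi> k = \<phi> (k - 1) - 2 * \<phi> k + \<phi> (k + 1)"

lemma heat_kernel_sums: "(\<lambda>j. exp (- 4 * t) * (cbin j k / fact j * t ^ j)) sums heat_kernel t k"
  unfolding heat_kernel_series by (intro sums_mult summable_sums summable_cbin)

lemma heat_kernel_nonneg: "0 \<le> t \<Longrightarrow> 0 \<le> heat_kernel t k"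
  using heat_kernel_sums by (rule sums_le[OF _ sums_zero, rotated]) (simp add: cbin_nonneg)

lemma heat_kernel_minus: "heat_kernel t (- k) = heat_kernel t k"
  by (simp add: heat_kernel_series cbin_minus)

lemma heat_kernel_abs: "heat_kernel t \<bar>k\<bar> = heat_kernel t k"
  by (simp add: abs_if heat_kernel_minus)

lemma heat_kernel_decreasing:
  assumes "0 \<le> t" "0 \<le> k"
  shows "heat_kernel t (k + 1) \<le> heat_kernel t k"
  using heat_kernel_sums heat_kernel_sums
  by (rule sums_le[rotated]) (use assms cbin_decreasing in \<open>auto intro!: mult_right_mono divide_right_mono\<close>)

lemma heat_kernel_antimono:
  assumes "0 \<le> t" "0 \<le> k" "k \<le> l"
  shows "heat_kernel t l \<le> heat_kernel t k"
  using assms(3)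
proof (induction l rule: int_ge_induct)
  case (step l)
  have "heat_kernel t (l + 1) \<le> heat_kernel t l" using step assms by (intro heat_kernel_decreasing) auto
  with step show ?case by simp
qed simp

lemma exp4_sums: "(\<lambda>j. exp (- 4 * t) * (4 ^ j / fact j * t ^ j)) sums (1 :: real)"
proof -
  have "(\<lambda>j. (4 * t) ^ j /\<^sub>R fact j) sums exp (4 * t)" by (rule exp_converges)
  hence "(\<lambda>j. exp (- 4 * t) * ((4 * t) ^ j /\<^sub>R fact j)) sums (exp (- 4 * t) * exp (4 * t))" by (rule sums_mult)
  thus ?thesis by (simp add: exp_add[symmetric] power_mult_distrib field_simps)
qed

lemma cbin_finite_sum_le: "finite F \<Longrightarrow> (\<Sum>k\<in>F. cbin j k) \<le> 4 ^ j"
  using has_sum_mono_neutral[OF has_sum_finite[of F "cbin j"] cbin_has_sum[of j]] cbin_nonneg by auto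

lemma heat_kernel_mass:
  assumes "0 \<le> t" "finite F"
  shows "(\<Sum>k\<in>F. heat_kernel t k) \<le> 1"
proof -
  have 1: "(\<lambda>j. \<Sum>k\<in>F. exp (- 4 * t) * (cbin j k / fact j * t ^ j)) sums (\<Sum>k\<in>F. heat_kernel t k)"
    by (intro sums_sum heat_kernel_sums)
  show ?thesis
  proof (rule sums_le[OF _ 1 exp4_sums[of t]])
    fix j
    have "(\<Sum>k\<in>F. exp (- 4 * t) * (cbin j k / fact j * t ^ j)) = exp (- 4 * t) * ((\<Sum>k\<in>F. cbin j k) / fact j * t ^ j)"
      by (simp add: sum_distrib_left sum_distrib_right sum_divide_distrib)
    also have "\<dots> \<le> exp (- 4 * t) * (4 ^ j / fact j * t ^ j)"
      using assms by (intro mult_left_mono mult_right_mono divide_right_mono cbin_finite_sum_le) auto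
    finally show "(\<Sum>k\<in>F. exp (- 4 * t) * (cbin j k / fact j * t ^ j)) \<le> exp (- 4 * t) * (4 ^ j / fact j * t ^ j)" .
  qed
qed

lemma heat_kernel_le:
  assumes "0 \<le> t"
  shows "heat_kernel t k \<le> 1 / (2 * \<bar>of_int k\<bar> + 1)"
proof -
  define l where "l = \<bar>k\<bar>"
  have l: "0 \<le> l" by (simp add: l_def)
  have "(2 * of_int l + 1) * heat_kernel t l = (\<Sum>i= -l..l. heat_kernel t l)" using l by simp
  also have "\<dots> \<le> (\<Sum>i= -l..l. heat_kernel t i)"
  proof (rule sum_mono)
    fix i assume "i \<in> {-l..l}"
    hence "heat_kernel t l \<le> heat_kernel t \<bar>i\<bar>" using assms by (intro heat_kernel_antimono) auto
    thus "heat_kernel t l \<le> heat_kernel t i" by (simp add: heat_kernel_abs)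
  qed
  also have "\<dots> \<le> 1" using assms by (intro heat_kernel_mass) auto
  finally have "heat_kernel t l \<le> 1 / (2 * of_int l + 1)" using l by (simp add: field_simps)
  thus ?thesis by (simp add: l_def heat_kernel_abs)
qed

lemma heat_kernel_0: "heat_kernel 0 k = (if k = 0 then 1 else 0)"
proof -
  have "(\<Sum>j. cbin j k / fact j * 0 ^ j) = (\<Sum>j\<in>{0}. cbin j k / fact j * 0 ^ j)"
    by (rule suminf_finite) auto
  thus ?thesis by (simp add: heat_kernel_series cbin_0)
qed

lemma heat_kernel_deriv: "((\<lambda>t. heat_kernel t k) has_real_derivative lap (heat_kernel t) k) (at t)"
proof -
  define q where "q k j = cbin j k / fact j" for k j
  have sm: "summable (\<lambda>j. q k j * x ^ j)" for k x unfolding q_def by (rule summable_cbin)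
  have dq: "diffs (q k) = (\<lambda>j. q (k - 1) j + 2 * q k j + q (k + 1) j)"
  proof
    fix j
    have "real (Suc j) * (X / fact (Suc j)) = X / fact j" for X
      unfolding fact_Suc of_nat_mult by (simp del: of_nat_Suc)
    thus "diffs (q k) j = q (k - 1) j + 2 * q k j + q (k + 1) j"
      unfolding diffs_def q_def by (simp only: cbin_Suc add_divide_distrib distrib_left times_divide_eq_right)
  qed
  have 1: "((\<lambda>x. \<Sum>j. q k j * x ^ j) has_field_derivative (\<Sum>j. diffs (q k) j * t ^ j)) (at t)"
    using sm by (rule termdiffs_strong_converges_everywhere)
  have 2: "(\<Sum>j. diffs (q k) j * t ^ j) = (\<Sum>j. q (k - 1) j * t ^ j) + 2 * (\<Sum>j. q k j * t ^ j) + (\<Sum>j. q (k + 1) j * t ^ j)"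
  proof -
    have "(\<lambda>j. q (k - 1) j * t ^ j + 2 * (q k j * t ^ j) + q (k + 1) j * t ^ j)
      sums ((\<Sum>j. q (k - 1) j * t ^ j) + 2 * (\<Sum>j. q k j * t ^ j) + (\<Sum>j. q (k + 1) j * t ^ j))"
      by (intro sums_add sums_mult summable_sums sm)
    also have "(\<lambda>j. q (k - 1) j * t ^ j + 2 * (q k j * t ^ j) + q (k + 1) j * t ^ j) = (\<lambda>j. diffs (q k) j * t ^ j)"
      by (simp add: dq distrib_right mult.assoc)
    finally show ?thesis by (rule sums_unique[symmetric])
  qed
  define S where "S k x = (\<Sum>j. q k j * x ^ j)" for k x
  have hk: "heat_kernel x k = exp (- 4 * x) * S k x" for x k
    by (simp add: heat_kernel_series S_def q_def)
  have 3: "(S k has_real_derivative (S (k - 1) t + 2 * S k t + S (k + 1) t)) (at t)"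
    using 1 unfolding 2 S_def[symmetric] .
  show ?thesis
    unfolding hk lap_def by (rule derivative_eq_intros refl 3)+ (simp add: algebra_simps)
qed

lemma heat_kernel_continuous: "continuous_on S (\<lambda>t. heat_kernel t k)"
  by (intro continuous_at_imp_continuous_on ballI DERIV_isCont[OF heat_kernel_deriv])

text \<open>
The three term recurrence \<open>k I\<^sub>k(s) = (s/2) (I\<^sub>k\<^sub>-\<^sub>1(s) - I\<^sub>k\<^sub>+\<^sub>1(s))\<close> of Bessel functions.
\<close>

lemma heat_kernel_recurrence:
  "of_int k * heat_kernel t k = t * (heat_kernel t (k - 1) - heat_kernel t (k + 1))"
proof -
  have "(\<lambda>j. exp (- 4 * t) * (cbin j (k - 1) / fact j * t ^ j) - exp (- 4 * t) * (cbin j (k + 1) / fact j * t ^ j))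
     sums (heat_kernel t (k - 1) - heat_kernel t (k + 1))"
    by (intro sums_diff heat_kernel_sums)
  hence "(\<lambda>j. t * (exp (- 4 * t) * (cbin j (k - 1) / fact j * t ^ j) - exp (- 4 * t) * (cbin j (k + 1) / fact j * t ^ j)))
     sums (t * (heat_kernel t (k - 1) - heat_kernel t (k + 1)))"
    by (rule sums_mult)
  moreover have "t * (exp (- 4 * t) * (cbin j (k - 1) / fact j * t ^ j) - exp (- 4 * t) * (cbin j (k + 1) / fact j * t ^ j))
     = of_int k * (exp (- 4 * t) * (cbin (Suc j) k / fact (Suc j) * t ^ Suc j))" for j
  proof -
    have "of_int k * cbin (Suc j) k / fact (Suc j) = (cbin j (k - 1) - cbin j (k + 1)) / fact j"
    proof -
      have "fact (Suc j) = (real j + 1) * fact j" "real j + 1 \<noteq> 0" by auto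
      thus ?thesis unfolding cbin_central_diff[symmetric] by (simp only: mult.commute[of _ "real j + 1"] mult_divide_mult_cancel_left not_False_eq_True)
    qed
    moreover have "of_int k * (exp (- 4 * t) * (cbin (Suc j) k / fact (Suc j) * t ^ Suc j))
       = exp (- 4 * t) * (of_int k * cbin (Suc j) k / fact (Suc j) * t ^ Suc j)"
      by (simp only: times_divide_eq_left times_divide_eq_right mult_ac)
    ultimately have "of_int k * (exp (- 4 * t) * (cbin (Suc j) k / fact (Suc j) * t ^ Suc j))
       = exp (- 4 * t) * ((cbin j (k - 1) - cbin j (k + 1)) / fact j * t ^ Suc j)" by (simp only:)
    thus ?thesis by (simp add: diff_divide_distrib algebra_simps)
  qed
  ultimately have 1: "(\<lambda>j. of_int k * (exp (- 4 * t) * (cbin (Suc j) k / fact (Suc j) * t ^ Suc j)))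
     sums (t * (heat_kernel t (k - 1) - heat_kernel t (k + 1)))" by simp
  have "(\<lambda>j. of_int k * (exp (- 4 * t) * (cbin j k / fact j * t ^ j))) sums (of_int k * heat_kernel t k)"
    by (intro sums_mult heat_kernel_sums)
  hence 2: "(\<lambda>j. of_int k * (exp (- 4 * t) * (cbin (Suc j) k / fact (Suc j) * t ^ Suc j))) sums (of_int k * heat_kernel t k)"
    using sums_Suc_iff[of "\<lambda>j. of_int k * (exp (- 4 * t) * (cbin j k / fact j * t ^ j))" "of_int k * heat_kernel t k"]
    by (simp add: cbin_0 split: if_splits)
  show ?thesis using sums_unique2[OF 2 1] .
qed

text \<open>
By \<open>cbin_laplacian\<close>, the term of index \<open>j\<close> in the series for the second difference is the term of index \<open>j + 1\<close> or \<open>j + 2\<close> in the series for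
\<open>heat_kernel t k\<close>, up to the powers of \<open>t\<close> and the factor \<open>k\<^sup>2\<close>.
\<close>

lemma heat_kernel_lap_le:
  assumes t: "0 < t"
  shows "\<bar>lap (heat_kernel t) k\<bar> \<le> (2 * (of_int k)\<^sup>2 / t\<^sup>2 + 1 / t) * heat_kernel t k"
proof -
  define e where "e = exp (- 4 * t)"
  have e: "0 < e" by (simp add: e_def)
  define a where "a j = e * (cbin j k / fact j * t ^ j)" for j
  have a: "a sums heat_kernel t k" unfolding a_def e_def by (rule heat_kernel_sums)
  have a0: "0 \<le> a j" for j using t e by (simp add: a_def cbin_nonneg)
  have tail: "summable (\<lambda>j. a (j + m))" "(\<Sum>j. a (j + m)) \<le> heat_kernel t k" for m
  proof -
    show s: "summable (\<lambda>j. a (j + m))" using a by (simp add: sums_iff summable_iff_shift)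
    have "(\<Sum>j. a (j + m)) = heat_kernel t k - (\<Sum>j<m. a j)"
      using a suminf_minus_initial_segment[of a m] by (simp add: sums_iff)
    thus "(\<Sum>j. a (j + m)) \<le> heat_kernel t k" using a0 by (simp add: sum_nonneg)
  qed
  define d where "d j = e * ((cbin j (k - 1) - 2 * cbin j k + cbin j (k + 1)) / fact j * t ^ j)" for j
  have "(\<lambda>j. e * (cbin j (k - 1) / fact j * t ^ j) - 2 * a j + e * (cbin j (k + 1) / fact j * t ^ j)) sums lap (heat_kernel t) k"
    unfolding lap_def a_def e_def by (intro sums_add sums_diff sums_mult heat_kernel_sums)
  hence d: "d sums lap (heat_kernel t) k"
    by (simp add: d_def[abs_def] a_def algebra_simps add_divide_distrib diff_divide_distrib)
  have dle: "\<bar>d j\<bar> \<le> 2 * (of_int k)\<^sup>2 / t\<^sup>2 * a (j + 2) + 1 / t * a (j + 1)" for j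
  proof -
    define X where "X = (real j + 1) * (2 * real j + 1)"
    have X: "0 < X" by (simp add: X_def)
    have dj: "d j = e * (t ^ j / fact j) * (cbin (Suc j) k * (2 * (of_int k)\<^sup>2 - (real j + 1)) / X)"
    proof -
      have "cbin j (k - 1) - 2 * cbin j k + cbin j (k + 1) = cbin (Suc j) k * (2 * (of_int k)\<^sup>2 - (real j + 1)) / X"
        using cbin_laplacian[of j k] X by (simp only: X_def nonzero_eq_divide_eq less_imp_neq[symmetric] not_False_eq_True)
      thus ?thesis by (simp add: d_def mult_ac)
    qed
    have "\<bar>2 * (of_int k)\<^sup>2 - (real j + 1)\<bar> \<le> 2 * (of_int k)\<^sup>2 + (real j + 1)"
      using zero_le_power2[of "of_int k :: real"] by (simp add: abs_le_iff)
    hence "e * (t ^ j / fact j) * (cbin (Suc j) k * \<bar>2 * (of_int k)\<^sup>2 - (real j + 1)\<bar> / X)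
       \<le> e * (t ^ j / fact j) * (cbin (Suc j) k * (2 * (of_int k)\<^sup>2 + (real j + 1)) / X)"
      using e t X cbin_nonneg[of "Suc j" k] by (intro mult_left_mono divide_right_mono) auto
    also have "e * (t ^ j / fact j) * (cbin (Suc j) k * \<bar>2 * (of_int k)\<^sup>2 - (real j + 1)\<bar> / X) = \<bar>d j\<bar>"
      unfolding dj using e t X cbin_nonneg[of "Suc j" k] by (simp add: abs_mult)
    finally have "\<bar>d j\<bar> \<le> e * (t ^ j / fact j) * (cbin (Suc j) k * (2 * (of_int k)\<^sup>2 + (real j + 1)) / X)" .
    also have "\<dots> = e * (t ^ j / fact j) * (2 * (of_int k)\<^sup>2 * (cbin (Suc j) k / X)) + e * (t ^ j / fact j) * (cbin (Suc j) k * (real j + 1) / X)"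
      by (simp add: algebra_simps add_divide_distrib)
    also have "\<dots> \<le> e * (t ^ j / fact j) * (2 * (of_int k)\<^sup>2 * (cbin (Suc (Suc j)) k / ((real j + 1) * (real j + 2)))) + e * (t ^ j / fact j) * (cbin (Suc j) k / (real j + 1))"
    proof (intro add_mono mult_left_mono)
      have "cbin (Suc j) k * (real j + 2) \<le> cbin (Suc j) k * (2 * (2 * real j + 1))"
        using cbin_nonneg by (intro mult_left_mono) auto
      also have "\<dots> \<le> cbin (Suc (Suc j)) k * (2 * real j + 1)"
        using mult_right_mono[OF cbin_Suc_ge[of "Suc j" k], of "2 * real j + 1"] by (simp add: algebra_simps)
      finally show "cbin (Suc j) k / X \<le> cbin (Suc (Suc j)) k / ((real j + 1) * (real j + 2))"
        by (simp add: X_def divide_simps)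
      have "cbin (Suc j) k * (real j + 1) / X = cbin (Suc j) k / (2 * real j + 1)"
        by (simp add: X_def)
      also have "\<dots> \<le> cbin (Suc j) k / (real j + 1)"
        using cbin_nonneg by (intro divide_left_mono) auto
      finally show "cbin (Suc j) k * (real j + 1) / X \<le> cbin (Suc j) k / (real j + 1)" .
    qed (use e t in auto)
    also have "e * (t ^ j / fact j) * (2 * (of_int k)\<^sup>2 * (cbin (Suc (Suc j)) k / ((real j + 1) * (real j + 2)))) = 2 * (of_int k)\<^sup>2 / t\<^sup>2 * a (j + 2)"
      using t by (simp add: a_def power2_eq_square divide_simps) (simp add: algebra_simps)
    also have "e * (t ^ j / fact j) * (cbin (Suc j) k / (real j + 1)) = 1 / t * a (j + 1)"
      using t by (simp add: a_def divide_simps)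
    finally show ?thesis .
  qed
  define b where "b j = 2 * (of_int k)\<^sup>2 / t\<^sup>2 * a (j + 2) + 1 / t * a (j + 1)" for j
  have bs: "summable b" unfolding b_def by (intro summable_add summable_mult tail)
  have "\<bar>lap (heat_kernel t) k\<bar> = norm (suminf d)" using d by (simp add: sums_iff)
  also have "\<dots> \<le> suminf b" using dle bs by (intro norm_suminf_le) (auto simp: b_def)
  also have "\<dots> = 2 * (of_int k)\<^sup>2 / t\<^sup>2 * (\<Sum>j. a (j + 2)) + 1 / t * (\<Sum>j. a (j + 1))"
    unfolding b_def using tail(1) by (subst suminf_add[symmetric]) (auto intro: summable_mult simp only: suminf_mult[symmetric])
  also have "\<dots> \<le> 2 * (of_int k)\<^sup>2 / t\<^sup>2 * heat_kernel t k + 1 / t * heat_kernel t k"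
    using t by (intro add_mono mult_left_mono tail(2)) auto
  finally show ?thesis by (simp add: distrib_right)
qed

section \<open>Decay of the heat kernel and of its differences\<close>

lemma cbin_lap_diff:
  assumes k: "0 \<le> k"
  shows "\<bar>lap (cbin j) k - lap (cbin j) (k + 1)\<bar>
    \<le> (2 * of_int k + 1) * cbin (Suc j) k * (2 * (of_int k)\<^sup>2 / (real j + 1) + 3) / ((real j + 1) * (2 * real j + 1))"
proof -
  define x where "x = (of_int k :: real)"
  define J where "J = real j + 1"
  define X where "X = J * (2 * real j + 1)"
  define c where "c = cbin (Suc j) k"
  define c' where "c' = cbin (Suc j) (k + 1)"
  have x: "0 \<le> x" and J: "1 \<le> J" and X: "0 < X" using k by (auto simp: x_def J_def X_def)
  have c: "0 \<le> c" "0 \<le> c'" "c' \<le> c" using k by (auto simp: c_def c'_def cbin_nonneg cbin_decreasing)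
  have L: "lap (cbin j) k = c * (2 * x\<^sup>2 - J) / X" "lap (cbin j) (k + 1) = c' * (2 * (x + 1)\<^sup>2 - J) / X"
    using cbin_laplacian[of j k] cbin_laplacian[of j "k + 1"] X
    by (simp_all add: lap_def nonzero_eq_divide_eq X_def J_def x_def c_def c'_def)
  have n: "c' * (J + x + 1) = c * (J - x)"
    using cbin_next[of "Suc j" k] by (simp add: c_def c'_def J_def x_def add_ac)
  hence d: "c - c' = c * (2 * x + 1) / (J + x + 1)" using x J by (simp add: field_simps)
  have "c * (2 * x\<^sup>2 - J) - c' * (2 * (x + 1)\<^sup>2 - J) = (c - c') * (2 * x\<^sup>2 - J) - c' * (2 * (2 * x + 1))"
    by (simp add: power2_eq_square algebra_simps)
  also have "\<bar>\<dots>\<bar> \<le> \<bar>(c - c') * (2 * x\<^sup>2 - J)\<bar> + \<bar>c' * (2 * (2 * x + 1))\<bar>" by (rule abs_triangle_ineq4)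
  also have "\<bar>(c - c') * (2 * x\<^sup>2 - J)\<bar> \<le> (c - c') * (2 * x\<^sup>2 + J)"
    unfolding abs_mult using c J by (intro mult_mono) (auto simp: abs_le_iff)
  also have "(c - c') * (2 * x\<^sup>2 + J) = c * (2 * x + 1) * ((2 * x\<^sup>2 + J) / (J + x + 1))" by (simp add: d)
  also have "\<dots> \<le> c * (2 * x + 1) * (2 * x\<^sup>2 / J + 1)"
  proof (rule mult_left_mono)
    have "(2 * x\<^sup>2 + J) / (J + x + 1) \<le> (2 * x\<^sup>2 + J) / J" using x J by (intro divide_left_mono) auto
    thus "(2 * x\<^sup>2 + J) / (J + x + 1) \<le> 2 * x\<^sup>2 / J + 1" using J by (simp add: add_divide_distrib)
  qed (use c x in auto)
  also have "\<bar>c' * (2 * (2 * x + 1))\<bar> \<le> c * (2 * x + 1) * 2"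
    using mult_right_mono[OF c(3), of "2 * (2 * x + 1)"] c x by (simp add: abs_mult mult_ac)
  finally have "\<bar>c * (2 * x\<^sup>2 - J) - c' * (2 * (x + 1)\<^sup>2 - J)\<bar> \<le> (2 * x + 1) * c * (2 * x\<^sup>2 / J + 3)"
    by (simp add: algebra_simps)
  hence "\<bar>c * (2 * x\<^sup>2 - J) - c' * (2 * (x + 1)\<^sup>2 - J)\<bar> / X \<le> (2 * x + 1) * c * (2 * x\<^sup>2 / J + 3) / X"
    using X by (intro divide_right_mono) auto
  moreover have "lap (cbin j) k - lap (cbin j) (k + 1) = (c * (2 * x\<^sup>2 - J) - c' * (2 * (x + 1)\<^sup>2 - J)) / X"
    by (simp add: L diff_divide_distrib)
  ultimately show ?thesis using X by (simp add: x_def c_def X_def J_def)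
qed

text \<open>
The same comparison of series, with a shift of the index by two and by three.
\<close>

lemma heat_kernel_lap_diff_le:
  assumes t: "0 < t" and k: "0 \<le> k"
  shows "\<bar>lap (heat_kernel t) k - lap (heat_kernel t) (k + 1)\<bar>
     \<le> 3 * (2 * of_int k + 1) * ((of_int k)\<^sup>2 / t ^ 3 + 1 / t\<^sup>2) * heat_kernel t k"
proof -
  define e where "e = exp (- 4 * t)"
  have e: "0 < e" by (simp add: e_def)
  define x where "x = (of_int k :: real)"
  have x: "0 \<le> x" using k by (simp add: x_def)
  define a where "a j = e * (cbin j k / fact j * t ^ j)" for j
  have a: "a sums heat_kernel t k" unfolding a_def e_def by (rule heat_kernel_sums)
  have a0: "0 \<le> a j" for j using t e by (simp add: a_def cbin_nonneg)
  have tail: "summable (\<lambda>j. a (j + m))" "(\<Sum>j. a (j + m)) \<le> heat_kernel t k" for m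
  proof -
    show s: "summable (\<lambda>j. a (j + m))" using a by (simp add: sums_iff summable_iff_shift)
    have "(\<Sum>j. a (j + m)) = heat_kernel t k - (\<Sum>j<m. a j)"
      using a suminf_minus_initial_segment[of a m] by (simp add: sums_iff)
    thus "(\<Sum>j. a (j + m)) \<le> heat_kernel t k" using a0 by (simp add: sum_nonneg)
  qed
  have lap_sums: "(\<lambda>j. e * (lap (cbin j) k / fact j * t ^ j)) sums lap (heat_kernel t) k" for k
  proof -
    have "(\<lambda>j. e * (cbin j (k - 1) / fact j * t ^ j) - 2 * (e * (cbin j k / fact j * t ^ j)) + e * (cbin j (k + 1) / fact j * t ^ j))
        sums lap (heat_kernel t) k"
      unfolding lap_def e_def by (intro sums_add sums_diff sums_mult heat_kernel_sums)
    thus ?thesis by (simp add: lap_def algebra_simps add_divide_distrib diff_divide_distrib)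
  qed
  define d where "d j = e * (lap (cbin j) k / fact j * t ^ j) - e * (lap (cbin j) (k + 1) / fact j * t ^ j)" for j
  have d: "d sums (lap (heat_kernel t) k - lap (heat_kernel t) (k + 1))"
    unfolding d_def by (intro sums_diff lap_sums)
  define b where "b j = 3 * (2 * x + 1) * (x\<^sup>2 / t ^ 3 * a (j + 3) + 1 / t\<^sup>2 * a (j + 2))" for j
  have dle: "\<bar>d j\<bar> \<le> b j" for j
  proof -
    define J where "J = real j + 1"
    have J: "1 \<le> J" "2 * real j + 1 = 2 * J - 1" by (auto simp: J_def)
    define c where "c = cbin (Suc j) k"
    define c2 where "c2 = cbin (Suc (Suc j)) k"
    define c3 where "c3 = cbin (Suc (Suc (Suc j))) k"
    have c: "0 \<le> c" "2 * c \<le> c2" "2 * c2 \<le> c3" by (simp_all add: c_def c2_def c3_def cbin_nonneg cbin_Suc_ge)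
    have dj: "d j = e * (t ^ j / fact j) * (lap (cbin j) k - lap (cbin j) (k + 1))"
      by (simp add: d_def algebra_simps diff_divide_distrib)
    have "\<bar>d j\<bar> = e * (t ^ j / fact j) * \<bar>lap (cbin j) k - lap (cbin j) (k + 1)\<bar>"
      unfolding dj using e t by (simp add: abs_mult)
    also have "\<dots> \<le> e * (t ^ j / fact j) * ((2 * x + 1) * c * (2 * x\<^sup>2 / J + 3) / (J * (2 * J - 1)))"
      using cbin_lap_diff[OF k, of j] e t unfolding J(2) unfolding x_def c_def J_def
      by (intro mult_left_mono) auto
    also have "\<dots> = e * (t ^ j / fact j) * ((2 * x + 1) * (2 * x\<^sup>2 * (c / (J * J * (2 * J - 1))) + 3 * (c / (J * (2 * J - 1)))))"
      using J by (simp add: divide_simps) (simp add: algebra_simps)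
    also have "\<dots> \<le> e * (t ^ j / fact j) * ((2 * x + 1) * (2 * x\<^sup>2 * (3 / 2 * (c3 / (J * (J + 1) * (J + 2)))) + 3 * (c2 / (J * (J + 1)))))"
    proof (intro mult_left_mono add_mono)
      have JJ: "0 < J" "0 < 2 * J - 1" using J by auto
      have "c * (J + 1) \<le> c * (2 * (2 * J - 1))" using c J by (intro mult_left_mono) auto
      also have "\<dots> \<le> c2 * (2 * J - 1)" using mult_right_mono[OF c(2), of "2 * J - 1"] JJ by (simp add: algebra_simps)
      finally have "c / (2 * J - 1) \<le> c2 / (J + 1)" using JJ by (simp add: field_simps)
      from divide_right_mono[OF this, of J] JJ show "c / (J * (2 * J - 1)) \<le> c2 / (J * (J + 1))"
        by (simp add: mult.commute)
      have "(J + 1) * (J + 2) \<le> 6 * (J * (2 * J - 1))"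
      proof -
        have "J \<le> J * J" using mult_left_mono[OF J(1), of J] J by simp
        hence "2 + 9 * J \<le> 11 * (J * J)" using J(1) by linarith
        thus ?thesis by (simp add: algebra_simps)
      qed
      hence "c * ((J + 1) * (J + 2)) \<le> c * (6 * (J * (2 * J - 1)))" using c by (intro mult_left_mono) auto
      also have "\<dots> = 4 * c * (3 / 2 * (J * (2 * J - 1)))" by simp
      also have "\<dots> \<le> c3 * (3 / 2 * (J * (2 * J - 1)))" using c JJ by (intro mult_right_mono) auto
      finally have cJ: "c * ((J + 1) * (J + 2)) \<le> c3 * (3 / 2 * (J * (2 * J - 1)))" .
      have "c / (J * (2 * J - 1)) \<le> 3 / 2 * (c3 / ((J + 1) * (J + 2)))"
      proof -
        define P where "P = (J + 1) * (J + 2)"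
        define R where "R = J * (2 * J - 1)"
        have "0 < P" "0 < R" using JJ by (auto simp: P_def R_def)
        thus ?thesis using cJ unfolding P_def[symmetric] R_def[symmetric]
          by (simp add: pos_divide_le_eq pos_le_divide_eq mult_ac)
      qed
      from divide_right_mono[OF this, of J] JJ
      show "c / (J * J * (2 * J - 1)) \<le> 3 / 2 * (c3 / (J * (J + 1) * (J + 2)))" by (simp add: mult_ac)
    qed (use e t x in auto)
    also have "\<dots> = b j"
    proof -
      have f: "fact (j + 3) = (J + 2) * (J + 1) * J * fact j" "fact (j + 2) = (J + 1) * J * fact j"
        by (simp_all add: J_def numeral_3_eq_3 numeral_2_eq_2 algebra_simps)
      have a3: "a (j + 3) = e * (c3 / ((J + 2) * (J + 1) * J * fact j) * (t ^ j * t ^ 3))"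
        "a (j + 2) = e * (c2 / ((J + 1) * J * fact j) * (t ^ j * t\<^sup>2))"
        unfolding a_def f c3_def c2_def by (simp_all add: power_add numeral_3_eq_3 numeral_2_eq_2)
      show ?thesis unfolding b_def a3 using t J(1)
        by (simp add: divide_simps) (simp add: algebra_simps)
    qed
    finally show ?thesis .
  qed
  have s: "(\<lambda>j. 3 * (2 * x + 1) * (x\<^sup>2 / t ^ 3 * a (j + 3) + 1 / t\<^sup>2 * a (j + 2)))
     sums (3 * (2 * x + 1) * (x\<^sup>2 / t ^ 3 * (\<Sum>j. a (j + 3)) + 1 / t\<^sup>2 * (\<Sum>j. a (j + 2))))"
    by (intro sums_mult sums_add summable_sums tail)
  have b: "b sums (3 * (2 * x + 1) * (x\<^sup>2 / t ^ 3 * (\<Sum>j. a (j + 3)) + 1 / t\<^sup>2 * (\<Sum>j. a (j + 2))))"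
    using s unfolding b_def .
  have "\<bar>lap (heat_kernel t) k - lap (heat_kernel t) (k + 1)\<bar> = norm (suminf d)" using d by (simp add: sums_iff)
  also have "\<dots> \<le> suminf b"
    by (rule norm_suminf_le[OF _ sums_summable[OF b]]) (simp add: dle)
  also have "\<dots> = 3 * (2 * x + 1) * (x\<^sup>2 / t ^ 3 * (\<Sum>j. a (j + 3)) + 1 / t\<^sup>2 * (\<Sum>j. a (j + 2)))"
    by (rule sums_unique[OF b, symmetric])
  also have "\<dots> \<le> 3 * (2 * x + 1) * (x\<^sup>2 / t ^ 3 * heat_kernel t k + 1 / t\<^sup>2 * heat_kernel t k)"
    using t x by (intro add_mono mult_left_mono tail(2)) auto
  finally show ?thesis by (simp add: x_def algebra_simps)
qed

text \<open>
The central binomial coefficient is at most \<open>4\<^sup>j / sqrt (2j + 1)\<close>.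
\<close>

lemma cbin_central_le: "(cbin j 0)\<^sup>2 * (2 * real j + 1) \<le> 16 ^ j"
proof (induction j)
  case (Suc j)
  have "cbin j 0 * (2 * (2 * real j + 1)) * (real j + 1) = cbin (Suc j) 0 * (real j + 1) * (real j + 1)"
    using cbin_Suc_ratio(1)[of j 0] by (simp add: power2_eq_square algebra_simps)
  hence e: "cbin (Suc j) 0 * (real j + 1) = cbin j 0 * (2 * (2 * real j + 1))"
    by (simp add: add_nonneg_eq_0_iff)
  have "(cbin (Suc j) 0)\<^sup>2 * (2 * real j + 3) * (real j + 1)\<^sup>2 = (cbin (Suc j) 0 * (real j + 1))\<^sup>2 * (2 * real j + 3)"
    by (simp add: power_mult_distrib)
  also have "\<dots> = ((cbin j 0)\<^sup>2 * (2 * real j + 1)) * (4 * (2 * real j + 1) * (2 * real j + 3))"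
    unfolding e by (simp add: power2_eq_square algebra_simps)
  also have "\<dots> \<le> 16 ^ j * (16 * (real j + 1)\<^sup>2)"
  proof (rule mult_mono[OF Suc])
    show "4 * (2 * real j + 1) * (2 * real j + 3) \<le> 16 * (real j + 1)\<^sup>2"
      by (simp add: power2_eq_square algebra_simps)
  qed auto
  finally have "(cbin (Suc j) 0)\<^sup>2 * (2 * real j + 3) * (real j + 1)\<^sup>2 \<le> 16 ^ Suc j * (real j + 1)\<^sup>2" by simp
  thus ?case by (simp add: mult_le_cancel_right add_nonneg_eq_0_iff add.commute)
qed (simp add: cbin_0)

text \<open>
The kernel is largest at \<open>0\<close>, where it is the Poisson mean of \<open>1 / sqrt (j + 1)\<close> at most. The tangent \<open>1/x \<le> 1/(2y) + y/(2x\<^sup>2)\<close> at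
\<open>y = 2 * sqrt t\<close> replaces this by the mean of \<open>1 / (j + 1)\<close>, which is explicit.
\<close>

lemma heat_kernel_le_sqrt:
  assumes t: "0 < t"
  shows "heat_kernel t k \<le> 1 / (2 * sqrt t)"
proof -
  define y where "y = 2 * sqrt t"
  have y: "0 < y" "y\<^sup>2 = 4 * t" using t by (auto simp: y_def power_mult_distrib)
  define e where "e = exp (- 4 * t)"
  have e: "0 < e" by (simp add: e_def)
  have cb: "cbin j 0 \<le> 4 ^ j * (1 / (2 * y)) + y / 2 * (4 ^ j / (real j + 1))" for j
  proof -
    define x where "x = sqrt (real j + 1)"
    have x: "0 < x" "x\<^sup>2 = real j + 1" by (auto simp: x_def)
    have "(cbin j 0 * x)\<^sup>2 \<le> (cbin j 0)\<^sup>2 * (2 * real j + 1)"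
      unfolding power_mult_distrib x by (intro mult_left_mono) auto
    also have "\<dots> \<le> (4 ^ j)\<^sup>2" using cbin_central_le[of j] by (simp add: power2_eq_square power_mult_distrib[symmetric])
    finally have "cbin j 0 * x \<le> 4 ^ j" by (rule power2_le_imp_le) simp
    hence "cbin j 0 \<le> 4 ^ j * (1 / x)" using x by (simp add: field_simps)
    also have "1 / x \<le> 1 / (2 * y) + y / (2 * x\<^sup>2)"
    proof -
      have "1 / (2 * y) + y / (2 * x\<^sup>2) - 1 / x = (x - y)\<^sup>2 / (2 * y * x\<^sup>2)"
        using x(1) y(1) by (simp add: divide_simps) (simp add: power2_eq_square algebra_simps)
      also have "\<dots> \<ge> 0" using y(1) by simp
      finally show ?thesis by simp
    qed
    finally show ?thesis by (simp add: x(2) algebra_simps)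
  qed
  define u where "u j = e * (4 ^ j / fact j * t ^ j)" for j
  have u: "u sums 1" unfolding u_def e_def by (rule exp4_sums)
  have us: "(\<lambda>j. u (Suc j)) sums (1 - u 0)" using u by (simp add: sums_Suc_iff)
  have s: "(\<lambda>j. 1 / (2 * y) * u j + y / 2 * (1 / (4 * t) * u (Suc j))) sums (1 / (2 * y) * 1 + y / 2 * (1 / (4 * t) * (1 - u 0)))"
    by (intro sums_add sums_mult u us)
  have "heat_kernel t 0 \<le> 1 / (2 * y) * 1 + y / 2 * (1 / (4 * t) * (1 - u 0))"
  proof (rule sums_le[OF _ heat_kernel_sums s])
    fix j
    have "exp (- 4 * t) * (cbin j 0 / fact j * t ^ j) \<le> e * ((4 ^ j * (1 / (2 * y)) + y / 2 * (4 ^ j / (real j + 1))) / fact j * t ^ j)"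
      unfolding e_def using t cb by (intro mult_left_mono mult_right_mono divide_right_mono) auto
    also have "\<dots> = 1 / (2 * y) * u j + y / 2 * (1 / (4 * t) * u (Suc j))"
      using t y by (simp add: u_def divide_simps) (simp add: algebra_simps)
    finally show "exp (- 4 * t) * (cbin j 0 / fact j * t ^ j) \<le> 1 / (2 * y) * u j + y / 2 * (1 / (4 * t) * u (Suc j))" .
  qed
  also have "\<dots> \<le> 1 / (2 * y) + y / 2 * (1 / (4 * t) * 1)"
    using t y e by (intro add_mono mult_left_mono) (auto simp: u_def)
  also have "\<dots> = 1 / y" unfolding y(2)[symmetric] using y(1) by (simp add: power2_eq_square field_simps)
  finally have "heat_kernel t 0 \<le> 1 / (2 * sqrt t)" by (simp add: y_def)
  moreover have "heat_kernel t k \<le> heat_kernel t 0"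
    using heat_kernel_antimono[of t 0 "\<bar>k\<bar>"] t by (simp add: heat_kernel_abs)
  ultimately show ?thesis by simp
qed

text \<open>
Summing the recurrence \<open>i K(i) = t (K(i - 1) - K(i + 1))\<close> over \<open>k/2 < i \<le> k\<close> telescopes on the right, while the left-hand side is at least
a multiple of \<open>k\<^sup>2 K(k)\<close> by monotonicity.
\<close>

lemma heat_kernel_halving:
  assumes t: "0 \<le> t"
  shows "heat_kernel t (int k) \<le> 22 * (t + 1) / (real k + 1)\<^sup>2 * heat_kernel t (int (k div 2))"
proof (cases "k = 0")
  case True
  have "heat_kernel t 0 * 1 \<le> heat_kernel t 0 * (22 * (t + 1))"
    using t heat_kernel_nonneg by (intro mult_left_mono) auto
  thus ?thesis using True by (simp add: mult_ac)
next
  case False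
  define m where "m = k div 2"
  have m: "m < k" "2 * m \<le> k" using False by (auto simp: m_def)
  have tel: "(\<Sum>i\<in>{m<..m + n}. heat_kernel t (int i - 1) - heat_kernel t (int i + 1))
     = heat_kernel t (int m) + heat_kernel t (int m + 1) - heat_kernel t (int (m + n)) - heat_kernel t (int (m + n) + 1)" for n
  proof (induction n)
    case (Suc n)
    have "{m<..m + Suc n} = insert (m + Suc n) {m<..m + n}" by auto
    thus ?case using Suc by (simp add: algebra_simps)
  qed simp
  have mk: "m + (k - m) = k" using m by simp
  have "real (k - m) * (real m + 1) * heat_kernel t (int k) = (\<Sum>i\<in>{m<..k}. (real m + 1) * heat_kernel t (int k))" by simp
  also have "\<dots> \<le> (\<Sum>i\<in>{m<..k}. of_int (int i) * heat_kernel t (int i))"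
    using t by (intro sum_mono mult_mono heat_kernel_antimono heat_kernel_nonneg) auto
  also have "\<dots> = t * (\<Sum>i\<in>{m<..k}. heat_kernel t (int i - 1) - heat_kernel t (int i + 1))"
    unfolding heat_kernel_recurrence sum_distrib_left ..
  also have "\<dots> = t * (heat_kernel t (int m) + heat_kernel t (int m + 1) - heat_kernel t (int k) - heat_kernel t (int k + 1))"
    using tel[of "k - m"] unfolding mk by simp
  also have "\<dots> \<le> t * (2 * heat_kernel t (int m))"
    using t heat_kernel_decreasing[of t "int m"] heat_kernel_nonneg[of t "int k"] heat_kernel_nonneg[of t "int k + 1"]
    by (intro mult_left_mono) auto
  finally have 1: "real (k - m) * (real m + 1) * heat_kernel t (int k) \<le> 2 * t * heat_kernel t (int m)" by simp
  have "real k + 1 \<le> 4 * real (k - m)" "real k + 1 \<le> 2 * (real m + 1)"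
    using m False by (auto simp: m_def of_nat_diff)
  hence "(real k + 1) * (real k + 1) \<le> (4 * real (k - m)) * (2 * (real m + 1))"
    by (intro mult_mono) auto
  hence "(real k + 1)\<^sup>2 \<le> 8 * (real (k - m) * (real m + 1))" by (simp add: power2_eq_square algebra_simps)
  hence "(real k + 1)\<^sup>2 * heat_kernel t (int k) \<le> 8 * (real (k - m) * (real m + 1)) * heat_kernel t (int k)"
    using heat_kernel_nonneg[OF t] by (intro mult_right_mono) auto
  also have "\<dots> \<le> 16 * t * heat_kernel t (int m)" using mult_left_mono[OF 1, of 8] by (simp add: mult_ac)
  also have "\<dots> \<le> 22 * (t + 1) * heat_kernel t (int m)"
    using t heat_kernel_nonneg[OF t] by (intro mult_right_mono) auto
  finally show ?thesis unfolding m_def by (simp add: field_simps add_nonneg_eq_0_iff)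
qed

text \<open>
Each halving of \<open>k\<close> gains a factor \<open>(t + 1) / k\<^sup>2\<close>; after \<open>a\<close> of them \<open>heat_kernel_le\<close> is applied. The factor is \<open>t + 1\<close> and not
\<open>t\<close> because \<open>K\<^sub>t(1)\<close> is of the order of \<open>t\<close> for small \<open>t\<close>, for every \<open>a\<close>.
\<close>

lemma heat_kernel_decay:
  assumes t: "0 \<le> t"
  shows "heat_kernel t (int k) \<le> (176 * (t + 1)) ^ a / (real k + 1) ^ (2 * a + 1) * 2 ^ (a * (a + 1))"
proof (induction a arbitrary: k)
  case 0
  have "heat_kernel t (int k) \<le> 1 / (2 * real k + 1)" using heat_kernel_le[OF t, of "int k"] by simp
  also have "\<dots> \<le> 1 / (real k + 1)" by (intro divide_left_mono) auto
  finally show ?case by simp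
next
  case (Suc a)
  define K where "K = real k + 1"
  have K: "0 < K" by (simp add: K_def)
  define m where "m = k div 2"
  have "k + 1 \<le> 2 * m + 2" unfolding m_def by presburger
  hence "real (k + 1) \<le> real (2 * m + 2)" by (simp only: of_nat_le_iff)
  hence mk: "K / 2 \<le> real m + 1" by (simp add: K_def)
  have "heat_kernel t (int m) \<le> (176 * (t + 1)) ^ a / (real m + 1) ^ (2 * a + 1) * 2 ^ (a * (a + 1))" by (rule Suc)
  also have "\<dots> \<le> (176 * (t + 1)) ^ a / (K / 2) ^ (2 * a + 1) * 2 ^ (a * (a + 1))"
    using mk K t by (intro mult_right_mono divide_left_mono power_mono) auto
  finally have 1: "heat_kernel t (int m) \<le> (176 * (t + 1)) ^ a / (K / 2) ^ (2 * a + 1) * 2 ^ (a * (a + 1))" .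
  have "heat_kernel t (int k) \<le> 22 * (t + 1) / K\<^sup>2 * heat_kernel t (int m)"
    unfolding K_def m_def by (rule heat_kernel_halving[OF t])
  also have "\<dots> \<le> 22 * (t + 1) / K\<^sup>2 * ((176 * (t + 1)) ^ a / (K / 2) ^ (2 * a + 1) * 2 ^ (a * (a + 1)))"
    using 1 t by (intro mult_left_mono) auto
  also have "\<dots> = 22 * (t + 1) * (176 * (t + 1)) ^ a / K ^ (2 * Suc a + 1) * (2 ^ (2 * a + 1) * 2 ^ (a * (a + 1)))"
    using K by (simp add: power_divide power2_eq_square field_simps)
  also have "\<dots> \<le> (176 * (t + 1)) ^ Suc a / K ^ (2 * Suc a + 1) * 2 ^ (Suc a * (Suc a + 1))"
  proof (intro mult_mono divide_right_mono)
    show "22 * (t + 1) * (176 * (t + 1)) ^ a \<le> (176 * (t + 1)) ^ Suc a" using t by (simp add: mult_right_mono)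
    have "2 ^ (2 * a + 1) * 2 ^ (a * (a + 1)) = (2 :: real) ^ (2 * a + 1 + a * (a + 1))" by (simp only: power_add)
    also have "\<dots> \<le> 2 ^ (Suc a * (Suc a + 1))" by (intro power_increasing) auto
    finally show "2 ^ (2 * a + 1) * 2 ^ (a * (a + 1)) \<le> (2 :: real) ^ (Suc a * (Suc a + 1))" .
  qed (use t K in auto)
  finally show ?case unfolding K_def .
qed

text \<open>
For \<open>t \<le> 1\<close> the decay of the kernel itself suffices; for larger \<open>t\<close> the recurrence expresses the difference through \<open>k K\<^sub>t(k) / t\<close>.
\<close>

lemma heat_kernel_grad:
  obtains C where "0 < C" "\<And>t k. 0 \<le> t \<Longrightarrow> 1 \<le> k \<Longrightarrow> \<bar>heat_kernel t k - heat_kernel t (k + 1)\<bar> \<le> C / (of_int k)\<^sup>2"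
proof (rule that[of 1408])
  fix t :: real and k :: int assume t: "0 \<le> t" and k: "1 \<le> k"
  define x where "x = (of_int k :: real)"
  have x: "1 \<le> x" using k by (simp add: x_def)
  have "heat_kernel t k \<le> 704 * (t + 1) / (x + 1) ^ 3"
    using heat_kernel_decay[OF t, of "nat k" 1] k by (simp add: x_def)
  also have "\<dots> \<le> 704 * (t + 1) / x ^ 3"
    using t x by (intro divide_left_mono power_mono) auto
  finally have K: "heat_kernel t k \<le> 704 * (t + 1) / x ^ 3" .
  have nn: "0 \<le> heat_kernel t (k + 1)" "0 \<le> heat_kernel t k" by (rule heat_kernel_nonneg[OF t])+
  have "heat_kernel t k - heat_kernel t (k + 1) \<le> 1408 / x\<^sup>2"
  proof (cases "t \<le> 1")
    case True
    have "heat_kernel t k - heat_kernel t (k + 1) \<le> 704 * (t + 1) / x ^ 3" using K nn by simp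
    also have "\<dots> \<le> 1408 / x\<^sup>2"
      using True x t by (intro frac_le) (auto intro: power_increasing)
    finally show ?thesis .
  next
    case False
    have "heat_kernel t k - heat_kernel t (k + 1) \<le> heat_kernel t (k - 1) - heat_kernel t (k + 1)"
      using heat_kernel_decreasing[of t "k - 1"] t k by simp
    also have "\<dots> = x * heat_kernel t k / t"
      using heat_kernel_recurrence[of k t] False by (simp add: x_def field_simps)
    also have "\<dots> \<le> x * (704 * (2 * t) / x ^ 3) / t"
      using K False x
      by (intro divide_right_mono mult_left_mono order_trans[OF K] divide_right_mono) auto
    also have "\<dots> = 1408 / x\<^sup>2" using False x by (simp add: power3_eq_cube power2_eq_square)
    finally show ?thesis .
  qed
  thus "\<bar>heat_kernel t k - heat_kernel t (k + 1)\<bar> \<le> 1408 / (of_int k)\<^sup>2"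
    using heat_kernel_decreasing[OF t, of k] k by (simp add: x_def)
qed simp

text \<open>
The right-hand sides have the parabolic scaling \<open>t ~ k\<^sup>2\<close> and integrate over \<open>t \<ge> 0\<close> to multiples of \<open>1/k\<^sup>2\<close> and \<open>1/k\<^sup>4\<close>. For \<open>t \<ge> 1\<close> they
follow from the bounds of differences by the kernel, combined with \<open>K\<^sub>t(k) \<le> 1/(2 sqrt t)\<close> for \<open>k\<^sup>2 \<le> t\<close> and with
\<open>heat_kernel_decay\<close> otherwise. For \<open>t \<le> 1\<close>, where dividing by \<open>t\<close> is too costly, the differences are estimated by the values of the kernel.
\<close>

lemma heat_kernel_lap_weighted:
  obtains C where "0 < C"
    "\<And>t k. 0 < t \<Longrightarrow> 1 \<le> k \<Longrightarrow> t * (lap (heat_kernel t) k)\<^sup>2 \<le> C / ((of_int k)\<^sup>2 + t)\<^sup>2"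
    "\<And>t k. 0 < t \<Longrightarrow> 1 \<le> k \<Longrightarrow> t * (lap (heat_kernel t) k - lap (heat_kernel t) (k + 1))\<^sup>2 \<le> C / ((of_int k)\<^sup>2 + t) ^ 3"
proof -
  \<comment> \<open>the constant of \<open>heat_kernel_decay\<close> with \<open>a = 3\<close>, where \<open>t + 1 \<le> 2\<close> or \<open>t + 1 \<le> 2 * t\<close>\<close>
  define A where "A = (176 ^ 3 * 2 ^ 12 * 8 :: real)"
  have A: "0 < A" by (simp add: A_def)
  define C where "C = 81 * (2 ^ 7 * A\<^sup>2 + 32) + 512 * A\<^sup>2"
  have C: "0 < C" using A by (simp add: C_def add_nonneg_pos)
  have main: "t * (lap (heat_kernel t) k)\<^sup>2 \<le> C / ((of_int k)\<^sup>2 + t)\<^sup>2 \<and>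
    t * (lap (heat_kernel t) k - lap (heat_kernel t) (k + 1))\<^sup>2 \<le> C / ((of_int k)\<^sup>2 + t) ^ 3"
    if t: "0 < t" and k: "1 \<le> k" for t k
  proof -
    define x where "x = (of_int k :: real)"
    have x: "1 \<le> x" using k by (simp add: x_def)
    define s where "s = x\<^sup>2 + t"
    have x2: "1 \<le> x\<^sup>2" using x by simp
    have s: "0 < s" using x2 t by (simp add: s_def)
    define L where "L = lap (heat_kernel t) k"
    define L' where "L' = lap (heat_kernel t) k - lap (heat_kernel t) (k + 1)"
    have nn: "0 \<le> heat_kernel t m" for m using t by (intro heat_kernel_nonneg) auto
    have "t * L\<^sup>2 * s\<^sup>2 \<le> C \<and> t * L'\<^sup>2 * s ^ 3 \<le> C"
    proof (cases "t \<le> 1")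
      case True
      have "heat_kernel t (int (nat (k - 1))) \<le> (176 * (t + 1)) ^ 3 / (real (nat (k - 1)) + 1) ^ (2 * 3 + 1) * 2 ^ (3 * (3 + 1))"
        using t by (intro heat_kernel_decay) auto
      hence "heat_kernel t (k - 1) \<le> (176 * (t + 1)) ^ 3 / x ^ 7 * 2 ^ 12" using k by (simp add: x_def)
      also have "\<dots> \<le> (176 * 2) ^ 3 / x ^ 7 * 2 ^ 12"
        using True t x by (intro mult_right_mono divide_right_mono power_mono) auto
      also have "\<dots> = A / x ^ 7" by (simp add: A_def)
      finally have K: "heat_kernel t (k - 1) \<le> A / x ^ 7" .
      have m: "heat_kernel t m \<le> heat_kernel t (k - 1)" if "k - 1 \<le> m" for m
        using that k t by (intro heat_kernel_antimono) auto
      have LL: "\<bar>lap (heat_kernel t) j\<bar> \<le> 4 * heat_kernel t (k - 1)" if "k \<le> j" for j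
        unfolding lap_def using m[of "j - 1"] m[of j] m[of "j + 1"] nn[of "j - 1"] nn[of j] nn[of "j + 1"] that
        by (simp add: abs_le_iff)
      have L: "\<bar>L\<bar> \<le> 8 * (A / x ^ 7)" "\<bar>L'\<bar> \<le> 8 * (A / x ^ 7)"
        using LL[of k] LL[of "k + 1"] K nn[of "k - 1"] by (auto simp: L_def L'_def)
      have "s \<le> 2 * x\<^sup>2" using True x2 by (simp add: s_def)
      hence s23: "s\<^sup>2 \<le> (2 * x\<^sup>2)\<^sup>2" "s ^ 3 \<le> (2 * x\<^sup>2) ^ 3" using s by (simp_all only: power_mono less_imp_le)
      have x14: "x ^ 4 \<le> x ^ 14" "x ^ 6 \<le> x ^ 14" using x by (auto intro: power_increasing)
      have aux: "t * l\<^sup>2 * u \<le> C" if "\<bar>l\<bar> \<le> 8 * (A / x ^ 7)" "u \<le> 8 * x ^ 14" "0 \<le> u" for l u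
      proof -
        have "l\<^sup>2 \<le> (8 * (A / x ^ 7))\<^sup>2" using that(1) A x by (intro power2_le_iff_abs_le[THEN iffD2]) auto
        hence "t * l\<^sup>2 * u \<le> 1 * (8 * (A / x ^ 7))\<^sup>2 * (8 * x ^ 14)"
          using True t that by (intro mult_mono) auto
        also have "\<dots> = 512 * A\<^sup>2" using x by (simp add: power_mult_distrib power_divide power_mult[symmetric])
        also have "\<dots> \<le> C" by (simp add: C_def)
        finally show ?thesis .
      qed
      have "s\<^sup>2 \<le> 4 * x ^ 4" "s ^ 3 \<le> 8 * x ^ 6"
        using s23 by (simp_all add: power_mult_distrib power_mult[symmetric])
      moreover have "0 \<le> x ^ 14" using x by simp
      ultimately have "s\<^sup>2 \<le> 8 * x ^ 14" "s ^ 3 \<le> 8 * x ^ 14"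
        using x14 by linarith+
      thus ?thesis using aux L s by auto
    next
      case False
      hence t1: "1 \<le> t" by simp
      define K where "K = heat_kernel t k"
      have K0: "0 \<le> K" by (simp add: K_def nn)
      have Ks: "K\<^sup>2 * s ^ 7 \<le> (2 ^ 7 * A\<^sup>2 + 32) * t ^ 6"
      proof (cases "x\<^sup>2 \<le> t")
        case True
        have "K\<^sup>2 \<le> (1 / (2 * sqrt t))\<^sup>2"
          using heat_kernel_le_sqrt[OF t, of k] K0 by (intro power_mono) (auto simp: K_def)
        also have "\<dots> = 1 / (4 * t)" using t by (simp add: power_divide power_mult_distrib)
        finally have "K\<^sup>2 * s ^ 7 \<le> 1 / (4 * t) * (2 * t) ^ 7"
          using True s t by (intro mult_mono power_mono) (auto simp: s_def)
        also have "\<dots> = 32 * t ^ 6" using t by (simp add: power_mult_distrib eval_nat_numeral)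
        also have "\<dots> \<le> (2 ^ 7 * A\<^sup>2 + 32) * t ^ 6" using t by (intro mult_right_mono) auto
        finally show ?thesis .
      next
        case False
        have "heat_kernel t (int (nat k)) \<le> (176 * (t + 1)) ^ 3 / (real (nat k) + 1) ^ (2 * 3 + 1) * 2 ^ (3 * (3 + 1))"
          using t by (intro heat_kernel_decay) auto
        hence "K \<le> (176 * (t + 1)) ^ 3 / (x + 1) ^ 7 * 2 ^ 12" using k by (simp add: x_def K_def)
        also have "\<dots> \<le> (176 * (2 * t)) ^ 3 / x ^ 7 * 2 ^ 12"
          using t1 x by (intro mult_right_mono frac_le power_mono) auto
        also have "\<dots> = A * t ^ 3 / x ^ 7" by (simp add: A_def power_mult_distrib)
        finally have "K\<^sup>2 \<le> (A * t ^ 3 / x ^ 7)\<^sup>2" using K0 by (intro power_mono)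
        hence "K\<^sup>2 * s ^ 7 \<le> (A * t ^ 3 / x ^ 7)\<^sup>2 * (2 * x\<^sup>2) ^ 7"
          using False s by (intro mult_mono[OF _ power_mono]) (auto simp: s_def)
        also have "\<dots> = 2 ^ 7 * A\<^sup>2 * t ^ 6" using x by (simp add: power_mult_distrib power_divide power_mult[symmetric])
        also have "\<dots> \<le> (2 ^ 7 * A\<^sup>2 + 32) * t ^ 6" using t by (intro mult_right_mono) auto
        finally show ?thesis .
      qed
      define C0 where "C0 = 2 ^ 7 * A\<^sup>2 + 32"
      have C0: "0 \<le> C0" "81 * C0 \<le> C" by (auto simp: C0_def C_def)
      have ts: "t \<le> s" by (simp add: s_def)
      have K6: "K\<^sup>2 * s ^ 6 \<le> C0 * t ^ 5"
      proof -
        have "(K\<^sup>2 * s ^ 6) * t \<le> (K\<^sup>2 * s ^ 6) * s" using ts s by (intro mult_left_mono) auto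
        also have "\<dots> = K\<^sup>2 * s ^ 7" by (simp add: eval_nat_numeral)
        also have "\<dots> \<le> (C0 * t ^ 5) * t" using Ks by (simp add: C0_def eval_nat_numeral mult_ac)
        finally show ?thesis using t by simp
      qed
      have K4: "K\<^sup>2 * s ^ 4 \<le> C0 * t ^ 3"
      proof -
        have "(K\<^sup>2 * s ^ 4) * t\<^sup>2 \<le> (K\<^sup>2 * s ^ 4) * s\<^sup>2" using ts s t by (intro mult_left_mono power_mono) auto
        also have "\<dots> = K\<^sup>2 * s ^ 6" by (simp add: eval_nat_numeral)
        also have "\<dots> \<le> (C0 * t ^ 3) * t\<^sup>2" using K6 by (simp add: eval_nat_numeral mult_ac)
        finally show ?thesis using t by simp
      qed
      have "\<bar>L\<bar> \<le> (2 * x\<^sup>2 / t\<^sup>2 + 1 / t) * K"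
        unfolding L_def K_def x_def by (rule heat_kernel_lap_le[OF t])
      also have "\<dots> \<le> (2 * s / t\<^sup>2) * K"
      proof (rule mult_right_mono[OF _ K0])
        have "2 * x\<^sup>2 / t\<^sup>2 + 1 / t = (2 * x\<^sup>2 + t) / t\<^sup>2" using t by (simp add: power2_eq_square field_simps)
        also have "\<dots> \<le> 2 * s / t\<^sup>2" using t by (intro divide_right_mono) (auto simp: s_def)
        finally show "2 * x\<^sup>2 / t\<^sup>2 + 1 / t \<le> 2 * s / t\<^sup>2" .
      qed
      finally have "L\<^sup>2 \<le> (2 * s / t\<^sup>2 * K)\<^sup>2"
        using s K0 by (intro power2_le_iff_abs_le[THEN iffD2]) auto
      hence "t * L\<^sup>2 * s\<^sup>2 \<le> t * (2 * s / t\<^sup>2 * K)\<^sup>2 * s\<^sup>2" using t by (intro mult_left_mono mult_right_mono) auto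
      also have "\<dots> = 4 * (K\<^sup>2 * s ^ 4) / t ^ 3"
        using t by (simp add: power_mult_distrib power_divide eval_nat_numeral)
      also have "\<dots> \<le> 4 * (C0 * t ^ 3) / t ^ 3" using K4 t by (intro divide_right_mono) auto
      also have "\<dots> \<le> C" using t C0 by simp
      finally have 1: "t * L\<^sup>2 * s\<^sup>2 \<le> C" .
      have "\<bar>L'\<bar> \<le> 3 * (2 * x + 1) * (x\<^sup>2 / t ^ 3 + 1 / t\<^sup>2) * K"
        unfolding L'_def K_def x_def using k by (intro heat_kernel_lap_diff_le[OF t]) auto
      also have "\<dots> \<le> 3 * (3 * x) * (s / t ^ 3) * K"
      proof (intro mult_right_mono[OF _ K0] mult_mono)
        show "x\<^sup>2 / t ^ 3 + 1 / t\<^sup>2 \<le> s / t ^ 3" using t by (simp add: s_def field_simps eval_nat_numeral)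
      qed (use x t s in auto)
      finally have "L'\<^sup>2 \<le> (3 * (3 * x) * (s / t ^ 3) * K)\<^sup>2"
        using s K0 x t by (intro power2_le_iff_abs_le[THEN iffD2]) auto
      also have "\<dots> = 81 * (x\<^sup>2 * s\<^sup>2 * K\<^sup>2) / t ^ 6"
        by (simp add: power_mult_distrib power_divide power_mult[symmetric])
      also have "\<dots> \<le> 81 * (s * s\<^sup>2 * K\<^sup>2) / t ^ 6"
        using t by (intro divide_right_mono mult_left_mono mult_right_mono) (auto simp: s_def)
      finally have "t * L'\<^sup>2 * s ^ 3 \<le> t * (81 * (s * s\<^sup>2 * K\<^sup>2) / t ^ 6) * s ^ 3"
        using t s by (intro mult_left_mono mult_right_mono) auto
      also have "\<dots> = 81 * (K\<^sup>2 * s ^ 6) / t ^ 5"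
        using t by (simp add: eval_nat_numeral)
      also have "\<dots> \<le> 81 * (C0 * t ^ 5) / t ^ 5" using K6 t by (intro divide_right_mono) auto
      also have "\<dots> \<le> C" using t C0 by simp
      finally show ?thesis using 1 by simp
    qed
    thus ?thesis
      using s unfolding L'_def[symmetric] unfolding L_def[symmetric] x_def[symmetric] s_def[symmetric]
      by (simp add: pos_le_divide_eq)
  qed
  show ?thesis using that[OF C] main by blast
qed

lemma has_sum_finite_sum:
  fixes f :: "'i \<Rightarrow> 'a \<Rightarrow> real"
  assumes "finite I" "\<And>i. i \<in> I \<Longrightarrow> (f i has_sum g i) A"
  shows "((\<lambda>x. \<Sum>i\<in>I. f i x) has_sum (\<Sum>i\<in>I. g i)) A"
  using assms by (induction I rule: finite_induct) (auto intro: has_sum_add)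

text \<open>
By \<open>cbin_vandermonde\<close>, since the sum of two independent Poisson variables with mean \<open>4t\<close> is a Poisson variable with mean \<open>8t\<close>.
\<close>

lemma heat_kernel_semigroup:
  assumes t: "0 \<le> t"
  shows "((\<lambda>n. heat_kernel t (n - a) * heat_kernel t (n - b)) has_sum heat_kernel (2 * t) (a - b)) UNIV"
proof -
  define P where "P j = exp (- 4 * t) / fact j * t ^ j" for j
  have P0: "0 \<le> P j" for j using t by (simp add: P_def)
  have K: "(\<lambda>j. P j * cbin j k) sums heat_kernel t k" for k
    using heat_kernel_sums[of t k] by (simp add: P_def mult_ac)
  have Kn: "summable (\<lambda>j. norm (P j * cbin j k))" for k
    using K[of k] P0 by (simp add: cbin_nonneg sums_iff)
  define R where "R N n = (\<Sum>i\<le>N. (P i * cbin i (n - a)) * (P (N - i) * cbin (N - i) (n - b)))" for N n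
  have R0: "0 \<le> R N n" for N n using P0 by (auto simp: R_def cbin_nonneg intro!: sum_nonneg)
  have R1: "((\<lambda>N. R N n) has_sum (heat_kernel t (n - a) * heat_kernel t (n - b))) UNIV" for n
  proof (rule sums_nonneg_imp_has_sum[OF _ R0])
    show "(\<lambda>N. R N n) sums (heat_kernel t (n - a) * heat_kernel t (n - b))"
      using Cauchy_product_sums[OF Kn Kn, of "n - a" "n - b"] K[of "n - a"] K[of "n - b"]
      by (simp add: R_def sums_iff)
  qed
  define g where "g N = exp (- 4 * (2 * t)) * (cbin N (a - b) / fact N * (2 * t) ^ N)" for N
  have R2: "((\<lambda>n. R N n) has_sum g N) UNIV" for N
  proof -
    have "((\<lambda>n. \<Sum>i\<le>N. P i * P (N - i) * (cbin i (n - a) * cbin (N - i) (n - b)))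
       has_sum (\<Sum>i\<le>N. P i * P (N - i) * cbin (i + (N - i)) (a - b))) UNIV"
      by (intro has_sum_finite_sum has_sum_cmult_right cbin_vandermonde) auto
    also have "(\<lambda>n. \<Sum>i\<le>N. P i * P (N - i) * (cbin i (n - a) * cbin (N - i) (n - b))) = R N"
      by (rule ext) (simp add: R_def mult_ac)
    also have "(\<Sum>i\<le>N. P i * P (N - i) * cbin (i + (N - i)) (a - b)) = (\<Sum>i\<le>N. real (N choose i)) * (exp (- 4 * t) * exp (- 4 * t) * t ^ N / fact N * cbin N (a - b))"
      unfolding sum_distrib_right
    proof (rule sum.cong)
      fix i assume "i \<in> {..N}"
      hence i: "i \<le> N" by simp
      have "t ^ i * t ^ (N - i) = t ^ N" using i by (simp add: power_add[symmetric])
      thus "P i * P (N - i) * cbin (i + (N - i)) (a - b) = real (N choose i) * (exp (- 4 * t) * exp (- 4 * t) * t ^ N / fact N * cbin N (a - b))"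
        using i by (simp add: P_def binomial_fact field_simps)
    qed simp
    also have "(\<Sum>i\<le>N. real (N choose i)) = 2 ^ N"
      using choose_row_sum[of N] by (metis of_nat_numeral of_nat_power of_nat_sum)
    also have "2 ^ N * (exp (- 4 * t) * exp (- 4 * t) * t ^ N / fact N * cbin N (a - b)) = g N"
      by (simp add: g_def exp_add[symmetric] power_mult_distrib)
    finally show ?thesis .
  qed
  have g: "(g has_sum heat_kernel (2 * t) (a - b)) UNIV"
  proof (rule sums_nonneg_imp_has_sum)
    show "g sums heat_kernel (2 * t) (a - b)" unfolding g_def by (rule heat_kernel_sums)
  qed (use t in \<open>simp add: g_def cbin_nonneg\<close>)
  have sm: "(\<lambda>(N, n). R N n) summable_on (UNIV \<times> UNIV)"
    by (rule summable_on_SigmaI[where g = g]) (use R2 g R0 in \<open>auto simp: summable_on_def\<close>)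
  have "((\<lambda>(N, n). R N n) has_sum heat_kernel (2 * t) (a - b)) (UNIV \<times> UNIV)"
    by (rule has_sum_SigmaI[where g = g]) (use R2 g sm in auto)
  hence sw: "((\<lambda>(n, N). R N n) has_sum heat_kernel (2 * t) (a - b)) (UNIV \<times> UNIV)"
    by (subst (asm) has_sum_swap) simp
  show ?thesis
    by (rule has_sum_SigmaD[OF sw]) (use R1 in auto)
qed

section \<open>The semigroups on sequences of moderate growth\<close>

text \<open>
A common domain of the three operators: their kernels are of size \<open>1 / (1 + |k|)\<close>, hence
\<open>weighted_sum f n\<close> controls \<open>T f n\<close>. It contains all the weighted spaces of the theorem.
\<close>

definition admissible :: "(int \<Rightarrow> complex) \<Rightarrow> bool" where
  "admissible f \<longleftrightarrow> (\<lambda>m. norm (f m) / (1 + \<bar>of_int m\<bar>)) summable_on (UNIV :: int set)"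

definition weighted_sum :: "(int \<Rightarrow> complex) \<Rightarrow> int \<Rightarrow> real" where
  "weighted_sum f n = (\<Sum>\<^sub>\<infinity>m. norm (f m) / (1 + \<bar>of_int (n - m)\<bar>))"

lemma admissible_summable:
  assumes "admissible f"
  shows "(\<lambda>m. norm (f m) / (1 + \<bar>of_int (n - m)\<bar>)) summable_on UNIV"
proof -
  have "(\<lambda>m. (1 + \<bar>of_int n\<bar>) * (norm (f m) / (1 + \<bar>of_int m\<bar>))) summable_on (UNIV :: int set)"
    using assms by (intro summable_on_cmult_right) (simp add: admissible_def)
  thus ?thesis
  proof (rule summable_on_comparison_test)
    fix m :: int
    have "1 + \<bar>of_int m\<bar> \<le> (1 + \<bar>of_int n\<bar>) * (1 + \<bar>of_int (n - m)\<bar> :: real)"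
    proof -
      have "\<bar>of_int m\<bar> \<le> \<bar>of_int n\<bar> + \<bar>of_int (n - m) :: real\<bar>" by simp
      moreover have "0 \<le> \<bar>of_int n\<bar> * \<bar>of_int (n - m) :: real\<bar>" by simp
      ultimately show ?thesis by (simp only: distrib_left distrib_right mult_1_left mult_1_right)
    qed
    hence "norm (f m) * (1 + \<bar>of_int m\<bar>) \<le> norm (f m) * ((1 + \<bar>of_int n\<bar>) * (1 + \<bar>of_int (n - m)\<bar>))"
      by (intro mult_left_mono) auto
    moreover have "x / c \<le> a * (x / b)" if "x * b \<le> x * (a * c)" "0 < b" "0 < c" for x a b c :: real
      using that by (simp add: pos_divide_le_eq pos_le_divide_eq mult_ac)
    ultimately show "norm (f m) / (1 + \<bar>of_int (n - m)\<bar>) \<le> (1 + \<bar>of_int n\<bar>) * (norm (f m) / (1 + \<bar>of_int m\<bar>))"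
      by (simp del: of_int_diff)
  qed auto
qed

lemma weighted_sum_nonneg: "0 \<le> weighted_sum f n"
  unfolding weighted_sum_def by (intro infsum_nonneg) auto

lemma admissible_finite:
  assumes "finite {m. f m \<noteq> 0}"
  shows "admissible f"
proof -
  have "((\<lambda>m. norm (f m) / (1 + \<bar>of_int m\<bar>)) summable_on (UNIV :: int set)) \<longleftrightarrow>
    ((\<lambda>m. norm (f m) / (1 + \<bar>of_int m\<bar>)) summable_on {m. f m \<noteq> 0})"
    by (rule summable_on_cong_neutral) auto
  thus ?thesis using assms by (simp add: admissible_def summable_on_finite)
qed

lemma admissible_bound:
  assumes "admissible f" "\<And>m. norm (g m) \<le> norm (f m)"
  shows "admissible g"
  using assms(1) unfolding admissible_def
  by (rule summable_on_comparison_test) (use assms(2) in \<open>auto intro!: divide_right_mono\<close>)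

lemma admissible_scale: "admissible f \<Longrightarrow> admissible (\<lambda>m. a * f m)"
  unfolding admissible_def norm_mult times_divide_eq_right[symmetric] by (rule summable_on_cmult_right)

lemma admissible_add:
  assumes "admissible f" "admissible g"
  shows "admissible (\<lambda>m. f m + g m)"
proof -
  have "(\<lambda>m. norm (f m) / (1 + \<bar>of_int m\<bar>) + norm (g m) / (1 + \<bar>of_int m\<bar>)) summable_on (UNIV :: int set)"
    using assms unfolding admissible_def by (rule summable_on_add)
  thus ?thesis unfolding admissible_def
    by (rule summable_on_comparison_test)
      (auto simp: add_divide_distrib[symmetric] intro!: divide_right_mono norm_triangle_ineq)
qed

lemma filterlim_symmetric_intervals:
  "filterlim (\<lambda>R. {- int R..int R}) (finite_subsets_at_top UNIV) sequentially"
  unfolding filterlim_finite_subsets_at_top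
proof (intro allI impI)
  fix X :: "int set" assume "finite X \<and> X \<subseteq> UNIV"
  hence "finite (abs ` X)" by simp
  then obtain b where b: "\<And>x. x \<in> X \<Longrightarrow> \<bar>x\<bar> \<le> b" by (meson Max_ge imageI)
  have "\<forall>R\<ge>nat b. X \<subseteq> {- int R..int R}"
  proof (intro allI impI subsetI)
    fix R x assume "nat b \<le> R" "x \<in> X"
    thus "x \<in> {- int R..int R}" using b[of x] by auto
  qed
  thus "eventually (\<lambda>R. finite {- int R..int R} \<and> X \<subseteq> {- int R..int R} \<and> {- int R..int R} \<subseteq> UNIV) sequentially"
    unfolding eventually_sequentially by auto
qed

text \<open>
The common domination that gives convergence, continuity in \<open>t\<close> and differentiability of the series.
\<close>

lemma kernel_abs_summable:
  assumes f: "admissible f" and \<phi>: "\<And>k. \<bar>\<phi> k\<bar> \<le> c / (1 + \<bar>of_int k\<bar>)"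
  shows "(\<lambda>m. norm (\<phi> (n - m) *\<^sub>R f m)) summable_on UNIV"
    and "norm (\<Sum>\<^sub>\<infinity>m. \<phi> (n - m) *\<^sub>R f m) \<le> c * weighted_sum f n"
proof -
  have le: "norm (\<phi> (n - m) *\<^sub>R f m) \<le> c * (norm (f m) / (1 + \<bar>of_int (n - m)\<bar>))" for m
    using mult_right_mono[OF \<phi>[of "n - m"], of "norm (f m)"] by simp
  have s: "(\<lambda>m. c * (norm (f m) / (1 + \<bar>of_int (n - m)\<bar>))) summable_on UNIV"
    by (intro summable_on_cmult_right admissible_summable f)
  show a: "(\<lambda>m. norm (\<phi> (n - m) *\<^sub>R f m)) summable_on UNIV"
    using s by (rule summable_on_comparison_test) (use le in auto)
  have "norm (\<Sum>\<^sub>\<infinity>m. \<phi> (n - m) *\<^sub>R f m) \<le> (\<Sum>\<^sub>\<infinity>m. norm (\<phi> (n - m) *\<^sub>R f m))"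
    by (rule norm_infsum_bound[OF a])
  also have "\<dots> \<le> (\<Sum>\<^sub>\<infinity>m. c * (norm (f m) / (1 + \<bar>of_int (n - m)\<bar>)))"
    using a s le by (intro infsum_mono) auto
  also have "\<dots> = c * weighted_sum f n" by (simp only: weighted_sum_def infsum_cmult_right')
  finally show "norm (\<Sum>\<^sub>\<infinity>m. \<phi> (n - m) *\<^sub>R f m) \<le> c * weighted_sum f n" .
qed

lemma heat_kernel_bound:
  assumes "0 \<le> t"
  shows "\<bar>heat_kernel t k\<bar> \<le> 1 / (1 + \<bar>of_int k\<bar>)"
proof -
  have "\<bar>heat_kernel t k\<bar> \<le> 1 / (2 * \<bar>of_int k\<bar> + 1)"
    using heat_kernel_nonneg[OF assms, of k] heat_kernel_le[OF assms, of k] by simp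
  also have "\<dots> \<le> 1 / (1 + \<bar>of_int k\<bar>)" by (intro divide_left_mono) auto
  finally show ?thesis .
qed

lemma lap_heat_kernel_bound:
  assumes "0 \<le> t"
  shows "\<bar>lap (heat_kernel t) k\<bar> \<le> 8 / (1 + \<bar>of_int k\<bar>)"
proof -
  have b: "\<bar>heat_kernel t j\<bar> \<le> 2 / (1 + \<bar>of_int k\<bar>)" if "\<bar>j - k\<bar> \<le> 1" for j
  proof -
    have "\<bar>heat_kernel t j\<bar> \<le> 1 / (1 + \<bar>of_int j\<bar>)" by (rule heat_kernel_bound[OF assms])
    also have "\<dots> \<le> 2 / (1 + \<bar>of_int k\<bar>)"
    proof -
      have "\<bar>k\<bar> \<le> \<bar>j\<bar> + 1" using that by linarith
      hence "of_int \<bar>k\<bar> \<le> (of_int (\<bar>j\<bar> + 1) :: real)" by (simp only: of_int_le_iff)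
      moreover have "1 / (1 + b) \<le> 2 / (1 + a)" if "0 \<le> a" "0 \<le> b" "a \<le> b + 1" for a b :: real
        using that by (simp add: divide_simps)
      ultimately show ?thesis by simp
    qed
    finally show ?thesis .
  qed
  have "\<bar>lap (heat_kernel t) k\<bar> \<le> \<bar>heat_kernel t (k - 1)\<bar> + 2 * \<bar>heat_kernel t k\<bar> + \<bar>heat_kernel t (k + 1)\<bar>"
    unfolding lap_def by linarith
  also have "\<dots> \<le> 2 / (1 + \<bar>of_int k\<bar>) + 2 * (2 / (1 + \<bar>of_int k\<bar>)) + 2 / (1 + \<bar>of_int k\<bar>)"
    by (intro add_mono mult_left_mono b) auto
  finally show ?thesis by simp
qed

lemma heat_abs_summable:
  "admissible f \<Longrightarrow> 0 \<le> t \<Longrightarrow> (\<lambda>m. norm (heat_kernel t (n - m) *\<^sub>R f m)) summable_on UNIV"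
  by (rule kernel_abs_summable(1)[OF _ heat_kernel_bound])

lemma heat_has_sum:
  "admissible f \<Longrightarrow> 0 \<le> t \<Longrightarrow> ((\<lambda>m. heat_kernel t (n - m) *\<^sub>R f m) has_sum heat t f n) UNIV"
  unfolding heat_def by (rule has_sum_infsum[OF abs_summable_summable[OF heat_abs_summable]])

lemma heat_norm_le:
  assumes "admissible f" "0 \<le> t"
  shows "norm (heat t f n) \<le> weighted_sum f n"
  unfolding heat_def using kernel_abs_summable(2)[OF assms(1) heat_kernel_bound[OF assms(2)], of n] by simp

lemma heat_linear:
  assumes "admissible f" "admissible g" "0 \<le> t"
  shows "heat t (\<lambda>m. a * f m + b * g m) n = a * heat t f n + b * heat t g n"
proof -
  have "((\<lambda>m. a * (heat_kernel t (n - m) *\<^sub>R f m) + b * (heat_kernel t (n - m) *\<^sub>R g m)) has_sum (a * heat t f n + b * heat t g n)) UNIV"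
    using assms by (intro has_sum_add has_sum_cmult_right heat_has_sum)
  hence "((\<lambda>m. heat_kernel t (n - m) *\<^sub>R (a * f m + b * g m)) has_sum (a * heat t f n + b * heat t g n)) UNIV"
    by (simp add: scaleR_add_right)
  thus ?thesis unfolding heat_def by (rule infsumI)
qed

lemma continuous_on_heat:
  assumes "admissible f"
  shows "continuous_on {0..} (\<lambda>t. heat t f n)"
proof -
  have ul: "uniform_limit {0..} (\<lambda>X t. \<Sum>m\<in>X. heat_kernel t (n - m) *\<^sub>R f m) (\<lambda>t. heat t f n) (finite_subsets_at_top UNIV)"
    unfolding heat_def
  proof (rule Weierstrass_m_test_general)
    show "(\<lambda>m. norm (f m) / (1 + \<bar>of_int (n - m)\<bar>)) summable_on UNIV" by (rule admissible_summable[OF assms])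
    fix m t assume "t \<in> {0 :: real..}"
    thus "norm (heat_kernel t (n - m) *\<^sub>R f m) \<le> norm (f m) / (1 + \<bar>of_int (n - m)\<bar>)"
      using mult_right_mono[OF heat_kernel_bound[of t "n - m"], of "norm (f m)"] by simp
  qed
  show ?thesis
    by (rule uniform_limit_theorem[OF _ ul])
      (auto intro!: always_eventually continuous_on_sum continuous_on_scaleR heat_kernel_continuous)
qed

text \<open>
The generator applied to the semigroup: \<open>\<Delta> W\<^sub>t f\<close>, with the discrete Laplacian placed on the kernel.
\<close>

definition dheat :: "real \<Rightarrow> (int \<Rightarrow> complex) \<Rightarrow> int \<Rightarrow> complex" where
  "dheat t f n = (\<Sum>\<^sub>\<infinity>m. lap (heat_kernel t) (n - m) *\<^sub>R f m)"

lemma dheat_has_sum: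
  "admissible f \<Longrightarrow> 0 \<le> t \<Longrightarrow> ((\<lambda>m. lap (heat_kernel t) (n - m) *\<^sub>R f m) has_sum dheat t f n) UNIV"
  unfolding dheat_def
  by (rule has_sum_infsum[OF abs_summable_summable[OF kernel_abs_summable(1)[OF _ lap_heat_kernel_bound]]])

lemma dheat_linear:
  assumes "admissible f" "admissible g" "0 \<le> t"
  shows "dheat t (\<lambda>m. a * f m + b * g m) n = a * dheat t f n + b * dheat t g n"
proof -
  have "((\<lambda>m. a * (lap (heat_kernel t) (n - m) *\<^sub>R f m) + b * (lap (heat_kernel t) (n - m) *\<^sub>R g m)) has_sum (a * dheat t f n + b * dheat t g n)) UNIV"
    using assms by (intro has_sum_add has_sum_cmult_right dheat_has_sum)
  hence "((\<lambda>m. lap (heat_kernel t) (n - m) *\<^sub>R (a * f m + b * g m)) has_sum (a * dheat t f n + b * dheat t g n)) UNIV"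
    by (simp add: scaleR_add_right)
  thus ?thesis unfolding dheat_def by (rule infsumI)
qed

lemma lap_heat_kernel_continuous: "continuous_on S (\<lambda>t. lap (heat_kernel t) k)"
  unfolding lap_def by (intro continuous_intros heat_kernel_continuous)

lemma dheat_uniform_limit:
  assumes "admissible f"
  shows "uniform_limit {0..} (\<lambda>X t. \<Sum>m\<in>X. lap (heat_kernel t) (n - m) *\<^sub>R f m) (\<lambda>t. dheat t f n) (finite_subsets_at_top UNIV)"
  unfolding dheat_def
proof (rule Weierstrass_m_test_general)
  show "(\<lambda>m. 8 * (norm (f m) / (1 + \<bar>of_int (n - m)\<bar>))) summable_on UNIV"
    by (intro summable_on_cmult_right admissible_summable[OF assms])
  fix m t assume "t \<in> {0 :: real..}"
  thus "norm (lap (heat_kernel t) (n - m) *\<^sub>R f m) \<le> 8 * (norm (f m) / (1 + \<bar>of_int (n - m)\<bar>))"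
    using mult_right_mono[OF lap_heat_kernel_bound[of t "n - m"], of "norm (f m)"] by simp
qed

lemma continuous_on_dheat:
  assumes "admissible f"
  shows "continuous_on {0..} (\<lambda>t. dheat t f n)"
  by (rule uniform_limit_theorem[OF _ dheat_uniform_limit[OF assms]])
    (auto intro!: always_eventually continuous_on_sum continuous_on_scaleR lap_heat_kernel_continuous)

text \<open>
The series may be differentiated term by term since the series of derivatives converges uniformly.
\<close>

lemma heat_has_vector_derivative:
  assumes f: "admissible f" and t: "0 < t"
  shows "((\<lambda>s. heat s f n) has_vector_derivative dheat t f n) (at t)"
proof -
  define I where "I R = {- int R..int R}" for R
  have I: "filterlim I (finite_subsets_at_top UNIV) sequentially"
    unfolding I_def by (rule filterlim_symmetric_intervals)
  define F where "F R s = (\<Sum>m\<in>I R. heat_kernel s (n - m) *\<^sub>R f m)" for R s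
  define F' where "F' R s = (\<Sum>m\<in>I R. lap (heat_kernel s) (n - m) *\<^sub>R f m)" for R s
  have F_lim: "(\<lambda>R. F R s) \<longlonglongrightarrow> heat s f n" if "0 \<le> s" for s
    using heat_has_sum[OF f that, of n] unfolding has_sum_def F_def by (rule filterlim_compose[OF _ I])
  have ul: "uniform_limit {0..} F' (\<lambda>t. dheat t f n) sequentially"
    using dheat_uniform_limit[OF f, of n] unfolding F'_def[abs_def] uniform_limit_iff
    by (auto intro: eventually_compose_filterlim[OF _ I])
  have "\<exists>g. \<forall>s\<in>{0<..}. (\<lambda>R. F R s) \<longlonglongrightarrow> g s \<and> (g has_derivative (\<lambda>h. h *\<^sub>R dheat s f n)) (at s within {0<..})"
  proof (rule has_derivative_sequence)
    show "t \<in> {0<..}" using t by simp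
    show "(\<lambda>R. F R t) \<longlonglongrightarrow> heat t f n" using t by (intro F_lim) auto
    fix R s assume "s \<in> {0 :: real<..}"
    have "((\<lambda>s. heat_kernel s (n - m) *\<^sub>R f m) has_vector_derivative (lap (heat_kernel s) (n - m) *\<^sub>R f m)) (at s within {0<..})" for m
      using has_vector_derivative_scaleR[OF DERIV_subset[OF heat_kernel_deriv subset_UNIV] has_vector_derivative_const]
      by simp
    hence "(F R has_vector_derivative F' R s) (at s within {0<..})"
      unfolding F_def[abs_def] F'_def by (intro has_vector_derivative_sum)
    thus "(F R has_derivative (\<lambda>h. h *\<^sub>R F' R s)) (at s within {0<..})" by (simp add: has_vector_derivative_def)
  next
    fix e :: real assume "0 < e"
    with ul have "eventually (\<lambda>R. \<forall>s\<in>{0..}. dist (F' R s) (dheat s f n) < e) sequentially" by (rule uniform_limitD)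
    thus "eventually (\<lambda>R. \<forall>s\<in>{0<..}. \<forall>h. norm (h *\<^sub>R F' R s - h *\<^sub>R dheat s f n) \<le> e * norm h) sequentially"
    proof eventually_elim
      case (elim R)
      show ?case
      proof (intro ballI allI)
        fix s h :: real assume "s \<in> {0<..}"
        hence "norm (F' R s - dheat s f n) \<le> e" using elim by (auto simp: dist_norm less_imp_le)
        hence "\<bar>h\<bar> * norm (F' R s - dheat s f n) \<le> \<bar>h\<bar> * e" by (intro mult_left_mono) auto
        thus "norm (h *\<^sub>R F' R s - h *\<^sub>R dheat s f n) \<le> e * norm h"
          by (simp add: scaleR_diff_right[symmetric] mult.commute)
      qed
    qed
  qed auto
  then obtain g where g: "\<And>s. 0 < s \<Longrightarrow> (\<lambda>R. F R s) \<longlonglongrightarrow> g s"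
    "\<And>s. 0 < s \<Longrightarrow> (g has_derivative (\<lambda>h. h *\<^sub>R dheat s f n)) (at s within {0<..})" by auto
  have gh: "g s = heat s f n" if "0 < s" for s
    using g(1)[OF that] F_lim[of s] that by (auto intro: LIMSEQ_unique)
  have "(g has_vector_derivative dheat t f n) (at t within {0<..})"
    using g(2)[OF t] by (simp add: has_vector_derivative_def)
  hence "(g has_vector_derivative dheat t f n) (at t)"
    using t at_within_open[of t "{0<..}"] by simp
  thus ?thesis
    by (rule has_vector_derivative_transform_within_open[of _ _ _ "{0<..}"]) (use t gh in auto)
qed

lemma t_dt_heat_eq:
  assumes "admissible f" "0 < t"
  shows "t_dt_heat t f n = t *\<^sub>R dheat t f n"
  unfolding t_dt_heat_def using heat_has_vector_derivative[OF assms, of n] by (simp add: vector_derivative_at)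

definition gamma_density :: "real \<Rightarrow> real" where
  "gamma_density u = exp (- u) / sqrt u"

text \<open>
\<open>\<Gamma>(1/2) = sqrt \<pi>\<close>: the weights in the subordination formula form a probability density.
\<close>

lemma gamma_density_integral:
  "set_integrable lborel {0<..} gamma_density" "(LINT u:{0<..}|lborel. gamma_density u) = sqrt pi"
proof -
  have "(\<integral>\<^sup>+u. ennreal (indicator {0<..} u *\<^sub>R gamma_density u) \<partial>lborel)
      = (\<integral>\<^sup>+u. ennreal (indicator {0..} u * u powr (1 / 2 - 1) / exp u) \<partial>lborel)"
  proof (rule nn_integral_cong)
    fix u :: real
    show "ennreal (indicator {0<..} u *\<^sub>R gamma_density u) = ennreal (indicator {0..} u * u powr (1 / 2 - 1) / exp u)"
    proof (cases "0 < u")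
      case True
      have "u powr (1 / 2 - 1) = inverse (sqrt u)"
        using True by (simp add: powr_minus powr_half_sqrt)
      thus ?thesis using True by (simp add: gamma_density_def exp_minus field_simps)
    next
      case False
      thus ?thesis by (cases "u = 0") (auto simp: indicator_def)
    qed
  qed
  also have "\<dots> = ennreal (sqrt pi)"
    using Gamma_conv_nn_integral_real[of "1 / 2"] by (simp add: Gamma_one_half_real)
  finally have nn: "(\<integral>\<^sup>+u. ennreal (indicator {0<..} u *\<^sub>R gamma_density u) \<partial>lborel) = ennreal (sqrt pi)" .
  have meas: "(\<lambda>u. indicator {0<..} u *\<^sub>R gamma_density u) \<in> borel_measurable lborel"
    unfolding gamma_density_def by measurable
  have nonneg: "0 \<le> indicator {0<..} u *\<^sub>R gamma_density u" for u
    by (simp add: gamma_density_def indicator_def)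
  show "set_integrable lborel {0<..} gamma_density"
    unfolding set_integrable_def
    by (rule integrableI_nonneg[OF meas]) (use nonneg nn in auto)
  show "(LINT u:{0<..}|lborel. gamma_density u) = sqrt pi"
    unfolding set_lebesgue_integral_def
    by (subst integral_eq_nn_integral[OF meas]) (use nonneg nn in auto)
qed

lemma poisson_integrand:
  assumes f: "admissible f"
  shows "set_integrable lborel {0<..} (\<lambda>u. (exp (- u) / sqrt u) *\<^sub>R heat (t\<^sup>2 / (4 * u)) f n)"
proof (rule set_integrable_bound[of lborel "{0<..}" "\<lambda>u. weighted_sum f n * gamma_density u"])
  show "set_integrable lborel {0<..} (\<lambda>u. weighted_sum f n * gamma_density u)"
    using gamma_density_integral(1) by (intro set_integrable_mult_right)
  have cont: "continuous_on {0<..} (\<lambda>u. (exp (- u) / sqrt u) *\<^sub>R heat (t\<^sup>2 / (4 * u)) f n)"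
    by (intro continuous_intros continuous_on_compose2[OF continuous_on_heat[OF f, of n]]) auto
  show "set_borel_measurable lborel {0<..} (\<lambda>u. (exp (- u) / sqrt u) *\<^sub>R heat (t\<^sup>2 / (4 * u)) f n)"
    unfolding set_borel_measurable_def measurable_lborel2
    by (rule borel_measurable_continuous_on_indicator[OF _ cont]) simp
  show "AE u in lborel. u \<in> {0<..} \<longrightarrow> norm ((exp (- u) / sqrt u) *\<^sub>R heat (t\<^sup>2 / (4 * u)) f n) \<le> norm (weighted_sum f n * gamma_density u)"
  proof (intro AE_I2 impI)
    fix u :: real assume u: "u \<in> {0<..}"
    have "gamma_density u * norm (heat (t\<^sup>2 / (4 * u)) f n) \<le> gamma_density u * weighted_sum f n"
      using u by (intro mult_left_mono heat_norm_le f) (auto simp: gamma_density_def)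
    thus "norm ((exp (- u) / sqrt u) *\<^sub>R heat (t\<^sup>2 / (4 * u)) f n) \<le> norm (weighted_sum f n * gamma_density u)"
      using u weighted_sum_nonneg[of f n] by (simp add: gamma_density_def mult_ac)
  qed
qed

lemma poisson_norm_le:
  assumes f: "admissible f" and B: "\<And>s. 0 \<le> s \<Longrightarrow> norm (heat s f n) \<le> B"
  shows "norm (poisson t f n) \<le> B"
proof -
  have B0: "0 \<le> B" using B[of 0] by (meson norm_ge_zero order_trans order_refl)
  have "norm (LINT u:{0<..}|lborel. (exp (- u) / sqrt u) *\<^sub>R heat (t\<^sup>2 / (4 * u)) f n)
     \<le> (LINT u:{0<..}|lborel. norm ((exp (- u) / sqrt u) *\<^sub>R heat (t\<^sup>2 / (4 * u)) f n))"
    by (rule set_integral_norm_bound[OF poisson_integrand[OF f]])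
  also have "\<dots> \<le> (LINT u:{0<..}|lborel. B * gamma_density u)"
  proof (rule set_integral_mono)
    show "set_integrable lborel {0<..} (\<lambda>u. norm ((exp (- u) / sqrt u) *\<^sub>R heat (t\<^sup>2 / (4 * u)) f n))"
      using poisson_integrand[OF f] by (rule set_integrable_norm)
    show "set_integrable lborel {0<..} (\<lambda>u. B * gamma_density u)"
      using gamma_density_integral(1) by (intro set_integrable_mult_right)
    fix u :: real assume u: "u \<in> {0<..}"
    have "gamma_density u * norm (heat (t\<^sup>2 / (4 * u)) f n) \<le> gamma_density u * B"
      using u by (intro mult_left_mono B) (auto simp: gamma_density_def)
    thus "norm ((exp (- u) / sqrt u) *\<^sub>R heat (t\<^sup>2 / (4 * u)) f n) \<le> B * gamma_density u"
      using u by (simp add: gamma_density_def mult_ac)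
  qed
  also have "\<dots> = B * sqrt pi" by (simp add: gamma_density_integral(2))
  finally show ?thesis by (simp add: poisson_def field_simps)
qed

lemma poisson_linear:
  assumes "admissible f" "admissible g"
  shows "poisson t (\<lambda>m. a * f m + b * g m) n = a * poisson t f n + b * poisson t g n"
proof -
  define F where "F h u = (exp (- u) / sqrt u) *\<^sub>R heat (t\<^sup>2 / (4 * u)) h n" for h u
  have int: "set_integrable lborel {0<..} (F f)" "set_integrable lborel {0<..} (F g)"
    unfolding F_def by (intro poisson_integrand assms)+
  have "(LINT u:{0<..}|lborel. F (\<lambda>m. a * f m + b * g m) u) = (LINT u:{0<..}|lborel. a * F f u + b * F g u)"
    by (rule set_lebesgue_integral_cong) (auto simp: F_def heat_linear[OF assms] scaleR_add_right)
  also have "\<dots> = a * (LINT u:{0<..}|lborel. F f u) + b * (LINT u:{0<..}|lborel. F g u)"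
    using int by (subst set_integral_add) auto
  finally show ?thesis by (simp add: poisson_def F_def scaleR_add_right)
qed

lemma semigroups_defined_admissible:
  assumes f: "admissible f"
  shows "semigroups_defined f"
  unfolding semigroups_defined_def
proof (intro allI conjI impI)
  fix n :: int and t :: real
  show "(\<lambda>m. heat_kernel t (n - m) *\<^sub>R f m) summable_on UNIV" if "0 \<le> t"
    using that by (rule abs_summable_summable[OF heat_abs_summable[OF f]])
  show "(\<lambda>s. heat s f n) differentiable (at t)" if "0 < t"
    using heat_has_vector_derivative[OF f that, of n] unfolding has_vector_derivative_def differentiable_def by blast
  show "set_integrable lborel {0<..} (\<lambda>u. (exp (- u) / sqrt u) *\<^sub>R heat (t\<^sup>2 / (4 * u)) f n)"
    by (rule poisson_integrand[OF f])
qed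

lemma heat_Linf: "admissible f \<Longrightarrow> (\<lambda>t. heat t f n) \<in> Linf"
  unfolding Linf_def bounded_iff using heat_norm_le by fastforce

lemma poisson_Linf:
  assumes "admissible f"
  shows "(\<lambda>t. poisson t f n) \<in> Linf"
  unfolding Linf_def bounded_iff using poisson_norm_le[OF assms heat_norm_le[OF assms]] by fastforce

section \<open>The Banach spaces of functions of time\<close>

lemma fscale_vector_space: "vector_space fscale"
  by unfold_locales (auto simp: fscale_def fun_eq_iff algebra_simps)

lemma Linf_iff: "\<phi> \<in> Linf \<longleftrightarrow> (\<exists>B. \<forall>t\<ge>0. norm (\<phi> t) \<le> B)"
  by (auto simp: Linf_def bounded_iff)

lemma Linf_E:
  assumes "\<phi> \<in> Linf"
  obtains B where "\<forall>t\<ge>0. norm (\<phi> t) \<le> B"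
  using assms unfolding Linf_iff by blast

lemma Linf_norm_ge:
  assumes "\<phi> \<in> Linf" "0 \<le> t"
  shows "norm (\<phi> t) \<le> Linf_norm \<phi>"
proof -
  obtain B where "\<forall>t\<ge>0. norm (\<phi> t) \<le> B" using assms(1) by (rule Linf_E)
  hence "bdd_above ((\<lambda>t. norm (\<phi> t)) ` {0..})" by (intro bdd_aboveI[of _ B]) auto
  thus ?thesis unfolding Linf_norm_def using assms(2) by (intro cSUP_upper) auto
qed

lemma Linf_norm_le: "(\<And>t. 0 \<le> t \<Longrightarrow> norm (\<phi> t) \<le> B) \<Longrightarrow> Linf_norm \<phi> \<le> B"
  unfolding Linf_norm_def by (intro cSUP_least) auto

lemma complex_banach_Linf: "complex_banach fscale Linf Linf_norm"
proof (intro complex_banach.intro fscale_vector_space complex_banach_axioms.intro)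
  interpret vector_space fscale by (rule fscale_vector_space)
  have add: "(\<lambda>t. x t + y t) \<in> Linf \<and> Linf_norm (\<lambda>t. x t + y t) \<le> Linf_norm x + Linf_norm y" if "x \<in> Linf" "y \<in> Linf" for x y
  proof -
    have "norm (x t + y t) \<le> Linf_norm x + Linf_norm y" if "0 \<le> t" for t
      using norm_triangle_ineq[of "x t" "y t"] Linf_norm_ge[OF \<open>x \<in> Linf\<close> that] Linf_norm_ge[OF \<open>y \<in> Linf\<close> that] by linarith
    thus ?thesis by (auto simp: Linf_iff intro: Linf_norm_le)
  qed
  have nonneg: "0 \<le> Linf_norm x" if "x \<in> Linf" for x
    using Linf_norm_ge[OF that, of 0] by (meson norm_ge_zero order_trans order_refl)
  have le: "Linf_norm (fscale c x) \<le> norm c * Linf_norm x" if "x \<in> Linf" for c x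
    using Linf_norm_ge[OF that] by (intro Linf_norm_le) (auto simp: fscale_def norm_mult intro: mult_left_mono)
  have sc: "fscale c x \<in> Linf" if x: "x \<in> Linf" for c x
  proof -
    obtain B where "\<forall>t\<ge>0. norm (x t) \<le> B" using x by (rule Linf_E)
    hence "norm (fscale c x t) \<le> norm c * B" if "0 \<le> t" for t
      using that by (simp add: fscale_def norm_mult mult_left_mono)
    thus ?thesis by (auto simp: Linf_iff)
  qed
  show "subspace Linf"
    using add sc by (auto simp: subspace_def plus_fun_def) (auto simp: Linf_iff)
  fix x y assume x: "x \<in> Linf"
  show "0 \<le> Linf_norm x" by (rule nonneg[OF x])
  show "Linf_norm (x + y) \<le> Linf_norm x + Linf_norm y" if "y \<in> Linf" using add[OF x that] by (simp add: plus_fun_def)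
  show "Linf_norm (fscale c x) = cmod c * Linf_norm x" for c
  proof (cases "c = 0")
    case True
    thus ?thesis using le[OF x, of c] nonneg[OF sc[OF x, of c]] by simp
  next
    case False
    have "fscale (inverse c) (fscale c x) = x" using False by (simp add: fscale_def fun_eq_iff)
    hence "Linf_norm x \<le> norm (inverse c) * Linf_norm (fscale c x)" using le[OF sc[OF x, of c], of "inverse c"] by simp
    hence "norm c * Linf_norm x \<le> norm c * (norm (inverse c) * Linf_norm (fscale c x))" by (rule mult_left_mono) simp
    also have "\<dots> = Linf_norm (fscale c x)" using False by (simp add: norm_inverse mult.assoc[symmetric])
    finally have "norm c * Linf_norm x \<le> Linf_norm (fscale c x)" .
    with le[OF x, of c] show ?thesis by simp
  qed
next
  fix X :: "nat \<Rightarrow> real \<Rightarrow> complex"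
  assume X: "\<And>k. X k \<in> Linf" and C: "\<And>e. e > 0 \<Longrightarrow> \<exists>k0::nat. \<forall>i\<ge>k0. \<forall>j\<ge>k0. Linf_norm (X i - X j) < e"
  have d: "norm (X i t - X j t) \<le> Linf_norm (X i - X j)" if "0 \<le> t" for i j t
  proof -
    obtain Bi where Bi: "\<forall>t\<ge>0. norm (X i t) \<le> Bi" using X[of i] by (rule Linf_E)
    obtain Bj where Bj: "\<forall>t\<ge>0. norm (X j t) \<le> Bj" using X[of j] by (rule Linf_E)
    have "norm ((X i - X j) t) \<le> Bi + Bj" if "0 \<le> t" for t
      using Bi[rule_format, OF that] Bj[rule_format, OF that] norm_triangle_ineq4[of "X i t" "X j t"] by simp
    hence "X i - X j \<in> Linf" by (auto simp: Linf_iff)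
    from Linf_norm_ge[OF this that] show ?thesis by simp
  qed
  define x where "x t = (if 0 \<le> t then lim (\<lambda>i. X i t) else 0)" for t
  have lim: "(\<lambda>i. X i t) \<longlonglongrightarrow> x t" if t: "0 \<le> t" for t
  proof -
    have "Cauchy (\<lambda>i. X i t)"
    proof (rule metric_CauchyI)
      fix e :: real assume "e > 0"
      from C[OF this] obtain k0 where "\<And>i j. k0 \<le> i \<Longrightarrow> k0 \<le> j \<Longrightarrow> Linf_norm (X i - X j) < e" by blast
      thus "\<exists>M. \<forall>m\<ge>M. \<forall>n\<ge>M. dist (X m t) (X n t) < e"
        unfolding dist_norm using d[OF t] by (meson le_less_trans)
    qed
    thus ?thesis using t by (simp add: x_def Cauchy_convergent_iff convergent_LIMSEQ_iff)
  qed
  have close: "\<exists>k0. \<forall>i\<ge>k0. \<forall>t\<ge>0. norm (X i t - x t) \<le> e" if "e > 0" for e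
  proof -
    from C[OF that] obtain k0 where k0: "\<And>i j. k0 \<le> i \<Longrightarrow> k0 \<le> j \<Longrightarrow> Linf_norm (X i - X j) < e" by blast
    have "norm (X i t - x t) \<le> e" if "k0 \<le> i" "0 \<le> t" for i t
    proof (rule LIMSEQ_le_const2)
      show "(\<lambda>j. norm (X i t - X j t)) \<longlonglongrightarrow> norm (X i t - x t)" by (intro tendsto_intros lim that)
      show "\<exists>N. \<forall>j\<ge>N. norm (X i t - X j t) \<le> e" using k0[OF that(1)] d[OF that(2), of i] by (meson less_imp_le order_trans)
    qed
    thus ?thesis by blast
  qed
  show "\<exists>x\<in>Linf. (\<lambda>k. Linf_norm (X k - x)) \<longlonglongrightarrow> 0"
  proof (rule bexI[of _ x])
    show "x \<in> Linf"
    proof -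
      obtain k0 where k0: "\<And>t. 0 \<le> t \<Longrightarrow> norm (X k0 t - x t) \<le> 1" using close[of 1] by auto
      obtain B where B: "\<forall>t\<ge>0. norm (X k0 t) \<le> B" using X[of k0] by (rule Linf_E)
      have "norm (x t) \<le> B + 1" if "0 \<le> t" for t
        using norm_triangle_ineq4[of "X k0 t" "X k0 t - x t"] k0[OF that] B[rule_format, OF that] by simp
      thus ?thesis by (auto simp: Linf_iff)
    qed
    show "(\<lambda>k. Linf_norm (X k - x)) \<longlonglongrightarrow> 0"
    proof (rule LIMSEQ_I)
      fix r :: real assume r: "0 < r"
      obtain k0 where k0: "\<And>i t. k0 \<le> i \<Longrightarrow> 0 \<le> t \<Longrightarrow> norm (X i t - x t) \<le> r / 2" using close[of "r / 2"] r by auto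
      have "norm (Linf_norm (X i - x) - 0) < r" if "k0 \<le> i" for i
      proof -
        have "Linf_norm (X i - x) \<le> r / 2" using k0[OF that] by (intro Linf_norm_le) auto
        moreover have "X i - x \<in> Linf" using k0[OF that] by (auto simp: Linf_iff intro!: exI[of _ "r / 2"])
        hence "0 \<le> Linf_norm (X i - x)" using Linf_norm_ge[of "X i - x" 0] by (meson norm_ge_zero order_trans order_refl)
        ultimately show ?thesis using r by simp
      qed
      thus "\<exists>no. \<forall>n\<ge>no. norm (Linf_norm (X n - x) - 0) < r" by blast
    qed
  qed
qed

lemma L2_norm_nonneg: "0 \<le> L2_norm \<phi>"
  by (simp add: L2_norm_def)

lemma L2_nn_integral:
  assumes "\<phi> \<in> L2"
  shows "(\<integral>\<^sup>+t. ennreal ((norm (\<phi> t))\<^sup>2) \<partial>dt_over_t) = ennreal ((L2_norm \<phi>)\<^sup>2)"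
  using assms by (subst nn_integral_eq_integral) (auto simp: L2_def L2_norm_def)

lemma L2_I:
  assumes "\<phi> \<in> borel_measurable dt_over_t" "(\<integral>\<^sup>+t. ennreal ((norm (\<phi> t))\<^sup>2) \<partial>dt_over_t) \<le> ennreal (B\<^sup>2)" "0 \<le> B"
  shows "\<phi> \<in> L2" "L2_norm \<phi> \<le> B"
proof -
  show L: "\<phi> \<in> L2"
    unfolding L2_def using assms(1,2)
    by (auto intro!: integrableI_nonneg order_le_less_trans[OF assms(2)])
  have "ennreal ((L2_norm \<phi>)\<^sup>2) \<le> ennreal (B\<^sup>2)" using assms(2) L2_nn_integral[OF L] by simp
  hence "(L2_norm \<phi>)\<^sup>2 \<le> B\<^sup>2" by simp
  thus "L2_norm \<phi> \<le> B" using assms(3) by (rule power2_le_imp_le)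
qed

lemma L2_add:
  assumes x: "x \<in> L2" and y: "y \<in> L2"
  shows "(\<lambda>t. x t + y t) \<in> L2" "L2_norm (\<lambda>t. x t + y t) \<le> L2_norm x + L2_norm y"
proof -
  have [measurable]: "x \<in> borel_measurable dt_over_t" "y \<in> borel_measurable dt_over_t" using x y by (auto simp: L2_def)
  define a where "a = L2_norm x"
  define b where "b = L2_norm y"
  have ab: "0 \<le> a" "0 \<le> b" by (auto simp: a_def b_def L2_norm_nonneg)
  have main: "(\<lambda>t. x t + y t) \<in> L2 \<and> L2_norm (\<lambda>t. x t + y t) \<le> (a + e) + (b + e)" if e: "0 < e" for e
  proof -
    define s where "s = (b + e) / (a + e)"
    have s: "0 < s" using ab e by (simp add: s_def)
    \<comment> \<open>the weighted inequality \<open>(u + v)\<^sup>2 \<le> (1 + s) u\<^sup>2 + (1 + 1/s) v\<^sup>2\<close> with the optimal \<open>s\<close>\<close>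
    have pt: "(norm (x t + y t))\<^sup>2 \<le> (1 + s) * (norm (x t))\<^sup>2 + (1 + 1 / s) * (norm (y t))\<^sup>2" for t
    proof -
      define u where "u = norm (x t)"
      define v where "v = norm (y t)"
      have "(norm (x t + y t))\<^sup>2 \<le> (u + v)\<^sup>2" unfolding u_def v_def by (intro power_mono norm_triangle_ineq) auto
      also have "\<dots> \<le> (1 + s) * u\<^sup>2 + (1 + 1 / s) * v\<^sup>2"
      proof -
        have "0 \<le> (s * u - v)\<^sup>2 / s" using s by simp
        also have "\<dots> = (1 + s) * u\<^sup>2 + (1 + 1 / s) * v\<^sup>2 - (u + v)\<^sup>2"
          using s by (simp add: field_simps power2_eq_square)
        finally show ?thesis by simp
      qed
      finally show ?thesis by (simp add: u_def v_def)
    qed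
    have "(\<integral>\<^sup>+t. ennreal ((norm (x t + y t))\<^sup>2) \<partial>dt_over_t)
        \<le> (\<integral>\<^sup>+t. ennreal (1 + s) * ennreal ((norm (x t))\<^sup>2) + ennreal (1 + 1 / s) * ennreal ((norm (y t))\<^sup>2) \<partial>dt_over_t)"
      using pt s by (intro nn_integral_mono) (auto simp: ennreal_mult[symmetric] ennreal_plus[symmetric] simp del: ennreal_plus)
    also have "\<dots> = ennreal (1 + s) * ennreal (a\<^sup>2) + ennreal (1 + 1 / s) * ennreal (b\<^sup>2)"
      using L2_nn_integral[OF x] L2_nn_integral[OF y]
      by (subst nn_integral_add) (auto simp: nn_integral_cmult a_def b_def)
    also have "\<dots> = ennreal ((1 + s) * a\<^sup>2 + (1 + 1 / s) * b\<^sup>2)"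
      using s by (simp add: ennreal_mult[symmetric] ennreal_plus[symmetric] del: ennreal_plus)
    also have "\<dots> \<le> ennreal (((a + e) + (b + e))\<^sup>2)"
    proof (rule ennreal_leI)
      have "(1 + s) * a\<^sup>2 + (1 + 1 / s) * b\<^sup>2 \<le> (1 + s) * (a + e)\<^sup>2 + (1 + 1 / s) * (b + e)\<^sup>2"
        using s ab e by (intro add_mono mult_left_mono power_mono) auto
      also have "\<dots> = ((a + e) + (b + e))\<^sup>2"
      proof -
        have "0 < a + e" "0 < b + e" using ab e by auto
        thus ?thesis unfolding s_def by (simp add: divide_simps) (simp add: power2_eq_square algebra_simps)
      qed
      finally show "(1 + s) * a\<^sup>2 + (1 + 1 / s) * b\<^sup>2 \<le> ((a + e) + (b + e))\<^sup>2" .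
    qed
    finally show ?thesis using ab e L2_I[of "\<lambda>t. x t + y t" "(a + e) + (b + e)"] by auto
  qed
  show "(\<lambda>t. x t + y t) \<in> L2" using main[of 1] by simp
  show "L2_norm (\<lambda>t. x t + y t) \<le> L2_norm x + L2_norm y"
  proof (rule field_le_epsilon)
    fix e :: real assume "0 < e"
    thus "L2_norm (\<lambda>t. x t + y t) \<le> L2_norm x + L2_norm y + e" using main[of "e / 2"] by (simp add: a_def b_def)
  qed
qed

lemma L2_scale:
  assumes "x \<in> L2"
  shows "(\<lambda>t. c * x t) \<in> L2" "L2_norm (\<lambda>t. c * x t) = norm c * L2_norm x"
  using assms by (auto simp: L2_def L2_norm_def norm_mult power_mult_distrib real_sqrt_mult)

lemma L2_diff:
  assumes "x \<in> L2" "y \<in> L2"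
  shows "(\<lambda>t. x t - y t) \<in> L2"
  using L2_add(1)[OF assms(1) L2_scale(1)[OF assms(2), of "-1"]] by simp

text \<open>
Bounds in \<open>L\<^sup>2\<close> pass to pointwise limits. This yields completeness, and the bound of the square function of a general sequence from those of its truncations.
\<close>

lemma L2_Fatou:
  assumes Z: "\<And>i::nat. Z i \<in> L2" "eventually (\<lambda>i. L2_norm (Z i) \<le> B) sequentially" and B: "0 \<le> B"
    and z: "z \<in> borel_measurable dt_over_t" and lim: "AE t in dt_over_t. (\<lambda>i. Z i t) \<longlonglongrightarrow> z t"
  shows "z \<in> L2" "L2_norm z \<le> B"
proof -
  have [measurable]: "Z i \<in> borel_measurable dt_over_t" for i using Z(1)[of i] by (simp add: L2_def)
  have "(\<integral>\<^sup>+t. ennreal ((norm (z t))\<^sup>2) \<partial>dt_over_t) = (\<integral>\<^sup>+t. liminf (\<lambda>i. ennreal ((norm (Z i t))\<^sup>2)) \<partial>dt_over_t)"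
  proof (rule nn_integral_cong_AE)
    show "AE t in dt_over_t. ennreal ((norm (z t))\<^sup>2) = liminf (\<lambda>i. ennreal ((norm (Z i t))\<^sup>2))"
      using lim
    proof eventually_elim
      case (elim t)
      have "(\<lambda>i. ennreal ((norm (Z i t))\<^sup>2)) \<longlonglongrightarrow> ennreal ((norm (z t))\<^sup>2)"
        by (intro tendsto_ennrealI tendsto_intros elim)
      thus ?case by (rule lim_imp_Liminf[OF trivial_limit_sequentially, symmetric])
    qed
  qed
  also have "\<dots> \<le> liminf (\<lambda>i. \<integral>\<^sup>+t. ennreal ((norm (Z i t))\<^sup>2) \<partial>dt_over_t)"
    by (rule nn_integral_liminf) simp
  also have "\<dots> \<le> liminf (\<lambda>i. ennreal (B\<^sup>2))"
  proof (rule Liminf_mono)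
    show "eventually (\<lambda>i. (\<integral>\<^sup>+t. ennreal ((norm (Z i t))\<^sup>2) \<partial>dt_over_t) \<le> ennreal (B\<^sup>2)) sequentially"
      using Z(2) by eventually_elim (auto simp: L2_nn_integral[OF Z(1)] L2_norm_nonneg intro!: ennreal_leI power_mono)
  qed
  also have "\<dots> = ennreal (B\<^sup>2)" by (simp add: Liminf_const)
  finally show "z \<in> L2" "L2_norm z \<le> B" using z B by (auto intro: L2_I)
qed

text \<open>
The Riesz--Fischer argument: a subsequence with summable increments converges almost everywhere, and Fatou's lemma shows that the limit is also one in norm.
\<close>

lemma complex_banach_L2: "complex_banach fscale L2 L2_norm"
proof (intro complex_banach.intro fscale_vector_space complex_banach_axioms.intro)
  interpret vector_space fscale by (rule fscale_vector_space)
  have zero: "(\<lambda>_. 0) \<in> L2" by (simp add: L2_def)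
  show "subspace L2"
    using L2_add(1) L2_scale(1) zero by (auto simp: subspace_def plus_fun_def zero_fun_def fscale_def)
  fix x y c assume x: "x \<in> L2"
  show "0 \<le> L2_norm x" by (rule L2_norm_nonneg)
  show "L2_norm (x + y) \<le> L2_norm x + L2_norm y" if "y \<in> L2" using L2_add(2)[OF x that] by (simp add: plus_fun_def)
  show "L2_norm (fscale c x) = cmod c * L2_norm x" using L2_scale(2)[OF x] by (simp add: fscale_def)
next
  fix X :: "nat \<Rightarrow> real \<Rightarrow> complex"
  assume X: "\<And>k. X k \<in> L2" and C: "\<And>e. e > 0 \<Longrightarrow> \<exists>k0::nat. \<forall>i\<ge>k0. \<forall>j\<ge>k0. L2_norm (X i - X j) < e"
  have Xm [measurable]: "X i \<in> borel_measurable dt_over_t" for i using X[of i] by (simp add: L2_def)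
  have diff: "X i - X j = (\<lambda>t. X i t - X j t)" for i j by auto
  have "\<forall>n. \<exists>k0. \<forall>i\<ge>k0. \<forall>j\<ge>k0. L2_norm (X i - X j) < (1 / 2) ^ n" using C by simp
  then obtain K where K: "\<And>n i j. K n \<le> i \<Longrightarrow> K n \<le> j \<Longrightarrow> L2_norm (X i - X j) < (1 / 2) ^ n" by metis
  define r where "r n = n + (\<Sum>i\<le>n. K i)" for n
  have rK: "K n \<le> r m" if "n \<le> m" for n m
  proof -
    have "K n \<le> (\<Sum>i\<le>m. K i)" using that by (intro member_le_sum) auto
    thus ?thesis by (simp add: r_def)
  qed
  define Y where "Y n = X (r n)" for n
  have Y: "Y n \<in> L2" for n by (simp add: Y_def X)
  have Ym [measurable]: "Y n \<in> borel_measurable dt_over_t" for n by (simp add: Y_def)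
  define D where "D n t = complex_of_real (norm (Y (Suc n) t - Y n t))" for n t
  have D: "D n \<in> L2" "L2_norm (D n) \<le> (1 / 2) ^ n" for n
  proof -
    have "(\<lambda>t. Y (Suc n) t - Y n t) \<in> L2" by (intro L2_diff Y)
    hence "D n \<in> L2" "L2_norm (D n) = L2_norm (X (r (Suc n)) - X (r n))"
      unfolding D_def by (auto simp: L2_def L2_norm_def Y_def)
    thus "D n \<in> L2" "L2_norm (D n) \<le> (1 / 2) ^ n" using K[OF rK rK, of n "Suc n" n] by (auto simp: less_imp_le)
  qed
  have zero: "(\<lambda>_. 0) \<in> L2" by (simp add: L2_def)
  have S: "(\<lambda>t. \<Sum>i<n. D i t) \<in> L2 \<and> L2_norm (\<lambda>t. \<Sum>i<n. D i t) \<le> (\<Sum>i<n. (1 / 2) ^ i)" for n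
  proof (induction n)
    case (Suc n)
    thus ?case using L2_add[OF _ D(1), of "\<lambda>t. \<Sum>i<n. D i t" n] D(2)[of n] by (auto intro: order_trans)
  qed (use zero in \<open>auto simp: L2_norm_def\<close>)
  have S2: "L2_norm (\<lambda>t. \<Sum>i<n. D i t) \<le> 2" for n
  proof -
    have "(\<Sum>i<n. (1 / 2) ^ i) \<le> (\<Sum>i. (1 / 2 :: real) ^ i)" by (intro sum_le_suminf summable_geometric) auto
    thus ?thesis using S[of n] suminf_geometric[of "1 / 2 :: real"] by simp
  qed
  define G where "G n t = (\<Sum>i<n. norm (Y (Suc i) t - Y i t))" for n t
  have G0: "0 \<le> G n t" for n t by (auto simp: G_def intro: sum_nonneg)
  have GD: "norm (\<Sum>i<n. D i t) = G n t" for n t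
  proof -
    have "(\<Sum>i<n. D i t) = complex_of_real (G n t)" by (simp add: D_def G_def)
    thus ?thesis using G0[of n t] by simp
  qed
  have Gm [measurable]: "G n \<in> borel_measurable dt_over_t" for n unfolding G_def by measurable
  have "(\<integral>\<^sup>+t. (SUP n. ennreal ((G n t)\<^sup>2)) \<partial>dt_over_t) = (SUP n. \<integral>\<^sup>+t. ennreal ((G n t)\<^sup>2) \<partial>dt_over_t)"
  proof (rule nn_integral_monotone_convergence_SUP)
    show "incseq (\<lambda>n t. ennreal ((G n t)\<^sup>2))"
    proof (intro incseq_SucI le_funI ennreal_leI power_mono G0)
      fix n t show "G n t \<le> G (Suc n) t" by (simp add: G_def)
    qed
  qed simp
  also have "\<dots> \<le> ennreal (2\<^sup>2)"
  proof (rule SUP_least)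
    fix n
    have "(\<integral>\<^sup>+t. ennreal ((G n t)\<^sup>2) \<partial>dt_over_t) = ennreal ((L2_norm (\<lambda>t. \<Sum>i<n. D i t))\<^sup>2)"
      using L2_nn_integral[of "\<lambda>t. \<Sum>i<n. D i t"] S[of n] by (simp add: GD)
    also have "\<dots> \<le> ennreal (2\<^sup>2)" using S2[of n] by (intro ennreal_leI power_mono L2_norm_nonneg)
    finally show "(\<integral>\<^sup>+t. ennreal ((G n t)\<^sup>2) \<partial>dt_over_t) \<le> ennreal (2\<^sup>2)" .
  qed
  finally have "(\<integral>\<^sup>+t. (SUP n. ennreal ((G n t)\<^sup>2)) \<partial>dt_over_t) \<noteq> \<infinity>"
    by (metis ennreal_less_top infinity_ennreal_def le_less_trans less_irrefl)
  hence "AE t in dt_over_t. (SUP n. ennreal ((G n t)\<^sup>2)) \<noteq> \<infinity>"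
    by (intro nn_integral_PInf_AE) auto
  hence conv: "AE t in dt_over_t. convergent (\<lambda>n. Y n t)"
  proof eventually_elim
    case (elim t)
    then obtain B where B: "(SUP n. ennreal ((G n t)\<^sup>2)) = ennreal B" "0 \<le> B"
      by (cases "SUP n. ennreal ((G n t)\<^sup>2)") auto
    have "(G n t)\<^sup>2 \<le> B" for n
    proof -
      have "ennreal ((G n t)\<^sup>2) \<le> ennreal B" unfolding B(1)[symmetric] by (rule SUP_upper) auto
      thus ?thesis using B(2) by simp
    qed
    hence "G n t \<le> sqrt B" for n by (simp add: real_le_rsqrt)
    hence "summable (\<lambda>i. norm (Y (Suc i) t - Y i t))"
      unfolding G_def by (intro summableI_nonneg_bounded[where x = "sqrt B"]) auto
    hence "summable (\<lambda>i. Y (Suc i) t - Y i t)" by (rule summable_norm_cancel)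
    hence "convergent (\<lambda>n. \<Sum>i<n. (Y (Suc i) t - Y i t))" by (simp add: summable_iff_convergent)
    hence "convergent (\<lambda>n. Y n t - Y 0 t)" by (simp only: sum_lessThan_telescope[of "\<lambda>i. Y i t"])
    hence "convergent (\<lambda>n. (Y n t - Y 0 t) + Y 0 t)" by (intro convergent_add convergent_const)
    thus ?case by simp
  qed
  define x where "x t = lim (\<lambda>n. Y n t)" for t
  have xm [measurable]: "x \<in> borel_measurable dt_over_t" unfolding x_def by (rule borel_measurable_lim_metric) simp
  have lim: "AE t in dt_over_t. (\<lambda>n. Y n t) \<longlonglongrightarrow> x t"
    using conv by eventually_elim (simp add: x_def convergent_LIMSEQ_iff)
  have close: "(\<lambda>t. X j t - x t) \<in> L2 \<and> L2_norm (\<lambda>t. X j t - x t) \<le> e"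
    if e: "0 < e" and k: "\<And>i. k \<le> i \<Longrightarrow> L2_norm (X j - X i) < e" for e j k
  proof -
    have "eventually (\<lambda>i. L2_norm (\<lambda>t. X j t - Y i t) \<le> e) sequentially"
      unfolding eventually_sequentially
    proof (intro exI[of _ k] allI impI)
      fix i assume "k \<le> i"
      hence "k \<le> r i" by (simp add: r_def)
      from k[OF this] show "L2_norm (\<lambda>t. X j t - Y i t) \<le> e" by (simp add: Y_def diff)
    qed
    moreover have "AE t in dt_over_t. (\<lambda>i. X j t - Y i t) \<longlonglongrightarrow> X j t - x t"
      using lim by eventually_elim (intro tendsto_intros)
    ultimately show ?thesis
      using e L2_Fatou[of "\<lambda>i t. X j t - Y i t" e "\<lambda>t. X j t - x t"] L2_diff[OF X Y] by auto
  qed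
  show "\<exists>x\<in>L2. (\<lambda>k. L2_norm (X k - x)) \<longlonglongrightarrow> 0"
  proof (rule bexI[of _ x])
    obtain k0 where "\<And>i j. k0 \<le> i \<Longrightarrow> k0 \<le> j \<Longrightarrow> L2_norm (X i - X j) < 1" using C[of 1] by auto
    hence "(\<lambda>t. X k0 t - x t) \<in> L2" using close[of 1 k0 k0] by auto
    hence "(\<lambda>t. X k0 t - (X k0 t - x t)) \<in> L2" by (rule L2_diff[OF X])
    moreover have "(\<lambda>t. X k0 t - (X k0 t - x t)) = x" by auto
    ultimately show "x \<in> L2" by (simp only:)
    show "(\<lambda>k. L2_norm (X k - x)) \<longlonglongrightarrow> 0"
    proof (rule LIMSEQ_I)
      fix e :: real assume e: "0 < e"
      obtain k0 where k0: "\<And>i j. k0 \<le> i \<Longrightarrow> k0 \<le> j \<Longrightarrow> L2_norm (X i - X j) < e / 2" using C[of "e / 2"] e by auto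
      have "norm (L2_norm (X j - x) - 0) < e" if "k0 \<le> j" for j
        using close[of "e / 2" k0 j] k0[OF that] e L2_norm_nonneg[of "X j - x"] by (auto simp: fun_diff_def)
      thus "\<exists>no. \<forall>n\<ge>no. norm (L2_norm (X n - x) - 0) < e" by blast
    qed
  qed
qed

section \<open>Operators given by a standard kernel\<close>

definition delta :: "int \<Rightarrow> int \<Rightarrow> complex" where
  "delta m k = (if k = m then 1 else 0)"

lemma finite_supp_delta [simp]: "finite {k. delta m k \<noteq> 0}"
  by (rule finite_subset[of _ "{m}"]) (auto simp: delta_def)

lemma admissible_delta [simp]: "admissible (delta m)"
  by (rule admissible_finite) simp

lemma weighted_sum_finite:
  assumes "finite S" "\<And>m. m \<notin> S \<Longrightarrow> f m = 0"
  shows "weighted_sum f n = (\<Sum>m\<in>S. norm (f m) / (1 + \<bar>of_int (n - m)\<bar>))"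
proof -
  have "weighted_sum f n = (\<Sum>\<^sub>\<infinity>m\<in>S. norm (f m) / (1 + \<bar>of_int (n - m)\<bar>))"
    unfolding weighted_sum_def by (rule infsum_cong_neutral) (use assms in auto)
  thus ?thesis using assms(1) by simp
qed

lemma weighted_sum_delta: "weighted_sum (delta m) n = 1 / (1 + \<bar>of_int (n - m)\<bar>)"
  using weighted_sum_finite[of "{m}" "delta m" n] by (simp add: delta_def)

lemma admissible_restr: "admissible f \<Longrightarrow> admissible (restr S f)"
  by (erule admissible_bound) (simp add: restr_def)

lemma admissible_tail_tendsto:
  assumes f: "admissible f"
  shows "((\<lambda>F. weighted_sum (restr (- F) f) n) \<longlongrightarrow> 0) (finite_subsets_at_top UNIV)"
proof -
  have s: "(\<lambda>m. norm (f m) / (1 + \<bar>of_int (n - m)\<bar>)) summable_on UNIV" by (rule admissible_summable[OF f])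
  have lim: "((\<lambda>F. weighted_sum f n - (\<Sum>m\<in>F. norm (f m) / (1 + \<bar>of_int (n - m)\<bar>))) \<longlongrightarrow> weighted_sum f n - weighted_sum f n) (finite_subsets_at_top UNIV)"
    unfolding weighted_sum_def by (intro tendsto_diff tendsto_const infsum_tendsto s)
  have ev: "eventually (\<lambda>F. weighted_sum f n - (\<Sum>m\<in>F. norm (f m) / (1 + \<bar>of_int (n - m)\<bar>)) = weighted_sum (restr (- F) f) n) (finite_subsets_at_top UNIV)"
  proof (rule eventually_finite_subsets_at_top_weakI)
    fix F :: "int set" assume F: "finite F"
    have "weighted_sum (restr (- F) f) n = (\<Sum>\<^sub>\<infinity>m\<in>UNIV - F. norm (f m) / (1 + \<bar>of_int (n - m)\<bar>))"
      unfolding weighted_sum_def by (rule infsum_cong_neutral) (auto simp: restr_def)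
    also have "\<dots> = weighted_sum f n - (\<Sum>\<^sub>\<infinity>m\<in>F. norm (f m) / (1 + \<bar>of_int (n - m)\<bar>))"
      unfolding weighted_sum_def by (rule infsum_Diff) (use s F in \<open>auto intro: summable_on_finite\<close>)
    finally show "weighted_sum f n - (\<Sum>m\<in>F. norm (f m) / (1 + \<bar>of_int (n - m)\<bar>)) = weighted_sum (restr (- F) f) n"
      using F by simp
  qed
  from Lim_transform_eventually[OF lim ev] show ?thesis by simp
qed

text \<open>
A translation invariant formulation of what the three operators have in common. The kernel is \<open>K n m = T (delta m) n\<close>; it determines
\<open>T\<close> because \<open>T_size\<close> makes \<open>T f n\<close> depend continuously on \<open>f\<close>.
\<close>

locale kernel_operator = complex_banach fscale E nrm
  for E :: "(real \<Rightarrow> complex) set" and nrm :: "(real \<Rightarrow> complex) \<Rightarrow> real" +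
  fixes T :: "(int \<Rightarrow> complex) \<Rightarrow> int \<Rightarrow> real \<Rightarrow> complex" and C :: real
  assumes T_in: "admissible f \<Longrightarrow> T f n \<in> E"
    and T_linear: "admissible f \<Longrightarrow> admissible g \<Longrightarrow>
       nrm (T (\<lambda>m. a * f m + b * g m) n - (fscale a (T f n) + fscale b (T g n))) = 0"
    and T_size: "admissible f \<Longrightarrow> nrm (T f n) \<le> C * weighted_sum f n"
    and T_regular: "2 * \<bar>m - m'\<bar> < \<bar>n - m\<bar> \<Longrightarrow>
       nrm (T (delta m) n - T (delta m') n) \<le> C * of_int \<bar>m - m'\<bar> / (of_int (n - m))\<^sup>2"
    and T_regular': "2 * \<bar>m - m'\<bar> < \<bar>n - m\<bar> \<Longrightarrow>
       nrm (T (delta n) m - T (delta n) m') \<le> C * of_int \<bar>m - m'\<bar> / (of_int (n - m))\<^sup>2"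
    and C_nonneg: "0 \<le> C"
begin

lemma E_add: "x \<in> E \<Longrightarrow> y \<in> E \<Longrightarrow> x + y \<in> E" and E_scale: "x \<in> E \<Longrightarrow> fscale c x \<in> E" and E_zero: "0 \<in> E"
  using subspace_E by (auto simp: subspace_def)

lemma fscale_minus: "fscale (- 1) x = - x" and fscale_zero: "fscale 0 x = 0" and fscale_one: "fscale 1 x = x"
  by (auto simp: fscale_def fun_eq_iff)

lemma E_diff: "x \<in> E \<Longrightarrow> y \<in> E \<Longrightarrow> x - y \<in> E"
  using E_add[of x "- y"] E_scale[of y "- 1"] by (simp add: fscale_minus)

lemma E_sum: "(\<And>i. i \<in> I \<Longrightarrow> x i \<in> E) \<Longrightarrow> (\<Sum>i\<in>I. x i) \<in> E"
  by (induction I rule: infinite_finite_induct) (auto intro: E_zero E_add)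

lemma nrm_minus: "x \<in> E \<Longrightarrow> nrm (- x) = nrm x"
  using nrm_scale[of x "- 1"] by (simp add: fscale_minus)

lemma nrm_zero: "nrm 0 = 0"
  using nrm_scale[OF E_zero, of 0] by (simp add: fscale_zero)

lemma nrm_diff_commute: "x \<in> E \<Longrightarrow> y \<in> E \<Longrightarrow> nrm (x - y) = nrm (y - x)"
  using nrm_minus[OF E_diff[of y x]] by simp

lemma nrm_triangle_diff: "x \<in> E \<Longrightarrow> y \<in> E \<Longrightarrow> z \<in> E \<Longrightarrow> nrm (x - z) \<le> nrm (x - y) + nrm (y - z)"
  using nrm_triangle[OF E_diff[of x y] E_diff[of y z]] by simp

lemma nrm_sum_le: "(\<And>i. i \<in> I \<Longrightarrow> x i \<in> E) \<Longrightarrow> nrm (\<Sum>i\<in>I. x i) \<le> (\<Sum>i\<in>I. nrm (x i))"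
proof (induction I rule: infinite_finite_induct)
  case (insert i I)
  have "nrm (x i + (\<Sum>i\<in>I. x i)) \<le> nrm (x i) + nrm (\<Sum>i\<in>I. x i)"
    using insert by (intro nrm_triangle E_sum) auto
  moreover have "nrm (\<Sum>i\<in>I. x i) \<le> (\<Sum>i\<in>I. nrm (x i))" using insert.prems by (intro insert.IH) auto
  ultimately show ?case unfolding sum.insert[OF insert.hyps] by linarith
qed (auto simp: nrm_zero)

lemma T_finite:
  assumes "finite S"
  shows "nrm (T (\<lambda>k. \<Sum>m\<in>S. c m * delta m k) n - (\<Sum>m\<in>S. fscale (c m) (T (delta m) n))) = 0"
  using assms
proof (induction S rule: finite_induct)
  case empty
  have "nrm (T (\<lambda>k. 0 * delta 0 k + 0 * delta 0 k) n - (fscale 0 (T (delta 0) n) + fscale 0 (T (delta 0) n))) = 0"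
    by (rule T_linear) auto
  thus ?case by (simp add: fscale_zero)
next
  case (insert m S)
  define g where "g = (\<lambda>k. \<Sum>m\<in>S. c m * delta m k)"
  have g: "admissible g"
  proof (rule admissible_finite, rule finite_subset)
    show "{k. g k \<noteq> 0} \<subseteq> S"
    proof
      fix k assume "k \<in> {k. g k \<noteq> 0}"
      then obtain j where "j \<in> S" "c j * delta j k \<noteq> 0"
        unfolding g_def by (metis (mono_tags, lifting) mem_Collect_eq sum.not_neutral_contains_not_neutral)
      thus "k \<in> S" by (auto simp: delta_def split: if_splits)
    qed
  qed fact
  define y where "y = (\<Sum>m\<in>S. fscale (c m) (T (delta m) n))"
  have in_E: "T g n \<in> E" "y \<in> E" "fscale (c m) (T (delta m) n) \<in> E" "T (\<lambda>k. c m * delta m k + 1 * g k) n \<in> E"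
    unfolding y_def by (intro T_in E_scale E_sum admissible_add admissible_scale g admissible_delta)+
  have "nrm (T (\<lambda>k. c m * delta m k + 1 * g k) n - (fscale (c m) (T (delta m) n) + y))
      \<le> nrm (T (\<lambda>k. c m * delta m k + 1 * g k) n - (fscale (c m) (T (delta m) n) + fscale 1 (T g n)))
        + nrm ((fscale (c m) (T (delta m) n) + fscale 1 (T g n)) - (fscale (c m) (T (delta m) n) + y))"
    using in_E by (intro nrm_triangle_diff E_add E_scale T_in admissible_delta admissible_add admissible_scale g)
  also have "nrm (T (\<lambda>k. c m * delta m k + 1 * g k) n - (fscale (c m) (T (delta m) n) + fscale 1 (T g n))) = 0"
    by (rule T_linear) (use g in auto)
  also have "(fscale (c m) (T (delta m) n) + fscale 1 (T g n)) - (fscale (c m) (T (delta m) n) + y) = T g n - y"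
    by (simp add: fscale_one)
  also have "nrm (T g n - y) = 0" unfolding g_def y_def by (rule insert.IH)
  finally have "nrm (T (\<lambda>k. c m * delta m k + 1 * g k) n - (fscale (c m) (T (delta m) n) + y)) \<le> 0" by (simp only: add_0_left)
  moreover have "0 \<le> nrm (T (\<lambda>k. c m * delta m k + 1 * g k) n - (fscale (c m) (T (delta m) n) + y))"
    using in_E by (intro nrm_nonneg E_diff E_add)
  ultimately have 0: "nrm (T (\<lambda>k. c m * delta m k + 1 * g k) n - (fscale (c m) (T (delta m) n) + y)) = 0" by (rule antisym)
  have e: "(\<lambda>k. \<Sum>m\<in>insert m S. c m * delta m k) = (\<lambda>k. c m * delta m k + 1 * g k)"
    using insert.hyps by (simp add: g_def fun_eq_iff)
  have e': "(\<Sum>m\<in>insert m S. fscale (c m) (T (delta m) n)) = fscale (c m) (T (delta m) n) + y"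
    unfolding y_def by (rule sum.insert[OF insert.hyps])
  show ?case unfolding e e' by (rule 0)
qed

lemma restr_finite_eq: "finite S \<Longrightarrow> restr S f = (\<lambda>k. \<Sum>m\<in>S. f m * delta m k)"
  by (auto simp: fun_eq_iff restr_def delta_def if_distrib[of "\<lambda>x. _ * x"] cong: if_cong)

lemma T_diff_le:
  assumes "admissible f" "admissible g"
  shows "nrm (T f n - T g n) \<le> nrm (T (\<lambda>m. f m - g m) n)"
proof -
  have a: "admissible (\<lambda>m. 1 * f m + (- 1) * g m)" using assms by (intro admissible_add admissible_scale)
  have "nrm (T f n - T g n) \<le> nrm (T f n - T g n - T (\<lambda>m. 1 * f m + (- 1) * g m) n) + nrm (T (\<lambda>m. 1 * f m + (- 1) * g m) n - 0)"
    using nrm_triangle_diff[OF E_diff[OF T_in[OF assms(1)] T_in[OF assms(2)]] T_in[OF a] E_zero, of n n n] by simp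
  also have "nrm (T f n - T g n - T (\<lambda>m. 1 * f m + (- 1) * g m) n) = nrm (T (\<lambda>m. 1 * f m + (- 1) * g m) n - (fscale 1 (T f n) + fscale (- 1) (T g n)))"
    using nrm_diff_commute[OF E_diff[OF T_in[OF assms(1)] T_in[OF assms(2)]] T_in[OF a], of n n n] by (simp add: fscale_one fscale_minus)
  also have "\<dots> = 0" by (rule T_linear[OF assms])
  also have "(\<lambda>m. 1 * f m + (- 1) * g m) = (\<lambda>m. f m - g m)" by auto
  finally show ?thesis by (simp only: diff_zero add_0)
qed

text \<open>
By linearity the difference is, up to a null element, the value of \<open>T\<close> at the tail of \<open>f\<close>.
\<close>

lemma T_approx:
  assumes f: "admissible f" and S: "finite S"
  shows "nrm (T f n - (\<Sum>m\<in>S. fscale (f m) (T (delta m) n))) \<le> C * weighted_sum (restr (- S) f) n"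
proof -
  have in_E: "T f n \<in> E" "T (restr S f) n \<in> E" "(\<Sum>m\<in>S. fscale (f m) (T (delta m) n)) \<in> E"
    by (intro T_in admissible_restr E_sum E_scale f admissible_delta)+
  have "nrm (T f n - (\<Sum>m\<in>S. fscale (f m) (T (delta m) n)))
     \<le> nrm (T f n - T (restr S f) n) + nrm (T (restr S f) n - (\<Sum>m\<in>S. fscale (f m) (T (delta m) n)))"
    using in_E by (rule nrm_triangle_diff)
  also have "nrm (T (restr S f) n - (\<Sum>m\<in>S. fscale (f m) (T (delta m) n))) = 0"
    unfolding restr_finite_eq[OF S] by (rule T_finite[OF S])
  also have "nrm (T f n - T (restr S f) n) \<le> nrm (T (\<lambda>m. f m - restr S f m) n)"
    using f by (intro T_diff_le admissible_restr)
  also have "(\<lambda>m. f m - restr S f m) = restr (- S) f" by (auto simp: restr_def fun_eq_iff)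
  also have "nrm (T (restr (- S) f) n) \<le> C * weighted_sum (restr (- S) f) n"
    using f by (intro T_size admissible_restr)
  finally show ?thesis by (simp only: add_0_right)
qed

lemma T_truncation_tendsto:
  assumes f: "admissible f"
  shows "(\<lambda>R. nrm (T (restr {- int R..int R} f) n)) \<longlonglongrightarrow> nrm (T f n)"
proof -
  have b: "norm (nrm (T (restr {- int R..int R} f) n) - nrm (T f n)) \<le> C * weighted_sum (restr (- {- int R..int R}) f) n" for R
  proof -
    let ?S = "{- int R..int R}"
    have in_E: "T f n \<in> E" "T (restr ?S f) n \<in> E" by (intro T_in admissible_restr f)+
    have "nrm (T f n - T (restr ?S f) n) \<le> nrm (T (\<lambda>m. f m - restr ?S f m) n)"
      using f by (intro T_diff_le admissible_restr)
    also have "(\<lambda>m. f m - restr ?S f m) = restr (- ?S) f" by (auto simp: restr_def fun_eq_iff)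
    also have "nrm (T (restr (- ?S) f) n) \<le> C * weighted_sum (restr (- ?S) f) n"
      using f by (intro T_size admissible_restr)
    finally have d: "nrm (T f n - T (restr ?S f) n) \<le> C * weighted_sum (restr (- ?S) f) n" .
    have "nrm (T f n - 0) \<le> nrm (T f n - T (restr ?S f) n) + nrm (T (restr ?S f) n - 0)"
      using in_E E_zero by (intro nrm_triangle_diff)
    moreover have "nrm (T (restr ?S f) n - 0) \<le> nrm (T (restr ?S f) n - T f n) + nrm (T f n - 0)"
      using in_E E_zero by (intro nrm_triangle_diff)
    ultimately show ?thesis using d nrm_diff_commute[OF in_E] by (simp only: diff_zero real_norm_def abs_le_iff) linarith
  qed
  have l: "(\<lambda>R. C * weighted_sum (restr (- {- int R..int R}) f) n) \<longlonglongrightarrow> 0"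
    using tendsto_mult_right_zero[OF filterlim_compose[OF admissible_tail_tendsto[OF f] filterlim_symmetric_intervals]] .
  have "(\<lambda>R. nrm (T (restr {- int R..int R} f) n) - nrm (T f n)) \<longlonglongrightarrow> 0"
    by (rule Lim_null_comparison[OF always_eventually[OF allI[OF b]] l])
  thus ?thesis by (simp add: LIM_zero_iff)
qed

lemma calderon_zygmund_T:
  assumes adm: "\<And>f. f \<in> lp 2 \<Longrightarrow> admissible f"
    and l2: "strong_type 2 (\<lambda>_. 1) (\<lambda>f n. nrm (T f n))"
  shows "calderon_zygmund fscale E nrm T"
proof -
  have cb: "complex_banach fscale E nrm" by unfold_locales
  show ?thesis unfolding calderon_zygmund_def
proof (rule conjI[OF cb exI[of _ "2::real"]], intro conjI)
  show "\<forall>f\<in>lp 2. \<forall>n. T f n \<in> E" using adm by (auto intro: T_in)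
  show "\<forall>f\<in>lp 2. \<forall>g\<in>lp 2. \<forall>a b n. nrm (T (\<lambda>m. a * f m + b * g m) n - (fscale a (T f n) + fscale b (T g n))) = 0"
    using adm by (auto intro: T_linear)
  show "\<exists>A. \<forall>f\<in>lp 2. (\<lambda>n. nrm (T f n)) \<in> lp 2 \<and> lp_norm 2 (\<lambda>n. nrm (T f n)) \<le> A * lp_norm 2 f"
    using l2 unfolding strong_type_def .
  show "\<exists>K C. (\<forall>n m. K n m \<in> E) \<and>
       (\<forall>f\<in>lp 2. \<forall>n. ((\<lambda>F. nrm (T f n - (\<Sum>m\<in>F. fscale (f m) (K n m)))) \<longlongrightarrow> 0) (finite_subsets_at_top UNIV)) \<and>
       (\<forall>n m. n \<noteq> m \<longrightarrow> nrm (K n m) \<le> C / of_int \<bar>n - m\<bar>) \<and>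
       (\<forall>n m m'. \<bar>n - m\<bar> > 2 * \<bar>m - m'\<bar> \<longrightarrow>
          nrm (K n m - K n m') + nrm (K m n - K m' n) \<le> C * of_int \<bar>m - m'\<bar> / (of_int \<bar>n - m\<bar>)\<^sup>2)"
  proof (intro exI[of _ "\<lambda>n m. T (delta m) n"] exI[of _ "2 * C"] conjI allI ballI impI)
    fix n m show "T (delta m) n \<in> E" by (rule T_in) simp
  next
    fix f :: "int \<Rightarrow> complex" and n :: int assume "f \<in> lp 2"
    hence f: "admissible f" by (rule adm)
    show "((\<lambda>F. nrm (T f n - (\<Sum>m\<in>F. fscale (f m) (T (delta m) n)))) \<longlongrightarrow> 0) (finite_subsets_at_top UNIV)"
    proof (rule Lim_null_comparison)
      show "((\<lambda>F. C * weighted_sum (restr (- F) f) n) \<longlongrightarrow> 0) (finite_subsets_at_top UNIV)"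
        by (rule tendsto_mult_right_zero[OF admissible_tail_tendsto[OF f]])
      show "eventually (\<lambda>F. norm (nrm (T f n - (\<Sum>m\<in>F. fscale (f m) (T (delta m) n)))) \<le> C * weighted_sum (restr (- F) f) n) (finite_subsets_at_top UNIV)"
      proof (rule eventually_finite_subsets_at_top_weakI)
        fix F :: "int set" assume F: "finite F"
        have "T f n - (\<Sum>m\<in>F. fscale (f m) (T (delta m) n)) \<in> E"
          using f by (intro E_diff E_sum E_scale T_in) auto
        thus "norm (nrm (T f n - (\<Sum>m\<in>F. fscale (f m) (T (delta m) n)))) \<le> C * weighted_sum (restr (- F) f) n"
          using T_approx[OF f F, of n] nrm_nonneg by simp
      qed
    qed
  next
    fix n m :: int assume nm: "n \<noteq> m"
    have "nrm (T (delta m) n) \<le> C * (1 / (1 + \<bar>of_int (n - m)\<bar>))"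
      using T_size[of "delta m" n] by (simp add: weighted_sum_delta)
    also have "\<dots> \<le> C * (2 / \<bar>of_int (n - m)\<bar>)"
      using nm by (intro mult_left_mono C_nonneg frac_le) auto
    finally show "nrm (T (delta m) n) \<le> 2 * C / of_int \<bar>n - m\<bar>" by (simp add: mult.commute)
  next
    fix n m m' :: int assume "2 * \<bar>m - m'\<bar> < \<bar>n - m\<bar>"
    from add_mono[OF T_regular[OF this] T_regular'[OF this]]
    show "nrm (T (delta m) n - T (delta m') n) + nrm (T (delta n) m - T (delta n) m') \<le> 2 * C * of_int \<bar>m - m'\<bar> / (of_int \<bar>n - m\<bar>)\<^sup>2"
      by simp
  qed
qed simp
qed

end

context kernel_operator begin

lemma nrm_eqI:
  assumes "x \<in> E" "y \<in> E" "nrm (x - y) = 0"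
  shows "nrm x = nrm y"
  using nrm_triangle_diff[OF assms(1,2) E_zero] nrm_triangle_diff[OF assms(2,1) E_zero]
    nrm_diff_commute[OF assms(1,2)] assms(3) by (simp only: diff_zero)

lemma T_finite_support:
  assumes S: "finite S" "\<And>x. x \<notin> S \<Longrightarrow> f x = 0"
  shows "nrm (T f n - (\<Sum>m\<in>S. fscale (f m) (T (delta m) n))) = 0"
proof -
  have "restr S f = f" using S(2) by (auto simp: restr_def fun_eq_iff)
  thus ?thesis using T_finite[OF S(1), of f n] unfolding restr_finite_eq[OF S(1), symmetric] by simp
qed

lemma admissible_finite_support:
  assumes "finite S" "\<And>x. x \<notin> S \<Longrightarrow> f x = 0"
  shows "admissible f"
proof (rule admissible_finite)
  show "finite {m. f m \<noteq> 0}" by (rule finite_subset[OF _ assms(1)]) (use assms(2) in auto)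
qed

lemma T_finite_support_nrm:
  assumes S: "finite S" "\<And>x. x \<notin> S \<Longrightarrow> f x = 0"
  shows "nrm (T f n) = nrm (\<Sum>m\<in>S. fscale (f m) (T (delta m) n))"
  by (rule nrm_eqI[OF _ _ T_finite_support[of S f n, OF S]])
    (intro T_in E_sum E_scale admissible_delta admissible_finite_support[OF S] | assumption)+

text \<open>
The linear operator may be expanded in the kernel on finitely supported sequences. Subtracting the value of the kernel at the centre
exploits the vanishing mean.
\<close>

lemma cz_sublinear_T:
  assumes c: "C \<le> c" and l2: "\<And>f S F. finite S \<Longrightarrow> (\<And>x. x \<notin> S \<Longrightarrow> f x = 0) \<Longrightarrow> finite F \<Longrightarrow>
        (\<Sum>n\<in>F. (nrm (T f n))\<^sup>2) \<le> c * (\<Sum>x\<in>S. (norm (f x))\<^sup>2)"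
    and nn: "\<And>f n. 0 \<le> nrm (T f n)"
  shows "cz_sublinear (\<lambda>f n. nrm (T f n)) c"
proof
  show "0 \<le> c" using C_nonneg c by simp
  show "0 \<le> nrm (T f n)" for f n by (rule nn)
  show "nrm (T (\<lambda>x. f x + g x) n) \<le> nrm (T f n) + nrm (T g n)"
    if "finite {x. f x \<noteq> 0}" "finite {x. g x \<noteq> 0}" for f g n
  proof -
    note a = admissible_finite[OF that(1)] admissible_finite[OF that(2)]
    have "nrm (T (\<lambda>x. 1 * f x + 1 * g x) n) = nrm (fscale 1 (T f n) + fscale 1 (T g n))"
      by (rule nrm_eqI[OF _ _ T_linear[OF a]]) (intro T_in E_add E_scale admissible_add admissible_scale a)+
    also have "\<dots> \<le> nrm (T f n) + nrm (T g n)" unfolding fscale_one by (intro nrm_triangle T_in a)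
    finally show ?thesis by simp
  qed
  show "nrm (T (\<lambda>x. - f x) n) = nrm (T f n)" if "finite {x. f x \<noteq> 0}" for f n
  proof -
    note a = admissible_finite[OF that]
    have "nrm (T (\<lambda>x. (- 1) * f x + 0 * f x) n) = nrm (fscale (- 1) (T f n) + fscale 0 (T f n))"
      by (rule nrm_eqI[OF _ _ T_linear[OF a a]]) (intro T_in E_add E_scale admissible_add admissible_scale a)+
    also have "fscale (- 1) (T f n) + fscale 0 (T f n) = fscale (- 1) (T f n)" unfolding fscale_zero by (rule add_0_right)
    also have "nrm (fscale (- 1) (T f n)) = nrm (T f n)" using nrm_scale[OF T_in[OF a, of n], of "- 1"] by simp
    finally show ?thesis by simp
  qed
  show "(\<Sum>n\<in>F. (nrm (T f n))\<^sup>2) \<le> c * (\<Sum>x\<in>S. (norm (f x))\<^sup>2)"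
    if "finite S" "\<And>x. x \<notin> S \<Longrightarrow> f x = 0" "finite F" for f S F using that by (rule l2)
  show "nrm (T f n) \<le> c * (\<Sum>m\<in>S. norm (f m) * of_int \<bar>m - a\<bar> / (of_int (n - a))\<^sup>2)"
    if S: "finite S" "\<And>x. x \<notin> S \<Longrightarrow> f x = 0" and f0: "(\<Sum>x\<in>S. f x) = 0"
      and far: "\<And>m. m \<in> S \<Longrightarrow> 2 * \<bar>m - a\<bar> < \<bar>n - a\<bar>" for f S a n
  proof -
    have "(\<Sum>m\<in>S. fscale (f m) (T (delta a) n)) = fscale (\<Sum>m\<in>S. f m) (T (delta a) n)"
      by (simp only: scale_sum_left)
    hence z: "(\<Sum>m\<in>S. fscale (f m) (T (delta a) n)) = 0" unfolding f0 fscale_zero .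
    have "(\<Sum>m\<in>S. fscale (f m) (T (delta m) n)) = (\<Sum>m\<in>S. fscale (f m) (T (delta m) n)) - (\<Sum>m\<in>S. fscale (f m) (T (delta a) n))"
      unfolding z by (rule diff_zero[symmetric])
    also have "\<dots> = (\<Sum>m\<in>S. fscale (f m) (T (delta m) n - T (delta a) n))"
      unfolding sum_subtractf[symmetric] scale_right_diff_distrib ..
    finally have "nrm (\<Sum>m\<in>S. fscale (f m) (T (delta m) n)) = nrm (\<Sum>m\<in>S. fscale (f m) (T (delta m) n - T (delta a) n))"
      by (rule arg_cong)
    moreover have "nrm (T f n) = nrm (\<Sum>m\<in>S. fscale (f m) (T (delta m) n))"
      using S by (rule T_finite_support_nrm)
    ultimately have "nrm (T f n) = nrm (\<Sum>m\<in>S. fscale (f m) (T (delta m) n - T (delta a) n))"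
      by (rule trans[rotated])
    also have "\<dots> \<le> (\<Sum>m\<in>S. nrm (fscale (f m) (T (delta m) n - T (delta a) n)))"
      by (intro nrm_sum_le E_scale E_diff T_in admissible_delta)
    also have "\<dots> \<le> (\<Sum>m\<in>S. norm (f m) * (c * of_int \<bar>m - a\<bar> / (of_int (n - a))\<^sup>2))"
    proof (rule sum_mono)
      fix m assume m: "m \<in> S"
      have d: "T (delta m) n - T (delta a) n \<in> E" by (intro E_diff T_in admissible_delta)
      have "nrm (T (delta m) n - T (delta a) n) = nrm (T (delta a) n - T (delta m) n)"
        by (intro nrm_diff_commute T_in admissible_delta)
      also have "\<dots> \<le> C * of_int \<bar>a - m\<bar> / (of_int (n - a))\<^sup>2" using far[OF m] by (intro T_regular) (simp only: abs_minus_commute[of a m])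
      also have "\<dots> \<le> c * of_int \<bar>m - a\<bar> / (of_int (n - a))\<^sup>2"
        unfolding abs_minus_commute[of a m] using c by (intro divide_right_mono mult_right_mono) auto
      finally show "nrm (fscale (f m) (T (delta m) n - T (delta a) n)) \<le> norm (f m) * (c * of_int \<bar>m - a\<bar> / (of_int (n - a))\<^sup>2)"
        unfolding nrm_scale[OF d] by (intro mult_left_mono) auto
    qed
    also have "\<dots> = c * (\<Sum>m\<in>S. norm (f m) * of_int \<bar>m - a\<bar> / (of_int (n - a))\<^sup>2)"
      by (simp add: sum_distrib_left mult_ac)
    finally show ?thesis .
  qed
  show "nrm (T f y) \<le> nrm (T f x) + c * (\<Sum>m\<in>S. norm (f m) * of_int \<bar>x - y\<bar> / (of_int (m - x))\<^sup>2)"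
    if S: "finite S" "\<And>x. x \<notin> S \<Longrightarrow> f x = 0"
      and far: "\<And>m. m \<in> S \<Longrightarrow> 2 * \<bar>x - y\<bar> < \<bar>m - x\<bar>" for f S x y
  proof -
    define F where "F n = (\<Sum>m\<in>S. fscale (f m) (T (delta m) n))" for n
    have F: "F n \<in> E" for n unfolding F_def by (intro E_sum E_scale T_in admissible_delta)
    have "nrm (F y - 0) \<le> nrm (F y - F x) + nrm (F x - 0)" by (intro nrm_triangle_diff F E_zero)
    moreover have "nrm (T f z) = nrm (F z)" for z
      unfolding F_def using S by (rule T_finite_support_nrm)
    ultimately have "nrm (T f y) \<le> nrm (F y - F x) + nrm (T f x)"
      by (simp only: diff_zero)
    also have "F y - F x = (\<Sum>m\<in>S. fscale (f m) (T (delta m) y - T (delta m) x))"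
      unfolding F_def sum_subtractf[symmetric] scale_right_diff_distrib ..
    also have "nrm \<dots> \<le> (\<Sum>m\<in>S. nrm (fscale (f m) (T (delta m) y - T (delta m) x)))"
      by (intro nrm_sum_le E_scale E_diff T_in admissible_delta)
    also have "\<dots> \<le> (\<Sum>m\<in>S. norm (f m) * (c * of_int \<bar>x - y\<bar> / (of_int (m - x))\<^sup>2))"
    proof (rule sum_mono)
      fix m assume m: "m \<in> S"
      have d: "T (delta m) y - T (delta m) x \<in> E" by (intro E_diff T_in admissible_delta)
      have "nrm (T (delta m) y - T (delta m) x) = nrm (T (delta m) x - T (delta m) y)"
        by (intro nrm_diff_commute T_in admissible_delta)
      also have "\<dots> \<le> C * of_int \<bar>x - y\<bar> / (of_int (m - x))\<^sup>2" using far[OF m] by (intro T_regular')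
      also have "\<dots> \<le> c * of_int \<bar>x - y\<bar> / (of_int (m - x))\<^sup>2"
        using c by (intro divide_right_mono mult_right_mono) auto
      finally show "nrm (fscale (f m) (T (delta m) y - T (delta m) x)) \<le> norm (f m) * (c * of_int \<bar>x - y\<bar> / (of_int (m - x))\<^sup>2)"
        unfolding nrm_scale[OF d] by (intro mult_left_mono) auto
    qed
    also have "\<dots> = c * (\<Sum>m\<in>S. norm (f m) * of_int \<bar>x - y\<bar> / (of_int (m - x))\<^sup>2)"
      by (simp add: sum_distrib_left mult_ac)
    finally show ?thesis by simp
  qed
qed

end

section \<open>From consecutive differences to kernel regularity\<close>

text \<open>
The condition \<open>2 * |j - l| < |l|\<close> forces \<open>j\<close> and \<open>l\<close> onto the same side of the origin and keeps all intermediate points at distance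
\<open>|l|/2\<close> from it. Hence bounds of the steps from \<open>i\<close> to \<open>i + 1\<close> with \<open>i \<ge> 1\<close> suffice.
\<close>

lemma telescope_regularity:
  fixes D :: "int \<Rightarrow> int \<Rightarrow> real" and c :: real
  assumes refl: "\<And>i. D i i = 0" and sym: "\<And>i j. D i j = D j i" and tri: "\<And>i j l. D i l \<le> D i j + D j l"
    and even: "\<And>i j. D (- i) (- j) = D i j" and c: "0 \<le> c"
    and step: "\<And>i. 1 \<le> i \<Longrightarrow> D i (i + 1) \<le> c / (of_int i)\<^sup>2"
    and jl: "2 * \<bar>j - l\<bar> < \<bar>l\<bar>"
  shows "D j l \<le> 4 * c * of_int \<bar>j - l\<bar> / (of_int l)\<^sup>2"
proof -
  have run: "D a (a + int n) \<le> real n * (c / (of_int a)\<^sup>2)" if a: "1 \<le> a" for a n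
  proof (induction n)
    case (Suc n)
    have "D a (a + int (Suc n)) \<le> D a (a + int n) + D (a + int n) (a + int n + 1)"
      using tri[of a "a + int (Suc n)" "a + int n"] by (simp add: algebra_simps)
    also have "D (a + int n) (a + int n + 1) \<le> c / (of_int (a + int n))\<^sup>2" using a by (intro step) auto
    also have "\<dots> \<le> c / (of_int a)\<^sup>2" using a c by (intro divide_left_mono power_mono mult_pos_pos) auto
    finally have "D a (a + int (Suc n)) \<le> real n * (c / (of_int a)\<^sup>2) + c / (of_int a)\<^sup>2" using Suc by simp
    thus ?case by (simp only: of_nat_Suc distrib_right mult_1_left add_ac)
  qed (simp add: refl)
  have pos: "D j l \<le> 4 * c * of_int \<bar>j - l\<bar> / (of_int l)\<^sup>2" if l: "0 < l" and jl: "2 * \<bar>j - l\<bar> < l" for j l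
  proof -
    define a where "a = min j l"
    have a: "1 \<le> a" "l \<le> 2 * a" using l jl by (auto simp: a_def min_def abs_if split: if_splits)
    have e: "max j l = a + int (nat \<bar>j - l\<bar>)" by (auto simp: a_def max_def min_def)
    have "D j l = D (min j l) (max j l)" using sym by (auto simp: min_def max_def)
    also have "\<dots> \<le> real (nat \<bar>j - l\<bar>) * (c / (of_int a)\<^sup>2)" unfolding e a_def[symmetric] by (rule run[OF a(1)])
    also have "\<dots> \<le> of_int \<bar>j - l\<bar> * (4 * c / (of_int l)\<^sup>2)"
    proof (rule mult_mono)
      have "(of_int l :: real) \<le> of_int (2 * a)" using a(2) by (simp only: of_int_le_iff)
      hence "(of_int l)\<^sup>2 \<le> (of_int (2 * a) :: real)\<^sup>2" using l by (intro power_mono) auto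
      hence "(of_int l)\<^sup>2 \<le> 4 * (of_int a :: real)\<^sup>2" by (simp add: power_mult_distrib)
      hence "c * (of_int l)\<^sup>2 \<le> c * (4 * (of_int a)\<^sup>2)" using c by (intro mult_left_mono) auto
      thus "c / (of_int a)\<^sup>2 \<le> 4 * c / (of_int l)\<^sup>2" using a l by (simp add: divide_simps mult_ac)
    qed (use c in auto)
    finally show ?thesis by (simp add: mult_ac)
  qed
  show ?thesis
  proof (cases "0 < l")
    case True thus ?thesis using jl by (intro pos) auto
  next
    case False
    have "D j l = D (- j) (- l)" by (rule even[symmetric])
    also have "\<dots> \<le> 4 * c * of_int \<bar>(- j) - (- l)\<bar> / (of_int (- l))\<^sup>2" using False jl by (intro pos) (auto simp: abs_if split: if_splits)
    also have "\<bar>(- j) - (- l)\<bar> = \<bar>j - l\<bar>" by simp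
    finally show ?thesis by simp
  qed
qed

section \<open>Estimates of square integrals with respect to \<open>dt/t\<close>\<close>

lemma space_dt_over_t [simp]: "space dt_over_t = {0<..}"
  by (simp add: dt_over_t_def space_restrict_space)

lemma sets_dt_over_t: "sets dt_over_t = sets (restrict_space borel {0<..})"
  by (simp add: dt_over_t_def sets_restrict_space)

lemma continuous_measurable_dt_over_t:
  fixes \<phi> :: "real \<Rightarrow> 'a :: topological_space"
  assumes "continuous_on {0<..} \<phi>"
  shows "\<phi> \<in> borel_measurable dt_over_t"
  using borel_measurable_continuous_on_restrict[OF assms] measurable_cong_sets[OF sets_dt_over_t refl] by blast

lemma L2_cong:
  assumes "\<And>t. 0 < t \<Longrightarrow> \<phi> t = \<psi> t"
  shows "\<phi> \<in> L2 \<longleftrightarrow> \<psi> \<in> L2" "L2_norm \<phi> = L2_norm \<psi>"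
proof -
  have "\<phi> \<in> borel_measurable dt_over_t \<longleftrightarrow> \<psi> \<in> borel_measurable dt_over_t"
    by (rule measurable_cong) (use assms in auto)
  moreover have "integrable dt_over_t (\<lambda>t. (norm (\<phi> t))\<^sup>2) \<longleftrightarrow> integrable dt_over_t (\<lambda>t. (norm (\<psi> t))\<^sup>2)"
    by (rule Bochner_Integration.integrable_cong) (use assms in auto)
  ultimately show "\<phi> \<in> L2 \<longleftrightarrow> \<psi> \<in> L2" by (simp add: L2_def)
  have "(LINT t|dt_over_t. (norm (\<phi> t))\<^sup>2) = (LINT t|dt_over_t. (norm (\<psi> t))\<^sup>2)"
    by (rule Bochner_Integration.integral_cong) (use assms in auto)
  thus "L2_norm \<phi> = L2_norm \<psi>" by (simp add: L2_norm_def)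
qed

lemma nn_integral_dt_over_t_le:
  fixes g h :: "real \<Rightarrow> real"
  assumes g: "continuous_on {0<..} g" and h: "\<And>t. 0 < t \<Longrightarrow> 0 \<le> g t \<and> g t / t \<le> h t"
    and I: "(\<integral>\<^sup>+t. ennreal (h t) * indicator {0..} t \<partial>lborel) \<le> B"
  shows "(\<integral>\<^sup>+t. ennreal (g t) \<partial>dt_over_t) \<le> B"
proof -
  have m: "g \<in> borel_measurable (restrict_space lborel {0<..})"
    using continuous_measurable_dt_over_t[OF g] by (simp add: dt_over_t_def)
  have "(\<integral>\<^sup>+t. ennreal (g t) \<partial>dt_over_t) = (\<integral>\<^sup>+t. ennreal (1 / t) * ennreal (g t) \<partial>restrict_space lborel {0<..})"
    unfolding dt_over_t_def
  proof (rule nn_integral_density)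
    show "(\<lambda>t. ennreal (1 / t)) \<in> borel_measurable (restrict_space lborel {0<..})"
      by (intro measurable_restrict_space1) measurable
    show "(\<lambda>t. ennreal (g t)) \<in> borel_measurable (restrict_space lborel {0<..})" using m by measurable
  qed
  also have "\<dots> = (\<integral>\<^sup>+t. ennreal (1 / t) * ennreal (g t) * indicator {0<..} t \<partial>lborel)"
    by (rule nn_integral_restrict_space) simp
  also have "\<dots> \<le> (\<integral>\<^sup>+t. ennreal (h t) * indicator {0..} t \<partial>lborel)"
  proof (rule nn_integral_mono)
    fix t :: real
    show "ennreal (1 / t) * ennreal (g t) * indicator {0<..} t \<le> ennreal (h t) * indicator {0..} t"
    proof (cases "0 < t")
      case True
      have "ennreal (1 / t) * ennreal (g t) = ennreal (g t / t)" using True h by (simp add: ennreal_mult[symmetric])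
      also have "\<dots> \<le> ennreal (h t)" using h[OF True] by (intro ennreal_leI) auto
      finally show ?thesis using True by simp
    qed simp
  qed
  also note I
  finally show ?thesis .
qed

lemma nn_integral_inverse_powers:
  assumes a: "0 < a" and C: "0 \<le> C"
  shows "(\<integral>\<^sup>+t. ennreal (C / (a + t)\<^sup>2) * indicator {0..} t \<partial>lborel) = ennreal (C / a)"
    and "(\<integral>\<^sup>+t. ennreal (C / (a + t) ^ 3) * indicator {0..} t \<partial>lborel) = ennreal (C / (2 * a\<^sup>2))"
proof -
  have "(\<integral>\<^sup>+t. ennreal (C / (a + t)\<^sup>2) * indicator {0..} t \<partial>lborel) = ennreal (0 - (- C / (a + 0)))"
  proof (rule nn_integral_FTC_atLeast)
    fix x :: real assume x: "0 \<le> x"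
    show "((\<lambda>t. - C / (a + t)) has_real_derivative C / (a + x)\<^sup>2) (at x)"
      using a x by (auto intro!: derivative_eq_intros simp: power2_eq_square)
    show "0 \<le> C / (a + x)\<^sup>2" using C by simp
  next
    show "((\<lambda>t. - C / (a + t)) \<longlongrightarrow> 0) at_top" by real_asymp
  qed measurable
  thus "(\<integral>\<^sup>+t. ennreal (C / (a + t)\<^sup>2) * indicator {0..} t \<partial>lborel) = ennreal (C / a)" by simp
  have "(\<integral>\<^sup>+t. ennreal (C / (a + t) ^ 3) * indicator {0..} t \<partial>lborel) = ennreal (0 - (- (C / 2) / (a + 0)\<^sup>2))"
  proof (rule nn_integral_FTC_atLeast)
    fix x :: real assume x: "0 \<le> x"
    show "((\<lambda>t. - (C / 2) / (a + t)\<^sup>2) has_real_derivative C / (a + x) ^ 3) (at x)"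
      using a x by (auto intro!: derivative_eq_intros simp: eval_nat_numeral divide_simps)
    show "0 \<le> C / (a + x) ^ 3" using C a x by simp
  next
    show "((\<lambda>t. - (C / 2) / (a + t)\<^sup>2) \<longlongrightarrow> 0) at_top" by real_asymp
  qed measurable
  thus "(\<integral>\<^sup>+t. ennreal (C / (a + t) ^ 3) * indicator {0..} t \<partial>lborel) = ennreal (C / (2 * a\<^sup>2))" by simp
qed

section \<open>The square function on square summable sequences\<close>

lemma lap_minus: "(\<And>k. \<phi> (- k) = \<phi> k) \<Longrightarrow> lap \<phi> (- k) = lap \<phi> k"
proof -
  assume e: "\<And>k. \<phi> (- k) = \<phi> k"
  have "\<phi> (- k - 1) = \<phi> (k + 1)" "\<phi> (- k + 1) = \<phi> (k - 1)" using e[of "k + 1"] e[of "k - 1"] by simp_all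
  thus ?thesis using e[of k] by (simp add: lap_def)
qed

lemma lap_lap_deriv:
  "((\<lambda>t. lap (heat_kernel (2 * t)) k) has_real_derivative 2 * lap (lap (heat_kernel (2 * t))) k) (at t)"
proof -
  have d: "((\<lambda>t. heat_kernel (2 * t) k) has_real_derivative lap (heat_kernel (2 * t)) k * 2) (at t)" for k
    by (rule DERIV_chain2[OF heat_kernel_deriv]) (auto intro!: derivative_eq_intros)
  show ?thesis unfolding lap_def[of "heat_kernel _"] lap_def[of "lap _"]
    by (rule derivative_eq_intros d refl | simp add: lap_def algebra_simps)+
qed

text \<open>
The Laplacian is applied to the semigroup law in \<open>a\<close> and in \<open>b\<close>.
\<close>

lemma lap_heat_kernel_semigroup:
  assumes t: "0 \<le> t"
  shows "((\<lambda>n. lap (heat_kernel t) (n - a) * lap (heat_kernel t) (n - b)) has_sum lap (lap (heat_kernel (2 * t))) (a - b)) UNIV"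
proof -
  have *: "((\<lambda>n. lap (heat_kernel t) (n - a) * heat_kernel t (n - b)) has_sum lap (heat_kernel (2 * t)) (a - b)) UNIV" for a b
  proof -
    have "((\<lambda>n. heat_kernel t (n - (a + 1)) * heat_kernel t (n - b) + (- 2) * (heat_kernel t (n - a) * heat_kernel t (n - b)) + heat_kernel t (n - (a - 1)) * heat_kernel t (n - b))
       has_sum (heat_kernel (2 * t) (a + 1 - b) + (- 2) * heat_kernel (2 * t) (a - b) + heat_kernel (2 * t) (a - 1 - b))) UNIV"
      by (intro has_sum_add has_sum_cmult_right heat_kernel_semigroup t)
    thus ?thesis by (simp add: lap_def algebra_simps)
  qed
  have "((\<lambda>n. lap (heat_kernel t) (n - a) * heat_kernel t (n - (b + 1)) + (- 2) * (lap (heat_kernel t) (n - a) * heat_kernel t (n - b)) + lap (heat_kernel t) (n - a) * heat_kernel t (n - (b - 1)))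
       has_sum (lap (heat_kernel (2 * t)) (a - (b + 1)) + (- 2) * lap (heat_kernel (2 * t)) (a - b) + lap (heat_kernel (2 * t)) (a - (b - 1)))) UNIV"
    by (intro has_sum_add has_sum_cmult_right * t)
  thus ?thesis by (simp add: lap_def algebra_simps)
qed

text \<open>
The form \<open>\<langle>\<phi> * f, f\<rangle>\<close>, for a finitely supported \<open>f\<close> and a convolution kernel \<open>\<phi>\<close>.
\<close>

definition quad_form :: "int set \<Rightarrow> (int \<Rightarrow> complex) \<Rightarrow> (int \<Rightarrow> real) \<Rightarrow> real" where
  "quad_form S f \<phi> = (\<Sum>(m, m')\<in>S \<times> S. (f m \<bullet> f m') * \<phi> (m - m'))"

text \<open>
The sum over all \<open>n\<close> equals the right-hand side, by expanding the square and the semigroup law.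
\<close>

lemma dheat_l2_sum_le:
  assumes S: "finite S" "\<And>x. x \<notin> S \<Longrightarrow> f x = 0" and F: "finite F" and t: "0 \<le> t"
  shows "(\<Sum>n\<in>F. (norm (dheat t f n))\<^sup>2) \<le> quad_form S f (lap (lap (heat_kernel (2 * t))))"
proof -
  have d: "dheat t f n = (\<Sum>m\<in>S. lap (heat_kernel t) (n - m) *\<^sub>R f m)" for n
  proof -
    have "dheat t f n = (\<Sum>\<^sub>\<infinity>m\<in>S. lap (heat_kernel t) (n - m) *\<^sub>R f m)"
      unfolding dheat_def by (rule infsum_cong_neutral) (use S(2) in auto)
    thus ?thesis using S(1) by simp
  qed
  have sq: "(norm (dheat t f n))\<^sup>2 = (\<Sum>p\<in>S \<times> S. (f (fst p) \<bullet> f (snd p)) * (lap (heat_kernel t) (n - fst p) * lap (heat_kernel t) (n - snd p)))" for n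
    unfolding d power2_norm_eq_inner inner_sum_left inner_sum_right sum.cartesian_product
    by (rule sum.cong) (auto simp: mult_ac inner_commute)
  have hs: "((\<lambda>n. (norm (dheat t f n))\<^sup>2) has_sum (\<Sum>p\<in>S \<times> S. (f (fst p) \<bullet> f (snd p)) * lap (lap (heat_kernel (2 * t))) (fst p - snd p))) UNIV"
    unfolding sq using S(1) by (intro has_sum_finite_sum has_sum_cmult_right lap_heat_kernel_semigroup t) auto
  have e: "quad_form S f (lap (lap (heat_kernel (2 * t)))) = (\<Sum>p\<in>S \<times> S. (f (fst p) \<bullet> f (snd p)) * lap (lap (heat_kernel (2 * t))) (fst p - snd p))"
    by (simp add: quad_form_def case_prod_beta)
  show ?thesis unfolding e
    by (rule has_sum_mono2[OF has_sum_finite[OF F] hs]) auto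
qed

text \<open>
With \<open>\<psi> t = \<langle>K\<^sub>2\<^sub>t * f, f\<rangle>\<close> the integrand is \<open>t \<psi>''(t) / 4\<close>, which has the antiderivative \<open>(t \<psi>'(t) - \<psi>(t)) / 4\<close>. The latter vanishes at
infinity by the decay of the kernel in \<open>t\<close> and equals \<open>- |f|\<^sup>2 / 4\<close> at \<open>0\<close>, since \<open>K\<^sub>0\<close> is the unit mass at the origin.
\<close>

lemma quad_form_integral:
  assumes S: "finite S" and nn: "\<And>t. 0 \<le> t \<Longrightarrow> 0 \<le> quad_form S f (lap (lap (heat_kernel (2 * t))))"
  shows "(\<integral>\<^sup>+t. ennreal (t * quad_form S f (lap (lap (heat_kernel (2 * t))))) * indicator {0..} t \<partial>lborel)
     = ennreal ((\<Sum>m\<in>S. (norm (f m))\<^sup>2) / 4)"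
proof -
  define \<psi> where "\<psi> t = quad_form S f (heat_kernel (2 * t))" for t
  define \<psi>' where "\<psi>' t = 2 * quad_form S f (lap (heat_kernel (2 * t)))" for t
  define \<Psi> where "\<Psi> t = (t * \<psi>' t - \<psi> t) / 4" for t
  have d1: "(\<psi> has_real_derivative \<psi>' t) (at t)" for t
  proof -
    have d: "((\<lambda>t. heat_kernel (2 * t) k) has_real_derivative lap (heat_kernel (2 * t)) k * 2) (at t)" for k
      by (rule DERIV_chain2[OF heat_kernel_deriv]) (auto intro!: derivative_eq_intros)
    have "((\<lambda>t. \<Sum>p\<in>S \<times> S. (f (fst p) \<bullet> f (snd p)) * heat_kernel (2 * t) (fst p - snd p)) has_real_derivative
        (\<Sum>p\<in>S \<times> S. (f (fst p) \<bullet> f (snd p)) * (lap (heat_kernel (2 * t)) (fst p - snd p) * 2))) (at t)"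
      by (intro DERIV_sum DERIV_cmult d)
    moreover have "\<psi> = (\<lambda>t. \<Sum>p\<in>S \<times> S. (f (fst p) \<bullet> f (snd p)) * heat_kernel (2 * t) (fst p - snd p))"
      by (simp add: \<psi>_def quad_form_def case_prod_beta fun_eq_iff)
    moreover have "\<psi>' t = (\<Sum>p\<in>S \<times> S. (f (fst p) \<bullet> f (snd p)) * (lap (heat_kernel (2 * t)) (fst p - snd p) * 2))"
      by (simp add: \<psi>'_def quad_form_def case_prod_beta sum_distrib_left mult_ac)
    ultimately show ?thesis by simp
  qed
  have d2: "(\<psi>' has_real_derivative 4 * quad_form S f (lap (lap (heat_kernel (2 * t))))) (at t)" for t
  proof -
    have "((\<lambda>t. 2 * (\<Sum>p\<in>S \<times> S. (f (fst p) \<bullet> f (snd p)) * lap (heat_kernel (2 * t)) (fst p - snd p))) has_real_derivative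
        2 * (\<Sum>p\<in>S \<times> S. (f (fst p) \<bullet> f (snd p)) * (2 * lap (lap (heat_kernel (2 * t))) (fst p - snd p)))) (at t)"
      by (intro DERIV_sum DERIV_cmult lap_lap_deriv)
    moreover have "\<psi>' = (\<lambda>t. 2 * (\<Sum>p\<in>S \<times> S. (f (fst p) \<bullet> f (snd p)) * lap (heat_kernel (2 * t)) (fst p - snd p)))"
      by (simp add: \<psi>'_def quad_form_def case_prod_beta fun_eq_iff)
    moreover have "4 * quad_form S f (lap (lap (heat_kernel (2 * t)))) = 2 * (\<Sum>p\<in>S \<times> S. (f (fst p) \<bullet> f (snd p)) * (2 * lap (lap (heat_kernel (2 * t))) (fst p - snd p)))"
      by (simp add: quad_form_def case_prod_beta sum_distrib_left mult_ac)
    ultimately show ?thesis by (simp only:)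
  qed
  have lim0: "((\<lambda>t. heat_kernel (2 * t) k) \<longlongrightarrow> 0) at_top" for k
  proof (rule Lim_null_comparison)
    show "eventually (\<lambda>t. norm (heat_kernel (2 * t) k) \<le> 1 / (2 * sqrt (2 * t))) at_top"
      using eventually_gt_at_top[of 0] by eventually_elim (use heat_kernel_le_sqrt heat_kernel_nonneg in auto)
    show "((\<lambda>t::real. 1 / (2 * sqrt (2 * t))) \<longlongrightarrow> 0) at_top" by real_asymp
  qed
  have lim1: "((\<lambda>t. t * lap (heat_kernel (2 * t)) k) \<longlongrightarrow> 0) at_top" for k
  proof (rule Lim_null_comparison)
    define c where "c = 2 * (of_int k :: real)\<^sup>2"
    show "eventually (\<lambda>t. norm (t * lap (heat_kernel (2 * t)) k) \<le> t * (c / (2 * t)\<^sup>2 + 1 / (2 * t)) * (1 / (2 * sqrt (2 * t)))) at_top"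
      using eventually_gt_at_top[of 0]
    proof eventually_elim
      case (elim t)
      have "\<bar>lap (heat_kernel (2 * t)) k\<bar> \<le> (c / (2 * t)\<^sup>2 + 1 / (2 * t)) * heat_kernel (2 * t) k"
        unfolding c_def using elim by (intro heat_kernel_lap_le) auto
      also have "\<dots> \<le> (c / (2 * t)\<^sup>2 + 1 / (2 * t)) * (1 / (2 * sqrt (2 * t)))"
        using elim by (intro mult_left_mono heat_kernel_le_sqrt) (auto simp: c_def)
      finally have "\<bar>lap (heat_kernel (2 * t)) k\<bar> \<le> \<dots>" .
      from mult_left_mono[OF this, of t] show ?case using elim by (simp add: abs_mult mult_ac)
    qed
    show "((\<lambda>t::real. t * (c / (2 * t)\<^sup>2 + 1 / (2 * t)) * (1 / (2 * sqrt (2 * t)))) \<longlongrightarrow> 0) at_top" by real_asymp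
  qed
  have q0: "((\<lambda>t. quad_form S f (\<phi> t)) \<longlongrightarrow> 0) at_top" if "\<And>k. ((\<lambda>t. \<phi> t k) \<longlongrightarrow> 0) at_top" for \<phi> :: "real \<Rightarrow> int \<Rightarrow> real"
    unfolding quad_form_def case_prod_beta by (intro tendsto_null_sum tendsto_mult_right_zero) (rule that)
  have tq: "t * \<psi>' t = 2 * quad_form S f (\<lambda>k. t * lap (heat_kernel (2 * t)) k)" for t
    by (simp add: \<psi>'_def quad_form_def case_prod_beta sum_distrib_left mult_ac)
  have lim: "(\<Psi> \<longlongrightarrow> 0) at_top"
  proof -
    have "((\<lambda>t. (2 * quad_form S f (\<lambda>k. t * lap (heat_kernel (2 * t)) k) - \<psi> t) / 4) \<longlongrightarrow> (2 * 0 - 0) / 4) at_top"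
      unfolding \<psi>_def by (intro tendsto_intros q0 lim0 lim1) auto
    thus ?thesis unfolding \<Psi>_def tq by simp
  qed
  have d: "(\<Psi> has_real_derivative t * quad_form S f (lap (lap (heat_kernel (2 * t))))) (at t)" for t
    unfolding \<Psi>_def by (rule derivative_eq_intros d1 d2 refl | simp)+
  have cont: "continuous_on UNIV (\<lambda>t. quad_form S f (lap (lap (heat_kernel (2 * t)))))"
    unfolding quad_form_def case_prod_beta lap_def
    by (intro continuous_intros continuous_on_compose2[OF heat_kernel_continuous[of UNIV]]) auto
  have "(\<integral>\<^sup>+t. ennreal (t * quad_form S f (lap (lap (heat_kernel (2 * t))))) * indicator {0..} t \<partial>lborel) = ennreal (0 - \<Psi> 0)"
  proof (rule nn_integral_FTC_atLeast)
    show "(\<lambda>t. t * quad_form S f (lap (lap (heat_kernel (2 * t))))) \<in> borel_measurable borel"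
      using cont by (intro borel_measurable_times borel_measurable_continuous_onI) auto
  qed (use d nn lim in auto)
  also have "0 - \<Psi> 0 = (\<Sum>m\<in>S. (norm (f m))\<^sup>2) / 4"
  proof -
    have "\<psi> 0 = (\<Sum>m\<in>S. \<Sum>m'\<in>S. if m = m' then f m \<bullet> f m' else 0)"
      unfolding \<psi>_def quad_form_def sum.cartesian_product by (rule sum.cong) (auto simp: heat_kernel_0)
    also have "\<dots> = (\<Sum>m\<in>S. (norm (f m))\<^sup>2)" using S by (simp add: power2_norm_eq_inner)
    finally show ?thesis by (simp add: \<Psi>_def)
  qed
  finally show ?thesis .
qed

lemma t_dheat_l2:
  assumes S: "finite S" "\<And>x. x \<notin> S \<Longrightarrow> f x = 0" and F: "finite F"
  shows "(\<integral>\<^sup>+t. ennreal (\<Sum>n\<in>F. (norm (t *\<^sub>R dheat t f n))\<^sup>2) \<partial>dt_over_t) \<le> ennreal ((\<Sum>m\<in>S. (norm (f m))\<^sup>2) / 4)"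
proof (rule nn_integral_dt_over_t_le)
  have f: "admissible f"
    by (rule admissible_finite, rule finite_subset[OF _ S(1)]) (use S(2) in auto)
  show "continuous_on {0<..} (\<lambda>t. \<Sum>n\<in>F. (norm (t *\<^sub>R dheat t f n))\<^sup>2)"
    by (intro continuous_intros continuous_on_subset[OF continuous_on_dheat[OF f]]) auto
  fix t :: real assume t: "0 < t"
  have "(\<Sum>n\<in>F. (norm (t *\<^sub>R dheat t f n))\<^sup>2) / t = t * (\<Sum>n\<in>F. (norm (dheat t f n))\<^sup>2)"
    using t by (simp add: sum_divide_distrib sum_distrib_left power_mult_distrib power2_eq_square mult_ac)
  also have "\<dots> \<le> t * quad_form S f (lap (lap (heat_kernel (2 * t))))"
    using t by (intro mult_left_mono dheat_l2_sum_le[OF S F]) auto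
  finally show "0 \<le> (\<Sum>n\<in>F. (norm (t *\<^sub>R dheat t f n))\<^sup>2) \<and>
     (\<Sum>n\<in>F. (norm (t *\<^sub>R dheat t f n))\<^sup>2) / t \<le> t * quad_form S f (lap (lap (heat_kernel (2 * t))))"
    by (simp add: sum_nonneg)
next
  have "0 \<le> quad_form S f (lap (lap (heat_kernel (2 * t))))" if "0 \<le> t" for t
    using dheat_l2_sum_le[of S f "{}" t] S that by simp
  from quad_form_integral[OF S(1) this]
  show "(\<integral>\<^sup>+t. ennreal (t * quad_form S f (lap (lap (heat_kernel (2 * t))))) * indicator {0..} t \<partial>lborel) \<le> ennreal ((\<Sum>m\<in>S. (norm (f m))\<^sup>2) / 4)"
    by simp
qed

lemma dheat_measurable:
  assumes "admissible f"
  shows "(\<lambda>t. t *\<^sub>R dheat t f n) \<in> borel_measurable dt_over_t"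
  by (intro continuous_measurable_dt_over_t continuous_intros continuous_on_subset[OF continuous_on_dheat[OF assms]]) auto

lemma t_dheat_L2_l2:
  assumes S: "finite S" "\<And>x. x \<notin> S \<Longrightarrow> f x = 0" and F: "finite F"
  shows "\<And>n. (\<lambda>t. t *\<^sub>R dheat t f n) \<in> L2"
    and "(\<Sum>n\<in>F. (L2_norm (\<lambda>t. t *\<^sub>R dheat t f n))\<^sup>2) \<le> (\<Sum>m\<in>S. (norm (f m))\<^sup>2) / 4"
proof -
  have f: "admissible f"
    by (rule admissible_finite, rule finite_subset[OF _ S(1)]) (use S(2) in auto)
  define B where "B = (\<Sum>m\<in>S. (norm (f m))\<^sup>2) / 4"
  have B: "0 \<le> B" by (simp add: B_def sum_nonneg)
  show L: "(\<lambda>t. t *\<^sub>R dheat t f n) \<in> L2" for n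
  proof (rule L2_I(1))
    show "(\<integral>\<^sup>+t. ennreal ((norm (t *\<^sub>R dheat t f n))\<^sup>2) \<partial>dt_over_t) \<le> ennreal ((sqrt B)\<^sup>2)"
      using t_dheat_l2[of S f "{n}"] S B by (simp add: B_def)
  qed (use B in \<open>auto intro: dheat_measurable f\<close>)
  have "ennreal (\<Sum>n\<in>F. (L2_norm (\<lambda>t. t *\<^sub>R dheat t f n))\<^sup>2) = (\<Sum>n\<in>F. ennreal ((L2_norm (\<lambda>t. t *\<^sub>R dheat t f n))\<^sup>2))"
    by (rule sum_ennreal[symmetric]) simp
  also have "\<dots> = (\<Sum>n\<in>F. \<integral>\<^sup>+t. ennreal ((norm (t *\<^sub>R dheat t f n))\<^sup>2) \<partial>dt_over_t)"
    by (rule sum.cong) (simp_all only: L2_nn_integral[OF L])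
  also have "\<dots> = (\<integral>\<^sup>+t. (\<Sum>n\<in>F. ennreal ((norm (t *\<^sub>R dheat t f n))\<^sup>2)) \<partial>dt_over_t)"
    by (rule nn_integral_sum[symmetric]) (use dheat_measurable[OF f] in measurable)
  also have "\<dots> = (\<integral>\<^sup>+t. ennreal (\<Sum>n\<in>F. (norm (t *\<^sub>R dheat t f n))\<^sup>2) \<partial>dt_over_t)"
    by (simp add: sum_ennreal)
  also have "\<dots> \<le> ennreal B" unfolding B_def using S F by (rule t_dheat_l2)
  finally show "(\<Sum>n\<in>F. (L2_norm (\<lambda>t. t *\<^sub>R dheat t f n))\<^sup>2) \<le> (\<Sum>m\<in>S. (norm (f m))\<^sup>2) / 4"
    using B by (simp add: B_def)
qed

section \<open>The kernels of the three operators\<close>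

lemma heat_delta: "heat t (delta m) n = of_real (heat_kernel t (n - m))"
proof -
  have "heat t (delta m) n = (\<Sum>\<^sub>\<infinity>k\<in>{m}. heat_kernel t (n - k) *\<^sub>R delta m k)"
    unfolding heat_def by (rule infsum_cong_neutral) (auto simp: delta_def)
  thus ?thesis by (simp add: delta_def scaleR_conv_of_real)
qed

lemma dheat_delta: "dheat t (delta m) n = of_real (lap (heat_kernel t) (n - m))"
proof -
  have "dheat t (delta m) n = (\<Sum>\<^sub>\<infinity>k\<in>{m}. lap (heat_kernel t) (n - k) *\<^sub>R delta m k)"
    unfolding dheat_def by (rule infsum_cong_neutral) (auto simp: delta_def)
  thus ?thesis by (simp add: delta_def scaleR_conv_of_real)
qed

text \<open>
Evenness of the kernel, which reduces the regularity in the first variable to that in the second.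
\<close>

lemma heat_delta_commute: "heat t (delta m) n = heat t (delta n) m"
  using heat_kernel_minus[of t "n - m"] by (simp add: heat_delta)

lemma poisson_delta_commute: "poisson t (delta m) n = poisson t (delta n) m"
  unfolding poisson_def by (subst heat_delta_commute) (rule refl)

lemma heat_kernel_regular:
  obtains C where "0 < C" "\<And>t j l. 0 \<le> t \<Longrightarrow> 2 * \<bar>j - l\<bar> < \<bar>l\<bar> \<Longrightarrow>
    \<bar>heat_kernel t j - heat_kernel t l\<bar> \<le> C * of_int \<bar>j - l\<bar> / (of_int l)\<^sup>2"
proof -
  obtain C where C: "0 < C" "\<And>t k. 0 \<le> t \<Longrightarrow> 1 \<le> k \<Longrightarrow> \<bar>heat_kernel t k - heat_kernel t (k + 1)\<bar> \<le> C / (of_int k)\<^sup>2"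
    by (rule heat_kernel_grad) blast
  have "\<bar>heat_kernel t j - heat_kernel t l\<bar> \<le> 4 * C * of_int \<bar>j - l\<bar> / (of_int l)\<^sup>2"
    if "0 \<le> t" "2 * \<bar>j - l\<bar> < \<bar>l\<bar>" for t j l
  proof (rule telescope_regularity[of "\<lambda>j l. \<bar>heat_kernel t j - heat_kernel t l\<bar>"])
    show "\<bar>heat_kernel t i - heat_kernel t (i + 1)\<bar> \<le> C / (of_int i)\<^sup>2" if "1 \<le> i" for i
      using C(2)[OF \<open>0 \<le> t\<close> that] .
  qed (use C(1) \<open>2 * \<bar>j - l\<bar> < \<bar>l\<bar>\<close> in \<open>auto simp: heat_kernel_minus abs_minus_commute\<close>)
  with C(1) show thesis by (intro that[of "4 * C"]) auto
qed

lemma Linf_norm_eq_0: "(\<And>t. 0 \<le> t \<Longrightarrow> \<phi> t = 0) \<Longrightarrow> Linf_norm \<phi> = 0"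
proof -
  assume z: "\<And>t. 0 \<le> t \<Longrightarrow> \<phi> t = 0"
  have "(\<lambda>t. norm (\<phi> t)) ` {0..} = {0 :: real}" using z by (auto simp: image_iff intro!: bexI[of _ 0])
  thus ?thesis unfolding Linf_norm_def by simp
qed

text \<open>
The pointwise bounds of the kernel are uniform in \<open>t\<close>; for the Poisson semigroup they are averaged by \<open>poisson_norm_le\<close>.
\<close>

lemma kernel_operator_heat: "\<exists>C. kernel_operator Linf Linf_norm (\<lambda>f n t. heat t f n) C"
  and kernel_operator_poisson: "\<exists>C. kernel_operator Linf Linf_norm (\<lambda>f n t. poisson t f n) C"
proof -
  interpret complex_banach fscale Linf Linf_norm by (rule complex_banach_Linf)
  obtain C where C: "0 < C" "\<And>t j l. 0 \<le> t \<Longrightarrow> 2 * \<bar>j - l\<bar> < \<bar>l\<bar> \<Longrightarrow>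
    \<bar>heat_kernel t j - heat_kernel t l\<bar> \<le> C * of_int \<bar>j - l\<bar> / (of_int l)\<^sup>2"
    by (rule heat_kernel_regular) blast
  define D where "D = max 1 C"
  have D: "1 \<le> D" "C \<le> D" by (auto simp: D_def)
  have size: "weighted_sum f n \<le> D * weighted_sum f n" for f n
    using mult_right_mono[OF D(1) weighted_sum_nonneg[of f n]] by simp
  have hreg: "norm (heat t (delta m) n - heat t (delta m') n) \<le> D * of_int \<bar>m - m'\<bar> / (of_int (n - m))\<^sup>2"
    if "0 \<le> t" "2 * \<bar>m - m'\<bar> < \<bar>n - m\<bar>" for t n m m'
  proof -
    have e: "\<bar>(n - m') - (n - m)\<bar> = \<bar>m - m'\<bar>" by simp
    have "norm (heat t (delta m) n - heat t (delta m') n) = \<bar>heat_kernel t (n - m') - heat_kernel t (n - m)\<bar>"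
      unfolding heat_delta of_real_diff[symmetric] norm_of_real by (rule abs_minus_commute)
    also have "\<dots> \<le> C * of_int \<bar>m - m'\<bar> / (of_int (n - m))\<^sup>2"
      using C(2)[OF that(1), of "n - m'" "n - m"] that(2) unfolding e by blast
    also have "\<dots> \<le> D * of_int \<bar>m - m'\<bar> / (of_int (n - m))\<^sup>2"
      by (intro divide_right_mono mult_right_mono D) auto
    finally show ?thesis .
  qed
  have preg: "norm (poisson t (delta m) n - poisson t (delta m') n) \<le> D * of_int \<bar>m - m'\<bar> / (of_int (n - m))\<^sup>2"
    if "2 * \<bar>m - m'\<bar> < \<bar>n - m\<bar>" for t n m m'
  proof -
    have "poisson t (delta m) n - poisson t (delta m') n = poisson t (\<lambda>k. 1 * delta m k + (- 1) * delta m' k) n"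
      by (simp only: poisson_linear[OF admissible_delta admissible_delta]) simp
    also have "norm \<dots> \<le> D * of_int \<bar>m - m'\<bar> / (of_int (n - m))\<^sup>2"
    proof (rule poisson_norm_le)
      show "admissible (\<lambda>k. 1 * delta m k + (- 1) * delta m' k)" by (intro admissible_add admissible_scale admissible_delta)
      fix s :: real assume s: "0 \<le> s"
      have "heat s (\<lambda>k. 1 * delta m k + (- 1) * delta m' k) n = heat s (delta m) n - heat s (delta m') n"
        by (simp only: heat_linear[OF admissible_delta admissible_delta s]) simp
      thus "norm (heat s (\<lambda>k. 1 * delta m k + (- 1) * delta m' k) n) \<le> D * of_int \<bar>m - m'\<bar> / (of_int (n - m))\<^sup>2"
        using hreg[OF s that] by (simp only:)
    qed
    finally show ?thesis .
  qed
  have "kernel_operator Linf Linf_norm (\<lambda>f n t. heat t f n) D"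
  proof unfold_locales
    fix f :: "int \<Rightarrow> complex" and n :: int assume f: "admissible f"
    show "(\<lambda>t. heat t f n) \<in> Linf" by (rule heat_Linf[OF f])
    show "Linf_norm (\<lambda>t. heat t f n) \<le> D * weighted_sum f n"
      by (rule order_trans[OF Linf_norm_le size]) (rule heat_norm_le[OF f])
  next
    fix f g :: "int \<Rightarrow> complex" and a b n assume fg: "admissible f" "admissible g"
    show "Linf_norm ((\<lambda>t. heat t (\<lambda>m. a * f m + b * g m) n) - (fscale a (\<lambda>t. heat t f n) + fscale b (\<lambda>t. heat t g n))) = 0"
      by (rule Linf_norm_eq_0) (simp add: fscale_def heat_linear[OF fg])
  next
    fix m m' n :: int assume "2 * \<bar>m - m'\<bar> < \<bar>n - m\<bar>"
    hence *: "Linf_norm ((\<lambda>t. heat t (delta m) n) - (\<lambda>t. heat t (delta m') n)) \<le> D * of_int \<bar>m - m'\<bar> / (of_int (n - m))\<^sup>2"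
      by (intro Linf_norm_le) (simp only: fun_diff_def hreg)
    thus "Linf_norm ((\<lambda>t. heat t (delta m) n) - (\<lambda>t. heat t (delta m') n)) \<le> D * of_int \<bar>m - m'\<bar> / (of_int (n - m))\<^sup>2" .
    show "Linf_norm ((\<lambda>t. heat t (delta n) m) - (\<lambda>t. heat t (delta n) m')) \<le> D * of_int \<bar>m - m'\<bar> / (of_int (n - m))\<^sup>2"
      using * unfolding heat_delta_commute[of _ n] .
  qed (use D in auto)
  thus "\<exists>C. kernel_operator Linf Linf_norm (\<lambda>f n t. heat t f n) C" ..
  have "kernel_operator Linf Linf_norm (\<lambda>f n t. poisson t f n) D"
  proof unfold_locales
    fix f :: "int \<Rightarrow> complex" and n :: int assume f: "admissible f"
    show "(\<lambda>t. poisson t f n) \<in> Linf" by (rule poisson_Linf[OF f])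
    show "Linf_norm (\<lambda>t. poisson t f n) \<le> D * weighted_sum f n"
      by (rule order_trans[OF Linf_norm_le size]) (rule poisson_norm_le[OF f heat_norm_le[OF f]])
  next
    fix f g :: "int \<Rightarrow> complex" and a b n assume fg: "admissible f" "admissible g"
    show "Linf_norm ((\<lambda>t. poisson t (\<lambda>m. a * f m + b * g m) n) - (fscale a (\<lambda>t. poisson t f n) + fscale b (\<lambda>t. poisson t g n))) = 0"
      by (rule Linf_norm_eq_0) (simp add: fscale_def poisson_linear[OF fg])
  next
    fix m m' n :: int assume "2 * \<bar>m - m'\<bar> < \<bar>n - m\<bar>"
    hence *: "Linf_norm ((\<lambda>t. poisson t (delta m) n) - (\<lambda>t. poisson t (delta m') n)) \<le> D * of_int \<bar>m - m'\<bar> / (of_int (n - m))\<^sup>2"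
      by (intro Linf_norm_le) (simp only: fun_diff_def preg)
    thus "Linf_norm ((\<lambda>t. poisson t (delta m) n) - (\<lambda>t. poisson t (delta m') n)) \<le> D * of_int \<bar>m - m'\<bar> / (of_int (n - m))\<^sup>2" .
    show "Linf_norm ((\<lambda>t. poisson t (delta n) m) - (\<lambda>t. poisson t (delta n) m')) \<le> D * of_int \<bar>m - m'\<bar> / (of_int (n - m))\<^sup>2"
      using * unfolding poisson_delta_commute[of _ n] .
  qed (use D in auto)
  thus "\<exists>C. kernel_operator Linf Linf_norm (\<lambda>f n t. poisson t f n) C" ..
qed

text \<open>
The kernel of \<open>t \<partial>\<^sub>t W\<^sub>t\<close>, as a function of \<open>t\<close>.
\<close>

definition sq_kernel :: "int \<Rightarrow> real \<Rightarrow> complex" where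
  "sq_kernel k t = of_real (t * lap (heat_kernel t) k)"

lemma sq_kernel_eq: "t *\<^sub>R dheat t (delta m) n = sq_kernel (n - m) t"
  by (simp add: sq_kernel_def dheat_delta scaleR_conv_of_real)

lemma sq_kernel_minus: "sq_kernel (- k) = sq_kernel k"
proof -
  have "lap (heat_kernel t) (- k) = lap (heat_kernel t) k" for t by (rule lap_minus) (rule heat_kernel_minus)
  thus ?thesis by (simp add: sq_kernel_def fun_eq_iff)
qed

lemma sq_kernel_continuous: "continuous_on S (sq_kernel k)"
  unfolding sq_kernel_def by (intro continuous_intros lap_heat_kernel_continuous)

text \<open>
The kernel estimates exclude \<open>k = 0\<close>; the \<open>\<ell>\<^sup>2\<close> bound applied to a unit sequence covers all \<open>k\<close>.
\<close>

lemma sq_kernel_L2: "sq_kernel k \<in> L2"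
  using t_dheat_L2_l2(1)[of "{0}" "delta 0" "{}" k] by (simp add: delta_def sq_kernel_eq)

lemma sq_kernel_bounds:
  obtains C where "0 < C" "\<And>k. 1 \<le> k \<Longrightarrow> L2_norm (sq_kernel k) \<le> C / of_int k"
    "\<And>k. 1 \<le> k \<Longrightarrow> L2_norm (\<lambda>t. sq_kernel k t - sq_kernel (k + 1) t) \<le> C / (of_int k)\<^sup>2"
proof -
  obtain C where C: "0 < C"
    "\<And>t k. 0 < t \<Longrightarrow> 1 \<le> k \<Longrightarrow> t * (lap (heat_kernel t) k)\<^sup>2 \<le> C / ((of_int k)\<^sup>2 + t)\<^sup>2"
    "\<And>t k. 0 < t \<Longrightarrow> 1 \<le> k \<Longrightarrow> t * (lap (heat_kernel t) k - lap (heat_kernel t) (k + 1))\<^sup>2 \<le> C / ((of_int k)\<^sup>2 + t) ^ 3"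
    by (rule heat_kernel_lap_weighted) blast
  have C0: "0 \<le> C" using C(1) by simp
  have sqd: "(norm (sq_kernel k t - sq_kernel j t))\<^sup>2 = (t * (lap (heat_kernel t) k - lap (heat_kernel t) j))\<^sup>2" for k j t
    unfolding sq_kernel_def of_real_diff[symmetric] norm_of_real by (simp add: right_diff_distrib)
  have sq: "(norm (sq_kernel k t))\<^sup>2 = (t * lap (heat_kernel t) k)\<^sup>2" for k t
    unfolding sq_kernel_def norm_of_real by simp
  have div: "(t * x)\<^sup>2 / t = t * x\<^sup>2" if "0 < t" for t x :: real
    using that by (simp add: power2_eq_square)
  show thesis
  proof (rule that[of "sqrt C"])
    fix k :: int assume k: "1 \<le> k"
    hence k2: "0 < (of_int k :: real)\<^sup>2" by simp
    show "L2_norm (sq_kernel k) \<le> sqrt C / of_int k"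
    proof (rule L2_I(2))
      show "sq_kernel k \<in> borel_measurable dt_over_t" by (intro continuous_measurable_dt_over_t sq_kernel_continuous)
      show "(\<integral>\<^sup>+t. ennreal ((norm (sq_kernel k t))\<^sup>2) \<partial>dt_over_t) \<le> ennreal ((sqrt C / of_int k)\<^sup>2)"
      proof (rule nn_integral_dt_over_t_le)
        show "continuous_on {0<..} (\<lambda>t. (norm (sq_kernel k t))\<^sup>2)" by (intro continuous_intros sq_kernel_continuous)
        show "0 \<le> (norm (sq_kernel k t))\<^sup>2 \<and> (norm (sq_kernel k t))\<^sup>2 / t \<le> C / ((of_int k)\<^sup>2 + t)\<^sup>2" if "0 < t" for t
          unfolding sq div[OF that] using C(2)[OF that k] by simp
        show "(\<integral>\<^sup>+t. ennreal (C / ((of_int k)\<^sup>2 + t)\<^sup>2) * indicator {0..} t \<partial>lborel) \<le> ennreal ((sqrt C / of_int k)\<^sup>2)"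
          unfolding nn_integral_inverse_powers(1)[OF k2 C0] using C0 by (simp add: power_divide)
      qed
    qed (use k C0 in auto)
    show "L2_norm (\<lambda>t. sq_kernel k t - sq_kernel (k + 1) t) \<le> sqrt C / (of_int k)\<^sup>2"
    proof (rule L2_I(2))
      show "(\<lambda>t. sq_kernel k t - sq_kernel (k + 1) t) \<in> borel_measurable dt_over_t"
        by (intro continuous_measurable_dt_over_t continuous_intros sq_kernel_continuous)
      show "(\<integral>\<^sup>+t. ennreal ((norm (sq_kernel k t - sq_kernel (k + 1) t))\<^sup>2) \<partial>dt_over_t) \<le> ennreal ((sqrt C / (of_int k)\<^sup>2)\<^sup>2)"
      proof (rule nn_integral_dt_over_t_le)
        show "continuous_on {0<..} (\<lambda>t. (norm (sq_kernel k t - sq_kernel (k + 1) t))\<^sup>2)" by (intro continuous_intros sq_kernel_continuous)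
        show "0 \<le> (norm (sq_kernel k t - sq_kernel (k + 1) t))\<^sup>2 \<and> (norm (sq_kernel k t - sq_kernel (k + 1) t))\<^sup>2 / t \<le> C / ((of_int k)\<^sup>2 + t) ^ 3" if "0 < t" for t
          unfolding sqd div[OF that] using C(3)[OF that k] by simp
        have "C / (2 * ((of_int k)\<^sup>2)\<^sup>2) \<le> C / ((of_int k)\<^sup>2)\<^sup>2"
          using C0 k2 by (intro divide_left_mono) auto
        thus "(\<integral>\<^sup>+t. ennreal (C / ((of_int k)\<^sup>2 + t) ^ 3) * indicator {0..} t \<partial>lborel) \<le> ennreal ((sqrt C / (of_int k)\<^sup>2)\<^sup>2)"
          unfolding nn_integral_inverse_powers(2)[OF k2 C0] using C0 by (intro ennreal_leI) (simp add: power_divide)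
      qed
    qed (use k C0 in auto)
  qed (use C in auto)
qed

lemma L2_sum:
  assumes "\<And>m. x m \<in> L2"
  shows "(\<lambda>t. \<Sum>m\<in>S. c m * x m t) \<in> L2 \<and> L2_norm (\<lambda>t. \<Sum>m\<in>S. c m * x m t) \<le> (\<Sum>m\<in>S. norm (c m) * L2_norm (x m))"
proof (induction S rule: infinite_finite_induct)
  case (insert m S)
  have e: "(\<lambda>t. \<Sum>m\<in>insert m S. c m * x m t) = (\<lambda>t. c m * x m t + (\<Sum>m\<in>S. c m * x m t))"
    using insert.hyps by (simp add: fun_eq_iff)
  note a = L2_scale(1)[OF assms[of m], of "c m"]
  have "L2_norm (\<lambda>t. c m * x m t + (\<Sum>m\<in>S. c m * x m t)) \<le> norm (c m) * L2_norm (x m) + L2_norm (\<lambda>t. \<Sum>m\<in>S. c m * x m t)"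
    using L2_add(2)[OF a conjunct1[OF insert.IH]] unfolding L2_scale(2)[OF assms] .
  moreover have "(\<Sum>m\<in>insert m S. norm (c m) * L2_norm (x m)) = norm (c m) * L2_norm (x m) + (\<Sum>m\<in>S. norm (c m) * L2_norm (x m))"
    using insert.hyps by simp
  ultimately have "L2_norm (\<lambda>t. c m * x m t + (\<Sum>m\<in>S. c m * x m t)) \<le> (\<Sum>m\<in>insert m S. norm (c m) * L2_norm (x m))"
    using conjunct2[OF insert.IH] by linarith
  thus ?case unfolding e using L2_add(1)[OF a conjunct1[OF insert.IH]] by (rule conjI[rotated])
qed (auto simp: L2_def L2_norm_def)

text \<open>
Minkowski's inequality for the truncations of \<open>f\<close>, whose constant does not depend on the truncation, followed by Fatou's lemma.
\<close>

lemma t_dheat_size: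
  obtains C where "0 < C" "\<And>f n. admissible f \<Longrightarrow> (\<lambda>t. t *\<^sub>R dheat t f n) \<in> L2"
    "\<And>f n. admissible f \<Longrightarrow> L2_norm (\<lambda>t. t *\<^sub>R dheat t f n) \<le> C * weighted_sum f n"
proof -
  obtain C where C: "0 < C" "\<And>k. 1 \<le> k \<Longrightarrow> L2_norm (sq_kernel k) \<le> C / of_int k" by (rule sq_kernel_bounds) blast
  \<comment> \<open>the factor two passes from \<open>1 / k\<close> to \<open>1 / (1 + k)\<close>\<close>
  define C1 where "C1 = max (L2_norm (sq_kernel 0)) (2 * C)"
  have C1: "0 < C1" "L2_norm (sq_kernel 0) \<le> C1" "2 * C \<le> C1" using C by (auto simp: C1_def)
  have pos: "L2_norm (sq_kernel k) \<le> C1 / (1 + of_int k)" if "1 \<le> k" for k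
  proof -
    have "C / of_int k \<le> (2 * C) / (1 + of_int k)" using that C(1) by (simp add: field_simps)
    also have "\<dots> \<le> C1 / (1 + of_int k)" using that by (intro divide_right_mono C1) auto
    finally show ?thesis using C(2)[OF that] by simp
  qed
  have ker: "L2_norm (sq_kernel k) \<le> C1 / (1 + \<bar>of_int k\<bar>)" for k
  proof -
    consider "k = 0" | "1 \<le> k" | "1 \<le> - k" by linarith
    thus ?thesis using C1(2) pos[of k] pos[of "- k"] by cases (auto simp: sq_kernel_minus)
  qed
  have main: "(\<lambda>t. t *\<^sub>R dheat t f n) \<in> L2 \<and> L2_norm (\<lambda>t. t *\<^sub>R dheat t f n) \<le> C1 * weighted_sum f n" if f: "admissible f" for f n
  proof -
    define Z where "Z R = (\<lambda>t. \<Sum>m\<in>{- int R..int R}. f m * sq_kernel (n - m) t)" for R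
    have Z: "Z R \<in> L2" and Zn: "L2_norm (Z R) \<le> (\<Sum>m\<in>{- int R..int R}. norm (f m) * L2_norm (sq_kernel (n - m)))" for R
      unfolding Z_def using L2_sum[of "\<lambda>m. sq_kernel (n - m)", OF sq_kernel_L2] by blast+
    have Zb: "L2_norm (Z R) \<le> C1 * weighted_sum f n" for R
    proof -
      have "(\<Sum>m\<in>{- int R..int R}. norm (f m) * L2_norm (sq_kernel (n - m))) \<le> (\<Sum>m\<in>{- int R..int R}. norm (f m) * (C1 / (1 + \<bar>of_int (n - m)\<bar>)))"
        by (intro sum_mono mult_left_mono ker) auto
      also have "\<dots> = C1 * (\<Sum>m\<in>{- int R..int R}. norm (f m) / (1 + \<bar>of_int (n - m)\<bar>))"
        by (simp add: sum_distrib_left mult_ac)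
      also have "\<dots> \<le> C1 * weighted_sum f n" unfolding weighted_sum_def
        using C1(1) by (intro mult_left_mono finite_sum_le_infsum admissible_summable f) auto
      finally show ?thesis using Zn[of R] by (rule order_trans[rotated])
    qed
    have lim: "(\<lambda>R. Z R t) \<longlonglongrightarrow> t *\<^sub>R dheat t f n" if "0 < t" for t
    proof -
      have "((\<lambda>S. \<Sum>m\<in>S. lap (heat_kernel t) (n - m) *\<^sub>R f m) \<longlongrightarrow> dheat t f n) (finite_subsets_at_top UNIV)"
        using dheat_has_sum[OF f, of t n] that by (simp add: has_sum_def)
      from tendsto_scaleR[OF tendsto_const filterlim_compose[OF this filterlim_symmetric_intervals]]
      have "(\<lambda>R. t *\<^sub>R (\<Sum>m\<in>{- int R..int R}. lap (heat_kernel t) (n - m) *\<^sub>R f m)) \<longlonglongrightarrow> t *\<^sub>R dheat t f n" .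
      moreover have "Z R t = t *\<^sub>R (\<Sum>m\<in>{- int R..int R}. lap (heat_kernel t) (n - m) *\<^sub>R f m)" for R
        unfolding Z_def scaleR_sum_right by (rule sum.cong) (simp_all add: sq_kernel_def scaleR_conv_of_real mult_ac)
      ultimately show ?thesis by simp
    qed
    have ae: "AE t in dt_over_t. (\<lambda>R. Z R t) \<longlonglongrightarrow> t *\<^sub>R dheat t f n" by (rule AE_I2) (use lim in simp)
    have nn: "0 \<le> C1 * weighted_sum f n" using C1(1) weighted_sum_nonneg[of f n] by simp
    from L2_Fatou[OF Z always_eventually[OF allI[OF Zb]] nn dheat_measurable[OF f] ae] show ?thesis by blast
  qed
  show thesis by (rule that[OF C1(1)]) (use main in blast)+
qed

lemma kernel_operator_square: "\<exists>C. kernel_operator L2 L2_norm (\<lambda>f n t. t_dt_heat t f n) C"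
proof -
  interpret complex_banach fscale L2 L2_norm by (rule complex_banach_L2)
  obtain C where C: "0 < C" "\<And>f n. admissible f \<Longrightarrow> (\<lambda>t. t *\<^sub>R dheat t f n) \<in> L2"
    "\<And>f n. admissible f \<Longrightarrow> L2_norm (\<lambda>t. t *\<^sub>R dheat t f n) \<le> C * weighted_sum f n" by (rule t_dheat_size) blast
  obtain C' where C': "0 < C'" "\<And>k. 1 \<le> k \<Longrightarrow> L2_norm (\<lambda>t. sq_kernel k t - sq_kernel (k + 1) t) \<le> C' / (of_int k)\<^sup>2"
    by (rule sq_kernel_bounds) blast
  define D where "D = max C (4 * C')"
  have D: "0 \<le> D" "C \<le> D" "4 * C' \<le> D" using C(1) by (auto simp: D_def)
  have L2_zero: "L2_norm (\<lambda>t. 0) = 0" by (simp add: L2_norm_def)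
  have reg: "L2_norm (\<lambda>t. sq_kernel j t - sq_kernel l t) \<le> 4 * C' * of_int \<bar>j - l\<bar> / (of_int l)\<^sup>2"
    if "2 * \<bar>j - l\<bar> < \<bar>l\<bar>" for j l
  proof (rule telescope_regularity[of "\<lambda>j l. L2_norm (\<lambda>t. sq_kernel j t - sq_kernel l t)"])
    show "L2_norm (\<lambda>t. sq_kernel i t - sq_kernel j t) = L2_norm (\<lambda>t. sq_kernel j t - sq_kernel i t)" for i j
      unfolding L2_norm_def by (simp add: norm_minus_commute)
    show "L2_norm (\<lambda>t. sq_kernel i t - sq_kernel l t) \<le> L2_norm (\<lambda>t. sq_kernel i t - sq_kernel j t) + L2_norm (\<lambda>t. sq_kernel j t - sq_kernel l t)" for i j l
      using L2_add(2)[OF L2_diff[OF sq_kernel_L2 sq_kernel_L2] L2_diff[OF sq_kernel_L2 sq_kernel_L2], of i j j l] by simp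
  qed (use C' that in \<open>auto simp: L2_zero sq_kernel_minus\<close>)
  have td: "t_dt_heat t (delta m) n = sq_kernel (n - m) t" if "0 < t" for t n m
    by (simp add: t_dt_heat_eq[OF admissible_delta that] sq_kernel_eq)
  have R: "L2_norm ((\<lambda>t. t_dt_heat t (delta m) n) - (\<lambda>t. t_dt_heat t (delta m') n)) \<le> D * of_int \<bar>m - m'\<bar> / (of_int (n - m))\<^sup>2"
    if "2 * \<bar>m - m'\<bar> < \<bar>n - m\<bar>" for n m m'
  proof -
    have e: "\<bar>(n - m') - (n - m)\<bar> = \<bar>m - m'\<bar>" by simp
    have "L2_norm ((\<lambda>t. t_dt_heat t (delta m) n) - (\<lambda>t. t_dt_heat t (delta m') n)) = L2_norm (\<lambda>t. sq_kernel (n - m) t - sq_kernel (n - m') t)"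
      by (rule L2_cong(2)) (simp add: td)
    also have "\<dots> = L2_norm (\<lambda>t. sq_kernel (n - m') t - sq_kernel (n - m) t)"
      unfolding L2_norm_def by (simp add: norm_minus_commute)
    also have "\<dots> \<le> 4 * C' * of_int \<bar>m - m'\<bar> / (of_int (n - m))\<^sup>2"
      using reg[of "n - m'" "n - m"] that unfolding e by blast
    also have "\<dots> \<le> D * of_int \<bar>m - m'\<bar> / (of_int (n - m))\<^sup>2"
      by (intro divide_right_mono mult_right_mono D) auto
    finally show ?thesis .
  qed
  have "kernel_operator L2 L2_norm (\<lambda>f n t. t_dt_heat t f n) D"
  proof unfold_locales
    fix f :: "int \<Rightarrow> complex" and n :: int assume f: "admissible f"
    have e: "t_dt_heat t f n = t *\<^sub>R dheat t f n" if "0 < t" for t by (rule t_dt_heat_eq[OF f that])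
    show "(\<lambda>t. t_dt_heat t f n) \<in> L2"
      by (rule iffD2[OF L2_cong(1) C(2)[OF f]]) (rule e)
    have "L2_norm (\<lambda>t. t_dt_heat t f n) = L2_norm (\<lambda>t. t *\<^sub>R dheat t f n)"
      by (rule L2_cong(2)) (rule e)
    also have "\<dots> \<le> C * weighted_sum f n" by (rule C(3)[OF f])
    also have "\<dots> \<le> D * weighted_sum f n" by (intro mult_right_mono D weighted_sum_nonneg)
    finally show "L2_norm (\<lambda>t. t_dt_heat t f n) \<le> D * weighted_sum f n" .
  next
    fix f g :: "int \<Rightarrow> complex" and a b n assume fg: "admissible f" "admissible g"
    have "L2_norm ((\<lambda>t. t_dt_heat t (\<lambda>m. a * f m + b * g m) n) - (fscale a (\<lambda>t. t_dt_heat t f n) + fscale b (\<lambda>t. t_dt_heat t g n))) = L2_norm (\<lambda>t. 0)"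
    proof (rule L2_cong(2))
      fix t :: real assume t: "0 < t"
      show "((\<lambda>t. t_dt_heat t (\<lambda>m. a * f m + b * g m) n) - (fscale a (\<lambda>t. t_dt_heat t f n) + fscale b (\<lambda>t. t_dt_heat t g n))) t = 0"
        using t by (simp add: fscale_def t_dt_heat_eq fg admissible_add admissible_scale dheat_linear scaleR_conv_of_real algebra_simps)
    qed
    thus "L2_norm ((\<lambda>t. t_dt_heat t (\<lambda>m. a * f m + b * g m) n) - (fscale a (\<lambda>t. t_dt_heat t f n) + fscale b (\<lambda>t. t_dt_heat t g n))) = 0"
      by (simp only: L2_zero)
  next
    fix m m' n :: int assume far: "2 * \<bar>m - m'\<bar> < \<bar>n - m\<bar>"
    show "L2_norm ((\<lambda>t. t_dt_heat t (delta m) n) - (\<lambda>t. t_dt_heat t (delta m') n)) \<le> D * of_int \<bar>m - m'\<bar> / (of_int (n - m))\<^sup>2"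
      by (rule R[OF far])
    have "sq_kernel (m - n) = sq_kernel (n - m)" "sq_kernel (m' - n) = sq_kernel (n - m')"
      using sq_kernel_minus[of "n - m"] sq_kernel_minus[of "n - m'"] by simp_all
    hence "L2_norm ((\<lambda>t. t_dt_heat t (delta n) m) - (\<lambda>t. t_dt_heat t (delta n) m')) = L2_norm ((\<lambda>t. t_dt_heat t (delta m) n) - (\<lambda>t. t_dt_heat t (delta m') n))"
      by (intro L2_cong(2)) (simp add: td)
    thus "L2_norm ((\<lambda>t. t_dt_heat t (delta n) m) - (\<lambda>t. t_dt_heat t (delta n) m')) \<le> D * of_int \<bar>m - m'\<bar> / (of_int (n - m))\<^sup>2"
      using R[OF far] by (simp only:)
  qed (rule D(1))
  thus ?thesis ..
qed

section \<open>Weighted spaces consist of admissible sequences\<close>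

lemma muckenhoupt_Ap_const:
  assumes "muckenhoupt p w" "1 < p"
  obtains C where "Ap_const p C w"
  using assms unfolding muckenhoupt_def Ap_const_def dual_weight_def by auto

lemma muckenhoupt_1_A1:
  assumes "muckenhoupt 1 w"
  obtains D where "muckenhoupt_A1 D w"
proof -
  obtain C where w: "\<And>n. 0 < w n"
    and C: "\<And>M N. M \<le> N \<Longrightarrow> (\<Sum>k=M..N. w k) * (SUP k\<in>{M..N}. inverse (w k)) \<le> C * of_int (N - M + 1)"
    using assms unfolding muckenhoupt_def by auto
  have "(\<Sum>n=M..N. w n) \<le> C * of_int (N - M + 1) * w k" if "M \<le> k" "k \<le> N" for M N k
  proof -
    have "inverse (w k) \<le> (SUP k\<in>{M..N}. inverse (w k))" using that by (intro cSUP_upper) auto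
    hence "(\<Sum>n=M..N. w n) * inverse (w k) \<le> (\<Sum>n=M..N. w n) * (SUP k\<in>{M..N}. inverse (w k))"
      by (rule mult_left_mono) (simp add: sum_nonneg less_imp_le[OF w])
    also have "\<dots> \<le> C * of_int (N - M + 1)" using that by (intro C) auto
    finally show ?thesis using w[of k] by (simp add: divide_simps)
  qed
  thus thesis using w by (intro that[of C]) (auto simp: muckenhoupt_A1_def)
qed

text \<open>
Summing the \<open>A\<^sub>1\<close> condition, divided by \<open>w k\<close>, over the points \<open>k\<close> of the interval.
\<close>

lemma A1_Ap_const_2:
  assumes w: "muckenhoupt_A1 D w"
  shows "Ap_const 2 D w"
  unfolding Ap_const_def
proof (intro conjI allI impI)
  note pos = muckenhoupt_A1D(1)[OF w]
  show "0 < w n" for n by (rule pos)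
  fix M N :: int assume MN: "M \<le> N"
  have dw: "dual_weight 2 w k = 1 / w k" for k
    using pos[of k] by (simp add: dual_weight_def powr_minus_divide)
  have "(\<Sum>k=M..N. w k) * (\<Sum>k=M..N. dual_weight 2 w k) = (\<Sum>k=M..N. (\<Sum>k=M..N. w k) / w k)"
    unfolding dw by (simp add: sum_distrib_left)
  also have "\<dots> \<le> (\<Sum>k=M..N. D * of_int (N - M + 1))"
  proof (rule sum_mono)
    fix k assume k: "k \<in> {M..N}"
    have "(\<Sum>k=M..N. w k) \<le> D * of_int (N - M + 1) * w k"
      by (rule muckenhoupt_A1D(2)[OF w]) (use k in auto)
    thus "(\<Sum>k=M..N. w k) / w k \<le> D * of_int (N - M + 1)" using pos[of k] by (simp only: pos_divide_le_eq)
  qed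
  also have "\<dots> = D * (of_int (N - M + 1))\<^sup>2" using MN by (simp add: power2_eq_square)
  finally show "(\<Sum>k=M..N. w k) * (\<Sum>k=M..N. dual_weight 2 w k) powr (2 - 1) \<le> D * of_int (N - M + 1) powr 2"
    using MN by (simp add: sum_nonneg powr_numeral dw less_imp_le[OF pos])
qed

lemma finite_int_subset_interval:
  fixes F :: "int set"
  assumes "finite F"
  obtains N where "F \<subseteq> {- N..N}" "0 \<le> N"
proof -
  have "F \<subseteq> {- (\<Sum>i\<in>F. \<bar>i\<bar>)..(\<Sum>i\<in>F. \<bar>i\<bar>)}"
  proof
    fix i assume "i \<in> F"
    hence "\<bar>i\<bar> \<le> (\<Sum>i\<in>F. \<bar>i\<bar>)" using assms by (intro member_le_sum) auto
    thus "i \<in> {- (\<Sum>i\<in>F. \<bar>i\<bar>)..(\<Sum>i\<in>F. \<bar>i\<bar>)}" by auto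
  qed
  thus thesis by (rule that) (simp add: sum_nonneg)
qed

text \<open>
The \<open>A\<^sub>1\<close> condition on the interval spanned by \<open>0\<close> and \<open>m\<close> says that \<open>w\<close> decays no faster than \<open>1 / (1 + |m|)\<close>.
\<close>

lemma admissible_A1:
  assumes w: "muckenhoupt_A1 D w" and f: "f \<in> wlp 1 w"
  shows "admissible f"
  unfolding admissible_def
proof (rule summable_on_comparison_test)
  note pos = muckenhoupt_A1D(1)[OF w]
  show "(\<lambda>m. D / w 0 * (norm (f m) powr 1 * w m)) summable_on UNIV"
    using f by (intro summable_on_cmult_right) (simp add: wlp_def)
  fix m :: int
  have "w 0 \<le> (\<Sum>n=min 0 m..max 0 m. w n)"
    by (intro member_le_sum) (use pos in \<open>auto intro: less_imp_le\<close>)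
  also have "\<dots> \<le> D * of_int (max 0 m - min 0 m + 1) * w m"
    by (rule muckenhoupt_A1D(2)[OF w]) auto
  also have "max 0 m - min 0 m + 1 = 1 + \<bar>m\<bar>" by (auto simp: max_def min_def)
  finally have "w 0 \<le> D * (1 + \<bar>of_int m\<bar>) * w m" by simp
  hence "norm (f m) * w 0 \<le> norm (f m) * (D * (1 + \<bar>of_int m\<bar>) * w m)" by (rule mult_left_mono) simp
  thus "norm (f m) / (1 + \<bar>of_int m\<bar>) \<le> D / w 0 * (norm (f m) powr 1 * w m)"
    using pos[of 0] by (simp add: field_simps)
qed auto

text \<open>
A form of Young's inequality: the term on the left is dominated by the first or by the second term on the right, according to the size of \<open>a\<close>.
\<close>

lemma young_weight:
  fixes a b w p :: real
  assumes "0 \<le> a" "0 < b" "0 < w" "1 < p"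
  shows "a * b \<le> a powr p * w + w powr (- 1 / (p - 1)) * b powr (p / (p - 1))"
proof (cases "a \<le> w powr (- 1 / (p - 1)) * b powr (1 / (p - 1))")
  case True
  have "p / (p - 1) = 1 / (p - 1) + 1" using assms(4) by (simp add: field_simps)
  hence "b powr (p / (p - 1)) = b powr (1 / (p - 1)) * b" using assms(2) by (simp add: powr_add)
  moreover have "a * b \<le> w powr (- 1 / (p - 1)) * b powr (1 / (p - 1)) * b" using True assms(2) by (intro mult_right_mono) auto
  moreover have "0 \<le> a powr p * w" using assms by simp
  ultimately show ?thesis by (simp add: mult.assoc)
next
  case False
  have ex: "- 1 / (p - 1) * (p - 1) = - 1" "1 / (p - 1) * (p - 1) = 1" using assms(4) by auto
  have "(w powr (- 1 / (p - 1)) * b powr (1 / (p - 1))) powr (p - 1) \<le> a powr (p - 1)"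
    using False assms by (intro powr_mono2) auto
  also have "(w powr (- 1 / (p - 1)) * b powr (1 / (p - 1))) powr (p - 1) = w powr (- 1) * b powr 1"
    by (simp only: powr_mult powr_powr ex)
  also have "\<dots> = b / w" using assms by (simp add: powr_minus_divide)
  finally have "b \<le> a powr (p - 1) * w" using assms(3) by (simp add: pos_divide_le_eq)
  hence "a * b \<le> a * (a powr (p - 1) * w)" using assms(1) by (rule mult_left_mono)
  also have "\<dots> = a powr p * w"
  proof (cases "a = 0")
    case False
    have "a powr p = a powr (1 + (p - 1))" by simp
    also have "\<dots> = a powr 1 * a powr (p - 1)" by (rule powr_add)
    finally show ?thesis using assms(1) False by simp
  qed simp
  finally show ?thesis by (simp add: add_increasing2)
qed

text \<open>
By duality it is enough that \<open>1 / (1 + |m|)\<close> belongs to \<open>\<ell>\<^sup>q(\<sigma>)\<close> for the dual weight \<open>\<sigma>\<close>. This function is dominated by the maximal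
averages of the unit mass at \<open>0\<close>, which are bounded on \<open>\<ell>\<^sup>q(\<sigma>)\<close> because \<open>\<sigma>\<close> is in \<open>A\<^sub>q\<close>.
\<close>

lemma admissible_Ap:
  assumes p: "1 < p" and w: "Ap_const p C w" and f: "f \<in> wlp p w"
  shows "admissible f"
proof -
  define \<sigma> where "\<sigma> = dual_weight p w"
  define q where "q = p / (p - 1)"
  have q: "1 < q" using p by (simp add: q_def field_simps)
  note pos = Ap_constD(1)[OF w]
  have \<sigma>: "0 < \<sigma> n" for n unfolding \<sigma>_def by (rule Ap_constD(2)[OF w])
  have \<sigma>_Ap: "Ap_const q (C powr (1 / (p - 1))) \<sigma>"
    unfolding q_def \<sigma>_def by (rule Ap_const_dual(1)[OF p w])
  obtain K where "K > 0" and K: "\<And>(h :: int \<Rightarrow> real) A B. (\<And>i. 0 \<le> h i) \<Longrightarrow>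
     (\<Sum>n=A..B. max_avg A B (\<lambda>_. 1) h n powr q * \<sigma> n) \<le> K * (\<Sum>n=A..B. h n powr q * \<sigma> n)"
    proof - show thesis by (rule max_avg_Ap[OF q \<sigma>_Ap]) (fact that) qed
  have fs: "(\<lambda>m. norm (f m) powr p * w m) summable_on UNIV" using f by (simp add: wlp_def)
  have dual: "(\<Sum>m=- N..N. \<sigma> m * (1 / (1 + \<bar>of_int m\<bar>)) powr q) \<le> K * \<sigma> 0" if N: "0 \<le> N" for N
  proof -
    define h where "h m = (if m = 0 then 1 else 0 :: real)" for m :: int
    have "(\<Sum>m=- N..N. \<sigma> m * (1 / (1 + \<bar>of_int m\<bar>)) powr q) \<le> (\<Sum>m=- N..N. max_avg (- N) N (\<lambda>_. 1) h m powr q * \<sigma> m)"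
    proof (rule sum_mono)
      fix m assume m: "m \<in> {- N..N}"
      have "(\<Sum>i=min 0 m..max 0 m. h i * 1) \<le> max_avg (- N) N (\<lambda>_. 1) h m * (\<Sum>i=min 0 m..max 0 m. 1)"
        by (rule max_avg_ge) (use m N in auto)
      moreover have "(\<Sum>i=min 0 m..max 0 m. h i * 1) = 1" by (simp add: h_def)
      moreover have "(\<Sum>i=min 0 m..max 0 m. 1 :: real) = 1 + \<bar>of_int m\<bar>" by (auto simp: max_def min_def)
      ultimately have "1 / (1 + \<bar>of_int m\<bar>) \<le> max_avg (- N) N (\<lambda>_. 1) h m"
        by (simp add: pos_divide_le_eq add.commute)
      hence "(1 / (1 + \<bar>of_int m\<bar>)) powr q \<le> max_avg (- N) N (\<lambda>_. 1) h m powr q"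
        using q by (intro powr_mono2) auto
      from mult_right_mono[OF this, of "\<sigma> m"]
      show "\<sigma> m * (1 / (1 + \<bar>of_int m\<bar>)) powr q \<le> max_avg (- N) N (\<lambda>_. 1) h m powr q * \<sigma> m"
        using \<sigma>[of m] by (simp add: mult.commute less_imp_le)
    qed
    also have "\<dots> \<le> K * (\<Sum>m=- N..N. h m powr q * \<sigma> m)" by (rule K) (simp add: h_def)
    also have "(\<Sum>m=- N..N. h m powr q * \<sigma> m) = (\<Sum>m=- N..N. if m = 0 then \<sigma> m else 0)"
      by (rule sum.cong) (auto simp: h_def)
    also have "\<dots> = \<sigma> 0" using N by simp
    finally show ?thesis .
  qed
  show ?thesis unfolding admissible_def
  proof (rule nonneg_bdd_above_summable_on)
    show "bdd_above (sum (\<lambda>m. norm (f m) / (1 + \<bar>of_int m\<bar>)) ` {F. F \<subseteq> UNIV \<and> finite F})"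
    proof (rule bdd_aboveI, elim imageE CollectE conjE)
      fix s F assume s: "s = (\<Sum>m\<in>F. norm (f m) / (1 + \<bar>of_int m\<bar>))" and "finite (F :: int set)"
      then obtain N where N: "F \<subseteq> {- N..N}" "0 \<le> N" by (rule_tac finite_int_subset_interval) auto
      have "s \<le> (\<Sum>m=- N..N. norm (f m) / (1 + \<bar>of_int m\<bar>))" unfolding s using N by (intro sum_mono2) auto
      also have "\<dots> \<le> (\<Sum>m=- N..N. norm (f m) powr p * w m + \<sigma> m * (1 / (1 + \<bar>of_int m\<bar>)) powr q)"
      proof (rule sum_mono)
        fix m :: int
        show "norm (f m) / (1 + \<bar>of_int m\<bar>) \<le> norm (f m) powr p * w m + \<sigma> m * (1 / (1 + \<bar>of_int m\<bar>)) powr q"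
          using young_weight[of "norm (f m)" "1 / (1 + \<bar>of_int m\<bar>)" "w m" p] pos[of m] p
          by (simp add: \<sigma>_def dual_weight_def q_def add_pos_nonneg)
      qed
      also have "\<dots> \<le> (\<Sum>\<^sub>\<infinity>m. norm (f m) powr p * w m) + K * \<sigma> 0"
        unfolding sum.distrib
        by (intro add_mono dual N finite_sum_le_infsum fs) (auto intro!: mult_nonneg_nonneg less_imp_le[OF pos])
      finally show "s \<le> (\<Sum>\<^sub>\<infinity>m. norm (f m) powr p * w m) + K * \<sigma> 0" .
    qed
  qed auto
qed

section \<open>The maximal operators are dominated by maximal averages\<close>

text \<open>
An even decreasing kernel is a positive combination of indicators of balls \<open>|n - m| \<le> r\<close>. With \<open>M\<close> the maximal average, the sum of \<open>M - h\<close> over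
the part of such a ball in \<open>{- N..N}\<close> is nonnegative, hence so is the kernel sum of \<open>M - h\<close>; and the total mass of the kernel is at most \<open>1\<close>.
\<close>

lemma heat_kernel_average_le:
  assumes t: "0 \<le> t" and n: "\<bar>n\<bar> \<le> N" and h: "\<And>i. 0 \<le> h i"
  shows "(\<Sum>m=- N..N. heat_kernel t (n - m) * h m) \<le> max_avg (- N) N (\<lambda>_. 1) h n"
proof -
  define M where "M = max_avg (- N) N (\<lambda>_. 1) h n"
  define d where "d m = M - h m" for m
  \<comment> \<open>no two points of \<open>{- N..N}\<close> are further apart than \<open>R\<close>\<close>
  define R where "R = nat (2 * N)"
  define a where "a r = heat_kernel t (int r) - heat_kernel t (int (Suc r))" for r
  have M: "0 \<le> M" unfolding M_def by (rule max_avg_nonneg) (use n h in auto)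
  have a: "0 \<le> a r" for r unfolding a_def using heat_kernel_decreasing[OF t, of "int r"] by (simp add: add.commute)
  have ball: "0 \<le> (\<Sum>m=- N..N. if nat \<bar>n - m\<bar> \<le> r then d m else 0)" for r
  proof -
    define x y where "x = max (- N) (n - int r)" and "y = min N (n + int r)"
    have xy: "- N \<le> x" "x \<le> n" "n \<le> y" "y \<le> N" using n by (auto simp: x_def y_def)
    have "(\<Sum>m=- N..N. if nat \<bar>n - m\<bar> \<le> r then d m else 0) = (\<Sum>m\<in>{- N..N} \<inter> {m. nat \<bar>n - m\<bar> \<le> r}. d m)"
      by (rule sum.inter_restrict[symmetric, THEN trans[rotated]]) (auto intro: sum.cong)
    also have "{- N..N} \<inter> {m. nat \<bar>n - m\<bar> \<le> r} = {x..y}" by (auto simp: x_def y_def)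
    also have "(\<Sum>m=x..y. d m) = M * (\<Sum>m=x..y. 1) - (\<Sum>m=x..y. h m * 1)"
      by (simp add: d_def sum_subtractf mult.commute)
    also have "\<dots> \<ge> 0" unfolding M_def using max_avg_ge[OF xy, of "\<lambda>_. 1" h] by simp
    finally show ?thesis .
  qed
  have K: "heat_kernel t (n - m) = (\<Sum>r<R. if nat \<bar>n - m\<bar> \<le> r then a r else 0) + heat_kernel t (int R)" if m: "m \<in> {- N..N}" for m
  proof -
    have i: "nat \<bar>n - m\<bar> \<le> R" using m n by (auto simp: R_def)
    have "(\<Sum>r<R. if nat \<bar>n - m\<bar> \<le> r then a r else 0) = (\<Sum>r\<in>{..<R} \<inter> {r. nat \<bar>n - m\<bar> \<le> r}. a r)"
      by (rule sum.inter_restrict[symmetric, THEN trans[rotated]]) (auto intro: sum.cong)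
    also have "{..<R} \<inter> {r. nat \<bar>n - m\<bar> \<le> r} = {nat \<bar>n - m\<bar>..<R}" by auto
    also have "(\<Sum>r=nat \<bar>n - m\<bar>..<R. a r) = heat_kernel t \<bar>n - m\<bar> - heat_kernel t (int R)"
      using sum_Suc_diff'[OF i, of "\<lambda>r. - heat_kernel t (int r)"] by (simp add: a_def)
    finally show ?thesis by (simp add: heat_kernel_abs)
  qed
  have "(\<Sum>m=- N..N. heat_kernel t (n - m) * d m)
      = (\<Sum>m=- N..N. (\<Sum>r<R. a r * (if nat \<bar>n - m\<bar> \<le> r then d m else 0)) + heat_kernel t (int R) * (if nat \<bar>n - m\<bar> \<le> R then d m else 0))"
  proof (rule sum.cong)
    fix m assume m: "m \<in> {- N..N}"
    have i: "nat \<bar>n - m\<bar> \<le> R" using m n by (auto simp: R_def)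
    show "heat_kernel t (n - m) * d m = (\<Sum>r<R. a r * (if nat \<bar>n - m\<bar> \<le> r then d m else 0)) + heat_kernel t (int R) * (if nat \<bar>n - m\<bar> \<le> R then d m else 0)"
    proof -
      have "(\<Sum>r<R. if nat \<bar>n - m\<bar> \<le> r then a r else 0) * d m = (\<Sum>r<R. a r * (if nat \<bar>n - m\<bar> \<le> r then d m else 0))"
        unfolding sum_distrib_right by (rule sum.cong) auto
      thus ?thesis unfolding K[OF m] using i by (simp only: distrib_right if_True simp_thms)
    qed
  qed simp
  also have "\<dots> = (\<Sum>r<R. a r * (\<Sum>m=- N..N. if nat \<bar>n - m\<bar> \<le> r then d m else 0)) + heat_kernel t (int R) * (\<Sum>m=- N..N. if nat \<bar>n - m\<bar> \<le> R then d m else 0)"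
    unfolding sum.distrib sum_distrib_left by (subst sum.swap) (rule refl)
  also have "\<dots> \<ge> 0"
    by (intro add_nonneg_nonneg sum_nonneg mult_nonneg_nonneg a ball heat_kernel_nonneg t)
  finally have "(\<Sum>m=- N..N. heat_kernel t (n - m) * h m) \<le> M * (\<Sum>m=- N..N. heat_kernel t (n - m))"
    by (simp add: d_def algebra_simps sum_subtractf sum_distrib_left)
  also have "(\<Sum>m=- N..N. heat_kernel t (n - m)) = (\<Sum>k\<in>(\<lambda>m. n - m) ` {- N..N}. heat_kernel t k)"
    by (subst sum.reindex) (auto simp: inj_on_def)
  also have "M * \<dots> \<le> M * 1" by (intro mult_left_mono heat_kernel_mass t M) auto
  finally show ?thesis by (simp add: M_def)
qed

lemma heat_max_le_max_avg:
  assumes f: "\<And>x. x \<notin> {- N..N} \<Longrightarrow> f x = 0" and n: "n \<in> {- N..N}"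
  shows "Linf_norm (\<lambda>t. heat t f n) \<le> max_avg (- N) N (\<lambda>_. 1) (\<lambda>m. norm (f m)) n"
proof (rule Linf_norm_le)
  fix t :: real assume t: "0 \<le> t"
  have "heat t f n = (\<Sum>\<^sub>\<infinity>m\<in>{- N..N}. heat_kernel t (n - m) *\<^sub>R f m)"
    unfolding heat_def by (rule infsum_cong_neutral) (use f in auto)
  also have "\<dots> = (\<Sum>m=- N..N. heat_kernel t (n - m) *\<^sub>R f m)" by simp
  also have "norm \<dots> \<le> (\<Sum>m=- N..N. heat_kernel t (n - m) * norm (f m))"
    by (rule sum_norm_le) (simp add: heat_kernel_nonneg[OF t])
  also have "\<dots> \<le> max_avg (- N) N (\<lambda>_. 1) (\<lambda>m. norm (f m)) n"
    using n by (intro heat_kernel_average_le t) auto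
  finally show "norm (heat t f n) \<le> max_avg (- N) N (\<lambda>_. 1) (\<lambda>m. norm (f m)) n" .
qed

lemma poisson_max_le_heat_max:
  assumes "admissible f"
  shows "Linf_norm (\<lambda>t. poisson t f n) \<le> Linf_norm (\<lambda>t. heat t f n)"
  by (intro Linf_norm_le poisson_norm_le[OF assms] Linf_norm_ge heat_Linf[OF assms])

lemma Linf_norm_nonneg: "\<phi> \<in> Linf \<Longrightarrow> 0 \<le> Linf_norm \<phi>"
  using Linf_norm_ge[of \<phi> 0] norm_ge_zero[of "\<phi> 0"] by linarith

lemma heat_max_strong_finite:
  assumes p: "1 < p" and w: "Ap_const p C w"
  obtains K where "0 < K" "\<And>f S F. finite S \<Longrightarrow> (\<And>x. x \<notin> S \<Longrightarrow> f x = 0) \<Longrightarrow> finite F \<Longrightarrow>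
        (\<Sum>n\<in>F. Linf_norm (\<lambda>t. heat t f n) powr p * w n) \<le> K * (\<Sum>x\<in>S. norm (f x) powr p * w x)"
proof -
  obtain K where K: "K > 0" "\<And>(h :: int \<Rightarrow> real) A B. (\<And>i. 0 \<le> h i) \<Longrightarrow>
     (\<Sum>n=A..B. max_avg A B (\<lambda>_. 1) h n powr p * w n) \<le> K * (\<Sum>n=A..B. h n powr p * w n)"
    proof - show thesis by (rule max_avg_Ap[OF p w]) (fact that) qed
  note pos = less_imp_le[OF Ap_constD(1)[OF w]]
  have "(\<Sum>n\<in>F. Linf_norm (\<lambda>t. heat t f n) powr p * w n) \<le> K * (\<Sum>x\<in>S. norm (f x) powr p * w x)"
    if S: "finite S" "\<And>x. x \<notin> S \<Longrightarrow> f x = 0" and F: "finite F" for f S F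
  proof -
    obtain N where N: "S \<union> F \<subseteq> {- N..N}" using S F by (rule_tac finite_int_subset_interval[of "S \<union> F"]) auto
    have adm: "admissible f" by (rule admissible_finite, rule finite_subset[OF _ S(1)]) (use S(2) in auto)
    have f: "f x = 0" if "x \<notin> {- N..N}" for x using that N by (intro S(2)) blast
    have "(\<Sum>n\<in>F. Linf_norm (\<lambda>t. heat t f n) powr p * w n) \<le> (\<Sum>n=- N..N. Linf_norm (\<lambda>t. heat t f n) powr p * w n)"
      using N pos by (intro sum_mono2) auto
    also have "\<dots> \<le> (\<Sum>n=- N..N. max_avg (- N) N (\<lambda>_. 1) (\<lambda>m. norm (f m)) n powr p * w n)"
      using p by (intro sum_mono mult_right_mono powr_mono2 pos heat_max_le_max_avg f Linf_norm_nonneg heat_Linf adm) auto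
    also have "\<dots> \<le> K * (\<Sum>n=- N..N. norm (f n) powr p * w n)" by (rule K(2)) simp
    also have "(\<Sum>n=- N..N. norm (f n) powr p * w n) = (\<Sum>x\<in>S. norm (f x) powr p * w x)"
      by (rule sum.mono_neutral_right) (use N S in auto)
    finally show ?thesis .
  qed
  with K(1) show thesis by (rule that)
qed

text \<open>
For \<open>A\<^sub>1\<close> weights \<open>1 / |I| \<le> D * w i / w(I)\<close> at every point \<open>i\<close> of an interval \<open>I\<close>, so averages are dominated by weighted averages.
\<close>

lemma max_avg_A1_le:
  assumes w: "muckenhoupt_A1 D w" and n: "n \<in> {A..B}" and h: "\<And>i. 0 \<le> h i"
  shows "max_avg A B (\<lambda>_. 1) h n \<le> D * max_avg A B w h n"
proof -
  note pos = muckenhoupt_A1D(1)[OF w]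
  obtain a b where ab: "A \<le> a" "a \<le> n" "n \<le> b" "b \<le> B"
    "max_avg A B (\<lambda>_. 1) h n * (\<Sum>i=a..b. 1) = (\<Sum>i=a..b. h i * 1)"
    by (rule max_avg_attained[OF n, of "\<lambda>_. 1" h]) auto
  define W where "W = (\<Sum>i=a..b. w i)"
  define l where "l = (of_int (b - a + 1) :: real)"
  have l: "0 < l" using ab by (simp add: l_def)
  have W: "0 < W" unfolding W_def using ab pos by (intro sum_weight_pos) auto
  have "(\<Sum>i=a..b. h i) * W = (\<Sum>i=a..b. h i * W)" by (rule sum_distrib_right)
  also have "\<dots> \<le> (\<Sum>i=a..b. h i * (D * l * w i))"
    unfolding W_def l_def by (intro sum_mono mult_left_mono muckenhoupt_A1D(2)[OF w] h) auto
  also have "\<dots> = D * l * (\<Sum>i=a..b. h i * w i)" by (simp add: sum_distrib_left mult_ac)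
  also have "\<dots> \<le> D * l * (max_avg A B w h n * W)"
    unfolding W_def using ab l muckenhoupt_A1D(3)[OF w] pos by (intro mult_left_mono max_avg_ge) auto
  finally have "(\<Sum>i=a..b. h i) * W \<le> D * l * max_avg A B w h n * W" by (simp add: mult_ac)
  hence "(\<Sum>i=a..b. h i) \<le> D * l * max_avg A B w h n" using W by (simp only: mult_le_cancel_right_pos)
  moreover have "(\<Sum>i=a..b. h i) = max_avg A B (\<lambda>_. 1) h n * l" using ab by (simp add: l_def)
  ultimately have "max_avg A B (\<lambda>_. 1) h n * l \<le> (D * max_avg A B w h n) * l" by (simp add: mult_ac)
  thus ?thesis using l by (simp only: mult_le_cancel_right_pos)
qed

lemma heat_max_weak_finite:
  assumes w: "muckenhoupt_A1 D w"
  obtains K where "0 < K" "\<And>f S F l. finite S \<Longrightarrow> (\<And>x. x \<notin> S \<Longrightarrow> f x = 0) \<Longrightarrow> finite F \<Longrightarrow> 0 < l \<Longrightarrow>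
        l * (\<Sum>n\<in>{n\<in>F. l < Linf_norm (\<lambda>t. heat t f n)}. w n) \<le> K * (\<Sum>x\<in>S. norm (f x) * w x)"
proof -
  note pos = muckenhoupt_A1D(1)[OF w]
  have D: "1 \<le> D" by (rule muckenhoupt_A1D(3)[OF w])
  have "l * (\<Sum>n\<in>{n\<in>F. l < Linf_norm (\<lambda>t. heat t f n)}. w n) \<le> (4 * D) * (\<Sum>x\<in>S. norm (f x) * w x)"
    if S: "finite S" "\<And>x. x \<notin> S \<Longrightarrow> f x = 0" and F: "finite F" and l: "0 < l" for f S F l
  proof -
    obtain N where N: "S \<union> F \<subseteq> {- N..N}" using S F by (rule_tac finite_int_subset_interval[of "S \<union> F"]) auto
    have f: "f x = 0" if "x \<notin> {- N..N}" for x using that N by (intro S(2)) blast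
    define h where "h = (\<lambda>m. norm (f m))"
    have "(\<Sum>n\<in>{n\<in>F. l < Linf_norm (\<lambda>t. heat t f n)}. w n) \<le> (\<Sum>n\<in>{n\<in>{- N..N}. l / D \<le> max_avg (- N) N w h n}. w n)"
    proof (rule sum_mono2)
      show "{n\<in>F. l < Linf_norm (\<lambda>t. heat t f n)} \<subseteq> {n\<in>{- N..N}. l / D \<le> max_avg (- N) N w h n}"
      proof (intro subsetI, elim CollectE conjE)
        fix n assume n: "n \<in> F" "l < Linf_norm (\<lambda>t. heat t f n)"
        hence nN: "n \<in> {- N..N}" using N by auto
        note n(2)
        also have "Linf_norm (\<lambda>t. heat t f n) \<le> max_avg (- N) N (\<lambda>_. 1) h n"
          unfolding h_def by (rule heat_max_le_max_avg[OF f nN])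
        also have "\<dots> \<le> D * max_avg (- N) N w h n" by (rule max_avg_A1_le[OF w nN]) (simp add: h_def)
        finally have "l / D \<le> max_avg (- N) N w h n" using D by (simp add: divide_simps mult.commute)
        thus "n \<in> {n\<in>{- N..N}. l / D \<le> max_avg (- N) N w h n}" using nN by auto
      qed
    qed (use pos in \<open>auto intro: less_imp_le\<close>)
    hence "l * (\<Sum>n\<in>{n\<in>F. l < Linf_norm (\<lambda>t. heat t f n)}. w n) \<le> l * (\<Sum>n\<in>{n\<in>{- N..N}. l / D \<le> max_avg (- N) N w h n}. w n)"
      using l by (intro mult_left_mono) auto
    also have "\<dots> = D * (l / D * (\<Sum>n\<in>{n\<in>{- N..N}. l / D \<le> max_avg (- N) N w h n}. w n))" using D by simp
    also have "\<dots> \<le> D * (4 * (\<Sum>n=- N..N. h n * w n))"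
      using D l pos by (intro mult_left_mono max_avg_weak) (auto simp: h_def)
    also have "(\<Sum>n=- N..N. h n * w n) = (\<Sum>x\<in>S. norm (f x) * w x)"
      unfolding h_def by (rule sum.mono_neutral_right) (use N S in auto)
    finally show ?thesis by simp
  qed
  thus thesis using D by (intro that[of "4 * D"]) auto
qed

context kernel_operator begin

text \<open>
For a finite set of points, the bound for the truncations of \<open>f\<close> passes to the limit by \<open>T_truncation_tendsto\<close>.
\<close>

lemma strong_type_T:
  assumes p: "0 < p" and w: "\<And>n. 0 < w n" and K: "0 \<le> K"
    and adm: "\<And>f. f \<in> wlp p w \<Longrightarrow> admissible f"
    and bound: "\<And>f S F. finite S \<Longrightarrow> (\<And>x. x \<notin> S \<Longrightarrow> f x = 0) \<Longrightarrow> finite F \<Longrightarrow>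
        (\<Sum>n\<in>F. nrm (T f n) powr p * w n) \<le> K * (\<Sum>x\<in>S. norm (f x) powr p * w x)"
  shows "strong_type p w (\<lambda>f n. nrm (T f n))"
  unfolding strong_type_def
proof (intro exI[of _ "K powr (1 / p)"] ballI)
  fix f :: "int \<Rightarrow> complex" assume f: "f \<in> wlp p w"
  note a = adm[OF f]
  have w0: "0 \<le> w n" for n using w[of n] by simp
  have fs: "(\<lambda>n. norm (f n) powr p * w n) summable_on UNIV" using f by (simp add: wlp_def)
  have nn: "norm (nrm (T f n)) = nrm (T f n)" for n using a by (simp add: T_in nrm_nonneg)
  have fin: "(\<Sum>n\<in>F. nrm (T f n) powr p * w n) \<le> K * (\<Sum>\<^sub>\<infinity>n. norm (f n) powr p * w n)" if F: "finite F" for F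
  proof (rule LIMSEQ_le_const2)
    show "(\<lambda>R. \<Sum>n\<in>F. nrm (T (restr {- int R..int R} f) n) powr p * w n) \<longlonglongrightarrow> (\<Sum>n\<in>F. nrm (T f n) powr p * w n)"
      using p by (intro tendsto_sum tendsto_mult tendsto_const tendsto_powr' T_truncation_tendsto a)
        (auto intro!: always_eventually nrm_nonneg T_in admissible_restr a)
    have "(\<Sum>n\<in>F. nrm (T (restr {- int R..int R} f) n) powr p * w n) \<le> K * (\<Sum>\<^sub>\<infinity>n. norm (f n) powr p * w n)" for R
    proof -
      have "(\<Sum>n\<in>F. nrm (T (restr {- int R..int R} f) n) powr p * w n) \<le> K * (\<Sum>n=- int R..int R. norm (restr {- int R..int R} f n) powr p * w n)"
        by (rule bound) (auto simp: restr_def F)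
      also have "(\<Sum>n=- int R..int R. norm (restr {- int R..int R} f n) powr p * w n) = (\<Sum>n=- int R..int R. norm (f n) powr p * w n)"
        by (rule sum.cong) (auto simp: restr_def)
      also have "K * \<dots> \<le> K * (\<Sum>\<^sub>\<infinity>n. norm (f n) powr p * w n)"
        using w0 K by (intro mult_left_mono finite_sum_le_infsum fs) auto
      finally show ?thesis .
    qed
    thus "\<exists>N. \<forall>R\<ge>N. (\<Sum>n\<in>F. nrm (T (restr {- int R..int R} f) n) powr p * w n) \<le> K * (\<Sum>\<^sub>\<infinity>n. norm (f n) powr p * w n)" by blast
  qed
  have sm: "(\<lambda>n. nrm (T f n) powr p * w n) summable_on UNIV"
    by (rule nonneg_bdd_above_summable_on) (use fin w0 in \<open>auto intro!: bdd_aboveI\<close>)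
  have "(\<Sum>\<^sub>\<infinity>n. nrm (T f n) powr p * w n) \<le> K * (\<Sum>\<^sub>\<infinity>n. norm (f n) powr p * w n)"
    by (rule infsum_le_finite_sums[OF sm]) (use fin in auto)
  hence "(\<Sum>\<^sub>\<infinity>n. nrm (T f n) powr p * w n) powr (1 / p) \<le> (K * (\<Sum>\<^sub>\<infinity>n. norm (f n) powr p * w n)) powr (1 / p)"
    using p w0 by (intro powr_mono2 infsum_nonneg) auto
  also have "\<dots> = K powr (1 / p) * (\<Sum>\<^sub>\<infinity>n. norm (f n) powr p * w n) powr (1 / p)" by (rule powr_mult)
  finally show "(\<lambda>n. nrm (T f n)) \<in> wlp p w \<and> wlp_norm p w (\<lambda>n. nrm (T f n)) \<le> K powr (1 / p) * wlp_norm p w f"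
    unfolding wlp_def wlp_norm_def mem_Collect_eq nn using sm by blast
qed

text \<open>
The inequality \<open>l < nrm (T f n)\<close> persists for all large truncations, simultaneously for finitely many \<open>n\<close>.
\<close>

lemma weak_type_T:
  assumes w: "\<And>n. 0 < w n" and K: "0 \<le> K"
    and adm: "\<And>f. f \<in> wlp 1 w \<Longrightarrow> admissible f"
    and bound: "\<And>f S F l. finite S \<Longrightarrow> (\<And>x. x \<notin> S \<Longrightarrow> f x = 0) \<Longrightarrow> finite F \<Longrightarrow> 0 < l \<Longrightarrow>
        l * (\<Sum>n\<in>{n\<in>F. l < nrm (T f n)}. w n) \<le> K * (\<Sum>x\<in>S. norm (f x) * w x)"
  shows "weak_type_1 w (\<lambda>f n. nrm (T f n))"
  unfolding weak_type_1_def
proof (intro exI[of _ K] ballI allI impI)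
  fix f :: "int \<Rightarrow> complex" and l :: real assume f: "f \<in> wlp 1 w" and l: "0 < l"
  note a = adm[OF f]
  have w0: "0 \<le> w n" for n using w[of n] by simp
  have fs: "(\<lambda>n. norm (f n) * w n) summable_on UNIV" using f by (simp add: wlp_def)
  define I where "I = (\<Sum>\<^sub>\<infinity>n. norm (f n) * w n)"
  have nrmI: "wlp_norm 1 w f = I" unfolding wlp_norm_def I_def using w0 by (simp add: infsum_nonneg)
  have nn: "\<bar>nrm (T f n)\<bar> = nrm (T f n)" for n using a by (simp add: T_in nrm_nonneg)
  have fin: "(\<Sum>n\<in>F. w n) \<le> K * I / l" if F: "finite F" "F \<subseteq> {n. l < nrm (T f n)}" for F
  proof -
    have "eventually (\<lambda>R. \<forall>n\<in>F. l < nrm (T (restr {- int R..int R} f) n)) sequentially"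
      using F(2) by (intro eventually_ball_finite[OF F(1)] ballI order_tendstoD(1)[OF T_truncation_tendsto[OF a]]) auto
    then obtain R where R: "\<forall>n\<in>F. l < nrm (T (restr {- int R..int R} f) n)"
      by (auto simp: eventually_sequentially)
    have "l * (\<Sum>n\<in>{n\<in>F. l < nrm (T (restr {- int R..int R} f) n)}. w n) \<le> K * (\<Sum>n=- int R..int R. norm (restr {- int R..int R} f n) * w n)"
      by (rule bound) (auto simp: restr_def F l)
    also have "{n\<in>F. l < nrm (T (restr {- int R..int R} f) n)} = F" using R by auto
    also have "(\<Sum>n=- int R..int R. norm (restr {- int R..int R} f n) * w n) = (\<Sum>n=- int R..int R. norm (f n) * w n)"
      by (rule sum.cong) (auto simp: restr_def)
    also have "K * \<dots> \<le> K * I" unfolding I_def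
      using w0 K by (intro mult_left_mono finite_sum_le_infsum fs) auto
    finally show ?thesis using l by (simp add: pos_le_divide_eq mult.commute)
  qed
  have sm: "w summable_on {n. l < nrm (T f n)}"
    by (rule nonneg_bdd_above_summable_on) (use fin w0 in \<open>auto intro!: bdd_aboveI\<close>)
  have "(\<Sum>\<^sub>\<infinity>n\<in>{n. l < nrm (T f n)}. w n) \<le> K * I / l"
    by (rule infsum_le_finite_sums[OF sm]) (use fin in auto)
  hence "l * (\<Sum>\<^sub>\<infinity>n\<in>{n. l < nrm (T f n)}. w n) \<le> K * I" using l by (simp add: pos_le_divide_eq mult.commute)
  thus "w summable_on {n. \<bar>nrm (T f n)\<bar> > l} \<and> l * (\<Sum>\<^sub>\<infinity>n\<in>{n. \<bar>nrm (T f n)\<bar> > l}. w n) \<le> K * wlp_norm 1 w f"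
    unfolding nn nrmI using sm by blast
qed

end

section \<open>Weighted bounds for the three operators\<close>

lemma heat_max_eq: "heat_max = (\<lambda>f n. Linf_norm (\<lambda>t. heat t f n))"
  by (simp add: fun_eq_iff heat_max_def Linf_norm_def)

lemma poisson_max_eq: "poisson_max = (\<lambda>f n. Linf_norm (\<lambda>t. poisson t f n))"
  by (simp add: fun_eq_iff poisson_max_def Linf_norm_def)

lemma square_cz:
  obtains c where "cz_sublinear (\<lambda>f n. L2_norm (\<lambda>t. t_dt_heat t f n)) c"
proof -
  obtain C where "kernel_operator L2 L2_norm (\<lambda>f n t. t_dt_heat t f n) C" using kernel_operator_square by blast
  then interpret kernel_operator L2 L2_norm "\<lambda>f n t. t_dt_heat t f n" C .
  have l2: "(\<Sum>n\<in>F. (L2_norm (\<lambda>t. t_dt_heat t f n))\<^sup>2) \<le> max C 1 * (\<Sum>x\<in>S. (norm (f x))\<^sup>2)"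
    if S: "finite S" "\<And>x. x \<notin> S \<Longrightarrow> f x = 0" and F: "finite F" for f S F
  proof -
    have f: "admissible f" by (rule admissible_finite, rule finite_subset[OF _ S(1)]) (use S(2) in auto)
    have e: "L2_norm (\<lambda>t. t_dt_heat t f n) = L2_norm (\<lambda>t. t *\<^sub>R dheat t f n)" for n
      by (rule L2_cong(2)) (rule t_dt_heat_eq[OF f])
    have "(\<Sum>n\<in>F. (L2_norm (\<lambda>t. t_dt_heat t f n))\<^sup>2) \<le> (\<Sum>x\<in>S. (norm (f x))\<^sup>2) / 4"
      unfolding e using S F by (rule t_dheat_L2_l2(2))
    also have "\<dots> \<le> 1 * (\<Sum>x\<in>S. (norm (f x))\<^sup>2)" using sum_nonneg[of S "\<lambda>x. (norm (f x))\<^sup>2"] by simp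
    also have "\<dots> \<le> max C 1 * (\<Sum>x\<in>S. (norm (f x))\<^sup>2)" by (intro mult_right_mono sum_nonneg) auto
    finally show ?thesis .
  qed
  show thesis by (rule that, rule cz_sublinear_T[of "max C 1"]) (use l2 L2_norm_nonneg in auto)
qed

lemma square_fun_eq:
  assumes f: "admissible f" and L2: "(\<lambda>t. t_dt_heat t f n) \<in> L2"
  shows "square_fun f n = L2_norm (\<lambda>t. t_dt_heat t f n)"
proof -
  let ?M = "restrict_space lborel {0<..} :: real measure"
  have m: "(\<lambda>t. (norm (t_dt_heat t f n))\<^sup>2) \<in> borel_measurable ?M"
  proof -
    have "(\<lambda>t. t_dt_heat t f n) \<in> borel_measurable ?M" using L2 by (simp add: L2_def dt_over_t_def)
    thus ?thesis by measurable
  qed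
  have m1: "(\<lambda>t. 1 / t :: real) \<in> borel_measurable ?M" by (intro measurable_restrict_space1) measurable
  have "(LINT t|dt_over_t. (norm (t_dt_heat t f n))\<^sup>2) = (LINT t|?M. (1 / t) *\<^sub>R (norm (t_dt_heat t f n))\<^sup>2)"
    unfolding dt_over_t_def by (rule integral_density[OF m m1], rule AE_I2) (simp add: space_restrict_space)
  also have "\<dots> = (LINT t|lborel. indicator {0<..} t *\<^sub>R ((1 / t) *\<^sub>R (norm (t_dt_heat t f n))\<^sup>2))"
    by (rule integral_restrict_space) simp
  also have "\<dots> = (LINT t:{0<..}|lborel. (norm (t_dt_heat t f n))\<^sup>2 / t)"
    unfolding set_lebesgue_integral_def by simp
  finally show ?thesis by (simp add: square_fun_def L2_norm_def)
qed

lemma strong_type_cong: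
  assumes "\<And>f n. f \<in> wlp p w \<Longrightarrow> S f n = S' f n" "strong_type p w S'"
  shows "strong_type p w S"
proof -
  have "S f = S' f" if "f \<in> wlp p w" for f using assms(1)[OF that] by blast
  thus ?thesis using assms(2) unfolding strong_type_def by simp
qed

lemma weak_type_1_cong:
  assumes "\<And>f n. f \<in> wlp 1 w \<Longrightarrow> S f n = S' f n" "weak_type_1 w S'"
  shows "weak_type_1 w S"
proof -
  have "S f = S' f" if "f \<in> wlp 1 w" for f using assms(1)[OF that] by blast
  thus ?thesis using assms(2) unfolding weak_type_1_def by simp
qed

text \<open>
The maximal operators are treated through maximal averages, the square function through sparse domination.
\<close>

lemma strong_type_operators:
  assumes p: "1 < p" and w: "Ap_const p C w"
  shows "strong_type p w (\<lambda>f n. Linf_norm (\<lambda>t. heat t f n))"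
    and "strong_type p w (\<lambda>f n. Linf_norm (\<lambda>t. poisson t f n))"
    and "strong_type p w (\<lambda>f n. L2_norm (\<lambda>t. t_dt_heat t f n))"
proof -
  note pos = Ap_constD(1)[OF w] and adm = admissible_Ap[OF p w]
  have p0: "0 < p" using p by simp
  obtain K where K: "0 < K" "\<And>f S F. finite S \<Longrightarrow> (\<And>x. x \<notin> S \<Longrightarrow> f x = 0) \<Longrightarrow> finite F \<Longrightarrow>
        (\<Sum>n\<in>F. Linf_norm (\<lambda>t. heat t f n) powr p * w n) \<le> K * (\<Sum>x\<in>S. norm (f x) powr p * w x)"
    proof - show thesis by (rule heat_max_strong_finite[OF p w]) (fact that) qed
  have K0: "0 \<le> K" using K(1) by simp
  obtain C1 where C1: "kernel_operator Linf Linf_norm (\<lambda>f n t. heat t f n) C1" using kernel_operator_heat by blast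
  show "strong_type p w (\<lambda>f n. Linf_norm (\<lambda>t. heat t f n))"
    by (rule kernel_operator.strong_type_T[OF C1 p0 pos K0 adm K(2)])
  obtain C2 where C2: "kernel_operator Linf Linf_norm (\<lambda>f n t. poisson t f n) C2" using kernel_operator_poisson by blast
  show "strong_type p w (\<lambda>f n. Linf_norm (\<lambda>t. poisson t f n))"
  proof (rule kernel_operator.strong_type_T[OF C2 p0 pos K0 adm])
    fix f :: "int \<Rightarrow> complex" and S F :: "int set"
    assume S: "finite S" "\<And>x. x \<notin> S \<Longrightarrow> f x = 0" and F: "finite F"
    have f: "admissible f" by (rule admissible_finite, rule finite_subset[OF _ S(1)]) (use S(2) in auto)
    have "(\<Sum>n\<in>F. Linf_norm (\<lambda>t. poisson t f n) powr p * w n) \<le> (\<Sum>n\<in>F. Linf_norm (\<lambda>t. heat t f n) powr p * w n)"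
      using p by (intro sum_mono mult_right_mono powr_mono2 poisson_max_le_heat_max f Linf_norm_nonneg poisson_Linf less_imp_le[OF pos]) auto
    also have "\<dots> \<le> K * (\<Sum>x\<in>S. norm (f x) powr p * w x)" using S F by (rule K(2))
    finally show "(\<Sum>n\<in>F. Linf_norm (\<lambda>t. poisson t f n) powr p * w n) \<le> K * (\<Sum>x\<in>S. norm (f x) powr p * w x)" .
  qed
  obtain C3 where C3: "kernel_operator L2 L2_norm (\<lambda>f n t. t_dt_heat t f n) C3" using kernel_operator_square by blast
  obtain c where "cz_sublinear (\<lambda>f n. L2_norm (\<lambda>t. t_dt_heat t f n)) c" by (rule square_cz)
  then interpret cz: cz_sublinear "\<lambda>f n. L2_norm (\<lambda>t. t_dt_heat t f n)" c .
  obtain B where B: "0 < B" "\<And>f S F. finite S \<Longrightarrow> (\<And>x. x \<notin> S \<Longrightarrow> f x = 0) \<Longrightarrow> finite F \<Longrightarrow>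
        (\<Sum>n\<in>F. L2_norm (\<lambda>t. t_dt_heat t f n) powr p * w n) \<le> B * (\<Sum>x\<in>S. norm (f x) powr p * w x)"
    proof - show thesis by (rule cz.strong_type_Ap[OF p w]) (fact that) qed
  show "strong_type p w (\<lambda>f n. L2_norm (\<lambda>t. t_dt_heat t f n))"
    by (rule kernel_operator.strong_type_T[OF C3 p0 pos less_imp_le[OF B(1)] adm B(2)])
qed

lemma weak_type_operators:
  assumes w: "muckenhoupt_A1 D w"
  shows "weak_type_1 w (\<lambda>f n. Linf_norm (\<lambda>t. heat t f n))"
    and "weak_type_1 w (\<lambda>f n. Linf_norm (\<lambda>t. poisson t f n))"
    and "weak_type_1 w (\<lambda>f n. L2_norm (\<lambda>t. t_dt_heat t f n))"
proof -
  note pos = muckenhoupt_A1D(1)[OF w] and adm = admissible_A1[OF w]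
  obtain K where K: "0 < K" "\<And>f S F l. finite S \<Longrightarrow> (\<And>x. x \<notin> S \<Longrightarrow> f x = 0) \<Longrightarrow> finite F \<Longrightarrow> 0 < l \<Longrightarrow>
        l * (\<Sum>n\<in>{n\<in>F. l < Linf_norm (\<lambda>t. heat t f n)}. w n) \<le> K * (\<Sum>x\<in>S. norm (f x) * w x)"
    proof - show thesis by (rule heat_max_weak_finite[OF w]) (fact that) qed
  have K0: "0 \<le> K" using K(1) by simp
  obtain C1 where C1: "kernel_operator Linf Linf_norm (\<lambda>f n t. heat t f n) C1" using kernel_operator_heat by blast
  show "weak_type_1 w (\<lambda>f n. Linf_norm (\<lambda>t. heat t f n))"
    by (rule kernel_operator.weak_type_T[OF C1 pos K0 adm K(2)])
  obtain C2 where C2: "kernel_operator Linf Linf_norm (\<lambda>f n t. poisson t f n) C2" using kernel_operator_poisson by blast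
  show "weak_type_1 w (\<lambda>f n. Linf_norm (\<lambda>t. poisson t f n))"
  proof (rule kernel_operator.weak_type_T[OF C2 pos K0 adm])
    fix f :: "int \<Rightarrow> complex" and S F :: "int set" and l :: real
    assume S: "finite S" "\<And>x. x \<notin> S \<Longrightarrow> f x = 0" and F: "finite F" and l: "0 < l"
    have f: "admissible f" by (rule admissible_finite, rule finite_subset[OF _ S(1)]) (use S(2) in auto)
    have "(\<Sum>n\<in>{n\<in>F. l < Linf_norm (\<lambda>t. poisson t f n)}. w n) \<le> (\<Sum>n\<in>{n\<in>F. l < Linf_norm (\<lambda>t. heat t f n)}. w n)"
      using F pos poisson_max_le_heat_max[OF f] by (intro sum_mono2) (auto intro: less_imp_le less_le_trans)
    hence "l * (\<Sum>n\<in>{n\<in>F. l < Linf_norm (\<lambda>t. poisson t f n)}. w n) \<le> l * (\<Sum>n\<in>{n\<in>F. l < Linf_norm (\<lambda>t. heat t f n)}. w n)"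
      using l by (intro mult_left_mono) auto
    also have "\<dots> \<le> K * (\<Sum>x\<in>S. norm (f x) * w x)" using S F l by (rule K(2))
    finally show "l * (\<Sum>n\<in>{n\<in>F. l < Linf_norm (\<lambda>t. poisson t f n)}. w n) \<le> K * (\<Sum>x\<in>S. norm (f x) * w x)" .
  qed
  obtain C3 where C3: "kernel_operator L2 L2_norm (\<lambda>f n t. t_dt_heat t f n) C3" using kernel_operator_square by blast
  obtain c where "cz_sublinear (\<lambda>f n. L2_norm (\<lambda>t. t_dt_heat t f n)) c" by (rule square_cz)
  then interpret cz: cz_sublinear "\<lambda>f n. L2_norm (\<lambda>t. t_dt_heat t f n)" c .
  have two: "1 < (2 :: real)" by simp
  obtain B where B: "0 < B" "\<And>f S F. finite S \<Longrightarrow> (\<And>x. x \<notin> S \<Longrightarrow> f x = 0) \<Longrightarrow> finite F \<Longrightarrow>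
        (\<Sum>n\<in>F. L2_norm (\<lambda>t. t_dt_heat t f n) powr 2 * w n) \<le> B * (\<Sum>x\<in>S. norm (f x) powr 2 * w x)"
    proof - show thesis by (rule cz.strong_type_Ap[OF two A1_Ap_const_2[OF w]]) (fact that) qed
  have sq: "x powr 2 = x\<^sup>2" if "0 \<le> x" for x :: real using that by (simp add: powr_numeral)
  have B2: "(\<Sum>n\<in>F. (L2_norm (\<lambda>t. t_dt_heat t f n))\<^sup>2 * w n) \<le> B * (\<Sum>x\<in>S. (norm (f x))\<^sup>2 * w x)"
    if S: "finite S" "\<And>x. x \<notin> S \<Longrightarrow> f x = 0" and F: "finite F" for f S F
    using S F by (rule B(2)[unfolded sq[OF L2_norm_nonneg] sq[OF norm_ge_zero]])
  obtain A where A: "0 < A" "\<And>f S F l. finite S \<Longrightarrow> (\<And>x. x \<notin> S \<Longrightarrow> f x = 0) \<Longrightarrow> finite F \<Longrightarrow> 0 < l \<Longrightarrow>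
        l * (\<Sum>n\<in>{n\<in>F. l < L2_norm (\<lambda>t. t_dt_heat t f n)}. w n) \<le> A * (\<Sum>x\<in>S. norm (f x) * w x)"
    proof - show thesis by (rule cz.weak_type_A1[OF w less_imp_le[OF B(1)]]) (fact B2, fact that) qed
  show "weak_type_1 w (\<lambda>f n. L2_norm (\<lambda>t. t_dt_heat t f n))"
    by (rule kernel_operator.weak_type_T[OF C3 pos less_imp_le[OF A(1)] adm A(2)])
qed

lemma calderon_zygmund_operators:
  shows "calderon_zygmund fscale Linf Linf_norm (\<lambda>f n t. heat t f n)"
    and "calderon_zygmund fscale Linf Linf_norm (\<lambda>f n t. poisson t f n)"
    and "calderon_zygmund fscale L2 L2_norm (\<lambda>f n t. t_dt_heat t f n)"
proof -
  have two: "1 < (2 :: real)" by simp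
  note one = A1_Ap_const_2[OF muckenhoupt_A1_one]
  note st = strong_type_operators[OF two one] and adm = admissible_Ap[OF two one]
  show "calderon_zygmund fscale Linf Linf_norm (\<lambda>f n t. heat t f n)"
    using kernel_operator_heat kernel_operator.calderon_zygmund_T[OF _ adm st(1)] by blast
  show "calderon_zygmund fscale Linf Linf_norm (\<lambda>f n t. poisson t f n)"
    using kernel_operator_poisson kernel_operator.calderon_zygmund_T[OF _ adm st(2)] by blast
  show "calderon_zygmund fscale L2 L2_norm (\<lambda>f n t. t_dt_heat t f n)"
    using kernel_operator_square kernel_operator.calderon_zygmund_T[OF _ adm st(3)] by blast
qed

theorem theorem2:
  fixes p :: real and w :: "int \<Rightarrow> real"
  assumes "1 \<le> p" and "muckenhoupt p w"
  shows
    "calderon_zygmund fscale Linf Linf_norm (\<lambda>f n t. heat t f n) \<and>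
     calderon_zygmund fscale Linf Linf_norm (\<lambda>f n t. poisson t f n) \<and>
     calderon_zygmund fscale L2 L2_norm (\<lambda>f n t. t_dt_heat t f n) \<and>
     (\<forall>f \<in> wlp p w. semigroups_defined f \<and> (\<forall>n.
        (\<lambda>t. heat t f n) \<in> Linf \<and> heat_max f n = Linf_norm (\<lambda>t. heat t f n) \<and>
        (\<lambda>t. poisson t f n) \<in> Linf \<and> poisson_max f n = Linf_norm (\<lambda>t. poisson t f n) \<and>
        (\<lambda>t. t_dt_heat t f n) \<in> L2 \<and> square_fun f n = L2_norm (\<lambda>t. t_dt_heat t f n))) \<and>
     (1 < p \<longrightarrow>
        strong_type p w heat_max \<and> strong_type p w poisson_max \<and> strong_type p w square_fun) \<and>
     (p = 1 \<longrightarrow>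
        weak_type_1 w heat_max \<and> weak_type_1 w poisson_max \<and> weak_type_1 w square_fun)"
proof -
  have adm: "admissible f" if f: "f \<in> wlp p w" for f
  proof (cases "p = 1")
    case True
    from assms(2) True obtain D where "muckenhoupt_A1 D w" by (auto elim: muckenhoupt_1_A1)
    thus ?thesis using f True by (auto intro: admissible_A1)
  next
    case False
    hence p: "1 < p" using assms(1) by simp
    obtain C where "Ap_const p C w" by (rule muckenhoupt_Ap_const[OF assms(2) p])
    thus ?thesis using f p by (auto intro: admissible_Ap)
  qed
  obtain C where C: "kernel_operator L2 L2_norm (\<lambda>f n t. t_dt_heat t f n) C" using kernel_operator_square by blast
  have L2: "(\<lambda>t. t_dt_heat t f n) \<in> L2" if "admissible f" for f n
    by (rule kernel_operator.T_in[OF C that])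
  have sq: "square_fun f n = L2_norm (\<lambda>t. t_dt_heat t f n)" if "f \<in> wlp p w" for f n
    by (rule square_fun_eq[OF adm[OF that] L2[OF adm[OF that]]])
  have strong: "strong_type p w heat_max \<and> strong_type p w poisson_max \<and> strong_type p w square_fun" if p: "1 < p"
  proof -
    obtain C where C: "Ap_const p C w" by (rule muckenhoupt_Ap_const[OF assms(2) p])
    show ?thesis unfolding heat_max_eq poisson_max_eq
      using strong_type_operators[OF p C] by (auto intro: strong_type_cong[OF sq])
  qed
  have weak: "weak_type_1 w heat_max \<and> weak_type_1 w poisson_max \<and> weak_type_1 w square_fun" if p: "p = 1"
  proof -
    obtain D where D: "muckenhoupt_A1 D w" using assms(2) p by (auto elim: muckenhoupt_1_A1)
    show ?thesis unfolding heat_max_eq poisson_max_eq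
      using weak_type_operators[OF D] by (auto intro: weak_type_1_cong[OF sq[unfolded p]])
  qed
  show ?thesis
    using calderon_zygmund_operators semigroups_defined_admissible adm heat_Linf poisson_Linf L2 sq strong weak
    by (simp add: heat_max_eq poisson_max_eq)
qed

end
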